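(* Let $\mathbf F_q$ be a finite field with $q$ elements. Then the number of Bertini involutions in $\mathrm{Bir}_{\mathbf F_q}(\mathbb P^2)$ with a base point of degree $8$, up to conjugacy by $\mathrm{PGL}_3(\mathbf F_q)$, is at least $M_q$, where $M_2=2$, $M_3=12$, and for $q\ge4$, $$M_q=\frac1{640}(q^6-1).$$ In particular, $M_q\ge q$ for all $q\ge2$.
   Context: Let $k=\mathbf F_q$ and $k^a$ an algebraic closure. A point of degree $8$ in $\mathbb P^2$ is an orbit $p=\{p_1,\dots,p_8\}\subset\mathbb P^2(k^a)$ of cardinality 8 under $\mathrm{Gal}(k^a/k)$. It is general if the blow-up of $p$ is a del Pezzo surface of degree 1, that is, no line (over $k^a$) contains 3 of the $p_i$, no conic contains 6 of them, and no cubic is singular at one of them and contains all the others. For such $p$, the pencil of cubics through $p$ has smooth general member and base locus $p\cup\{q_0\}$ with $q_0\in\mathbb P^2(k)$; the Bertini involution $b\in\mathrm{Bir}_k(\mathbb P^2)$ with base point $p$ sends a general point $x$ to $-x$ for the group law with neutral element $q_0$ on the smooth cubic of the pencil through $x$. *)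

theory Defs
  imports
    "HOL-Algebra.Algebraic_Closure_Type"
    "HOL-Library.Poly_Mapping"
    "HOL-Analysis.Finite_Cartesian_Product"
begin

section \<open>Ternary polynomials\<close>

text \<open>The variables are indexed by the three-element type \<open>3\<close>, so that they match the coordinates
  of vectors in \<open>'a ^ 3\<close>; a monomial is its exponent vector.\<close>

type_synonym 'a tpoly = "(3 \<Rightarrow>\<^sub>0 nat) \<Rightarrow>\<^sub>0 'a"

definition const_poly :: "'a::zero \<Rightarrow> 'a tpoly" where
  "const_poly c = Poly_Mapping.single 0 c"

definition var_poly :: "3 \<Rightarrow> 'a::zero_neq_one tpoly" where
  "var_poly i = Poly_Mapping.single (Poly_Mapping.single i 1) 1"

text \<open>\<open>insertion h v f\<close> applies \<open>h\<close> to the coefficients of \<open>f\<close> and substitutes \<open>v\<close> for the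
  variables. This covers evaluation (\<open>h = id\<close>), evaluation over an extension field (\<open>h\<close> the embedding)
  and substitution of polynomials (\<open>h = const_poly\<close>).\<close>

definition insertion :: "('a::zero \<Rightarrow> 'b::comm_semiring_1) \<Rightarrow> 'b ^ 3 \<Rightarrow> 'a tpoly \<Rightarrow> 'b" where
  "insertion h v f =
     (\<Sum>m\<in>Poly_Mapping.keys f. h (Poly_Mapping.lookup f m) *
        (\<Prod>i\<in>UNIV. v $ i ^ Poly_Mapping.lookup m i))"

text \<open>The zero polynomial is a form of every degree.\<close>

definition form :: "nat \<Rightarrow> 'a::zero tpoly \<Rightarrow> bool" where
  "form d f \<longleftrightarrow> (\<forall>m\<in>Poly_Mapping.keys f. (\<Sum>i\<in>UNIV. Poly_Mapping.lookup m i) = d)"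

text \<open>In the terms with exponent \<open>0\<close> in the variable \<open>i\<close>, the subtraction of exponents is truncated,
  but then the coefficient is \<open>0\<close>.\<close>

definition pderiv3 :: "3 \<Rightarrow> 'a::comm_semiring_1 tpoly \<Rightarrow> 'a tpoly" where
  "pderiv3 i f =
     (\<Sum>m\<in>Poly_Mapping.keys f.
        Poly_Mapping.single (m - Poly_Mapping.single i 1)
          (of_nat (Poly_Mapping.lookup m i) * Poly_Mapping.lookup f m))"


section \<open>The projective plane\<close>

definition proj_rel :: "('a::field ^ 3) rel" where
  "proj_rel = {(v, w). v \<noteq> 0 \<and> w \<noteq> 0 \<and> (\<exists>c. c \<noteq> 0 \<and> w = c *s v)}"

type_synonym 'a point = "('a ^ 3) set"

definition proj_plane :: "'a::field point set" where
  "proj_plane = (UNIV - {0}) // proj_rel"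

definition proj_class :: "'a::field ^ 3 \<Rightarrow> 'a point" where
  "proj_class v = proj_rel `` {v}"

text \<open>Only meant for forms, where it does not matter which representative of the point is taken.\<close>

definition vanishes_at :: "'a::field tpoly \<Rightarrow> 'a point \<Rightarrow> bool" where
  "vanishes_at F P \<longleftrightarrow> (\<forall>v\<in>P. insertion id v F = 0)"

definition singular_at :: "'a::field tpoly \<Rightarrow> 'a point \<Rightarrow> bool" where
  "singular_at F P \<longleftrightarrow> vanishes_at F P \<and> (\<forall>i. vanishes_at (pderiv3 i F) P)"

text \<open>A property holds at a general point if it holds on a nonempty Zariski open set, equivalently
  on the complement of some plane curve.\<close>

definition for_general_point :: "('a::field point \<Rightarrow> bool) \<Rightarrow> bool" where
  "for_general_point Q \<longleftrightarrow>
     (\<exists>d G. form d G \<and> G \<noteq> 0 \<and> (\<forall>x\<in>proj_plane. \<not> vanishes_at G x \<longrightarrow> Q x))"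


section \<open>The group law on a smooth plane cubic\<close>

text \<open>The plane curves below are taken over an algebraically closed field, so it suffices to look at
  the points with coordinates in the field itself.\<close>

definition smooth_cubic :: "'a::field tpoly \<Rightarrow> bool" where
  "smooth_cubic F \<longleftrightarrow> form 3 F \<and> F \<noteq> 0 \<and> (\<forall>P\<in>proj_plane. \<not> singular_at F P)"

text \<open>Some line, parametrised by \<open>[s : t] \<mapsto> [s u + t w]\<close>, meets the cubic \<open>F\<close> exactly in
  \<open>P + Q + R\<close>, counted with multiplicity: up to a nonzero constant, the restriction of \<open>F\<close> to the line
  is the product of the three linear forms that vanish at the parameters of \<open>P\<close>, \<open>Q\<close> and \<open>R\<close>. (Over
  an infinite field, equality for all \<open>s\<close> and \<open>t\<close> is equality of polynomials.)\<close>

definition line_section :: "'a::field tpoly \<Rightarrow> 'a point \<Rightarrow> 'a point \<Rightarrow> 'a point \<Rightarrow> bool" where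
  "line_section F P Q R \<longleftrightarrow>
     {P, Q, R} \<subseteq> proj_plane \<and>
     (\<exists>u w a\<^sub>1 b\<^sub>1 a\<^sub>2 b\<^sub>2 a\<^sub>3 b\<^sub>3 c.
        (\<forall>s t. s *s u + t *s w = 0 \<longrightarrow> s = 0 \<and> t = 0) \<and>
        P = proj_class (a\<^sub>1 *s u + b\<^sub>1 *s w) \<and>
        Q = proj_class (a\<^sub>2 *s u + b\<^sub>2 *s w) \<and>
        R = proj_class (a\<^sub>3 *s u + b\<^sub>3 *s w) \<and>
        c \<noteq> 0 \<and>
        (\<forall>s t. insertion id (s *s u + t *s w) F =
           c * (s * b\<^sub>1 - t * a\<^sub>1) * (s * b\<^sub>2 - t * a\<^sub>2) * (s * b\<^sub>3 - t * a\<^sub>3)))"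

definition third_point :: "'a::field tpoly \<Rightarrow> 'a point \<Rightarrow> 'a point \<Rightarrow> 'a point" where
  "third_point F P Q = (THE R. line_section F P Q R)"

text \<open>Chord-tangent law with an arbitrary point \<open>Z\<close> of the cubic (not necessarily a flex) as neutral
  element.\<close>

definition cubic_group :: "'a::field tpoly \<Rightarrow> 'a point \<Rightarrow> 'a point monoid" where
  "cubic_group F Z =
     \<lparr>carrier = {P \<in> proj_plane. vanishes_at F P},
      monoid.mult = (\<lambda>P Q. third_point F (third_point F P Q) Z),
      one = Z\<rparr>"


section \<open>Birational maps of the plane\<close>

text \<open>A rational map is given by three forms of the same degree, not all zero, and two such triples give
  the same rational map if they are proportional over the field of rational functions. Common factors
  are allowed.\<close>

type_synonym 'a triple = "'a tpoly ^ 3"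

definition triples :: "'a::field triple set" where
  "triples = {F. F \<noteq> 0 \<and> (\<exists>d. \<forall>i. form d (F $ i))}"

definition ratmap_rel :: "'a::field triple rel" where
  "ratmap_rel = {(F, G). F \<in> triples \<and> G \<in> triples \<and> (\<forall>i j. F $ i * G $ j = F $ j * G $ i)}"

type_synonym 'a ratmap = "'a triple set"

definition triple_comp :: "'a::field triple \<Rightarrow> 'a triple \<Rightarrow> 'a triple" where
  "triple_comp F G = (\<chi> i. insertion const_poly G (F $ i))"

definition triple_id :: "'a::field triple" where
  "triple_id = (\<chi> i. var_poly i)"

text \<open>As \<open>ratmap_rel\<close> relates only elements of \<open>triples\<close>, the compositions below are required to be
  defined, i.e. not identically zero.\<close>

definition birational :: "'a::field triple \<Rightarrow> bool" where
  "birational F \<longleftrightarrow>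
     F \<in> triples \<and>
     (\<exists>G\<in>triples. (triple_comp F G, triple_id) \<in> ratmap_rel \<and>
                   (triple_comp G F, triple_id) \<in> ratmap_rel)"

definition Bir :: "'a::field ratmap monoid" where
  "Bir =
     \<lparr>carrier = {F. birational F} // ratmap_rel,
      monoid.mult = (\<lambda>\<Phi> \<Psi>. ratmap_rel `` {triple_comp F G | F G. F \<in> \<Phi> \<and> G \<in> \<Psi>}),
      one = ratmap_rel `` {triple_id}\<rparr>"

definition linear_triple :: "'a::field ^ 3 ^ 3 \<Rightarrow> 'a triple" where
  "linear_triple A = (\<chi> i. \<Sum>j\<in>UNIV. const_poly (A $ i $ j) * var_poly j)"

definition PGL3 :: "'a::field ratmap set" where
  "PGL3 = {ratmap_rel `` {linear_triple A} | A. invertible A}"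

text \<open>The rational map \<open>b\<close> over \<open>'k\<close> is defined at the geometric point \<open>x\<close> and sends it to \<open>y\<close>.\<close>

definition maps_to ::
    "'k::field ratmap \<Rightarrow> 'k alg_closure point \<Rightarrow> 'k alg_closure point \<Rightarrow> bool" where
  "maps_to b x y \<longleftrightarrow>
     x \<in> proj_plane \<and> y \<in> proj_plane \<and> (\<exists>F\<in>b. \<exists>v\<in>x. (\<chi> i. insertion to_ac v (F $ i)) \<in> y)"


section \<open>Points of degree 8 and Bertini involutions\<close>

definition galois_group :: "('k::field alg_closure \<Rightarrow> 'k alg_closure) set" where
  "galois_group =
     {\<sigma>. bij \<sigma> \<and> (\<forall>x y. \<sigma> (x + y) = \<sigma> x + \<sigma> y) \<and> (\<forall>x y. \<sigma> (x * y) = \<sigma> x * \<sigma> y) \<and>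
         (\<forall>a. \<sigma> (to_ac a) = to_ac a)}"

definition galois_act ::
    "('k::field alg_closure \<Rightarrow> 'k alg_closure) \<Rightarrow> 'k alg_closure point \<Rightarrow> 'k alg_closure point" where
  "galois_act \<sigma> P = (\<lambda>v. \<chi> i. \<sigma> (v $ i)) ` P"

definition degree8_point :: "'k::field alg_closure point set \<Rightarrow> bool" where
  "degree8_point p \<longleftrightarrow>
     (\<exists>x\<in>proj_plane. p = {galois_act \<sigma> x | \<sigma>. \<sigma> \<in> galois_group}) \<and> card p = 8"

definition rational_points :: "'k::field alg_closure point set" where
  "rational_points = {proj_class (\<chi> i. to_ac (v $ i)) | v :: 'k ^ 3. v \<noteq> 0}"

definition general_points :: "'a::field point set \<Rightarrow> bool" where
  "general_points p \<longleftrightarrow>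
     (\<forall>L. form 1 L \<and> L \<noteq> 0 \<longrightarrow> card {x \<in> p. vanishes_at L x} < 3) \<and>
     (\<forall>C. form 2 C \<and> C \<noteq> 0 \<longrightarrow> card {x \<in> p. vanishes_at C x} < 6) \<and>
     (\<forall>F. form 3 F \<and> F \<noteq> 0 \<longrightarrow>
        \<not> ((\<exists>x\<in>p. singular_at F x) \<and> (\<forall>y\<in>p. vanishes_at F y)))"

definition cubics_through :: "'a::field point set \<Rightarrow> 'a tpoly set" where
  "cubics_through p = {F. form 3 F \<and> F \<noteq> 0 \<and> (\<forall>x\<in>p. vanishes_at F x)}"

definition base_locus :: "'a::field point set \<Rightarrow> 'a point set" where
  "base_locus p = {x \<in> proj_plane. \<forall>F\<in>cubics_through p. vanishes_at F x}"

text \<open>Outside the base locus of the pencil, the cubic \<open>F\<close> through \<open>x\<close> is unique up to scalars.\<close>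

definition bertini_involution_at ::
    "'k::field alg_closure point set \<Rightarrow> 'k ratmap \<Rightarrow> bool" where
  "bertini_involution_at p b \<longleftrightarrow>
     b \<in> carrier Bir \<and>
     (\<exists>q\<^sub>0\<in>rational_points.
        base_locus p = insert q\<^sub>0 p \<and>
        for_general_point (\<lambda>x.
          \<exists>F\<in>cubics_through p. smooth_cubic F \<and> vanishes_at F x \<and>
             maps_to b x (inv\<^bsub>cubic_group F q\<^sub>0\<^esub> x)))"

definition bertini_involutions :: "'k::field ratmap set" where
  "bertini_involutions =
     {b. \<exists>p. degree8_point p \<and> general_points p \<and> bertini_involution_at p b}"

definition bertini_conj :: "'k::field ratmap rel" where
  "bertini_conj =
     {(b, b'). b \<in> bertini_involutions \<and> b' \<in> bertini_involutions \<and>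
        (\<exists>a\<in>PGL3. b' = a \<otimes>\<^bsub>Bir\<^esub> b \<otimes>\<^bsub>Bir\<^esub> inv\<^bsub>Bir\<^esub> a)}"

definition bertini_bound :: "nat \<Rightarrow> real" where
  "bertini_bound q =
     (if q = 2 then 2 else if q = 3 then 12 else (real q ^ 6 - 1) / 640)"

end

theory Submission imports Defs "HOL-Analysis.Cartesian_Space" begin

text \<open>A parameter \<open>t\<close> of degree 8 over \<open>k\<close> gives a point of degree 8 on a fixed cuspidal cubic \<open>C\<close>. On \<open>C\<close>,
  lying on a line, a conic or a cubic is a condition on the sum of the parameters, so the point is
  general as soon as a trace condition holds; this leaves at least \<open>q^8 - q^7 - q^4\<close> values of \<open>t\<close>.
  The pencil is spanned by \<open>C\<close> and an explicit cubic \<open>D\<close>. If \<open>T v\<close> denotes the third intersection of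
  the member through \<open>v\<close> with its tangent at the ninth base point, the Bertini involution sends \<open>v\<close> to
  the third intersection with the line through \<open>v\<close> and \<open>T v\<close>, which gives explicit forms for it.

  The eight base points can be recovered from the involution: there, the line through \<open>v\<close> and its
  image varies with the direction from which \<open>v\<close> approaches the point. Hence a projectivity that
  conjugates two of these involutions maps one point of degree 8 to the other. It also maps a rational
  member of the first pencil to \<open>C\<close>. There are \<open>q + 1\<close> rational members, and at most \<open>q\<close> parameters
  are reached from a given one by rational projectivities that preserve \<open>C\<close>. As a point of degree 8
  has 8 parameters, a conjugacy class contains the involutions of at most \<open>8 q (q + 1)\<close> values of \<open>t\<close>.\<close>

text \<open>The argument has to work in every characteristic. Three orbit points on a line force
  \<open>3 tr8 t + 8 = 0\<close>, while six on a conic force only twice that condition, which says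
  nothing in characteristic 2; there the two remaining conjugates are used instead. Smoothness of
  the general member is delicate in characteristic 3, where the top coefficient 9 of an auxiliary
  polynomial disappears. Dividing \<open>q^8 - q^7 - q^4\<close> by \<open>8 q (q + 1)\<close> gives
  about \<open>q^6 / 8\<close>, so the constant 640 leaves a wide margin. Because
  \<open>card\<close> is 0 on infinite sets, the bound also requires that there are only finitely
  many Bertini involutions: there are finitely many points of degree 8, and each determines its
  involution. Intersection theory is replaced by identities between polynomial functions, which are
  checked at general points and then extended to all points; limits at base points are taken by
  dividing out powers of a parameter.\<close>

no_notation fps_nth (infixl \<open>$\<close> 75)

subsection \<open>Evaluation of ternary polynomials\<close>

text \<open>A predicate on maps, so that the same rules serve for \<open>id\<close>, for
  \<open>to_ac\<close> and for the evaluations \<open>insertion h v\<close>, which are again of this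
  kind.\<close>

definition coeff_hom :: "('a::comm_ring_1 \<Rightarrow> 'b::comm_ring_1) \<Rightarrow> bool" where
  "coeff_hom h \<longleftrightarrow> h 0 = 0 \<and> h 1 = 1 \<and> (\<forall>a b. h (a + b) = h a + h b) \<and> (\<forall>a b. h (a * b) = h a * h b)"

lemma coeff_hom_simps:
  assumes "coeff_hom h"
  shows "h 0 = 0" "h 1 = 1" "h (a + b) = h a + h b" "h (a * b) = h a * h b"
  using assms by (auto simp: coeff_hom_def)

definition mval :: "'a::comm_semiring_1 ^ 3 \<Rightarrow> (3 \<Rightarrow>\<^sub>0 nat) \<Rightarrow> 'a" where
  "mval v m = (\<Prod>i\<in>UNIV. v $ i ^ Poly_Mapping.lookup m i)"

lemma mval_0 [simp]: "mval v 0 = 1"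
  by (simp add: mval_def)

lemma mval_add: "mval v (m + n) = mval v m * mval v n"
  by (simp add: mval_def lookup_add power_add prod.distrib)

lemma mval_single: "mval v (Poly_Mapping.single i 1) = v $ i"
proof -
  have "mval v (Poly_Mapping.single i 1) = (\<Prod>j\<in>UNIV. if j = i then v $ j else 1)"
    unfolding mval_def by (intro prod.cong) (auto simp: lookup_single when_def)
  thus ?thesis by simp
qed

lemma insertion_mval:
  "insertion h v f = (\<Sum>m\<in>Poly_Mapping.keys f. h (Poly_Mapping.lookup f m) * mval v m)"
  by (simp add: insertion_def mval_def)

lemma insertion_superset:
  assumes "h 0 = 0" "finite A" "Poly_Mapping.keys f \<subseteq> A"
  shows "insertion h v f = (\<Sum>m\<in>A. h (Poly_Mapping.lookup f m) * mval v m)"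
  unfolding insertion_mval using assms
  by (intro sum.mono_neutral_left) (auto simp: in_keys_iff)

lemma insertion_0 [simp]: "insertion h v 0 = 0"
  by (simp add: insertion_def)

lemma insertion_single:
  assumes "h 0 = 0"
  shows "insertion h v (Poly_Mapping.single m c) = h c * mval v m"
  using insertion_superset[where h = h, OF assms, of "{m}" "Poly_Mapping.single m c" v] by simp

lemma insertion_add:
  assumes "coeff_hom h"
  shows "insertion h v (f + g) = insertion h v f + insertion h v g"
proof -
  let ?A = "Poly_Mapping.keys f \<union> Poly_Mapping.keys g"
  have h0: "h 0 = 0" using assms by (simp add: coeff_hom_def)
  have "Poly_Mapping.keys (f + g) \<subseteq> ?A" by (rule Poly_Mapping.keys_add)
  then show ?thesis
    using insertion_superset[where h = h, OF h0, of ?A "f + g" v] insertion_superset[where h = h, OF h0, of ?A f v]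
      insertion_superset[where h = h, OF h0, of ?A g v]
    by (simp add: lookup_add coeff_hom_simps[OF assms] sum.distrib algebra_simps)
qed

lemma insertion_sum:
  assumes "coeff_hom h"
  shows "insertion h v (\<Sum>a\<in>A. f a) = (\<Sum>a\<in>A. insertion h v (f a))"
  by (induction A rule: infinite_finite_induct) (auto simp: insertion_add[OF assms])

lemma tpoly_sum_monomials:
  fixes f :: "'a::comm_monoid_add tpoly"
  shows "f = (\<Sum>m\<in>Poly_Mapping.keys f. Poly_Mapping.single m (Poly_Mapping.lookup f m))"
  by (rule poly_mapping_eqI) (simp add: lookup_sum lookup_single when_def in_keys_iff)

lemma insertion_mult:
  assumes "coeff_hom h"
  shows "insertion h v (f * g) = insertion h v f * insertion h v g"
proof -
  have h0: "h 0 = 0" using assms by (simp add: coeff_hom_def)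
  have "f * g = (\<Sum>m\<in>Poly_Mapping.keys f. \<Sum>n\<in>Poly_Mapping.keys g.
      Poly_Mapping.single (m + n) (Poly_Mapping.lookup f m * Poly_Mapping.lookup g n))"
    by (subst tpoly_sum_monomials[of f], subst tpoly_sum_monomials[of g])
      (simp add: sum_product mult_single)
  then have "insertion h v (f * g) = (\<Sum>m\<in>Poly_Mapping.keys f. \<Sum>n\<in>Poly_Mapping.keys g.
      h (Poly_Mapping.lookup f m) * h (Poly_Mapping.lookup g n) * (mval v m * mval v n))"
    by (simp add: insertion_sum[OF assms] insertion_single[where h = h, OF h0] coeff_hom_simps[OF assms] mval_add)
  also have "\<dots> = insertion h v f * insertion h v g"
    by (simp add: insertion_mval sum_product mult_ac)
  finally show ?thesis .
qed

lemma insertion_const: "h 0 = 0 \<Longrightarrow> insertion h v (const_poly c) = h c"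
  by (simp add: const_poly_def insertion_single)

lemma insertion_var: "coeff_hom h \<Longrightarrow> insertion h v (var_poly i) = v $ i"
  by (simp only: var_poly_def insertion_single coeff_hom_simps mval_single mult_1_left)

lemma coeff_hom_to_ac: "coeff_hom to_ac"
  by (simp add: coeff_hom_def)

lemma coeff_hom_id: "coeff_hom id"
  by (simp add: coeff_hom_def)

lemma coeff_hom_insertion:
  assumes "coeff_hom h"
  shows "coeff_hom (insertion h v)"
  using insertion_const[where h = h and v = v and c = 0] insertion_const[where h = h and v = v and c = 1] assms
  by (simp add: coeff_hom_def insertion_add[OF assms] insertion_mult[OF assms] const_poly_def)

lemma coeff_hom_power: "coeff_hom h \<Longrightarrow> h (x ^ n) = h x ^ n"
  by (induction n) (simp_all add: coeff_hom_simps)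

lemma coeff_hom_prod: "coeff_hom h \<Longrightarrow> h (\<Prod>a\<in>A. f a) = (\<Prod>a\<in>A. h (f a))"
  by (induction A rule: infinite_finite_induct) (simp_all add: coeff_hom_simps)

lemma coeff_hom_sum: "coeff_hom h \<Longrightarrow> h (\<Sum>a\<in>A. f a) = (\<Sum>a\<in>A. h (f a))"
  by (induction A rule: infinite_finite_induct) (simp_all add: coeff_hom_simps)

lemma insertion_comp:
  assumes "coeff_hom h"
  shows "insertion h v (insertion const_poly G F) = insertion h (\<chi> i. insertion h v (G $ i)) F"
proof -
  note H = coeff_hom_insertion[OF assms, of v]
  show ?thesis
    unfolding insertion_def[of const_poly] insertion_def[of h "vec_lambda _"]
    by (simp add: coeff_hom_sum[OF H] coeff_hom_simps[OF H] coeff_hom_prod[OF H] coeff_hom_power[OF H]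
        insertion_const coeff_hom_simps[OF assms])
qed

subsection \<open>Forms\<close>

lemma form_0 [simp]: "form d 0"
  by (simp add: form_def)

lemma form_add: "form d f \<Longrightarrow> form d g \<Longrightarrow> form d (f + g)"
  unfolding form_def using Poly_Mapping.keys_add[of f g] by blast

lemma form_sum: "(\<And>a. a \<in> A \<Longrightarrow> form d (f a)) \<Longrightarrow> form d (\<Sum>a\<in>A. f a)"
  by (induction A rule: infinite_finite_induct) (auto intro: form_add)

lemma form_mult:
  assumes "form d f" "form e g"
  shows "form (d + e) (f * g)"
  using keys_mult[of f g] assms by (fastforce simp: form_def lookup_add sum.distrib)

lemma form_const: "form 0 (const_poly c)"
  by (auto simp: form_def const_poly_def)

lemma form_var: "form 1 (var_poly i)"
  by (auto simp: form_def var_poly_def lookup_single when_def)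

lemma form_one: "form 0 1"
  by (simp add: form_def)

lemma form_power: "form d f \<Longrightarrow> form (n * d) (f ^ n)"
proof (induction n)
  case (Suc n)
  then show ?case using form_mult[of d f "n * d" "f ^ n"] by simp
qed (simp add: form_one)

lemma prod_3: "prod f (UNIV :: 3 set) = f 1 * f 2 * f 3"
  unfolding UNIV_3 by (simp add: mult.assoc)

lemma form_prod_UNIV: "(\<And>i::3. form (d i) (f i)) \<Longrightarrow> form (\<Sum>i\<in>UNIV. d i) (\<Prod>i\<in>UNIV. f i)"
  using form_mult[OF form_mult[of "d 1" "f 1" "d 2" "f 2"], of "d 3" "f 3"]
  by (simp add: sum_3 prod_3)

lemma form_insertion:
  assumes "form d F" "\<And>i. form e (G $ i)"
  shows "form (d * e) (insertion const_poly G F)"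
  unfolding insertion_def
proof (rule form_sum)
  fix m assume m: "m \<in> Poly_Mapping.keys F"
  have "form (\<Sum>i\<in>UNIV. Poly_Mapping.lookup m i * e) (\<Prod>i\<in>UNIV. G $ i ^ Poly_Mapping.lookup m i)"
    by (intro form_prod_UNIV form_power assms)
  moreover have "(\<Sum>i\<in>UNIV. Poly_Mapping.lookup m i * e) = d * e"
    using assms(1) m by (simp add: form_def sum_distrib_right[symmetric])
  ultimately show "form (d * e) (const_poly (Poly_Mapping.lookup F m) * (\<Prod>i\<in>UNIV. G $ i ^ Poly_Mapping.lookup m i))"
    using form_mult[OF form_const] by fastforce
qed

subsection \<open>A polynomial that vanishes everywhere\<close>

lemma base_N_unique:
  fixes a b c a' b' c' N :: nat
  assumes "a < N" "b < N" "a' < N" "b' < N" "a + N * (b + N * c) = a' + N * (b' + N * c')"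
  shows "a = a' \<and> b = b' \<and> c = c'"
proof -
  have "a = (a + N * (b + N * c)) mod N" using assms(1) by simp
  also have "\<dots> = (a' + N * (b' + N * c')) mod N" by (simp only: assms(5))
  also have "\<dots> = a'" using assms(3) by simp
  finally have a: "a = a'" .
  with assms have bc: "b + N * c = b' + N * c'" by simp
  have "b = (b + N * c) mod N" using assms(2) by simp
  also have "\<dots> = (b' + N * c') mod N" by (simp only: bc)
  also have "\<dots> = b'" using assms(4) by simp
  finally show ?thesis using a bc assms by auto
qed

text \<open>Kronecker substitution: for large \<open>N\<close> distinct monomials have distinct powers of \<open>x\<close> as values
  at \<open>(x, x\<^sup>N, x\<^bsup>N^2\<^esup>)\<close>.\<close>

lemma insertion_eq_0_imp:
  fixes F :: "'a::comm_ring_1 tpoly" and h :: "'a \<Rightarrow> 'b::idom"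
  assumes inf: "infinite (UNIV :: 'b set)" and h: "coeff_hom h" "\<And>a. h a = 0 \<Longrightarrow> a = 0"
    and zero: "\<And>v. insertion h v F = 0"
  shows "F = 0"
proof (rule ccontr)
  assume "F \<noteq> 0"
  then obtain m0 where m0: "m0 \<in> Poly_Mapping.keys F"
    by (metis keys_eq_empty equals0I)
  define N where "N = Suc (Max (\<Union>m\<in>Poly_Mapping.keys F. Poly_Mapping.lookup m ` UNIV))"
  have N: "Poly_Mapping.lookup m i < N" if "m \<in> Poly_Mapping.keys F" for m i
    unfolding N_def less_Suc_eq_le using that by (intro Max_ge) auto
  define e where "e m = Poly_Mapping.lookup m (1::3) + N * (Poly_Mapping.lookup m 2 + N * Poly_Mapping.lookup m 3)" for m
  define P where "P = (\<Sum>m\<in>Poly_Mapping.keys F. Polynomial.monom (h (Poly_Mapping.lookup F m)) (e m))"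
  have inj: "m = m0" if "m \<in> Poly_Mapping.keys F" "e m = e m0" for m
  proof -
    have "Poly_Mapping.lookup m 1 = Poly_Mapping.lookup m0 1 \<and> Poly_Mapping.lookup m 2 = Poly_Mapping.lookup m0 2
        \<and> Poly_Mapping.lookup m 3 = Poly_Mapping.lookup m0 3"
      using that N m0 unfolding e_def by (intro base_N_unique[of _ N]) auto
    then show ?thesis by (intro poly_mapping_eqI) (metis exhaust_3)
  qed
  have "Polynomial.coeff P (e m0) = (\<Sum>m\<in>Poly_Mapping.keys F. if m = m0 then h (Poly_Mapping.lookup F m) else 0)"
    unfolding P_def coeff_sum by (intro sum.cong) (auto dest: inj)
  also have "\<dots> = h (Poly_Mapping.lookup F m0)" using m0 by simp
  also have "\<dots> \<noteq> 0" using m0 h(2)[of "Poly_Mapping.lookup F m0"] by (metis in_keys_iff)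
  finally have "P \<noteq> 0" by (metis coeff_0)
  have "poly P x = 0" for x
  proof -
    let ?v = "vector [x, x ^ N, x ^ (N * N)] :: 'b ^ 3"
    have "mval ?v m = x ^ e m" for m
      unfolding mval_def e_def
      by (simp add: prod_3 distrib_left mult.assoc add.assoc flip: power_add power_mult)
    then have "insertion h ?v F = poly P x"
      by (simp add: insertion_mval P_def poly_sum poly_monom)
    then show ?thesis using zero by simp
  qed
  then show False using poly_roots_finite[OF \<open>P \<noteq> 0\<close>] inf by simp
qed

subsection \<open>Homogeneous polynomial functions\<close>

inductive hp :: "'a::comm_ring_1 set \<Rightarrow> nat \<Rightarrow> ('a ^ 3 \<Rightarrow> 'a) \<Rightarrow> bool" for S where
  hp_const: "c \<in> S \<Longrightarrow> hp S 0 (\<lambda>v. c)"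
| hp_zero: "hp S d (\<lambda>v. 0)"
| hp_var: "hp S d f \<Longrightarrow> hp S (Suc d) (\<lambda>v. v $ i * f v)"
| hp_add: "hp S d f \<Longrightarrow> hp S d g \<Longrightarrow> hp S d (\<lambda>v. f v + g v)"

text \<open>The set of coefficients records rationality: \<open>UNIV\<close> for geometry over the
  closed field, \<open>range to_ac\<close> for forms defined over the ground field.\<close>

definition csubring :: "'a::comm_ring_1 set \<Rightarrow> bool" where
  "csubring S \<longleftrightarrow> 1 \<in> S \<and> (\<forall>a\<in>S. \<forall>b\<in>S. a * b \<in> S \<and> a - b \<in> S)"

lemma csubringD:
  assumes "csubring S"
  shows "0 \<in> S" "1 \<in> S" "a \<in> S \<Longrightarrow> b \<in> S \<Longrightarrow> a * b \<in> S" "a \<in> S \<Longrightarrow> b \<in> S \<Longrightarrow> a - b \<in> S"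
    "a \<in> S \<Longrightarrow> - a \<in> S" "a \<in> S \<Longrightarrow> b \<in> S \<Longrightarrow> a + b \<in> S"
proof -
  have *: "1 \<in> S" "\<And>a b. a \<in> S \<Longrightarrow> b \<in> S \<Longrightarrow> a * b \<in> S" "\<And>a b. a \<in> S \<Longrightarrow> b \<in> S \<Longrightarrow> a - b \<in> S"
    using assms by (auto simp: csubring_def)
  show 0: "0 \<in> S" using *(3)[OF *(1) *(1)] by simp
  have m: "- a \<in> S" if "a \<in> S" for a using *(3)[OF 0 that] by simp
  show "1 \<in> S" "a \<in> S \<Longrightarrow> b \<in> S \<Longrightarrow> a * b \<in> S" "a \<in> S \<Longrightarrow> b \<in> S \<Longrightarrow> a - b \<in> S" by fact+
  show "a \<in> S \<Longrightarrow> - a \<in> S" by (rule m)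
  show "a \<in> S \<Longrightarrow> b \<in> S \<Longrightarrow> a + b \<in> S" using *(3)[of a "- b"] m[of b] by simp
qed

lemma csubring_UNIV [simp]: "csubring UNIV"
  by (simp add: csubring_def)

lemma csubring_to_ac [simp]: "csubring (range to_ac)"
  unfolding csubring_def by (auto simp flip: to_ac_mult to_ac_diff to_ac_1)

lemma csubring_power: "csubring S \<Longrightarrow> a \<in> S \<Longrightarrow> a ^ n \<in> S"
  by (induction n) (auto intro: csubringD)

lemma csubring_sum: "csubring S \<Longrightarrow> (\<And>i. i \<in> A \<Longrightarrow> f i \<in> S) \<Longrightarrow> sum f A \<in> S"
  by (induction A rule: infinite_finite_induct) (auto intro: csubringD)

lemma csubring_numeral: "csubring S \<Longrightarrow> numeral n \<in> S"
proof (induction n)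
  case (Bit0 n)
  then show ?case unfolding numeral_Bit0 by (intro csubringD(6)) auto
next
  case (Bit1 n)
  then show ?case unfolding numeral_Bit1 by (intro csubringD(6)) (auto intro: csubringD)
qed (auto intro: csubringD)

lemma hp_smult:
  assumes "hp S d f" "c \<in> S" "csubring S"
  shows "hp S d (\<lambda>v. c * f v)"
  using assms(1)
proof induction
  case (hp_const c')
  then show ?case using assms by (auto intro: hp.hp_const csubringD)
next
  case (hp_zero d)
  show ?case by (simp add: hp.hp_zero)
next
  case (hp_var d f i)
  from hp.hp_var[OF hp_var.IH, of i] show ?case by (simp add: mult_ac)
next
  case (hp_add d f g)
  from hp.hp_add[OF hp_add.IH] show ?case by (simp add: algebra_simps)
qed

lemma hp_mult:
  assumes "hp S d f" "hp S e g" "csubring S"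
  shows "hp S (d + e) (\<lambda>v. f v * g v)"
  using assms(1)
proof induction
  case (hp_const c)
  then show ?case using hp_smult assms by auto
next
  case (hp_zero d)
  show ?case by (simp add: hp.hp_zero)
next
  case (hp_var d f i)
  from hp.hp_var[OF hp_var.IH, of i] show ?case by (simp add: mult_ac)
next
  case (hp_add d f g')
  from hp.hp_add[OF hp_add.IH] show ?case by (simp add: algebra_simps)
qed

lemma hp_neg: "hp S d f \<Longrightarrow> csubring S \<Longrightarrow> hp S d (\<lambda>v. - f v)"
  using hp_smult[of S d f "- 1"] csubringD(5)[of S 1] csubringD(2)[of S] by simp

lemma hp_diff: "hp S d f \<Longrightarrow> hp S d g \<Longrightarrow> csubring S \<Longrightarrow> hp S d (\<lambda>v. f v - g v)"
  using hp_add[of S d f "\<lambda>v. - g v"] hp_neg[of S d g] by simp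

lemma hp_component: "csubring S \<Longrightarrow> hp S 1 (\<lambda>v. v $ i)"
  using hp_var[OF hp_const[of 1 S], of i] by (simp add: csubringD)

lemma hp_sum: "(\<And>a. a \<in> A \<Longrightarrow> hp S d (f a)) \<Longrightarrow> hp S d (\<lambda>v. \<Sum>a\<in>A. f a v)"
  by (induction A rule: infinite_finite_induct) (auto intro: hp.intros)

lemma hp_power: "hp S d f \<Longrightarrow> csubring S \<Longrightarrow> hp S (n * d) (\<lambda>v. f v ^ n)"
proof (induction n)
  case 0
  then show ?case using hp_const[of 1 S] by (simp add: csubringD)
next
  case (Suc n)
  then show ?case using hp_mult[of S d f "n * d" "\<lambda>v. f v ^ n"] by simp
qed

lemma hp_mono: "hp S d f \<Longrightarrow> S \<subseteq> T \<Longrightarrow> hp T d f"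
  by (induction rule: hp.induct) (auto intro: hp.intros)

lemma hp_comp:
  assumes "hp S d f" "\<And>i. hp S e (\<lambda>v. G v $ i)" "csubring S"
  shows "hp S (d * e) (\<lambda>v. f (G v))"
  using assms(1)
proof induction
  case (hp_var d f i)
  from hp_mult[OF assms(2)[of i] hp_var.IH assms(3)] show ?case by simp
qed (auto intro: hp.intros)

lemma hp_scale: "hp S d f \<Longrightarrow> f (c *s v) = c ^ d * f v"
  by (induction rule: hp.induct) (simp_all add: algebra_simps)

lemma hp_insertion:
  assumes "form d F" "coeff_hom h"
  shows "hp (range h) d (\<lambda>v. insertion h v F)"
proof -
  have "csubring (range h)"
  proof -
    have "h (a - b) = h a - h b" for a b
      using coeff_hom_simps(3)[OF assms(2), of "a - b" b] by simp
    then have "h a - h b \<in> range h" for a b by (metis rangeI)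
    moreover have "h a * h b \<in> range h" for a b by (metis rangeI coeff_hom_simps(4)[OF assms(2)])
    moreover have "1 \<in> range h" by (metis rangeI coeff_hom_simps(2)[OF assms(2)])
    ultimately show ?thesis unfolding csubring_def by blast
  qed
  note cs = this
  show ?thesis unfolding insertion_def
  proof (rule hp_sum)
    fix m assume m: "m \<in> Poly_Mapping.keys F"
    have "hp (range h) (0 + (Poly_Mapping.lookup m 1 * 1 + Poly_Mapping.lookup m 2 * 1 + Poly_Mapping.lookup m 3 * 1))
      (\<lambda>v. h (Poly_Mapping.lookup F m) * (v $ 1 ^ Poly_Mapping.lookup m 1 * v $ 2 ^ Poly_Mapping.lookup m 2 * v $ 3 ^ Poly_Mapping.lookup m 3))"
      by (intro hp_mult hp_power hp_component hp_const cs) auto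
    moreover have "Poly_Mapping.lookup m 1 + Poly_Mapping.lookup m 2 + Poly_Mapping.lookup m 3 = d"
      using assms(1) m by (simp add: form_def sum_3)
    ultimately show "hp (range h) d (\<lambda>v. h (Poly_Mapping.lookup F m) * (\<Prod>i\<in>UNIV. v $ i ^ Poly_Mapping.lookup m i))"
      by (simp add: prod_3)
  qed
qed

lemma hp_imp_form:
  assumes "hp (range h) d f" "coeff_hom h"
  shows "\<exists>F. form d F \<and> (\<forall>v. insertion h v F = f v)"
  using assms(1)
proof induction
  case (hp_const c)
  then obtain a where "c = h a" by auto
  then show ?case using form_const[of a] insertion_const[where h = h] coeff_hom_simps[OF assms(2)] by metis
next
  case (hp_zero d)
  show ?case by (rule exI[of _ 0]) simp
next
  case (hp_var d f i)
  then obtain F where "form d F" "\<forall>v. insertion h v F = f v" by blast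
  then show ?case using form_mult[OF form_var[of i], of d F] insertion_mult[OF assms(2)] insertion_var[OF assms(2)]
    by (intro exI[of _ "var_poly i * F"]) auto
next
  case (hp_add d f g)
  then show ?case using form_add insertion_add[OF assms(2)] by metis
qed

text \<open>The coefficient at \<open>t^d\<close> is the value at the point at infinity
  \<open>w\<close> of the line; if it is nonzero, so is the polynomial.\<close>

lemma hp_poly_line:
  assumes "hp S d f"
  obtains p where "degree p \<le> d" "coeff p d = f w" "\<And>t. f (u + t *s w) = poly p t"
proof -
  have "\<exists>p. degree p \<le> d \<and> coeff p d = f w \<and> (\<forall>t. f (u + t *s w) = poly p t)"
    using assms
  proof induction
    case (hp_const c)
    show ?case by (rule exI[of _ "[:c:]"]) simp
  next
    case (hp_zero d)
    show ?case by (rule exI[of _ 0]) simp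
  next
    case (hp_var d f i)
    then obtain p where p: "degree p \<le> d" "coeff p d = f w" "\<forall>t. f (u + t *s w) = poly p t" by blast
    let ?p = "[:u $ i, w $ i:] * p"
    have "degree ?p \<le> Suc d"
      using degree_mult_le[of "[:u $ i, w $ i:]" p] p(1) by (auto intro: order.trans)
    moreover have "coeff ?p (Suc d) = w $ i * f w"
      using p(1,2) by (simp add: coeff_eq_0)
    moreover have "\<forall>t. (u + t *s w) $ i * f (u + t *s w) = poly ?p t"
      using p(3) by (simp add: algebra_simps)
    ultimately show ?case by blast
  next
    case (hp_add d f g)
    then obtain p q where "degree p \<le> d" "coeff p d = f w" "\<forall>t. f (u + t *s w) = poly p t"
      "degree q \<le> d" "coeff q d = g w" "\<forall>t. g (u + t *s w) = poly q t" by blast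
    then show ?case by (intro exI[of _ "p + q"]) (auto intro: degree_add_le)
  qed
  then show ?thesis using that by blast
qed

lemma sum_axis_mult: "(\<Sum>j\<in>UNIV. axis i 1 $ j * w j) = (w i :: 'a::comm_ring_1)"
proof -
  have "(\<Sum>j\<in>UNIV. axis i 1 $ j * w j) = (\<Sum>j\<in>UNIV. if j = i then w j else 0)"
    by (intro sum.cong) (auto simp: axis_def)
  then show ?thesis by simp
qed

text \<open>The gradient \<open>g\<close> at \<open>z\<close> is built along the induction, before
  \<open>v\<close> is given, so the first order term is linear in the direction. The remainder is
  polynomial in \<open>e\<close>, in any characteristic.\<close>

lemma hp_taylor:
  assumes "hp S d f"
  obtains g where "\<And>v. \<exists>r. \<forall>e. f (z + e *s v) = f z + e * (\<Sum>i\<in>UNIV. g $ i * v $ i) + e ^ 2 * poly r e"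
proof -
  have "\<exists>g :: 'a ^ 3. \<forall>v. \<exists>r. \<forall>e. f (z + e *s v) = f z + e * (\<Sum>i\<in>UNIV. g $ i * v $ i) + e ^ 2 * poly r e"
    using assms
  proof induction
    case (hp_const c)
    show ?case by (rule exI[of _ 0]) (auto intro: exI[of _ 0])
  next
    case (hp_zero d)
    show ?case by (rule exI[of _ 0]) (auto intro: exI[of _ 0])
  next
    case (hp_var d f i)
    then obtain g :: "'a ^ 3" where g: "\<forall>v. \<exists>r. \<forall>e. f (z + e *s v) = f z + e * (\<Sum>i\<in>UNIV. g $ i * v $ i) + e ^ 2 * poly r e"
      by blast
    show ?case
    proof (rule exI[of _ "z $ i *s g + f z *s axis i 1"], intro allI)
      fix v
      obtain r where r: "\<forall>e. f (z + e *s v) = f z + e * (\<Sum>i\<in>UNIV. g $ i * v $ i) + e ^ 2 * poly r e" using g by blast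
      have s: "(\<Sum>j\<in>UNIV. (z $ i *s g + f z *s axis i 1) $ j * v $ j) = z $ i * (\<Sum>j\<in>UNIV. g $ j * v $ j) + f z * v $ i"
      proof -
        have "(\<Sum>j\<in>UNIV. (z $ i *s g + f z *s axis i 1) $ j * v $ j)
          = (\<Sum>j\<in>UNIV. z $ i * (g $ j * v $ j) + f z * (axis i 1 $ j * v $ j))"
          by (intro sum.cong refl) (simp add: algebra_simps)
        also have "\<dots> = z $ i * (\<Sum>j\<in>UNIV. g $ j * v $ j) + f z * (\<Sum>j\<in>UNIV. axis i 1 $ j * v $ j)"
          by (simp only: sum.distrib sum_distrib_left)
        finally show ?thesis by (simp only: sum_axis_mult)
      qed
      show "\<exists>r. \<forall>e. (z + e *s v) $ i * f (z + e *s v) = z $ i * f z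
          + e * (\<Sum>j\<in>UNIV. (z $ i *s g + f z *s axis i 1) $ j * v $ j) + e ^ 2 * poly r e"
        unfolding s
        by (rule exI[of _ "smult (z $ i) r + [:v $ i * (\<Sum>j\<in>UNIV. g $ j * v $ j):] + [:0, v $ i:] * r"])
          (simp add: r algebra_simps power2_eq_square)
    qed
  next
    case (hp_add d f g)
    then obtain a b :: "'a ^ 3" where a: "\<forall>v. \<exists>r. \<forall>e. f (z + e *s v) = f z + e * (\<Sum>i\<in>UNIV. a $ i * v $ i) + e ^ 2 * poly r e"
      and b: "\<forall>v. \<exists>r. \<forall>e. g (z + e *s v) = g z + e * (\<Sum>i\<in>UNIV. b $ i * v $ i) + e ^ 2 * poly r e"
      by blast
    show ?case
    proof (rule exI[of _ "a + b"], intro allI)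
      fix v
      obtain r where r: "\<forall>e. f (z + e *s v) = f z + e * (\<Sum>i\<in>UNIV. a $ i * v $ i) + e ^ 2 * poly r e" using a by blast
      obtain r' where r': "\<forall>e. g (z + e *s v) = g z + e * (\<Sum>i\<in>UNIV. b $ i * v $ i) + e ^ 2 * poly r' e" using b by blast
      show "\<exists>r. \<forall>e. f (z + e *s v) + g (z + e *s v) = f z + g z + e * (\<Sum>i\<in>UNIV. (a + b) $ i * v $ i) + e ^ 2 * poly r e"
        by (rule exI[of _ "r + r'"]) (simp add: r r' algebra_simps sum.distrib)
    qed
  qed
  then show ?thesis using that by blast
qed

text \<open>Modulo a linear form \<open>n\<close> with \<open>n\<^sub>i \<noteq> 0\<close>, the coordinate \<open>x\<^sub>i\<close> can be eliminated.\<close>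

definition elim_coord :: "'a::field ^ 3 \<Rightarrow> 3 \<Rightarrow> 'a ^ 3 \<Rightarrow> 'a ^ 3" where
  "elim_coord n i v = v - ((\<Sum>j\<in>UNIV. n $ j * v $ j) / n $ i) *s axis i 1"

lemma hp_linear:
  assumes "csubring S" "\<And>j. n $ j \<in> S"
  shows "hp S 1 (\<lambda>v. \<Sum>j\<in>UNIV. n $ j * v $ j)"
  by (intro hp_sum hp_smult hp_component assms)

lemma hp_elim_coord: "hp UNIV 1 (\<lambda>v. elim_coord n i v $ j)"
proof -
  have "hp UNIV 1 (\<lambda>v. v $ j - (axis i 1 $ j / n $ i) * (\<Sum>j\<in>UNIV. n $ j * v $ j))"
    by (intro hp_diff hp_smult hp_component hp_linear) auto
  then show ?thesis by (simp add: elim_coord_def mult_ac)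
qed

text \<open>Eliminating a coordinate changes each variable by a multiple of the linear form. The
  quotient has degree \<open>d - 1\<close>, which in the natural numbers makes sense only for
  \<open>d > 0\<close>.\<close>

lemma hp_mod_linear:
  assumes "hp UNIV d f"
  shows "\<exists>g. (d > 0 \<longrightarrow> hp UNIV (d - 1) g) \<and>
    (\<forall>v. f v - f (elim_coord n i v) = (\<Sum>j\<in>UNIV. n $ j * v $ j) * g v)"
  using assms
proof induction
  case (hp_const c)
  show ?case by (rule exI[of _ "\<lambda>_. 0"]) simp
next
  case (hp_zero d)
  show ?case by (rule exI[of _ "\<lambda>_. 0"]) (simp add: hp.hp_zero)
next
  case (hp_var d f k)
  then obtain g where g: "d > 0 \<longrightarrow> hp UNIV (d - 1) g"
    "\<forall>v. f v - f (elim_coord n i v) = (\<Sum>j\<in>UNIV. n $ j * v $ j) * g v" by blast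
  \<comment> \<open>For \<open>d = 0\<close> the induction hypothesis gives no degree for
    \<open>g\<close>; as \<open>f\<close> is then constant, the zero function serves as
    quotient.\<close>
  define g' where "g' = (if d > 0 then g else (\<lambda>_. 0))"
  have const: "f v = f w" if "d = 0" for v w
  proof -
    have "f x = f 0" for x using hp_scale[OF hp_var.hyps, of 0 x] that by simp
    then show ?thesis by metis
  qed
  have g': "f v - f (elim_coord n i v) = (\<Sum>j\<in>UNIV. n $ j * v $ j) * g' v" for v
    using g(2) const[of v "elim_coord n i v"] by (cases "d = 0") (simp_all add: g'_def)
  have "hp UNIV d (\<lambda>v. v $ k * g' v)"
  proof (cases d)
    case 0
    then show ?thesis by (simp add: g'_def hp.hp_zero)
  next
    case (Suc m)
    then show ?thesis using g(1) hp.hp_var[of UNIV m g k] by (simp add: g'_def)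
  qed
  moreover have "hp UNIV d (\<lambda>v. (axis i 1 $ k / n $ i) * f (elim_coord n i v))"
    using hp_smult[OF hp_comp[OF hp_var.hyps hp_elim_coord], of "axis i 1 $ k / n $ i" n i] by simp
  ultimately have 1: "hp UNIV d (\<lambda>v. v $ k * g' v + (axis i 1 $ k / n $ i) * f (elim_coord n i v))"
    by (rule hp.hp_add)
  have 2: "v $ k * f v - elim_coord n i v $ k * f (elim_coord n i v)
      = (\<Sum>j\<in>UNIV. n $ j * v $ j) * (v $ k * g' v + (axis i 1 $ k / n $ i) * f (elim_coord n i v))" for v
  proof -
    have "v $ k * f v - elim_coord n i v $ k * f (elim_coord n i v)
      = v $ k * (f v - f (elim_coord n i v)) + (v $ k - elim_coord n i v $ k) * f (elim_coord n i v)"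
      by (simp add: algebra_simps)
    also have "v $ k - elim_coord n i v $ k = (\<Sum>j\<in>UNIV. n $ j * v $ j) * (axis i 1 $ k / n $ i)"
      by (simp add: elim_coord_def)
    finally show ?thesis unfolding g' by (simp add: algebra_simps)
  qed
  show ?case using 1 2 by (intro exI[of _ "\<lambda>v. v $ k * g' v + (axis i 1 $ k / n $ i) * f (elim_coord n i v)"]) simp
next
  case (hp_add d f f')
  then obtain g g' where "d > 0 \<longrightarrow> hp UNIV (d - 1) g" "d > 0 \<longrightarrow> hp UNIV (d - 1) g'"
    "\<forall>v. f v - f (elim_coord n i v) = (\<Sum>j\<in>UNIV. n $ j * v $ j) * g v"
    "\<forall>v. f' v - f' (elim_coord n i v) = (\<Sum>j\<in>UNIV. n $ j * v $ j) * g' v" by blast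
  note g = this
  have "f v + f' v - (f (elim_coord n i v) + f' (elim_coord n i v)) = (\<Sum>j\<in>UNIV. n $ j * v $ j) * (g v + g' v)" for v
    using g(3,4) by (simp add: distrib_left flip: g(3,4)[rule_format])
  moreover have "d > 0 \<longrightarrow> hp UNIV (d - 1) (\<lambda>v. g v + g' v)" using g(1,2) hp.hp_add by blast
  ultimately show ?case by (intro exI[of _ "\<lambda>v. g v + g' v"]) simp
qed

text \<open>\<open>elim_coord\<close> projects onto the kernel of \<open>n\<close> along a
  coordinate axis, so the vanishing hypothesis removes the remainder.\<close>

lemma hp_divide_linear:
  assumes "hp UNIV (Suc d) f" "n \<noteq> (0 :: 'a::field ^ 3)" "\<And>v. (\<Sum>j\<in>UNIV. n $ j * v $ j) = 0 \<Longrightarrow> f v = 0"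
  obtains g where "hp UNIV d g" "\<And>v. f v = (\<Sum>j\<in>UNIV. n $ j * v $ j) * g v"
proof -
  obtain i where i: "n $ i \<noteq> 0" using assms(2) by (metis vec_eq_iff zero_index)
  have "(\<Sum>j\<in>UNIV. n $ j * elim_coord n i v $ j) = 0" for v
  proof -
    have "(\<Sum>j\<in>UNIV. n $ j * elim_coord n i v $ j)
      = (\<Sum>j\<in>UNIV. n $ j * v $ j) - (\<Sum>j\<in>UNIV. n $ j * ((\<Sum>j\<in>UNIV. n $ j * v $ j) / n $ i * axis i 1 $ j))"
      by (simp add: elim_coord_def algebra_simps sum_subtractf)
    also have "(\<Sum>j\<in>UNIV. n $ j * ((\<Sum>j\<in>UNIV. n $ j * v $ j) / n $ i * axis i 1 $ j))
      = n $ i * ((\<Sum>j\<in>UNIV. n $ j * v $ j) / n $ i)"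
      by (simp add: axis_def if_distrib cong: if_cong)
    finally show ?thesis using i by simp
  qed
  then have "f (elim_coord n i v) = 0" for v using assms(3) by blast
  then show ?thesis using hp_mod_linear[OF assms(1), of n i] that by auto
qed

text \<open>On the line from \<open>u\<close> in the direction \<open>w\<close> neither function
  restricts to zero: \<open>f\<close> by its value at parameter 0, \<open>g\<close> by its top
  coefficient. The product is then a nonzero polynomial and has a nonroot.\<close>

lemma hp_mult_nonzero:
  fixes f g :: "'a::idom ^ 3 \<Rightarrow> 'a"
  assumes "infinite (UNIV :: 'a set)" "hp S d f" "hp S e g" "f u \<noteq> 0" "g w \<noteq> 0"
  shows "\<exists>v. f v \<noteq> 0 \<and> g v \<noteq> 0"
proof -
  obtain p where p: "degree p \<le> d" "coeff p d = f w" "\<And>t. f (u + t *s w) = poly p t"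
    using hp_poly_line[OF assms(2)] by blast
  obtain r where r: "degree r \<le> e" "coeff r e = g w" "\<And>t. g (u + t *s w) = poly r t"
    using hp_poly_line[OF assms(3)] by blast
  have "poly p 0 \<noteq> 0" using assms(4) p(3)[of 0] by simp
  then have "p \<noteq> 0" by auto
  moreover have "r \<noteq> 0" using r(2) assms(5) by auto
  ultimately have "p * r \<noteq> 0" by simp
  then obtain t where "poly (p * r) t \<noteq> 0"
    using poly_roots_finite[of "p * r"] assms(1) by (metis (mono_tags) UNIV_I finite_subset mem_Collect_eq subsetI)
  then show ?thesis using p(3) r(3) by (intro exI[of _ "u + t *s w"]) auto
qed

lemma infinite_alg_closed: "infinite (UNIV :: 'a::alg_closed_field set)"
proof
  assume fin: "finite (UNIV :: 'a set)"
  define P :: "'a poly" where "P = (\<Prod>a\<in>UNIV. [:- a, 1:])"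
  have "degree P = card (UNIV :: 'a set)"
    unfolding P_def by (subst degree_prod_sum_eq) auto
  then have "degree P > 0" using fin finite_UNIV_card_ge_0 by metis
  then have "degree (P + 1) > 0" by (simp add: degree_add_eq_left)
  then obtain x where "poly (P + 1) x = 0" using alg_closed_imp_poly_has_root by blast
  moreover have "poly P x = 0"
    using fin by (auto simp: P_def poly_prod)
  ultimately show False by simp
qed

subsection \<open>Generic points\<close>

text \<open>Validity on a nonempty Zariski open set of vectors, given by a single form. Over an
  algebraically closed field any two such sets meet, so a polynomial identity that holds generically
  holds everywhere.\<close>

definition gen :: "('a::field ^ 3 \<Rightarrow> bool) \<Rightarrow> bool" where
  "gen P \<longleftrightarrow> (\<exists>d f. hp UNIV d f \<and> (\<exists>u. f u \<noteq> 0) \<and> (\<forall>v. f v \<noteq> 0 \<longrightarrow> P v))"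

lemma gen_hp: "hp S d f \<Longrightarrow> f u \<noteq> 0 \<Longrightarrow> gen (\<lambda>v. f v \<noteq> 0)"
  unfolding gen_def using hp_mono[of S d f UNIV] by blast

lemma gen_mono: "gen P \<Longrightarrow> (\<And>v. P v \<Longrightarrow> Q v) \<Longrightarrow> gen Q"
  unfolding gen_def by blast

lemma gen_conj:
  fixes P Q :: "'a::alg_closed_field ^ 3 \<Rightarrow> bool"
  assumes "gen P" "gen Q"
  shows "gen (\<lambda>v. P v \<and> Q v)"
proof -
  obtain d f e g u w where f: "hp UNIV d f" "f u \<noteq> 0" "\<forall>v. f v \<noteq> 0 \<longrightarrow> P v"
    and g: "hp UNIV e g" "g w \<noteq> 0" "\<forall>v. g v \<noteq> 0 \<longrightarrow> Q v"
    using assms unfolding gen_def by blast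
  obtain v where "f v \<noteq> 0" "g v \<noteq> 0"
    using hp_mult_nonzero[OF infinite_alg_closed f(1) g(1) f(2) g(2)] by blast
  then have "\<exists>v. f v * g v \<noteq> 0" by auto
  moreover have "hp UNIV (d + e) (\<lambda>v. f v * g v)" using hp_mult[OF f(1) g(1)] by simp
  ultimately show ?thesis unfolding gen_def using f(3) g(3)
    by (intro exI[of _ "d + e"] exI[of _ "\<lambda>v. f v * g v"]) auto
qed

lemma gen_ex: "gen P \<Longrightarrow> \<exists>v. P v"
  unfolding gen_def by blast

lemma gen_hp_zero:
  fixes f :: "'a::alg_closed_field ^ 3 \<Rightarrow> 'a"
  assumes "hp S d f" "gen (\<lambda>v. f v = 0)"
  shows "f v = 0"
proof (rule ccontr)
  assume "f v \<noteq> 0"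
  from gen_ex[OF gen_conj[OF assms(2) gen_hp[OF assms(1) this]]] show False by simp
qed

subsection \<open>Rational maps at geometric points\<close>

text \<open>The zero vector is parallel to everything, so the relation between values of two triples
  makes sense also at their common zeros. The price is that transitivity needs a nonzero middle
  vector.\<close>

definition par :: "'a::field ^ 3 \<Rightarrow> 'a ^ 3 \<Rightarrow> bool" where
  "par v w \<longleftrightarrow> (\<forall>i j. v $ i * w $ j = v $ j * w $ i)"

lemma par_sym: "par v w \<Longrightarrow> par w v"
  unfolding par_def by (metis mult.commute)

lemma par_0 [simp]: "par 0 w" "par v 0"
  by (auto simp: par_def)

lemma par_refl [simp]: "par v v"
  by (auto simp: par_def mult.commute)

lemma par_smult: "par v w \<Longrightarrow> par (c *s v) w"
  by (simp add: par_def mult.assoc)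

lemma par_smult_self [simp]: "par (c *s v) v" "par v (c *s v)"
  using par_smult[OF par_refl, of c v] par_sym by auto

lemma parE:
  assumes "par v w" "v \<noteq> 0"
  obtains c where "w = c *s v"
proof -
  obtain i where i: "v $ i \<noteq> 0" using assms(2) by (metis vec_eq_iff zero_index)
  have "w = (w $ i / v $ i) *s v"
    using assms(1) i by (auto simp: vec_eq_iff par_def field_simps)
  then show ?thesis using that by blast
qed

lemma par_trans: "par u v \<Longrightarrow> par v w \<Longrightarrow> v \<noteq> 0 \<Longrightarrow> par u w"
proof -
  assume "par u v" "par v w" "v \<noteq> 0"
  then obtain c where "w = c *s v" by (auto elim: parE)
  then show ?thesis using par_smult[OF par_sym[OF \<open>par u v\<close>], of c] par_sym by simp
qed

lemma par_matrix: "par v w \<Longrightarrow> par (A *v v) (A *v w)"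
proof (cases "v = 0")
  case False
  moreover assume "par v w"
  ultimately obtain c where "w = c *s v" by (auto elim: parE)
  then show ?thesis by (simp add: vector_scalar_commute)
qed simp

definition ev :: "'k::field triple \<Rightarrow> 'k alg_closure ^ 3 \<Rightarrow> 'k alg_closure ^ 3" where
  "ev F v = (\<chi> i. insertion to_ac v (F $ i))"

lemma tpoly_eq_0_iff: "F = (0 :: 'k::field tpoly) \<longleftrightarrow> (\<forall>v. insertion to_ac v F = 0)"
  using insertion_eq_0_imp[OF infinite_alg_closed coeff_hom_to_ac, of F] by auto

lemma insertion_diff:
  fixes f :: "'a::comm_ring_1 tpoly"
  assumes "coeff_hom h"
  shows "insertion h v (f - g) = insertion h v f - insertion h v g"
  using insertion_add[OF assms, of v "f - g" g] by simp

text \<open>Identities between polynomials over the ground field can be tested at points over its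
  closure, which is infinite even when the ground field is finite.\<close>

lemma ratmap_rel_iff:
  "(F, G) \<in> ratmap_rel \<longleftrightarrow> F \<in> triples \<and> G \<in> triples \<and> (\<forall>v. par (ev F v) (ev G v))"
proof -
  have "F $ i * G $ j = F $ j * G $ i \<longleftrightarrow> (\<forall>v. ev F v $ i * ev G v $ j = ev F v $ j * ev G v $ i)" for i j
  proof -
    have "F $ i * G $ j = F $ j * G $ i \<longleftrightarrow> F $ i * G $ j - F $ j * G $ i = 0" by simp
    then show ?thesis
      unfolding tpoly_eq_0_iff by (simp add: insertion_diff insertion_mult coeff_hom_to_ac ev_def)
  qed
  then show ?thesis unfolding ratmap_rel_def par_def by blast
qed

lemma triples_hp:
  assumes "F \<in> triples"
  obtains d where "\<And>i. hp (range to_ac) d (\<lambda>v. ev F v $ i)"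
proof -
  obtain d where d: "\<And>i. form d (F $ i)" using assms by (auto simp: triples_def)
  have "hp (range to_ac) d (\<lambda>v. ev F v $ i)" for i
    using hp_insertion[OF d coeff_hom_to_ac, of i] by (simp add: ev_def)
  then show ?thesis using that by blast
qed

lemma triples_nonzero:
  assumes "F \<in> triples"
  shows "\<exists>v. ev F v \<noteq> 0"
proof -
  obtain i where "F $ i \<noteq> 0" using assms by (auto simp: triples_def vec_eq_iff)
  then show ?thesis unfolding tpoly_eq_0_iff by (auto simp: ev_def vec_eq_iff)
qed

lemma gen_triples: "F \<in> triples \<Longrightarrow> gen (\<lambda>v. ev F v \<noteq> 0)"
proof -
  assume F: "F \<in> triples"
  obtain d where d: "\<And>i. hp (range to_ac) d (\<lambda>v. ev F v $ i)" using triples_hp[OF F] by blast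
  obtain u i where "ev F u $ i \<noteq> 0" using triples_nonzero[OF F] by (auto simp: vec_eq_iff)
  from gen_hp[OF d[of i] this] show ?thesis by (rule gen_mono) auto
qed

lemma ev_scale: "F \<in> triples \<Longrightarrow> \<exists>d. \<forall>c v. ev F (c *s v) = c ^ d *s ev F v"
proof -
  assume "F \<in> triples"
  then obtain d where "\<And>i. hp (range to_ac) d (\<lambda>v. ev F v $ i)" using triples_hp by blast
  from hp_scale[OF this] show ?thesis by (intro exI[of _ d]) (simp add: vec_eq_iff)
qed

text \<open>Proportionality is a closed condition, so it extends from general vectors to all. This
  is what makes the relation transitive and compatible with composition despite common zeros of the
  forms.\<close>

lemma gen_par:
  assumes "F \<in> triples" "G \<in> triples" "gen (\<lambda>v. par (ev F v) (ev G v))"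
  shows "(F, G) \<in> ratmap_rel"
proof -
  obtain d where d: "\<And>i. hp (range to_ac) d (\<lambda>v. ev F v $ i)" using triples_hp[OF assms(1)] by blast
  obtain e where e: "\<And>i. hp (range to_ac) e (\<lambda>v. ev G v $ i)" using triples_hp[OF assms(2)] by blast
  have "ev F v $ i * ev G v $ j - ev F v $ j * ev G v $ i = 0" for v i j
  proof (rule gen_hp_zero[where f = "\<lambda>v. ev F v $ i * ev G v $ j - ev F v $ j * ev G v $ i"])
    show "hp (range to_ac) (d + e) (\<lambda>v. ev F v $ i * ev G v $ j - ev F v $ j * ev G v $ i)"
      by (intro hp_diff hp_mult d e csubring_to_ac)
    show "gen (\<lambda>v. ev F v $ i * ev G v $ j - ev F v $ j * ev G v $ i = 0)"
      using assms(3) by (rule gen_mono) (simp add: par_def)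
  qed
  then show ?thesis using assms by (simp add: ratmap_rel_iff par_def)
qed

lemma ratmap_rel_refl: "F \<in> triples \<Longrightarrow> (F, F) \<in> ratmap_rel"
  by (simp add: ratmap_rel_iff)

lemma ratmap_rel_sym: "(F, G) \<in> ratmap_rel \<Longrightarrow> (G, F) \<in> ratmap_rel"
  by (auto simp: ratmap_rel_iff intro: par_sym)

lemma ratmap_rel_trans:
  assumes "(F, G) \<in> ratmap_rel" "(G, H) \<in> ratmap_rel"
  shows "(F, H) \<in> ratmap_rel"
proof (rule gen_par)
  show "gen (\<lambda>v. par (ev F v) (ev H v))"
  proof (rule gen_mono)
    show "gen (\<lambda>v. ev G v \<noteq> 0)" using assms by (simp add: gen_triples ratmap_rel_iff)
    show "par (ev F v) (ev H v)" if "ev G v \<noteq> 0" for v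
      using par_trans[OF _ _ that] assms by (simp add: ratmap_rel_iff)
  qed
qed (use assms in \<open>auto simp: ratmap_rel_iff\<close>)

lemma ratmap_class_eq_iff:
  assumes "F \<in> triples" "G \<in> triples"
  shows "ratmap_rel `` {F} = ratmap_rel `` {G} \<longleftrightarrow> (F, G) \<in> ratmap_rel"
  using ratmap_rel_refl[OF assms(1)] ratmap_rel_refl[OF assms(2)] ratmap_rel_sym ratmap_rel_trans
  by blast

lemma ev_comp: "ev (triple_comp F G) v = ev F (ev G v)"
  by (simp add: ev_def triple_comp_def insertion_comp[OF coeff_hom_to_ac])

lemma ev_id [simp]: "ev triple_id v = v"
  by (simp add: ev_def triple_id_def insertion_var[OF coeff_hom_to_ac] vec_eq_iff)

lemma triple_id_triples: "triple_id \<in> triples"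
proof -
  have "ev 0 (\<chi> i. 1) = (0 :: 'a alg_closure ^ 3)" by (simp add: ev_def vec_eq_iff)
  then have "ev (triple_id :: 'a triple) (\<chi> i. 1) \<noteq> ev 0 (\<chi> i. 1)" by (simp add: vec_eq_iff)
  then have "triple_id \<noteq> (0 :: 'a triple)" by metis
  then show ?thesis using form_var by (auto simp: triples_def triple_id_def)
qed

lemma triple_comp_triples:
  assumes "F \<in> triples" "G \<in> triples" "ev F (ev G v) \<noteq> 0"
  shows "triple_comp F G \<in> triples"
proof -
  obtain d where d: "\<And>i. form d (F $ i)" using assms by (auto simp: triples_def)
  obtain e where e: "\<And>i. form e (G $ i)" using assms by (auto simp: triples_def)
  have "form (d * e) (triple_comp F G $ i)" for i
    using form_insertion[OF d[of i] e] by (simp add: triple_comp_def)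
  moreover have "triple_comp F G \<noteq> 0"
  proof
    assume "triple_comp F G = 0"
    then have "ev (triple_comp F G) v = 0" by (simp add: ev_def vec_eq_iff)
    then show False using assms(3) by (simp add: ev_comp)
  qed
  ultimately show ?thesis by (auto simp: triples_def)
qed

lemma ratmap_rel_comp:
  assumes "(F, F') \<in> ratmap_rel" "(G, G') \<in> ratmap_rel"
    "triple_comp F G \<in> triples" "triple_comp F' G' \<in> triples"
  shows "(triple_comp F G, triple_comp F' G') \<in> ratmap_rel"
proof (rule gen_par[OF assms(3,4)])
  have F: "F \<in> triples" "\<And>v. par (ev F v) (ev F' v)" using assms(1) by (auto simp: ratmap_rel_iff)
  have G: "G \<in> triples" "G' \<in> triples" "\<And>v. par (ev G v) (ev G' v)" using assms(2) by (auto simp: ratmap_rel_iff)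
  obtain d where d: "\<And>c v. ev F (c *s v) = c ^ d *s ev F v" using ev_scale[OF F(1)] by blast
  show "gen (\<lambda>v. par (ev (triple_comp F G) v) (ev (triple_comp F' G') v))"
    using gen_triples[OF G(2)]
  proof (rule gen_mono)
    fix v assume "ev G' v \<noteq> 0"
    then obtain c where "ev G v = c *s ev G' v" using parE par_sym[OF G(3)] by metis
    then show "par (ev (triple_comp F G) v) (ev (triple_comp F' G') v)"
      using F(2) by (simp add: ev_comp d par_smult)
  qed
qed

text \<open>The product in \<open>Bir\<close> runs over all pairs of representatives; compositions
  that vanish identically drop out because \<open>ratmap_rel\<close> relates only members of
  \<open>triples\<close>.\<close>

lemma Bir_mult:
  assumes "F \<in> triples" "G \<in> triples" "triple_comp F G \<in> triples"
  shows "(ratmap_rel `` {F}) \<otimes>\<^bsub>Bir\<^esub> (ratmap_rel `` {G}) = ratmap_rel `` {triple_comp F G}"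
proof -
  have "(triple_comp F G, H) \<in> ratmap_rel"
    if "(F, F') \<in> ratmap_rel" "(G, G') \<in> ratmap_rel" "(triple_comp F' G', H) \<in> ratmap_rel" for F' G' H
  proof -
    have "triple_comp F' G' \<in> triples" using that(3) by (simp add: ratmap_rel_iff)
    then show ?thesis using ratmap_rel_comp[OF that(1,2) assms(3)] that(3) ratmap_rel_trans by blast
  qed
  moreover have "(F, F) \<in> ratmap_rel" "(G, G) \<in> ratmap_rel" using assms ratmap_rel_refl by auto
  ultimately show ?thesis unfolding Bir_def by auto
qed

subsection \<open>Linear maps\<close>

definition acm :: "'k::field ^ 3 ^ 3 \<Rightarrow> 'k alg_closure ^ 3 ^ 3" where
  "acm A = (\<chi> i j. to_ac (A $ i $ j))"

lemma acm_mult: "acm (A ** B) = acm A ** acm B"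
  by (simp add: acm_def matrix_matrix_mult_def to_ac_sum vec_eq_iff)

lemma acm_1 [simp]: "acm (mat 1) = mat 1"
  by (simp add: acm_def mat_def vec_eq_iff)

lemma ev_linear: "ev (linear_triple A) v = acm A *v v"
  by (simp add: ev_def linear_triple_def insertion_sum insertion_mult insertion_var insertion_const
      coeff_hom_to_ac acm_def matrix_vector_mult_def vec_eq_iff)

lemma acm_inverse: "A ** B = mat 1 \<Longrightarrow> acm A *v (acm B *v v) = v"
  by (simp add: matrix_vector_mul_assoc flip: acm_mult)

lemma linear_triples:
  assumes "A ** B = mat 1"
  shows "linear_triple A \<in> triples"
proof -
  have "form 1 (linear_triple A $ i)" for i
    unfolding linear_triple_def using form_mult[OF form_const form_var]
    by (simp, intro form_sum) auto
  moreover have "linear_triple A \<noteq> 0"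
  proof
    assume "linear_triple A = 0"
    then have "ev (linear_triple A) (acm B *v 1) = 0" by (simp add: ev_def vec_eq_iff)
    then show False using acm_inverse[OF assms, of 1] by (simp add: ev_linear)
  qed
  ultimately show ?thesis by (auto simp: triples_def)
qed

lemma birational_linear:
  assumes "A ** B = mat 1" "B ** A = mat 1"
  shows "birational (linear_triple A)"
proof -
  have *: "(triple_comp (linear_triple A) (linear_triple B), triple_id) \<in> ratmap_rel"
    if "A ** B = mat 1" "B ** A = mat 1" for A B :: "'a ^ 3 ^ 3"
    using triple_comp_triples[OF linear_triples[OF that(1)] linear_triples[OF that(2)], of 1]
    by (simp add: ratmap_rel_iff triple_id_triples ev_comp ev_linear acm_inverse[OF that(1)])
  show ?thesis unfolding birational_def
    using *[OF assms] *[OF assms(2,1)] linear_triples assms by blast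
qed

text \<open>\<open>Bir\<close> is not established as a group, so the description behind the inverse
  is resolved directly: for an inverse \<open>Y\<close>, the vector \<open>A (Y v)\<close> is
  parallel to \<open>v\<close>, and applying \<open>B\<close> identifies \<open>Y\<close>.\<close>

lemma inv_linear:
  assumes AB: "A ** B = mat 1" "B ** A = mat 1"
  shows "inv\<^bsub>Bir\<^esub> (ratmap_rel `` {linear_triple A}) = ratmap_rel `` {linear_triple B}"
  unfolding m_inv_def
proof (rule the_equality)
  note tA = linear_triples[OF AB(1)] and tB = linear_triples[OF AB(2)]
  have car: "ratmap_rel `` {linear_triple B} \<in> carrier Bir"
    using birational_linear[OF AB(2,1)] by (auto simp: Bir_def quotient_def)
  have one: "\<one>\<^bsub>Bir\<^esub> = ratmap_rel `` {triple_id}" by (simp add: Bir_def)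
  have cAB: "triple_comp (linear_triple A) (linear_triple B) \<in> triples"
    by (rule triple_comp_triples[OF tA tB, of 1]) (simp add: ev_linear acm_inverse[OF AB(1)])
  have cBA: "triple_comp (linear_triple B) (linear_triple A) \<in> triples"
    by (rule triple_comp_triples[OF tB tA, of 1]) (simp add: ev_linear acm_inverse[OF AB(2)])
  have "(triple_comp (linear_triple A) (linear_triple B), triple_id) \<in> ratmap_rel"
    "(triple_comp (linear_triple B) (linear_triple A), triple_id) \<in> ratmap_rel"
    using cAB cBA by (simp_all add: ratmap_rel_iff triple_id_triples ev_comp ev_linear acm_inverse[OF AB(1)] acm_inverse[OF AB(2)])
  then show "ratmap_rel `` {linear_triple B} \<in> carrier Bir \<and>
      ratmap_rel `` {linear_triple A} \<otimes>\<^bsub>Bir\<^esub> ratmap_rel `` {linear_triple B} = \<one>\<^bsub>Bir\<^esub> \<and>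
      ratmap_rel `` {linear_triple B} \<otimes>\<^bsub>Bir\<^esub> ratmap_rel `` {linear_triple A} = \<one>\<^bsub>Bir\<^esub>"
    using car cAB cBA tA tB
    by (simp add: Bir_mult one ratmap_class_eq_iff[OF cAB triple_id_triples] ratmap_class_eq_iff[OF cBA triple_id_triples])
next
  note tA = linear_triples[OF AB(1)] and tB = linear_triples[OF AB(2)]
  fix y assume y: "y \<in> carrier Bir \<and> ratmap_rel `` {linear_triple A} \<otimes>\<^bsub>Bir\<^esub> y = \<one>\<^bsub>Bir\<^esub> \<and>
    y \<otimes>\<^bsub>Bir\<^esub> ratmap_rel `` {linear_triple A} = \<one>\<^bsub>Bir\<^esub>"
  then obtain Y where Y: "birational Y" "y = ratmap_rel `` {Y}" by (auto simp: Bir_def quotient_def)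
  then have tY: "Y \<in> triples" by (simp add: birational_def)
  obtain v where "ev Y v \<noteq> 0" using triples_nonzero[OF tY] by blast
  then have "ev (linear_triple A) (ev Y v) \<noteq> 0"
    using acm_inverse[OF AB(2), of "ev Y v"] by (auto simp: ev_linear)
  then have c: "triple_comp (linear_triple A) Y \<in> triples" by (rule triple_comp_triples[OF tA tY])
  have "ratmap_rel `` {triple_comp (linear_triple A) Y} = ratmap_rel `` {triple_id}"
    using y Y(2) Bir_mult[OF tA tY c] by (simp add: Bir_def)
  then have "(triple_comp (linear_triple A) Y, triple_id) \<in> ratmap_rel"
    using ratmap_class_eq_iff[OF c triple_id_triples] by blast
  then have "par (acm A *v ev Y v) v" for v by (simp add: ratmap_rel_iff ev_comp ev_linear)
  then have "par (ev Y v) (acm B *v v)" for v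
    using par_matrix[of "acm A *v ev Y v" v "acm B"] by (simp add: acm_inverse[OF AB(2)])
  then have "(Y, linear_triple B) \<in> ratmap_rel" using tY tB by (simp add: ratmap_rel_iff ev_linear)
  then show "y = ratmap_rel `` {linear_triple B}" using Y(2) ratmap_class_eq_iff[OF tY tB] by simp
qed

lemma Bir_conj:
  assumes AB: "A ** B = mat 1" "B ** A = mat 1" and F: "F \<in> triples"
  shows "\<exists>G\<in>triples. ratmap_rel `` {linear_triple A} \<otimes>\<^bsub>Bir\<^esub> ratmap_rel `` {F} \<otimes>\<^bsub>Bir\<^esub>
      inv\<^bsub>Bir\<^esub> (ratmap_rel `` {linear_triple A}) = ratmap_rel `` {G} \<and>
      (\<forall>v. ev G (acm A *v v) = acm A *v ev F v)"
proof -
  note tA = linear_triples[OF AB(1)] and tB = linear_triples[OF AB(2)]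
  obtain v where v: "ev F v \<noteq> 0" using triples_nonzero[OF F] by blast
  then have nz: "acm A *v ev F v \<noteq> 0" using acm_inverse[OF AB(2), of "ev F v"] by auto
  let ?H = "triple_comp (linear_triple A) F" and ?G = "triple_comp (triple_comp (linear_triple A) F) (linear_triple B)"
  have H: "?H \<in> triples" using nz by (intro triple_comp_triples[OF tA F, of v]) (simp add: ev_linear)
  have G: "?G \<in> triples" using nz
    by (intro triple_comp_triples[OF H tB, of "acm A *v v"]) (simp add: ev_comp ev_linear acm_inverse[OF AB(2)])
  have "ev ?G (acm A *v v) = acm A *v ev F v" for v
    by (simp add: ev_comp ev_linear acm_inverse[OF AB(2)])
  then show ?thesis
    using G by (intro bexI[of _ ?G]) (simp_all add: inv_linear[OF AB] Bir_mult tA F H tB)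
qed

lemma bertini_conjD:
  assumes "(b, b') \<in> bertini_conj" "b = ratmap_rel `` {F}" "b' = ratmap_rel `` {F'}" "F \<in> triples" "F' \<in> triples"
  obtains A B where "A ** B = mat 1" "B ** A = mat 1" "\<And>v. par (ev F' (acm A *v v)) (acm A *v ev F v)"
proof -
  obtain a where a: "a \<in> PGL3" "b' = a \<otimes>\<^bsub>Bir\<^esub> b \<otimes>\<^bsub>Bir\<^esub> inv\<^bsub>Bir\<^esub> a"
    using assms(1) by (auto simp: bertini_conj_def)
  obtain A B where AB: "A ** B = mat 1" "B ** A = mat 1" "a = ratmap_rel `` {linear_triple A}"
    using a(1) by (auto simp: PGL3_def invertible_def)
  obtain G where G: "G \<in> triples" "b' = ratmap_rel `` {G}" "\<And>v. ev G (acm A *v v) = acm A *v ev F v"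
    using Bir_conj[OF AB(1,2) assms(4)] a(2) AB(3) assms(2) by auto
  have "(F', G) \<in> ratmap_rel" using ratmap_class_eq_iff[OF assms(5) G(1)] G(2) assms(3) by simp
  then have "par (ev F' (acm A *v v)) (ev G (acm A *v v))" for v by (simp add: ratmap_rel_iff)
  then have "par (ev F' (acm A *v v)) (acm A *v ev F v)" for v by (simp only: G(3))
  then show ?thesis using that AB by blast
qed

lemma bertini_conj_refl:
  assumes "b \<in> bertini_involutions"
  shows "(b, b) \<in> bertini_conj"
proof -
  have "b \<in> carrier Bir" using assms by (auto simp: bertini_involutions_def bertini_involution_at_def)
  then obtain F where F: "F \<in> triples" "b = ratmap_rel `` {F}" by (auto simp: Bir_def quotient_def birational_def)
  have 1: "mat 1 ** mat 1 = (mat 1 :: 'a ^ 3 ^ 3)" by simp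
  let ?a = "ratmap_rel `` {linear_triple (mat 1 :: 'a ^ 3 ^ 3)}"
  obtain G where G: "G \<in> triples" "?a \<otimes>\<^bsub>Bir\<^esub> b \<otimes>\<^bsub>Bir\<^esub> inv\<^bsub>Bir\<^esub> ?a = ratmap_rel `` {G}" "\<forall>v. ev G v = ev F v"
    using Bir_conj[OF 1 1 F(1)] F(2) by auto
  have "(F, G) \<in> ratmap_rel" using F G by (simp add: ratmap_rel_iff)
  then have "b = ?a \<otimes>\<^bsub>Bir\<^esub> b \<otimes>\<^bsub>Bir\<^esub> inv\<^bsub>Bir\<^esub> ?a"
    using G F ratmap_class_eq_iff[OF F(1) G(1)] by simp
  moreover have "?a \<in> PGL3" using 1 by (auto simp: PGL3_def invertible_def)
  ultimately show ?thesis using assms by (auto simp: bertini_conj_def)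
qed

subsection \<open>Vectors in three-space\<close>

definition dot :: "'a::field ^ 3 \<Rightarrow> 'a ^ 3 \<Rightarrow> 'a" where
  "dot v w = v $ 1 * w $ 1 + v $ 2 * w $ 2 + v $ 3 * w $ 3"

definition cr :: "'a::field ^ 3 \<Rightarrow> 'a ^ 3 \<Rightarrow> 'a ^ 3" where
  "cr v w = vector [v $ 2 * w $ 3 - v $ 3 * w $ 2, v $ 3 * w $ 1 - v $ 1 * w $ 3, v $ 1 * w $ 2 - v $ 2 * w $ 1]"

definition det3 :: "'a::field ^ 3 \<Rightarrow> 'a ^ 3 \<Rightarrow> 'a ^ 3 \<Rightarrow> 'a" where
  "det3 u v w = dot u (cr v w)"

lemma cr_simps [simp]:
  "cr v w $ 1 = v $ 2 * w $ 3 - v $ 3 * w $ 2" "cr v w $ 2 = v $ 3 * w $ 1 - v $ 1 * w $ 3"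
  "cr v w $ 3 = v $ 1 * w $ 2 - v $ 2 * w $ 1"
  by (simp_all add: cr_def)

lemma vec3_eq: "v = w \<longleftrightarrow> v $ 1 = w $ 1 \<and> v $ 2 = w $ 2 \<and> v $ (3::3) = w $ 3"
  by (simp add: vec_eq_iff forall_3)

lemma det3_expand:
  "det3 u v w = u $ 1 * (v $ 2 * w $ 3 - v $ 3 * w $ 2) + u $ 2 * (v $ 3 * w $ 1 - v $ 1 * w $ 3)
    + u $ 3 * (v $ 1 * w $ 2 - v $ 2 * w $ 1)"
  by (simp add: det3_def dot_def)

lemma par_iff_cr: "par v w \<longleftrightarrow> cr v w = 0"
  unfolding par_def vec3_eq forall_3 by (auto simp: algebra_simps)

lemma solve_smult:
  assumes "m *s e = a *s u + b *s w" "m \<noteq> (0::'a::field)"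
  shows "e = (inverse m * a) *s u + (inverse m * b) *s w"
proof -
  have "inverse m *s (m *s e) = inverse m *s (a *s u + b *s w)" using assms(1) by simp
  then show ?thesis using assms(2) by (simp add: vector_add_ldistrib vector_smult_assoc)
qed

text \<open>Cramer's rule in two coordinates where \<open>u\<close> and \<open>w\<close> have a
  nonzero minor; the error in the third coordinate is the determinant.\<close>

lemma det3_zero_imp_span:
  assumes "\<not> par u w" "det3 u w e = 0"
  obtains a b where "e = a *s u + b *s w"
proof -
  consider "u $ 2 * w $ 3 - u $ 3 * w $ 2 \<noteq> 0" | "u $ 3 * w $ 1 - u $ 1 * w $ 3 \<noteq> 0"
    | "u $ 1 * w $ 2 - u $ 2 * w $ 1 \<noteq> 0"
    using assms(1) unfolding par_iff_cr vec3_eq by auto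
  then show ?thesis
  proof cases
    case 1
    have "(u $ 2 * w $ 3 - u $ 3 * w $ 2) *s e = (e $ 2 * w $ 3 - e $ 3 * w $ 2) *s u + (u $ 2 * e $ 3 - u $ 3 * e $ 2) *s w + det3 u w e *s axis 1 1"
      unfolding vec3_eq vector_add_component vector_smult_component det3_expand axis_def
      by (simp add: algebra_simps)
    then have "(u $ 2 * w $ 3 - u $ 3 * w $ 2) *s e = (e $ 2 * w $ 3 - e $ 3 * w $ 2) *s u + (u $ 2 * e $ 3 - u $ 3 * e $ 2) *s w" using assms(2) by simp
    from solve_smult[OF this 1] show ?thesis by (rule that)
  next
    case 2
    have "(u $ 3 * w $ 1 - u $ 1 * w $ 3) *s e = (e $ 3 * w $ 1 - e $ 1 * w $ 3) *s u + (u $ 3 * e $ 1 - u $ 1 * e $ 3) *s w + det3 u w e *s axis 2 1"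
      unfolding vec3_eq vector_add_component vector_smult_component det3_expand axis_def
      by (simp add: algebra_simps)
    then have "(u $ 3 * w $ 1 - u $ 1 * w $ 3) *s e = (e $ 3 * w $ 1 - e $ 1 * w $ 3) *s u + (u $ 3 * e $ 1 - u $ 1 * e $ 3) *s w" using assms(2) by simp
    from solve_smult[OF this 2] show ?thesis by (rule that)
  next
    case 3
    have "(u $ 1 * w $ 2 - u $ 2 * w $ 1) *s e = (e $ 1 * w $ 2 - e $ 2 * w $ 1) *s u + (u $ 1 * e $ 2 - u $ 2 * e $ 1) *s w + det3 u w e *s axis 3 1"
      unfolding vec3_eq vector_add_component vector_smult_component det3_expand axis_def
      by (simp add: algebra_simps)
    then have "(u $ 1 * w $ 2 - u $ 2 * w $ 1) *s e = (e $ 1 * w $ 2 - e $ 2 * w $ 1) *s u + (u $ 1 * e $ 2 - u $ 2 * e $ 1) *s w" using assms(2) by simp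
    from solve_smult[OF this 3] show ?thesis by (rule that)
  qed
qed

lemma det3_zero_of_dot:
  assumes "g \<noteq> 0" "dot g u = 0" "dot g w = 0" "dot g e = 0"
  shows "det3 u w e = 0"
proof -
  have "det3 u w e *s g = dot g u *s cr w e + dot g w *s cr e u + dot g e *s cr u w"
    unfolding vec3_eq vector_add_component vector_smult_component det3_expand dot_def cr_simps
    by (simp add: algebra_simps)
  then have "det3 u w e *s g = 0" using assms(2-4) by simp
  then show ?thesis using assms(1) by (simp add: vector_mul_eq_0)
qed

subsection \<open>Points of the projective plane\<close>

lemma proj_class_eq: "v \<noteq> 0 \<Longrightarrow> proj_class v = {c *s v | c. c \<noteq> 0}"
  by (auto simp: proj_class_def proj_rel_def)

lemma in_proj_class: "v \<noteq> 0 \<Longrightarrow> v \<in> proj_class v"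
  using proj_class_eq[of v] by (auto intro!: exI[of _ 1])

lemma proj_class_in [simp]: "v \<noteq> 0 \<Longrightarrow> proj_class v \<in> proj_plane"
  by (auto simp: proj_class_def proj_plane_def intro!: quotientI)

lemma proj_plane_cases:
  assumes "P \<in> proj_plane"
  obtains v where "v \<noteq> 0" "P = proj_class v"
  using assms by (auto simp: proj_plane_def proj_class_def quotient_def)

lemma proj_class_0 [simp]: "proj_class 0 = {}"
  by (auto simp: proj_class_def proj_rel_def)

lemma proj_class_in_iff: "proj_class v \<in> proj_plane \<longleftrightarrow> v \<noteq> 0"
proof
  assume "proj_class v \<in> proj_plane"
  then obtain w where "w \<noteq> 0" "proj_class v = proj_class w" by (rule proj_plane_cases)
  then show "v \<noteq> 0" using in_proj_class[of w] by auto
qed simp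

lemma proj_class_smult: "c \<noteq> 0 \<Longrightarrow> proj_class (c *s v) = proj_class v"
proof (cases "v = 0")
  case False
  assume c: "c \<noteq> 0"
  have "{d *s (c *s v) | d. d \<noteq> 0} = {d *s v | d. d \<noteq> 0}"
  proof (intro equalityI subsetI)
    fix x assume "x \<in> {d *s (c *s v) | d. d \<noteq> 0}"
    then obtain d where "x = d *s (c *s v)" "d \<noteq> 0" by blast
    then show "x \<in> {d *s v | d. d \<noteq> 0}" using c by (intro CollectI exI[of _ "d * c"]) (simp add: vector_smult_assoc)
  next
    fix x assume "x \<in> {d *s v | d. d \<noteq> 0}"
    then obtain d where "x = d *s v" "d \<noteq> 0" by blast
    then show "x \<in> {d *s (c *s v) | d. d \<noteq> 0}" using c by (intro CollectI exI[of _ "d / c"]) (simp add: vector_smult_assoc)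
  qed
  then show ?thesis using False c proj_class_eq[of v] proj_class_eq[of "c *s v"] by (simp add: vector_mul_eq_0)
qed simp

lemma proj_class_eq_iff: "v \<noteq> 0 \<Longrightarrow> w \<noteq> 0 \<Longrightarrow> proj_class v = proj_class w \<longleftrightarrow> par v w"
proof
  assume nz: "v \<noteq> 0" "w \<noteq> 0"
  { assume "proj_class v = proj_class w"
    then have "w \<in> proj_class v" using in_proj_class nz by metis
    then show "par v w" using proj_class_eq[OF nz(1)] by auto }
  { assume "par v w"
    then obtain c where c: "w = c *s v" using parE nz by metis
    then have "c \<noteq> 0" using nz by auto
    then show "proj_class v = proj_class w" using c by (simp add: proj_class_smult) }
qed

lemma proj_class_eqE:
  assumes "proj_class v = proj_class w" "v \<noteq> 0"
  obtains c where "c \<noteq> 0" "v = c *s w"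
proof -
  have "w \<noteq> 0" using assms in_proj_class[of v] by auto
  then have "v \<in> proj_class w" using assms in_proj_class by metis
  then show ?thesis using that proj_class_eq[OF \<open>w \<noteq> 0\<close>] by auto
qed

lemma form_vanish_scale:
  fixes F :: "'a::field tpoly"
  shows "form d F \<Longrightarrow> insertion id (c *s v) F = c ^ d * insertion id v F"
  by (rule hp_scale[OF hp_insertion[OF _ coeff_hom_id]])

lemma vanishes_at_class:
  assumes "form d F" "v \<noteq> 0"
  shows "vanishes_at F (proj_class v) \<longleftrightarrow> insertion id v F = 0"
  using form_vanish_scale[OF assms(1)] assms(2) in_proj_class[OF assms(2)]
  by (auto simp: vanishes_at_def proj_class_eq)

subsection \<open>Polar forms of cubics\<close>

text \<open>The derivative of \<open>F\<close> at \<open>u\<close> in the direction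
  \<open>w\<close>. For cubics both mixed coefficients of \<open>F\<close> on the line through
  \<open>u\<close> and \<open>w\<close> are of this shape, so no division by 2 or 3 occurs.\<close>

definition polar :: "'a::field tpoly \<Rightarrow> 'a ^ 3 \<Rightarrow> 'a ^ 3 \<Rightarrow> 'a" where
  "polar F u w = (\<Sum>i\<in>UNIV. w $ i * insertion id u (pderiv3 i F))"

lemma insertion_pderiv3:
  fixes u :: "'a::field ^ 3"
  shows "insertion id u (pderiv3 i F) = (\<Sum>m\<in>Poly_Mapping.keys F.
     of_nat (Poly_Mapping.lookup m i) * Poly_Mapping.lookup F m * mval u (m - Poly_Mapping.single i 1))"
  unfolding pderiv3_def by (simp add: insertion_sum[OF coeff_hom_id] insertion_single)

text \<open>Ten exponent triples of sum 3, each checked by expansion. A truncated exponent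
  \<open>i - 1\<close> with \<open>i = 0\<close> comes with the coefficient
  \<open>of_nat 0\<close>.\<close>

lemma cubic_monomial_expand_aux:
  fixes a b u1 u2 u3 w1 w2 w3 :: "'a::field"
  assumes "i + j + k = (3::nat)"
  shows "(a * u1 + b * w1) ^ i * (a * u2 + b * w2) ^ j * (a * u3 + b * w3) ^ k = a ^ 3 * (u1 ^ i * u2 ^ j * u3 ^ k)
    + a ^ 2 * b * (w1 * (of_nat i * (u1 ^ (i - 1) * u2 ^ j * u3 ^ k)) + w2 * (of_nat j * (u1 ^ i * u2 ^ (j - 1) * u3 ^ k))
        + w3 * (of_nat k * (u1 ^ i * u2 ^ j * u3 ^ (k - 1))))
    + a * b ^ 2 * (u1 * (of_nat i * (w1 ^ (i - 1) * w2 ^ j * w3 ^ k)) + u2 * (of_nat j * (w1 ^ i * w2 ^ (j - 1) * w3 ^ k))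
        + u3 * (of_nat k * (w1 ^ i * w2 ^ j * w3 ^ (k - 1))))
    + b ^ 3 * (w1 ^ i * w2 ^ j * w3 ^ k)"
proof -
  have k: "k = 3 - i - j" and ij: "i + j \<le> 3" using assms by auto
  have n: "1 = Suc 0" "2 = Suc (Suc 0)" "3 = Suc (Suc (Suc 0))" by auto
  have "(i = 0 \<and> (j = 0 \<or> j = 1 \<or> j = 2 \<or> j = 3)) \<or> (i = 1 \<and> (j = 0 \<or> j = 1 \<or> j = 2)) \<or> (i = 2 \<and> (j = 0 \<or> j = 1)) \<or> (i = 3 \<and> j = 0)"
    using ij by presburger
  then show ?thesis unfolding k
    by (elim disjE conjE; simp add: power2_eq_square power3_eq_cube algebra_simps)
qed

lemma cubic_monomial_expand:
  fixes u w :: "'a::field ^ 3"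
  assumes "(\<Sum>i\<in>UNIV. Poly_Mapping.lookup m i) = (3::nat)"
  shows "mval (a *s u + b *s w) m = a ^ 3 * mval u m
    + a ^ 2 * b * (\<Sum>i\<in>UNIV. w $ i * (of_nat (Poly_Mapping.lookup m i) * mval u (m - Poly_Mapping.single i 1)))
    + a * b ^ 2 * (\<Sum>i\<in>UNIV. u $ i * (of_nat (Poly_Mapping.lookup m i) * mval w (m - Poly_Mapping.single i 1)))
    + b ^ 3 * mval w m"
proof -
  have ne: "(1::3) \<noteq> 2" "(1::3) \<noteq> 3" "(2::3) \<noteq> 3" "(2::3) \<noteq> 1" "(3::3) \<noteq> 1" "(3::3) \<noteq> 2" by auto
  have "Poly_Mapping.lookup m 1 + Poly_Mapping.lookup m 2 + Poly_Mapping.lookup m 3 = 3"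
    using assms by (simp add: sum_3)
  from cubic_monomial_expand_aux[OF this, of a "u $ 1" b "w $ 1" "u $ 2" "w $ 2" "u $ 3" "w $ 3"]
  show ?thesis
    unfolding mval_def prod_3 sum_3 lookup_minus lookup_single vector_add_component vector_smult_component
    by (simp add: ne when_def)
qed

lemma cubic_expand:
  assumes "form 3 F"
  shows "insertion id (a *s u + b *s w) F = a ^ 3 * insertion id u F + a ^ 2 * b * polar F u w
    + a * b ^ 2 * polar F w u + b ^ 3 * insertion id w F"
proof -
  have pol: "polar F u w = (\<Sum>m\<in>Poly_Mapping.keys F. Poly_Mapping.lookup F m *
      (\<Sum>i\<in>UNIV. w $ i * (of_nat (Poly_Mapping.lookup m i) * mval u (m - Poly_Mapping.single i 1))))" for u w
    unfolding polar_def insertion_pderiv3 sum_distrib_left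
    by (subst sum.swap) (simp add: mult_ac)
  have "insertion id (a *s u + b *s w) F = (\<Sum>m\<in>Poly_Mapping.keys F. Poly_Mapping.lookup F m * (a ^ 3 * mval u m
    + a ^ 2 * b * (\<Sum>i\<in>UNIV. w $ i * (of_nat (Poly_Mapping.lookup m i) * mval u (m - Poly_Mapping.single i 1)))
    + a * b ^ 2 * (\<Sum>i\<in>UNIV. u $ i * (of_nat (Poly_Mapping.lookup m i) * mval w (m - Poly_Mapping.single i 1)))
    + b ^ 3 * mval w m))"
    unfolding insertion_mval id_apply
    by (intro sum.cong refl arg_cong2[where f = "(*)"] cubic_monomial_expand) (use assms in \<open>auto simp: form_def\<close>)
  also have "\<dots> = a ^ 3 * insertion id u F + a ^ 2 * b * polar F u w
    + a * b ^ 2 * polar F w u + b ^ 3 * insertion id w F"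
    unfolding pol insertion_mval id_apply distrib_left sum.distrib sum_distrib_left by (simp add: mult_ac)
  finally show ?thesis .
qed

lemma cubic_coeffs:
  fixes x0 x1 x2 x3 y0 y1 y2 y3 :: "'a::field"
  assumes "infinite (UNIV :: 'a set)" "\<And>t. x0 + t * x1 + t ^ 2 * x2 + t ^ 3 * x3 = y0 + t * y1 + t ^ 2 * y2 + t ^ 3 * y3"
  shows "x0 = y0 \<and> x1 = y1 \<and> x2 = y2 \<and> x3 = y3"
proof -
  have "poly ([:x0, x1, x2, x3:] - [:y0, y1, y2, y3:]) t = 0" for t
    using assms(2)[of t] by (simp add: algebra_simps power2_eq_square power3_eq_cube)
  then have "[:x0, x1, x2, x3:] - [:y0, y1, y2, y3:] = 0"
    using poly_roots_finite assms(1) by (metis (mono_tags, lifting) UNIV_I finite_subset mem_Collect_eq subsetI)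
  then show ?thesis by simp
qed

text \<open>Lets polar forms be read off from any expansion of \<open>F\<close> along a line,
  without computing derivatives.\<close>

lemma polar_unique:
  fixes F :: "'a::alg_closed_field tpoly"
  assumes "form 3 F" "\<And>t. insertion id (u + t *s w) F = y0 + t * y1 + t ^ 2 * y2 + t ^ 3 * y3"
  shows "y0 = insertion id u F" "y1 = polar F u w" "y2 = polar F w u" "y3 = insertion id w F"
proof -
  have "insertion id u F + t * polar F u w + t ^ 2 * polar F w u + t ^ 3 * insertion id w F = y0 + t * y1 + t ^ 2 * y2 + t ^ 3 * y3" for t
    using cubic_expand[OF assms(1), of 1 u t w] assms(2)[of t] by simp
  from cubic_coeffs[OF infinite_alg_closed this]
  show "y0 = insertion id u F" "y1 = polar F u w" "y2 = polar F w u" "y3 = insertion id w F" by simp_all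
qed

lemma polar_scale:
  fixes F :: "'a::alg_closed_field tpoly"
  assumes "form 3 F"
  shows "polar F (c *s u) w = c ^ 2 * polar F u w"
proof -
  have "insertion id (c *s u + t *s w) F = c ^ 3 * insertion id u F + t * (c ^ 2 * polar F u w) + t ^ 2 * (c * polar F w u) + t ^ 3 * insertion id w F" for t
    using cubic_expand[OF assms, of c u t w] by (simp add: algebra_simps)
  from polar_unique(2)[OF assms this] show ?thesis by simp
qed

lemma polar_self:
  fixes F :: "'a::alg_closed_field tpoly"
  assumes "form 3 F"
  shows "polar F u u = 3 * insertion id u F"
proof -
  have "insertion id (u + t *s u) F = insertion id u F + t * (3 * insertion id u F) + t ^ 2 * (3 * insertion id u F) + t ^ 3 * insertion id u F" for t
    using form_vanish_scale[OF assms, of "1 + t" u]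
    by (simp add: vector_sadd_rdistrib algebra_simps power2_eq_square power3_eq_cube)
  from polar_unique(2)[OF assms this] show ?thesis by simp
qed

lemma singular_at_class:
  fixes F :: "'a::alg_closed_field tpoly"
  assumes "form 3 F" "v \<noteq> 0"
  shows "singular_at F (proj_class v) \<longleftrightarrow> insertion id v F = 0 \<and> (\<forall>w. polar F v w = 0)"
proof -
  have ax: "polar F v (axis i 1) = insertion id v (pderiv3 i F)" for i v
    unfolding polar_def by (rule sum_axis_mult)
  have "insertion id (c *s v) (pderiv3 i F) = c ^ 2 * insertion id v (pderiv3 i F)" for c i
    unfolding ax[symmetric] by (rule polar_scale[OF assms(1)])
  then have "vanishes_at (pderiv3 i F) (proj_class v) \<longleftrightarrow> insertion id v (pderiv3 i F) = 0" for i
    using assms(2) in_proj_class[OF assms(2)] by (auto simp: vanishes_at_def proj_class_eq)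
  moreover have "(\<forall>w. polar F v w = 0) \<longleftrightarrow> (\<forall>i. insertion id v (pderiv3 i F) = 0)"
  proof
    show "\<forall>i. insertion id v (pderiv3 i F) = 0" if "\<forall>w. polar F v w = 0"
      using that ax[of v] by auto
    show "\<forall>w. polar F v w = 0" if "\<forall>i. insertion id v (pderiv3 i F) = 0"
      using that by (simp add: polar_def)
  qed
  ultimately show ?thesis using vanishes_at_class[OF assms] by (simp add: singular_at_def)
qed

subsection \<open>The third intersection point\<close>

lemma line_sectionI:
  assumes "{P, Q, R} \<subseteq> proj_plane" "\<forall>s t. s *s u + t *s w = 0 \<longrightarrow> s = 0 \<and> t = 0"
    "P = proj_class (pa *s u + pb *s w)" "Q = proj_class (qa *s u + qb *s w)" "R = proj_class (ra *s u + rb *s w)" "c \<noteq> 0"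
    "\<forall>s t. insertion id (s *s u + t *s w) F = c * (s * pb - t * pa) * (s * qb - t * qa) * (s * rb - t * ra)"
  shows "line_section F P Q R"
  unfolding line_section_def
  by (rule conjI[OF assms(1)], rule exI[of _ u], rule exI[of _ w], rule exI[of _ pa], rule exI[of _ pb],
      rule exI[of _ qa], rule exI[of _ qb], rule exI[of _ ra], rule exI[of _ rb], rule exI[of _ c])
    (intro conjI assms(2-7))

lemma line_sectionE:
  assumes "line_section F P Q R"
  obtains u w a1 b1 a2 b2 a3 b3 c where
    "{P, Q, R} \<subseteq> proj_plane" "\<forall>s t. s *s u + t *s w = 0 \<longrightarrow> s = 0 \<and> t = 0"
    "P = proj_class (a1 *s u + b1 *s w)" "Q = proj_class (a2 *s u + b2 *s w)" "R = proj_class (a3 *s u + b3 *s w)" "c \<noteq> 0"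
    "\<forall>s t. insertion id (s *s u + t *s w) F = c * (s * b1 - t * a1) * (s * b2 - t * a2) * (s * b3 - t * a3)"
  using assms unfolding line_section_def by (elim conjE exE) (rule that)

text \<open>On the line, \<open>F\<close> restricts to
  \<open>s t (s polar F u w + t polar F w u)\<close>, and the last factor gives the third point.
  Conversely, any other parametrisation of the line is compared through the coordinates of
  \<open>u\<close> and \<open>w\<close> in it.\<close>

lemma line_section_distinct:
  fixes F :: "'a::alg_closed_field tpoly"
  assumes F: "form 3 F" and uw: "insertion id u F = 0" "insertion id w F = 0" "\<not> par u w"
    and nz: "polar F u w \<noteq> 0 \<or> polar F w u \<noteq> 0"
  shows "line_section F (proj_class u) (proj_class w) R \<longleftrightarrow>
    R = proj_class (polar F w u *s u - polar F u w *s w)"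
proof -
  have nu: "u \<noteq> 0" and nw: "w \<noteq> 0" using uw(3) by auto
  have ind: "s = 0 \<and> t = 0" if "s *s u + t *s w = 0" for s t
  proof -
    have 1: "s *s u = - t *s w" using that by (simp add: eq_neg_iff_add_eq_0)
    have "s = 0"
    proof (rule ccontr)
      assume "s \<noteq> 0"
      then have "u = (inverse s * - t) *s w" using arg_cong[OF 1, of "\<lambda>x. inverse s *s x"] by (simp add: vector_smult_assoc)
      then show False using uw(3) by (simp only: par_smult_self not_True_eq_False)
    qed
    moreover from this have "t = 0" using that nw by (simp add: vector_mul_eq_0)
    ultimately show ?thesis by simp
  qed
  show ?thesis
  proof
    assume R: "R = proj_class (polar F w u *s u - polar F u w *s w)"
    have "polar F w u *s u + (- polar F u w) *s w \<noteq> 0" using ind[of "polar F w u" "- polar F u w"] nz by auto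
    then have "{proj_class u, proj_class w, R} \<subseteq> proj_plane" using R nu nw by simp
    moreover have "\<forall>s t. insertion id (s *s u + t *s w) F = 1 * (s * 0 - t * 1) * (s * 1 - t * 0) * (s * (- polar F u w) - t * polar F w u)"
      unfolding cubic_expand[OF F] uw by (simp add: algebra_simps power2_eq_square)
    ultimately show "line_section F (proj_class u) (proj_class w) R"
      by (intro line_sectionI[where u = u and w = w and c = 1 and pa = 1 and pb = 0 and qa = 0 and qb = 1
            and ra = "polar F w u" and rb = "- polar F u w"]) (use ind R in simp_all)
  next
    assume "line_section F (proj_class u) (proj_class w) R"
    then obtain x y a1 b1 a2 b2 a3 b3 c where
      P: "proj_class u = proj_class (a1 *s x + b1 *s y)" and Q: "proj_class w = proj_class (a2 *s x + b2 *s y)"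
      and R: "R = proj_class (a3 *s x + b3 *s y)" and
      sec: "\<forall>s t. insertion id (s *s x + t *s y) F = c * (s * b1 - t * a1) * (s * b2 - t * a2) * (s * b3 - t * a3)"
      by (rule line_sectionE)
    note sec = sec[rule_format]
    obtain k1 where k1: "k1 \<noteq> 0" "u = k1 *s (a1 *s x + b1 *s y)" by (rule proj_class_eqE[OF P nu])
    obtain k2 where k2: "k2 \<noteq> 0" "w = k2 *s (a2 *s x + b2 *s y)" by (rule proj_class_eqE[OF Q nw])
    define d where "d = a2 * b1 - b2 * a1"
    define \<kappa> where "\<kappa> = - c * k1 * k2 * d ^ 2"
    have "insertion id (u + t *s w) F = 0 + t * (\<kappa> * k1 * (a1 * b3 - b1 * a3)) + t ^ 2 * (\<kappa> * k2 * (a2 * b3 - b2 * a3)) + t ^ 3 * 0" for t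
    proof -
      have "u + t *s w = (k1 * a1 + t * k2 * a2) *s x + (k1 * b1 + t * k2 * b2) *s y"
        unfolding k1(2) k2(2) by (simp add: vec_eq_iff algebra_simps)
      then show ?thesis unfolding sec \<kappa>_def d_def by (simp only: sec) (simp add: algebra_simps power2_eq_square)
    qed
    note P = polar_unique[OF F this]
    have "\<kappa> \<noteq> 0" using nz P by auto
    then have d: "d \<noteq> 0" by (auto simp: \<kappa>_def)
    have "polar F w u *s u - polar F u w *s w = (\<kappa> * k1 * k2 * d) *s (a3 *s x + b3 *s y)"
      unfolding P(2,3)[symmetric] unfolding k1(2) k2(2) d_def by (simp add: vec_eq_iff algebra_simps)
    moreover have "\<kappa> * k1 * k2 * d \<noteq> 0" using \<open>\<kappa> \<noteq> 0\<close> d k1 k2 by simp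
    ultimately show "R = proj_class (polar F w u *s u - polar F u w *s w)"
      using R by (simp add: proj_class_smult)
  qed
qed

lemma polar_functional:
  "polar F u w = dot (\<chi> i. insertion id u (pderiv3 i F)) w"
  by (simp add: polar_def dot_def sum_3 mult.commute)

text \<open>On the tangent, \<open>F\<close> restricts to
  \<open>t^2 (s polar F w u + t F w)\<close>. For the converse, a line meeting the cubic doubly at
  \<open>u\<close> lies in the kernel of the gradient, which smoothness makes a single line.\<close>

lemma line_section_tangent:
  fixes F :: "'a::alg_closed_field tpoly"
  assumes F: "form 3 F" and uw: "insertion id u F = 0" "polar F u w = 0" "\<not> par u w"
    and nz: "polar F w u \<noteq> 0 \<or> insertion id w F \<noteq> 0" and smooth: "\<exists>e. polar F u e \<noteq> 0"
  shows "line_section F (proj_class u) (proj_class u) R \<longleftrightarrow>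
    R = proj_class (insertion id w F *s u - polar F w u *s w)"
proof -
  have nu: "u \<noteq> 0" and nw: "w \<noteq> 0" using uw(3) by auto
  have ind: "s = 0 \<and> t = 0" if "s *s u + t *s w = 0" for s t
  proof -
    have 1: "s *s u = - t *s w" using that by (simp add: eq_neg_iff_add_eq_0)
    have "s = 0"
    proof (rule ccontr)
      assume "s \<noteq> 0"
      then have "u = (inverse s * - t) *s w" using arg_cong[OF 1, of "\<lambda>x. inverse s *s x"] by (simp add: vector_smult_assoc)
      then show False using uw(3) by (simp only: par_smult_self not_True_eq_False)
    qed
    moreover from this have "t = 0" using that nw by (simp add: vector_mul_eq_0)
    ultimately show ?thesis by simp
  qed
  show ?thesis
  proof
    assume R: "R = proj_class (insertion id w F *s u - polar F w u *s w)"
    have "insertion id w F *s u + (- polar F w u) *s w \<noteq> 0" using ind[of "insertion id w F" "- polar F w u"] nz by auto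
    then have "{proj_class u, proj_class u, R} \<subseteq> proj_plane" using R nu by simp
    moreover have sec: "\<forall>s t. insertion id (s *s u + t *s w) F = (- 1) * (s * 0 - t * 1) * (s * 0 - t * 1) * (s * (- polar F w u) - t * insertion id w F)"
      unfolding cubic_expand[OF F] uw by (simp add: algebra_simps power2_eq_square power3_eq_cube)
    ultimately show "line_section F (proj_class u) (proj_class u) R"
      by (intro line_sectionI[where u = u and w = w and c = "- 1" and pa = 1 and pb = 0 and qa = 1 and qb = 0
            and ra = "insertion id w F" and rb = "- polar F w u"]) (use ind R in simp_all)
  next
    assume "line_section F (proj_class u) (proj_class u) R"
    then obtain x y a1 b1 a2 b2 a3 b3 c where xy: "\<forall>s t. s *s x + t *s y = 0 \<longrightarrow> s = 0 \<and> t = 0" and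
      P: "proj_class u = proj_class (a1 *s x + b1 *s y)" and Q: "proj_class u = proj_class (a2 *s x + b2 *s y)"
      and R: "R = proj_class (a3 *s x + b3 *s y)" and
      sec: "\<forall>s t. insertion id (s *s x + t *s y) F = c * (s * b1 - t * a1) * (s * b2 - t * a2) * (s * b3 - t * a3)"
      by (rule line_sectionE)
    note sec = sec[rule_format]
    note xy = xy[rule_format]
    obtain k1 where k1: "k1 \<noteq> 0" "u = k1 *s (a1 *s x + b1 *s y)" by (rule proj_class_eqE[OF P nu])
    obtain k2 where k2: "k2 \<noteq> 0" "u = k2 *s (a2 *s x + b2 *s y)" by (rule proj_class_eqE[OF Q nu])
    have "(k1 * a1 - k2 * a2) *s x + (k1 * b1 - k2 * b2) *s y = 0"
      using k1(2) k2(2) by (simp add: vec_eq_iff algebra_simps)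
    from xy[OF this] have a2: "a2 = k1 / k2 * a1" and b2: "b2 = k1 / k2 * b1" using k2(1) by (auto simp: field_simps)
    define k where "k = c * (k1 / k2)"
    have sec2: "insertion id (s *s x + t *s y) F = k * (s * b1 - t * a1) ^ 2 * (s * b3 - t * a3)" for s t
      unfolding sec a2 b2 k_def by (simp add: algebra_simps power2_eq_square)
    have ab: "a1 \<noteq> 0 \<or> b1 \<noteq> 0" using k1(2) nu by auto
    have tan: "polar F u (a *s x + b *s y) = 0" for a b
    proof -
      have "insertion id (u + t *s (a *s x + b *s y)) F
          = 0 + t * 0 + t ^ 2 * (k * (a * b1 - b * a1) ^ 2 * (k1 * (a1 * b3 - b1 * a3))) + t ^ 3 * (k * (a * b1 - b * a1) ^ 2 * (a * b3 - b * a3))" for t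
      proof -
        have "u + t *s (a *s x + b *s y) = (k1 * a1 + t * a) *s x + (k1 * b1 + t * b) *s y"
          unfolding k1(2) by (simp add: vec_eq_iff algebra_simps)
        then show ?thesis by (simp only: sec2) (simp add: algebra_simps power2_eq_square power3_eq_cube)
      qed
      from polar_unique(2)[OF F this] show ?thesis by simp
    qed
    \<comment> \<open>A point of the section line distinct from \<open>u\<close>; one of the two
      spanning vectors always serves.\<close>
    define e where "e = (if a1 = 0 then x else y)"
    have e: "e = (if a1 = 0 then 1 else 0) *s x + (if a1 = 0 then 0 else 1) *s y" by (simp add: e_def)
    have ue: "\<not> par u e"
    proof
      assume "par u e"
      then obtain m where m: "e = m *s u" using parE nu by metis
      then have "((if a1 = 0 then 1 else 0) - m * k1 * a1) *s x + ((if a1 = 0 then 0 else 1) - m * k1 * b1) *s y = 0"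
        unfolding k1(2) e by (simp add: vec_eq_iff algebra_simps)
      from xy[OF this] show False using ab by (auto split: if_splits)
    qed
    define g where "g = (\<chi> i. insertion id u (pderiv3 i F))"
    have pg: "polar F u v = dot g v" for v by (simp add: polar_functional g_def)
    have "g \<noteq> 0" using smooth by (auto simp: pg dot_def)
    moreover have "dot g u = 0" using polar_self[OF F, of u] uw(1) by (simp add: pg)
    moreover have "dot g e = 0" using tan unfolding e pg by blast
    moreover have "dot g w = 0" using uw(2) by (simp add: pg)
    ultimately have "det3 u e w = 0" by (rule det3_zero_of_dot)
    then obtain p r where "w = p *s u + r *s e" by (rule det3_zero_imp_span[OF ue])
    then have "w = (p * k1 * a1 + r * (if a1 = 0 then 1 else 0)) *s x + (p * k1 * b1 + r * (if a1 = 0 then 0 else 1)) *s y"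
      unfolding k1(2) e by (simp add: vec_eq_iff algebra_simps)
    then obtain a b where w: "w = a *s x + b *s y" by blast
    define h where "h = a * b1 - b * a1"
    have "insertion id (u + t *s w) F
        = 0 + t * 0 + t ^ 2 * (k * h ^ 2 * (k1 * (a1 * b3 - b1 * a3))) + t ^ 3 * (k * h ^ 2 * (a * b3 - b * a3))" for t
    proof -
      have "u + t *s w = (k1 * a1 + t * a) *s x + (k1 * b1 + t * b) *s y"
        unfolding k1(2) w by (simp add: vec_eq_iff algebra_simps)
      then show ?thesis unfolding h_def by (simp only: sec2) (simp add: algebra_simps power2_eq_square power3_eq_cube)
    qed
    note P = polar_unique[OF F this]
    have kh: "k * h ^ 2 \<noteq> 0" using nz P by auto
    then have h: "h \<noteq> 0" by auto
    have "insertion id w F *s u - polar F w u *s w = (k * h ^ 2 * k1 * h) *s (a3 *s x + b3 *s y)"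
      unfolding P(3,4)[symmetric] unfolding k1(2) w h_def by (simp add: vec_eq_iff algebra_simps)
    moreover have "k * h ^ 2 * k1 * h \<noteq> 0" using kh h k1 by simp
    ultimately show "R = proj_class (insertion id w F *s u - polar F w u *s w)"
      using R by (simp add: proj_class_smult)
  qed
qed

section \<open>Uniqueness of the third point and inverses for the chord-tangent law\<close>

lemma line_section_perm:
  assumes "line_section F P Q R"
  shows "line_section F Q P R" "line_section F P R Q"
proof -
  obtain u w a1 b1 a2 b2 a3 b3 c where *: "{P, Q, R} \<subseteq> proj_plane"
    "\<forall>s t. s *s u + t *s w = 0 \<longrightarrow> s = 0 \<and> t = 0"
    "P = proj_class (a1 *s u + b1 *s w)" "Q = proj_class (a2 *s u + b2 *s w)" "R = proj_class (a3 *s u + b3 *s w)" "c \<noteq> 0"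
    "\<forall>s t. insertion id (s *s u + t *s w) F = c * (s * b1 - t * a1) * (s * b2 - t * a2) * (s * b3 - t * a3)"
    using assms by (rule line_sectionE)
  have 1: "\<forall>s t. insertion id (s *s u + t *s w) F = c * (s * b2 - t * a2) * (s * b1 - t * a1) * (s * b3 - t * a3)"
    using *(7) by (simp add: mult_ac)
  have 2: "\<forall>s t. insertion id (s *s u + t *s w) F = c * (s * b1 - t * a1) * (s * b3 - t * a3) * (s * b2 - t * a2)"
    using *(7) by (simp add: mult_ac)
  show "line_section F Q P R" using *(1) by (intro line_sectionI[OF _ *(2,4,3,5,6) 1]) auto
  show "line_section F P R Q" using *(1) by (intro line_sectionI[OF _ *(2,3,5,4,6) 2]) auto
qed

definition line_free :: "'a::field tpoly \<Rightarrow> bool" where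
  "line_free F \<longleftrightarrow> (\<forall>u w. \<not> par u w \<longrightarrow> (\<exists>s t. insertion id (s *s u + t *s w) F \<noteq> 0))"

lemma line_freeD:
  assumes "form 3 F" "line_free F" "\<not> par u w" "insertion id u F = 0" "polar F u w = 0" "polar F w u = 0"
  shows "insertion id w F \<noteq> 0"
proof
  assume "insertion id w F = 0"
  then have "insertion id (s *s u + t *s w) F = 0" for s t
    unfolding cubic_expand[OF assms(1)] using assms by simp
  then show False using assms(2,3) unfolding line_free_def by blast
qed

text \<open>Take the cross product of \<open>g\<close> with an axis vector to which \<open>u\<close>
  is not orthogonal. If it were parallel to \<open>u\<close> it would be zero, and then
  \<open>g\<close> would be a multiple of that axis vector, against
  \<open>dot g u = 0\<close>.\<close>

lemma tangent_vector:
  fixes g :: "'a::field ^ 3"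
  assumes "g \<noteq> 0" "dot g u = 0" "u \<noteq> 0"
  obtains w where "\<not> par u w" "dot g w = 0"
proof -
  obtain i where i: "u $ i \<noteq> 0" using assms(3) by (metis vec_eq_iff zero_index)
  let ?w = "cr g (axis i 1)"
  have 1: "dot g ?w = 0" by (simp add: dot_def algebra_simps)
  have "\<not> par u ?w"
  proof
    assume "par u ?w"
    then obtain c where c: "?w = c *s u" using parE assms(3) by metis
    have "dot (axis i 1) ?w = 0" by (simp add: dot_def algebra_simps)
    moreover have "dot (axis i 1) ?w = c * u $ i"
      unfolding c using exhaust_3[of i] by (auto simp: dot_def axis_def)
    ultimately have "?w = 0" using i c by simp
    then have "par g (axis i 1)" by (simp add: par_iff_cr)
    then obtain d where d: "axis i 1 = d *s g" using parE assms(1) by metis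
    have "dot (axis i 1) u = u $ i" using exhaust_3[of i] by (auto simp: dot_def axis_def)
    moreover have "dot (d *s g) u = d * dot g u" by (simp add: dot_def algebra_simps)
    ultimately show False using i d assms(2) by simp
  qed
  then show ?thesis using that 1 by blast
qed

lemma smooth_cubic_polar:
  fixes F :: "'a::alg_closed_field tpoly"
  assumes "smooth_cubic F" "insertion id u F = 0" "u \<noteq> 0"
  shows "\<exists>e. polar F u e \<noteq> 0"
  using assms singular_at_class[of F u] by (auto simp: smooth_cubic_def)

lemma line_section_ex1:
  fixes F :: "'a::alg_closed_field tpoly"
  assumes "smooth_cubic F" "line_free F" "P \<in> proj_plane" "Q \<in> proj_plane" "vanishes_at F P" "vanishes_at F Q"
  shows "\<exists>!R. line_section F P Q R"
proof -
  have F: "form 3 F" using assms(1) by (simp add: smooth_cubic_def)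
  obtain u where u: "u \<noteq> 0" "P = proj_class u" using assms(3) by (rule proj_plane_cases)
  obtain w where w: "w \<noteq> 0" "Q = proj_class w" using assms(4) by (rule proj_plane_cases)
  have Fu: "insertion id u F = 0" and Fw: "insertion id w F = 0"
    using assms u w vanishes_at_class[OF F] by auto
  show ?thesis
  proof (cases "par u w")
    case False
    have "polar F u w \<noteq> 0 \<or> polar F w u \<noteq> 0"
      using line_freeD[OF F assms(2) False Fu] Fw by auto
    from line_section_distinct[OF F Fu Fw False this] show ?thesis using u w by auto
  next
    case True
    then have PQ: "Q = proj_class u" using u w proj_class_eq_iff by metis
    obtain e where e: "polar F u e \<noteq> 0" using smooth_cubic_polar[OF assms(1) Fu u(1)] by blast
    define g where "g = (\<chi> i. insertion id u (pderiv3 i F))"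
    have pg: "polar F u v = dot g v" for v by (simp add: polar_functional g_def)
    have "g \<noteq> 0" using e by (auto simp: pg dot_def)
    moreover have "dot g u = 0" using polar_self[OF F, of u] Fu by (simp add: pg)
    ultimately obtain v where v: "\<not> par u v" "dot g v = 0" using tangent_vector u(1) by metis
    have "polar F v u \<noteq> 0 \<or> insertion id v F \<noteq> 0"
      using line_freeD[OF F assms(2) v(1) Fu] v(2) pg by auto
    from line_section_tangent[OF F Fu _ v(1) this] e v(2) show ?thesis
      unfolding u(2) PQ by (auto simp: pg)
  qed
qed

lemma line_section_vanishes:
  fixes F :: "'a::field tpoly"
  assumes "form 3 F" "line_section F P Q R"
  shows "vanishes_at F R" "R \<in> proj_plane"
proof -
  obtain u w a1 b1 a2 b2 a3 b3 c where *: "{P, Q, R} \<subseteq> proj_plane"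
    "R = proj_class (a3 *s u + b3 *s w)"
    "\<forall>s t. insertion id (s *s u + t *s w) F = c * (s * b1 - t * a1) * (s * b2 - t * a2) * (s * b3 - t * a3)"
    using assms(2) by (rule line_sectionE)
  show R: "R \<in> proj_plane" using *(1) by simp
  then have "a3 *s u + b3 *s w \<noteq> 0" unfolding *(2) proj_class_in_iff .
  then show "vanishes_at F R" unfolding *(2) vanishes_at_class[OF assms(1) \<open>a3 *s u + b3 *s w \<noteq> 0\<close>]
    using *(3) by simp
qed

lemma third_point_eq:
  fixes F :: "'a::alg_closed_field tpoly"
  assumes "smooth_cubic F" "line_free F" "P \<in> proj_plane" "Q \<in> proj_plane" "vanishes_at F P" "vanishes_at F Q"
  shows "line_section F P Q R \<longleftrightarrow> R = third_point F P Q"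
proof
  assume "line_section F P Q R"
  then show "R = third_point F P Q"
    unfolding third_point_def using the1_equality[OF line_section_ex1[OF assms]] by simp
next
  assume "R = third_point F P Q"
  then show "line_section F P Q R"
    unfolding third_point_def using theI'[OF line_section_ex1[OF assms]] by simp
qed

text \<open>If the tangent at the neutral element meets the cubic again in \<open>T\<close>, then \<open>P\<close>, \<open>-P\<close> and \<open>T\<close> are
  collinear.\<close>

lemma cubic_group_inv:
  fixes F :: "'a::alg_closed_field tpoly"
  assumes sm: "smooth_cubic F" "line_free F" and P: "P \<in> proj_plane" "vanishes_at F P"
    and Z: "Z \<in> proj_plane" "vanishes_at F Z"
  shows "inv\<^bsub>cubic_group F Z\<^esub> P = third_point F P (third_point F Z Z)"
proof -
  have F: "form 3 F" using sm(1) by (simp add: smooth_cubic_def)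
  note tp = third_point_eq[OF sm]
  have ls: "line_section F P Q (third_point F P Q)"
    if "P \<in> proj_plane" "vanishes_at F P" "Q \<in> proj_plane" "vanishes_at F Q" for P Q
    using tp that by blast
  define T where "T = third_point F Z Z"
  have T: "T \<in> proj_plane" "vanishes_at F T"
    using line_section_vanishes[OF F ls[OF Z Z]] by (auto simp: T_def)
  define Y where "Y = third_point F P T"
  have Y: "Y \<in> proj_plane" "vanishes_at F Y"
    using line_section_vanishes[OF F ls[OF P T]] by (auto simp: Y_def)
  have comm: "third_point F Q Q' = third_point F Q' Q"
    if "Q \<in> proj_plane" "vanishes_at F Q" "Q' \<in> proj_plane" "vanishes_at F Q'" for Q Q'
    using ls[OF that] line_section_perm(1) tp[OF that(3,1,4,2)] by blast
  have PYT: "third_point F P Y = T"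
    using line_section_perm(2)[OF ls[OF P T]] tp[OF P(1) Y(1) P(2) Y(2)] Y_def by metis
  have TZ: "third_point F T Z = Z"
  proof -
    have "line_section F T Z Z"
      using line_section_perm(1)[OF line_section_perm(2)[OF ls[OF Z Z]]] by (simp add: T_def)
    then show ?thesis using tp[OF T(1) Z(1) T(2) Z(2)] by metis
  qed
  \<comment> \<open>Uniqueness without associativity: if the product of \<open>P\<close> and
    \<open>y\<close> is neutral, their third point must be the residual point \<open>T\<close> of
    the tangent at \<open>Z\<close>.\<close>
  have uniq: "y = Y" if y: "y \<in> proj_plane" "vanishes_at F y" and e: "third_point F (third_point F P y) Z = Z" for y
  proof -
    define R where "R = third_point F P y"
    have R: "R \<in> proj_plane" "vanishes_at F R"
      using line_section_vanishes[OF F ls[OF P y]] by (auto simp: R_def)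
    have "line_section F R Z Z" using ls[OF R Z] e by (simp add: R_def)
    then have "line_section F Z Z R" using line_section_perm by blast
    then have "R = T" using tp[OF Z(1) Z(1) Z(2) Z(2)] by (simp add: T_def)
    then have "line_section F P y T" using ls[OF P y] by (simp add: R_def)
    then have "line_section F P T y" by (rule line_section_perm(2))
    then show "y = Y" using tp[OF P(1) T(1) P(2) T(2)] by (simp add: Y_def)
  qed
  show ?thesis
    unfolding m_inv_def T_def[symmetric] Y_def[symmetric]
  proof (rule the_equality)
    show "Y \<in> carrier (cubic_group F Z) \<and> P \<otimes>\<^bsub>cubic_group F Z\<^esub> Y = \<one>\<^bsub>cubic_group F Z\<^esub> \<and>
        Y \<otimes>\<^bsub>cubic_group F Z\<^esub> P = \<one>\<^bsub>cubic_group F Z\<^esub>"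
      using Y PYT TZ comm[OF Y P] by (simp add: cubic_group_def)
  next
    fix y assume "y \<in> carrier (cubic_group F Z) \<and> P \<otimes>\<^bsub>cubic_group F Z\<^esub> y = \<one>\<^bsub>cubic_group F Z\<^esub> \<and>
        y \<otimes>\<^bsub>cubic_group F Z\<^esub> P = \<one>\<^bsub>cubic_group F Z\<^esub>"
    then show "y = Y" using uniq[of y] by (simp add: cubic_group_def)
  qed
qed

subsection \<open>Frobenius\<close>

lemma finite_field_power_card:
  fixes x :: "'k::{field,finite}"
  shows "x ^ CARD('k) = x"
proof (cases "x = 0")
  case False
  have "x * (\<Prod>y\<in>UNIV-{0}. x * y) = x * x ^ (CARD('k) - 1) * \<Prod>(UNIV-{0})"
    by (simp add: prod.distrib mult_ac card_Diff_singleton)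
  also have "x * x ^ (CARD('k) - 1) = x ^ CARD('k)"
    by (metis finite_UNIV_card_ge_0 finite power_eq_if not_gr_zero)
  also have "(\<Prod>y\<in>UNIV-{0}. x * y) = (\<Prod>y\<in>UNIV-{0}. y)"
    by (rule prod.reindex_bij_witness[of _ "\<lambda>y. y / x" "\<lambda>y. x * y"]) (use False in auto)
  finally show ?thesis by simp
qed (simp add: zero_power)

lemma card_field_ge_2: "CARD('k::{field,finite}) \<ge> 2"
  using card_mono[of "UNIV :: 'k set" "{0, 1}"] by simp

text \<open>Avoids writing \<open>q\<close> as a power of the characteristic:
  \<open>(1 + X)^q - X^q - 1\<close> has degree less than \<open>q\<close> and vanishes at all
  \<open>q\<close> elements of the field, so its coefficients are 0.\<close>

lemma binomial_card_eq_0: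
  assumes "0 < i" "i < CARD('k)"
  shows "of_nat (CARD('k) choose i) = (0 :: 'k::{field,finite})"
proof -
  let ?q = "CARD('k)"
  have q: "?q \<ge> 2" by (rule card_field_ge_2)
  define P :: "'k poly" where "P = [:1, 1:] ^ ?q - Polynomial.monom 1 ?q - 1"
  have c: "coeff P j = of_nat (?q choose j) - (if j = ?q then 1 else 0) - (if j = 0 then 1 else 0)" for j
  proof (cases "j \<le> ?q")
    case False
    then have "coeff ([:1, 1:] ^ ?q :: 'k poly) j = 0"
      by (intro coeff_eq_0) (simp add: degree_power_eq)
    then show ?thesis using False by (simp add: P_def binomial_eq_0)
  qed (simp add: P_def coeff_linear_poly_power)
  have "P = 0"
  proof (rule ccontr)
    assume "P \<noteq> 0"
    have "coeff P j = 0" if "j \<ge> ?q" for j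
      using that q by (cases "j = ?q") (auto simp: c binomial_eq_0)
    then have "degree P < ?q" using \<open>P \<noteq> 0\<close> by (metis leading_coeff_0_iff not_le)
    have "poly P x = 0" for x
      by (simp add: P_def poly_monom finite_field_power_card)
    then have "{x. poly P x = 0} = UNIV" by auto
    then show False using card_poly_roots_bound[OF \<open>P \<noteq> 0\<close>] \<open>degree P < ?q\<close> by simp
  qed
  then show ?thesis using c[of i] assms by simp
qed

lemma frob_add:
  fixes x y :: "'k::{field,finite} alg_closure"
  shows "(x + y) ^ CARD('k) = x ^ CARD('k) + y ^ CARD('k)"
proof -
  let ?q = "CARD('k)"
  have q: "?q \<ge> 2" by (rule card_field_ge_2)
  have z: "of_nat (?q choose i) = (0 :: 'k alg_closure)" if "0 < i" "i < ?q" for i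
    using arg_cong[OF binomial_card_eq_0[where 'k = 'k, OF that], of to_ac] by simp
  have "(x + y) ^ ?q = (\<Sum>k\<le>?q. of_nat (?q choose k) * x ^ k * y ^ (?q - k))"
    by (rule binomial_ring)
  also have "\<dots> = (\<Sum>k\<in>{0, ?q}. of_nat (?q choose k) * x ^ k * y ^ (?q - k))"
    by (intro sum.mono_neutral_right) (auto simp: z)
  finally show ?thesis using q by simp
qed

lemma of_nat_card_eq_0: "of_nat CARD('k) = (0 :: 'k::{field,finite} alg_closure)"
  using arg_cong[OF binomial_card_eq_0[where 'k = 'k and i = 1], of to_ac] card_field_ge_2[where 'k = 'k]
  by simp

lemma frob_pow_add:
  fixes x y :: "'k::{field,finite} alg_closure"
  shows "(x + y) ^ (CARD('k) ^ n) = x ^ (CARD('k) ^ n) + y ^ (CARD('k) ^ n)"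
  by (induction n arbitrary: x y) (simp_all add: power_mult frob_add)

lemma frob_pow_neg:
  fixes x :: "'k::{field,finite} alg_closure"
  shows "(- x) ^ (CARD('k) ^ n) = - (x ^ (CARD('k) ^ n))"
proof -
  have "x ^ (CARD('k) ^ n) + (- x) ^ (CARD('k) ^ n) = 0"
    using frob_pow_add[of x "- x" n] by (simp add: zero_power)
  then show ?thesis by (simp add: eq_neg_iff_add_eq_0 add.commute)
qed

lemma frob_pow_diff:
  fixes x y :: "'k::{field,finite} alg_closure"
  shows "(x - y) ^ (CARD('k) ^ n) = x ^ (CARD('k) ^ n) - y ^ (CARD('k) ^ n)"
  using frob_pow_add[of x "- y" n] by (simp add: frob_pow_neg)

lemma frob_pow_inj:
  fixes x y :: "'k::{field,finite} alg_closure"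
  assumes "x ^ (CARD('k) ^ n) = y ^ (CARD('k) ^ n)"
  shows "x = y"
  using assms frob_pow_diff[of x y n] by simp

lemma frob_pow_surj: "\<exists>y. y ^ (CARD('k::{field,finite}) ^ n) = (x :: 'k alg_closure)"
  by (rule nth_root_exists) simp

lemma frob_pow_sum:
  fixes f :: "'a \<Rightarrow> 'k::{field,finite} alg_closure"
  shows "(\<Sum>i\<in>A. f i) ^ (CARD('k) ^ n) = (\<Sum>i\<in>A. f i ^ (CARD('k) ^ n))"
  by (induction A rule: infinite_finite_induct) (simp_all add: frob_pow_add zero_power)

text \<open>The elements of the ground field are \<open>q\<close> roots of \<open>X^q - X\<close>,
  which has no room for others.\<close>

lemma range_to_ac_iff: "x \<in> range to_ac \<longleftrightarrow> x ^ CARD('k) = (x :: 'k::{field,finite} alg_closure)"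
proof -
  let ?q = "CARD('k)"
  define P :: "'k alg_closure poly" where "P = Polynomial.monom 1 ?q - [:0, 1:]"
  have "coeff P ?q = 1" using card_field_ge_2[where 'k = 'k] by (simp add: P_def coeff_pCons split: nat.split)
  then have P: "P \<noteq> 0" by auto
  have "degree P \<le> ?q" unfolding P_def using card_field_ge_2[where 'k = 'k]
    by (intro degree_diff_le) (auto simp: degree_monom_le)
  have roots: "{x. poly P x = 0} = {x. x ^ ?q = x}" by (auto simp: P_def poly_monom)
  have sub: "range to_ac \<subseteq> {x :: 'k alg_closure. x ^ ?q = x}"
    by (auto simp: finite_field_power_card simp flip: to_ac_power)
  have "card {x :: 'k alg_closure. x ^ ?q = x} \<le> card (range (to_ac :: 'k \<Rightarrow> _))"
    using card_poly_roots_bound[OF P] \<open>degree P \<le> ?q\<close> by (simp add: roots card_image inj_to_ac)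
  moreover have "finite {x :: 'k alg_closure. x ^ ?q = x}" using poly_roots_finite[OF P] roots by simp
  ultimately have "range to_ac = {x :: 'k alg_closure. x ^ ?q = x}" using sub by (metis card_seteq)
  then show ?thesis by auto
qed

lemma frob_pow_to_ac: "(x :: 'k::{field,finite} alg_closure) \<in> range to_ac \<Longrightarrow> x ^ (CARD('k) ^ n) = x"
  by (induction n) (simp_all add: range_to_ac_iff power_mult)

lemma poly_zero_alg_closed:
  fixes p :: "'a::alg_closed_field poly"
  assumes "\<And>x. poly p x = 0"
  shows "p = 0"
proof (rule ccontr)
  assume "p \<noteq> 0"
  then have "finite {x. poly p x = 0}" by (rule poly_roots_finite)
  then show False using assms infinite_alg_closed[where 'a = 'a] by simp
qed

lemma card_simple_roots:
  fixes P :: "'a::alg_closed_field poly"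
  assumes "P \<noteq> 0" "\<And>x. poly P x = 0 \<Longrightarrow> poly (pderiv P) x \<noteq> 0"
  shows "card {x. poly P x = 0} = degree P"
  using assms
proof (induction "degree P" arbitrary: P)
  case 0
  then obtain c where "P = [:c:]" "c \<noteq> 0" by (metis degree_eq_zeroE pCons_0_0)
  then show ?case by simp
next
  case (Suc n)
  then obtain x where "poly P x = 0" using alg_closed_imp_poly_has_root[of P] by auto
  then obtain Q where PQ: "P = [:- x, 1:] * Q" by (auto simp: poly_eq_0_iff_dvd dvd_def)
  have Q: "Q \<noteq> 0" using Suc.prems(1) PQ by auto
  have deg: "degree P = Suc (degree Q)" unfolding PQ using Q by (subst degree_mult_eq) auto
  have pd: "poly (pderiv P) y = (y - x) * poly (pderiv Q) y + poly Q y" for y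
    unfolding PQ pderiv_mult by (simp add: pderiv_pCons algebra_simps)
  have Qx: "poly Q x \<noteq> 0" using Suc.prems(2)[OF \<open>poly P x = 0\<close>] pd[of x] by simp
  have "card {y. poly Q y = 0} = degree Q"
  proof (rule Suc.hyps(1))
    show "n = degree Q" using Suc.hyps(2) deg by simp
    fix y assume "poly Q y = 0"
    then show "poly (pderiv Q) y \<noteq> 0" using Suc.prems(2)[of y] pd[of y] by (auto simp: PQ)
  qed (rule Q)
  moreover have "{y. poly P y = 0} = insert x {y. poly Q y = 0}" by (auto simp: PQ)
  ultimately show ?case using Qx deg poly_roots_finite[OF Q] by simp
qed

lemma card_frob_fixed:
  assumes "n > 0"
  shows "card {t :: 'k::{field,finite} alg_closure. t ^ (CARD('k) ^ n) = t} = CARD('k) ^ n"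
proof -
  let ?N = "CARD('k) ^ n"
  have N: "?N > 1" using card_field_ge_2[where 'k = 'k] assms by (intro one_less_power) auto
  define P :: "'k alg_closure poly" where "P = Polynomial.monom 1 ?N - [:0, 1:]"
  have "coeff P ?N = 1" using N assms by (auto simp: P_def coeff_pCons split: nat.split)
  then have P: "P \<noteq> 0" by auto
  have "degree P \<le> ?N" unfolding P_def using N
    by (intro degree_diff_le) (auto simp: degree_monom_le)
  moreover have "degree P \<ge> ?N" using \<open>coeff P ?N = 1\<close> by (intro le_degree) simp
  ultimately have deg: "degree P = ?N" by simp
  have "of_nat ?N = (0 :: 'k alg_closure)" using of_nat_card_eq_0[where 'k = 'k] assms by simp
  then have "pderiv P = [:- 1:]" using assms by (simp add: P_def pderiv_diff pderiv_monom pderiv_pCons zero_power)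
  then have "card {x. poly P x = 0} = degree P" using P by (intro card_simple_roots) auto
  moreover have "{x. poly P x = 0} = {t. t ^ ?N = t}" by (auto simp: P_def poly_monom)
  ultimately show ?thesis using deg by simp
qed

subsection \<open>Galois orbits\<close>

definition cj :: "'k::{field,finite} alg_closure \<Rightarrow> nat \<Rightarrow> 'k alg_closure" where
  "cj t i = t ^ (CARD('k) ^ i)"

lemma cj_0 [simp]: "cj t 0 = t"
  by (simp add: cj_def)

lemma cj_cj: "cj (cj t i) j = cj t (i + j)"
  by (simp add: cj_def power_add mult.commute flip: power_mult)

lemma cj_add: "cj (x + y) i = cj x i + cj y i"
  by (simp add: cj_def frob_pow_add)

lemma cj_diff: "cj (x - y) i = cj x i - cj y i"
  by (simp add: cj_def frob_pow_diff)

lemma cj_mult: "cj (x * y) i = cj x i * cj y i"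
  by (simp add: cj_def power_mult_distrib)

lemma cj_sum: "cj (\<Sum>a\<in>A. f a) i = (\<Sum>a\<in>A. cj (f a) i)"
  unfolding cj_def by (rule frob_pow_sum)

lemma cj_to_ac: "x \<in> range to_ac \<Longrightarrow> cj x i = x"
  unfolding cj_def by (rule frob_pow_to_ac)

lemma cj_inj: "cj x i = cj y i \<Longrightarrow> x = y"
  unfolding cj_def by (rule frob_pow_inj)

lemma range_to_ac_cj: "x \<in> range to_ac \<longleftrightarrow> cj x 1 = x"
  by (simp add: cj_def range_to_ac_iff)

lemma cj_galois: "(\<lambda>x :: 'k::{field,finite} alg_closure. cj x i) \<in> galois_group"
proof -
  have "bij (\<lambda>x :: 'k alg_closure. cj x i)"
    using frob_pow_surj[where 'k = 'k and n = i] cj_inj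
    by (auto simp: bij_def inj_def surj_def cj_def) metis
  then show ?thesis by (simp add: galois_group_def cj_add cj_mult cj_to_ac)
qed

text \<open>As 8 is a power of 2, not being fixed by the fourth power of Frobenius excludes every
  proper subfield over the ground field, so \<open>t\<close> has exact degree 8.\<close>

definition deg8 :: "'k::{field,finite} alg_closure \<Rightarrow> bool" where
  "deg8 t \<longleftrightarrow> cj t 8 = t \<and> cj t 4 \<noteq> t"

lemma cj_period_mult: "cj t d = t \<Longrightarrow> cj t (m * d) = t"
  by (induction m) (simp_all add: cj_cj[symmetric])

text \<open>Each \<open>d\<close> from 1 to 7 has a multiple congruent to 4 modulo 8, so a shorter
  period would make 4 a period.\<close>

lemma deg8_cj_neq:
  assumes "deg8 t" "0 < d" "d < 8"
  shows "cj t d \<noteq> t"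
proof
  assume d: "cj t d = t"
  have 4: "cj t 4 = t" if "m * d = 4 + 8 * n" for m n
  proof -
    have "cj t (m * d) = cj (cj t (n * 8)) 4" unfolding that cj_cj by (simp add: add.commute mult.commute)
    then show ?thesis using cj_period_mult[OF d, of m] cj_period_mult[of t 8 n] assms(1) by (simp add: deg8_def)
  qed
  have "d = 1 \<or> d = 2 \<or> d = 3 \<or> d = 4 \<or> d = 5 \<or> d = 6 \<or> d = 7" using assms by presburger
  then have "cj t 4 = t"
    using 4[of 4 0] 4[of 2 0] 4[of 4 1] 4[of 1 0] 4[of 4 2] 4[of 2 1] 4[of 4 3] by (elim disjE) simp_all
  then show False using assms(1) by (simp add: deg8_def)
qed

lemma cj_mod8:
  assumes "deg8 t"
  shows "cj t (i mod 8) = cj t i"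
proof -
  have "cj t i = cj (cj t (i div 8 * 8)) (i mod 8)" by (simp add: cj_cj)
  then show ?thesis using cj_period_mult[of t 8 "i div 8"] assms by (simp add: deg8_def)
qed

lemma deg8_inj:
  assumes "deg8 t"
  shows "inj_on (cj t) {..<8}"
proof -
  have *: "cj t i \<noteq> cj t j" if "i < j" "j < 8" for i j
  proof
    assume "cj t i = cj t j"
    then have "cj t i = cj (cj t (j - i)) i" using that by (simp add: cj_cj)
    then have "t = cj t (j - i)" by (rule cj_inj)
    moreover have "0 < j - i" "j - i < 8" using that by auto
    ultimately show False using deg8_cj_neq[OF assms, of "j - i"] by metis
  qed
  show ?thesis unfolding inj_on_def using * by (metis lessThan_iff linorder_neqE_nat)
qed

lemma deg8_not_rational: "deg8 t \<Longrightarrow> cj t i \<notin> range to_ac"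
proof
  assume t: "deg8 t" "cj t i \<in> range to_ac"
  then have "cj (cj t i) 4 = cj t i" by (intro cj_to_ac)
  then have "cj (cj t 4) i = cj t i" by (simp add: cj_cj add.commute)
  then show False using t(1) cj_inj by (auto simp: deg8_def)
qed

definition tr8 :: "'k::{field,finite} alg_closure \<Rightarrow> 'k alg_closure" where
  "tr8 t = (\<Sum>i<8. cj t i)"

lemma sum_cj_shift:
  assumes "cj t 8 = t"
  shows "(\<Sum>i<8. cj t (i + j)) = tr8 t"
proof (induction j)
  case 0
  show ?case by (simp add: tr8_def)
next
  case (Suc j)
  have "(\<Sum>i<8. cj t (i + Suc j)) + cj t j = (\<Sum>i<8. cj t (i + j)) + cj t (8 + j)"
    using sum.lessThan_Suc_shift[of "\<lambda>i. cj t (i + j)" 8] sum.lessThan_Suc[of "\<lambda>i. cj t (i + j)" 8]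
    by (simp add: add.commute)
  moreover have "cj t (8 + j) = cj t j" using assms by (simp add: cj_cj[symmetric])
  ultimately show ?case using Suc by simp
qed

lemma tr8_rational: "cj t 8 = t \<Longrightarrow> tr8 t \<in> range to_ac"
  using sum_cj_shift[of t 1] by (simp add: range_to_ac_cj tr8_def cj_sum cj_cj)

lemma tr8_to_ac: "x \<in> range to_ac \<Longrightarrow> tr8 x = 8 * x"
  by (simp add: tr8_def cj_to_ac)

lemma tr8_cj: "cj t 8 = t \<Longrightarrow> tr8 (cj t j) = tr8 t"
  using sum_cj_shift[of t j] by (simp add: tr8_def cj_cj add.commute)

section \<open>Galois conjugates of the parameter\<close>

definition minpoly8 :: "'k::{field,finite} alg_closure \<Rightarrow> 'k alg_closure poly" where
  "minpoly8 t = (\<Prod>i<8. [:- cj t i, 1:])"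

lemma poly_minpoly8: "poly (minpoly8 t) x = (\<Prod>i<8. x - cj t i)"
  by (simp add: minpoly8_def poly_prod)

lemma poly_map_frob: "poly (map_poly (\<lambda>x. cj x i) p) (cj x i) = cj (poly p x) i"
proof (induction p)
  case (pCons a p)
  have "cj (0 :: 'a alg_closure) i = 0" by (simp add: cj_def zero_power)
  then show ?case using pCons by (simp add: map_poly_pCons cj_add cj_mult)
qed (simp add: cj_def zero_power)

lemma cj_prod: "cj (\<Prod>a\<in>A. f a) i = (\<Prod>a\<in>A. cj (f a) i)"
  by (simp add: cj_def prod_power_distrib)

text \<open>Frobenius permutes the linear factors cyclically, so the polynomial with conjugated
  coefficients takes the same values; over an infinite field this makes the two polynomials
  equal.\<close>

lemma minpoly8_rational:
  assumes "cj t 8 = t"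
  shows "coeff (minpoly8 t) n \<in> range to_ac"
proof -
  have "poly (map_poly (\<lambda>x. cj x 1) (minpoly8 t)) y = poly (minpoly8 t) y" for y
  proof -
    obtain x where x: "y = cj x 1" using frob_pow_surj[where n = 1] by (metis cj_def)
    have "poly (map_poly (\<lambda>x. cj x 1) (minpoly8 t)) y = (\<Prod>i<8. cj x 1 - cj t (Suc i))"
      unfolding x poly_map_frob by (simp add: poly_minpoly8 cj_prod cj_diff cj_cj)
    also have "\<dots> = (\<Prod>i<8. cj x 1 - cj t i)"
      using assms prod.lessThan_Suc_shift[of "\<lambda>i. cj x 1 - cj t i" 7] prod.lessThan_Suc[of "\<lambda>i. cj x 1 - cj t (Suc i)" 7]
      by (simp add: mult.commute)
    finally show ?thesis by (simp add: x poly_minpoly8)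
  qed
  then have "map_poly (\<lambda>x. cj x 1) (minpoly8 t) - minpoly8 t = 0"
    by (intro poly_zero_alg_closed) simp
  then have "map_poly (\<lambda>x. cj x 1) (minpoly8 t) = minpoly8 t" by simp
  moreover have "cj (0 :: 'a alg_closure) 1 = 0" by (simp add: cj_def zero_power)
  ultimately have "cj (coeff (minpoly8 t) n) 1 = coeff (minpoly8 t) n" by (metis coeff_map_poly)
  then show ?thesis by (simp only: range_to_ac_cj)
qed

lemma galois_simps:
  assumes "\<sigma> \<in> galois_group"
  shows "\<sigma> (x + y) = \<sigma> x + \<sigma> y" "\<sigma> (x * y) = \<sigma> x * \<sigma> y" "\<sigma> 0 = 0" "\<sigma> 1 = 1"
    "\<sigma> (x ^ n) = \<sigma> x ^ n" "z \<in> range to_ac \<Longrightarrow> \<sigma> z = z" "bij \<sigma>"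
proof -
  show *: "\<sigma> (x * y) = \<sigma> x * \<sigma> y" "\<sigma> (x + y) = \<sigma> x + \<sigma> y" for x y using assms by (auto simp: galois_group_def)
  show tac: "z \<in> range to_ac \<Longrightarrow> \<sigma> z = z" for z using assms by (auto simp: galois_group_def)
  show "\<sigma> 0 = 0" using tac[of 0] by (metis rangeI to_ac_0)
  show 1: "\<sigma> 1 = 1" using tac[of 1] by (metis rangeI to_ac_1)
  show "\<sigma> (x ^ n) = \<sigma> x ^ n" by (induction n) (simp_all add: 1 *)
  show "bij \<sigma>" using assms by (simp add: galois_group_def)
qed

lemma galois_conj:
  assumes "\<sigma> \<in> galois_group" "cj t 8 = t"
  obtains i where "i < 8" "\<sigma> t = cj t i"
proof -
  note g = galois_simps[OF assms(1)]
  have "\<sigma> (poly p x) = poly p (\<sigma> x)" if "\<And>n. coeff p n \<in> range to_ac" for p x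
    using that
  proof (induction p)
    case (pCons a p)
    have "coeff p n \<in> range to_ac" for n using pCons.prems[of "Suc n"] by simp
    moreover have "a \<in> range to_ac" using pCons.prems[of 0] by simp
    ultimately show ?case using pCons.IH by (simp add: g)
  qed (simp add: g)
  then have "poly (minpoly8 t) (\<sigma> t) = \<sigma> (poly (minpoly8 t) t)" using minpoly8_rational[OF assms(2)] by metis
  also have "poly (minpoly8 t) t = 0" by (auto simp: poly_minpoly8 intro!: bexI[of _ 0])
  finally show ?thesis using that by (auto simp: poly_minpoly8 g)
qed

lemma galois_act_class:
  assumes "\<sigma> \<in> galois_group"
  shows "galois_act \<sigma> (proj_class v) = proj_class (\<chi> i. \<sigma> (v $ i))"
proof (cases "v = 0")
  case True
  have "(\<chi> i. \<sigma> ((0 :: 'a alg_closure ^ 3) $ i)) = 0" by (simp add: vec_eq_iff galois_simps(3)[OF assms])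
  then show ?thesis unfolding True by (simp add: galois_act_def)
next
  case False
  note g = galois_simps[OF assms]
  have inj: "\<sigma> x = 0 \<longleftrightarrow> x = 0" for x using g(3,7) by (metis bij_pointE)
  have nz: "(\<chi> i. \<sigma> (v $ i)) \<noteq> 0" using False by (auto simp: vec_eq_iff inj)
  show ?thesis unfolding proj_class_eq[OF False] proj_class_eq[OF nz] galois_act_def
  proof (intro equalityI subsetI)
    fix x assume "x \<in> (\<lambda>v. \<chi> i. \<sigma> (v $ i)) ` {c *s v | c. c \<noteq> 0}"
    then obtain c where c: "c \<noteq> 0" "x = (\<chi> i. \<sigma> ((c *s v) $ i))" by auto
    then have "x = \<sigma> c *s (\<chi> i. \<sigma> (v $ i))" by (simp add: vec_eq_iff g)
    then show "x \<in> {c *s (\<chi> i. \<sigma> (v $ i)) | c. c \<noteq> 0}" using inj c(1) by blast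
  next
    fix x assume "x \<in> {c *s (\<chi> i. \<sigma> (v $ i)) | c. c \<noteq> 0}"
    then obtain c where c: "c \<noteq> 0" "x = c *s (\<chi> i. \<sigma> (v $ i))" by auto
    obtain d where d: "c = \<sigma> d" using g(7) by (metis bij_pointE)
    have "x = (\<chi> i. \<sigma> ((d *s v) $ i))" using c(2) by (simp add: vec_eq_iff g d)
    moreover have "d \<noteq> 0" using c(1) d inj by simp
    ultimately show "x \<in> (\<lambda>v. \<chi> i. \<sigma> (v $ i)) ` {c *s v | c. c \<noteq> 0}" by blast
  qed
qed

subsection \<open>Points on the cuspidal cubic\<close>

text \<open>The cuspidal cubic \<open>x\<^sup>2 z = y\<^sup>3 + y\<^sup>2 x\<close>. Its smooth points with parameters \<open>a\<close>, \<open>b\<close>, \<open>c\<close> are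
  collinear iff \<open>a + b + c = -1\<close>. The quadratic term makes the genericity condition \<open>good\<close> below
  satisfiable in characteristic 3.\<close>

definition cf :: "'a::field \<Rightarrow> 'a" where
  "cf x = x ^ 3 + x ^ 2"

definition cpt :: "'a::field \<Rightarrow> 'a ^ 3" where
  "cpt t = vector [1, t, cf t]"

lemma cpt_simps [simp]: "cpt t $ 1 = 1" "cpt t $ 2 = t" "cpt t $ 3 = cf t"
  by (simp_all add: cpt_def)

lemma cpt_nonzero [simp]: "cpt t \<noteq> 0"
  by (auto simp: vec3_eq)

lemma par_cpt_iff: "par (cpt s) (cpt t) \<longleftrightarrow> s = t"
proof
  assume "par (cpt s) (cpt t)"
  then have "cpt s $ 1 * cpt t $ 2 = cpt s $ 2 * cpt t $ 1" unfolding par_def by blast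
  then show "s = t" by simp
qed simp

lemma cpt_class_eq_iff: "proj_class (cpt s) = proj_class (cpt t) \<longleftrightarrow> s = t"
  by (simp add: proj_class_eq_iff par_cpt_iff)

definition orb :: "'k::{field,finite} alg_closure \<Rightarrow> 'k alg_closure point set" where
  "orb t = (\<lambda>i. proj_class (cpt (cj t i))) ` {..<8}"

lemma galois_cpt:
  assumes "\<sigma> \<in> galois_group"
  shows "galois_act \<sigma> (proj_class (cpt t)) = proj_class (cpt (\<sigma> t))"
proof -
  have "(\<chi> i. \<sigma> (cpt t $ i)) = cpt (\<sigma> t)"
    by (simp add: vec3_eq cf_def galois_simps[OF assms])
  then show ?thesis by (simp add: galois_act_class[OF assms])
qed

lemma card_orb: "deg8 t \<Longrightarrow> card (orb t) = 8"
  unfolding orb_def using deg8_inj[of t]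
  by (subst card_image) (auto simp: inj_on_def cpt_class_eq_iff)

lemma degree8_orb:
  assumes "deg8 t"
  shows "degree8_point (orb t)"
proof -
  have "orb t = {galois_act \<sigma> (proj_class (cpt t)) | \<sigma>. \<sigma> \<in> galois_group}"
  proof (intro equalityI subsetI)
    fix x assume "x \<in> orb t"
    then obtain i where "x = proj_class (cpt (cj t i))" by (auto simp: orb_def)
    then have "x = galois_act (\<lambda>x. cj x i) (proj_class (cpt t))" by (simp add: galois_cpt[OF cj_galois])
    then show "x \<in> {galois_act \<sigma> (proj_class (cpt t)) | \<sigma>. \<sigma> \<in> galois_group}" using cj_galois by blast
  next
    fix x assume "x \<in> {galois_act \<sigma> (proj_class (cpt t)) | \<sigma>. \<sigma> \<in> galois_group}"
    then obtain \<sigma> where s: "\<sigma> \<in> galois_group" "x = proj_class (cpt (\<sigma> t))" using galois_cpt by blast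
    obtain i where "i < 8" "\<sigma> t = cj t i" using galois_conj[OF s(1)] assms by (auto simp: deg8_def)
    then show "x \<in> orb t" using s(2) by (auto simp: orb_def)
  qed
  then show ?thesis unfolding degree8_point_def using card_orb[OF assms] proj_class_in[OF cpt_nonzero] by blast
qed

subsection \<open>Forms of degree at most three\<close>

lemma hp_0E:
  assumes "hp S d f" "d = 0"
  obtains c where "\<And>v. f v = c"
proof -
  have "f v = f 0" for v using hp_scale[OF assms(1), of 0 v] assms(2) by simp
  then show ?thesis by (rule that)
qed

lemma hp_1E:
  assumes "hp S 1 f"
  obtains a b c where "\<And>v. f v = a * v $ 1 + b * v $ 2 + c * v $ 3"
proof -
  have "d = 1 \<longrightarrow> (\<exists>a b c. \<forall>v. f v = a * v $ 1 + b * v $ 2 + c * v $ 3)" if "hp S d f" for d f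
    using that
  proof induction
    case (hp_zero d)
    then show ?case by (auto intro!: exI[of _ 0])
  next
    case (hp_var d f i)
    show ?case
    proof
      assume "Suc d = 1"
      then obtain e where e: "f v = e" for v using hp_0E[OF hp_var.hyps] by auto
      consider "i = 1" | "i = 2" | "i = 3" using exhaust_3[of i] by blast
      then show "\<exists>a b c. \<forall>v. v $ i * f v = a * v $ 1 + b * v $ 2 + c * v $ 3"
      proof cases
        case 1
        have "\<forall>v. v $ i * f v = e * v $ 1 + 0 * v $ 2 + 0 * v $ 3" by (simp add: e 1)
        then show ?thesis by blast
      next
        case 2
        have "\<forall>v. v $ i * f v = 0 * v $ 1 + e * v $ 2 + 0 * v $ 3" by (simp add: e 2)
        then show ?thesis by blast
      next
        case 3
        have "\<forall>v. v $ i * f v = 0 * v $ 1 + 0 * v $ 2 + e * v $ 3" by (simp add: e 3)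
        then show ?thesis by blast
      qed
    qed
  next
    case (hp_add d f g)
    show ?case
    proof
      assume "d = 1"
      then obtain a b c a' b' c' where "\<forall>v. f v = a * v $ 1 + b * v $ 2 + c * v $ 3"
        "\<forall>v. g v = a' * v $ 1 + b' * v $ 2 + c' * v $ 3" using hp_add.IH by blast
      then show "\<exists>a b c. \<forall>v. f v + g v = a * v $ 1 + b * v $ 2 + c * v $ 3"
        by (intro exI[of _ "a + a'"] exI[of _ "b + b'"] exI[of _ "c + c'"]) (simp add: algebra_simps)
    qed
  qed simp
  then show ?thesis using assms that by blast
qed

definition quad :: "'a::field \<Rightarrow> 'a \<Rightarrow> 'a \<Rightarrow> 'a \<Rightarrow> 'a \<Rightarrow> 'a \<Rightarrow> 'a ^ 3 \<Rightarrow> 'a" where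
  "quad a b c d e f v = a * v $ 1 ^ 2 + b * (v $ 1 * v $ 2) + c * (v $ 1 * v $ 3)
     + d * v $ 2 ^ 2 + e * (v $ 2 * v $ 3) + f * v $ 3 ^ 2"

lemma hp_2E:
  assumes "hp S 2 f"
  obtains a b c d e g where "\<And>v. f v = quad a b c d e g v"
proof -
  have "n = 2 \<longrightarrow> (\<exists>a b c d e g. \<forall>v. f v = quad a b c d e g v)" if "hp S n f" for n f
    using that
  proof induction
    case (hp_zero d)
    show ?case by (intro impI exI[of _ 0]) (simp add: quad_def)
  next
    case (hp_var d f i)
    show ?case
    proof
      assume "Suc d = 2"
      then obtain a b c where e: "f v = a * v $ 1 + b * v $ 2 + c * v $ 3" for v using hp_1E[of S f] hp_var.hyps by auto
      consider "i = 1" | "i = 2" | "i = 3" using exhaust_3[of i] by blast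
      then show "\<exists>a b c d e g. \<forall>v. v $ i * f v = quad a b c d e g v"
      proof cases
        case 1
        have "\<forall>v. v $ i * f v = quad a b c 0 0 0 v" unfolding 1 e quad_def by (simp add: algebra_simps power2_eq_square)
        then show ?thesis by blast
      next
        case 2
        have "\<forall>v. v $ i * f v = quad 0 a 0 b c 0 v" unfolding 2 e quad_def by (simp add: algebra_simps power2_eq_square)
        then show ?thesis by blast
      next
        case 3
        have "\<forall>v. v $ i * f v = quad 0 0 a 0 b c v" unfolding 3 e quad_def by (simp add: algebra_simps power2_eq_square)
        then show ?thesis by blast
      qed
    qed
  next
    case (hp_add n f h)
    show ?case
    proof
      assume "n = 2"
      then obtain a b c d e g a' b' c' d' e' g' where 1: "\<forall>v. f v = quad a b c d e g v"
        "\<forall>v. h v = quad a' b' c' d' e' g' v" using hp_add.IH by blast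
      have "\<forall>v. f v + h v = quad (a + a') (b + b') (c + c') (d + d') (e + e') (g + g') v"
        using 1 by (simp add: quad_def algebra_simps)
      then show "\<exists>a b c d e g. \<forall>v. f v + h v = quad a b c d e g v" by blast
    qed
  qed simp
  then show ?thesis using assms that by blast
qed

definition cubf :: "'a::field \<Rightarrow> 'a \<Rightarrow> 'a \<Rightarrow> 'a \<Rightarrow> 'a \<Rightarrow> 'a \<Rightarrow> 'a \<Rightarrow> 'a \<Rightarrow> 'a \<Rightarrow> 'a \<Rightarrow> 'a ^ 3 \<Rightarrow> 'a" where
  "cubf a b c d e f g h i j v = v $ 1 * quad a b c d e f v + g * v $ 2 ^ 3 + h * (v $ 2 ^ 2 * v $ 3)
     + i * (v $ 2 * v $ 3 ^ 2) + j * v $ 3 ^ 3"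

lemma hp_3E:
  assumes "hp S 3 f"
  obtains a b c d e g h i j k where "\<And>v. f v = cubf a b c d e g h i j k v"
proof -
  have "n = 3 \<longrightarrow> (\<exists>a b c d e g h i j k. \<forall>v. f v = cubf a b c d e g h i j k v)" if "hp S n f" for n f
    using that
  proof induction
    case (hp_zero d)
    show ?case by (intro impI exI[of _ 0]) (simp add: quad_def cubf_def)
  next
    case (hp_var n f i)
    show ?case
    proof
      assume "Suc n = 3"
      then have "n = 2" by simp
      with hp_var.hyps have "hp S 2 f" by simp
      from hp_2E[OF this] obtain a b c d e g where q: "\<And>v. f v = quad a b c d e g v" by blast
      consider "i = 1" | "i = 2" | "i = 3" using exhaust_3[of i] by blast
      then show "\<exists>a b c d e g h i' j k. \<forall>v. v $ i * f v = cubf a b c d e g h i' j k v"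
      proof cases
        case 1
        have "\<forall>v. v $ i * f v = cubf a b c d e g 0 0 0 0 v" unfolding 1 q cubf_def by simp
        then show ?thesis by blast
      next
        case 2
        have "\<forall>v. v $ i * f v = cubf 0 a 0 b c 0 d e g 0 v" unfolding 2 q cubf_def quad_def
          by (simp add: algebra_simps power2_eq_square power3_eq_cube)
        then show ?thesis by blast
      next
        case 3
        have "\<forall>v. v $ i * f v = cubf 0 0 a 0 b c 0 d e g v" unfolding 3 q cubf_def quad_def
          by (simp add: algebra_simps power2_eq_square power3_eq_cube)
        then show ?thesis by blast
      qed
    qed
  next
    case (hp_add n f l)
    show ?case
    proof
      assume "n = 3"
      then have "\<exists>a b c d e g h i j k. \<forall>v. f v = cubf a b c d e g h i j k v"
        "\<exists>a b c d e g h i j k. \<forall>v. l v = cubf a b c d e g h i j k v" using hp_add.IH by auto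
      then obtain a b c d e g h i j k a' b' c' d' e' g' h' i' j' k' where 1: "\<forall>v. f v = cubf a b c d e g h i j k v"
        "\<forall>v. l v = cubf a' b' c' d' e' g' h' i' j' k' v" by (elim exE) (rule that)
      have "\<forall>v. f v + l v = cubf (a + a') (b + b') (c + c') (d + d') (e + e') (g + g') (h + h') (i + i') (j + j') (k + k') v"
        using 1 by (simp add: quad_def cubf_def algebra_simps)
      then show "\<exists>a b c d e g h i j k. \<forall>v. f v + l v = cubf a b c d e g h i j k v" by blast
    qed
  qed simp
  then show ?thesis using assms that by blast
qed

lemma hp_insertion_UNIV:
  fixes F :: "'a::field tpoly"
  shows "form d F \<Longrightarrow> hp UNIV d (\<lambda>v. insertion id v F)"
  using hp_insertion[OF _ coeff_hom_id, of d F] by simp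

lemma hp_UNIV_form:
  fixes f :: "'a::field ^ 3 \<Rightarrow> 'a"
  assumes "hp UNIV d f"
  obtains F where "form d F" "\<And>v. insertion id v F = f v"
  using hp_imp_form[of id d f] assms coeff_hom_id by auto

lemma tpoly_nonzero_iff:
  fixes F :: "'a::alg_closed_field tpoly"
  shows "F \<noteq> 0 \<longleftrightarrow> (\<exists>v. insertion id v F \<noteq> 0)"
  using insertion_eq_0_imp[OF infinite_alg_closed coeff_hom_id, of F] by auto

subsection \<open>Restriction to the cuspidal cubic\<close>

definition Cf :: "'a::field ^ 3 \<Rightarrow> 'a" where
  "Cf v = v $ 3 * v $ 1 ^ 2 - v $ 2 ^ 3 - v $ 2 ^ 2 * v $ 1"

lemma Cf_cpt [simp]: "Cf (cpt t) = 0"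
  by (simp add: Cf_def cf_def)

lemma hp_Cf: "csubring S \<Longrightarrow> hp S 3 Cf"
proof -
  assume S: "csubring S"
  have e: "1 + 2 * 1 = (3::nat)" "3 * 1 = (3::nat)" "2 * 1 + 1 = (3::nat)" by simp_all
  have "hp S (1 + 2 * 1) (\<lambda>v. v $ 3 * v $ 1 ^ 2)" "hp S (3 * 1) (\<lambda>v. v $ 2 ^ 3)" "hp S (2 * 1 + 1) (\<lambda>v. v $ 2 ^ 2 * v $ 1)"
    by (intro hp_mult hp_power hp_component S)+
  from this[unfolded e] have "hp S 3 (\<lambda>v. v $ 3 * v $ 1 ^ 2 - v $ 2 ^ 3 - v $ 2 ^ 2 * v $ 1)"
    by (intro hp_diff S)
  then show ?thesis by (simp add: Cf_def[abs_def])
qed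

text \<open>Vieta's formula without assuming full degree: if the coefficient at \<open>Suc n\<close>
  is 0, the second claim says \<open>R = 0\<close>.\<close>

lemma sum_of_roots:
  fixes R :: "'a::field poly"
  assumes "finite T" "card T = Suc n" "\<And>x. x \<in> T \<Longrightarrow> poly R x = 0" "degree R \<le> Suc n"
  shows "coeff R n = - coeff R (Suc n) * \<Sum>T" "R = smult (coeff R (Suc n)) (\<Prod>x\<in>T. [:- x, 1:])"
proof -
  have mon: "degree (\<Prod>x\<in>T. [:- x, 1:]) = card T \<and> coeff (\<Prod>x\<in>T. [:- x, 1:]) (card T) = 1
      \<and> (\<forall>n. card T = Suc n \<longrightarrow> coeff (\<Prod>x\<in>T. [:- x, 1:]) n = - \<Sum>T)" if "finite T" for T :: "'a set"
    using that
  proof (induction T rule: finite_induct)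
    case (insert x T)
    let ?Q = "\<Prod>x\<in>T. [:- x, 1:]"
    have nz: "?Q \<noteq> 0" using insert.hyps(1) by simp
    have e: "(\<Prod>x\<in>insert x T. [:- x, 1:]) = [:- x, 1:] * ?Q" using insert.hyps by simp
    have d: "degree ([:- x, 1:] * ?Q) = Suc (card T)" using insert.IH nz by (subst degree_mult_eq) auto
    have "coeff ([:- x, 1:] * ?Q) (Suc (card T)) = 1"
      using insert.IH by (simp add: coeff_eq_0)
    moreover have "coeff ([:- x, 1:] * ?Q) (card T) = - x - \<Sum>T"
    proof (cases "card T")
      case 0
      then have "T = {}" using insert.hyps by simp
      then show ?thesis by simp
    next
      case (Suc m)
      then show ?thesis using insert.IH by simp
    qed
    ultimately show ?case using d insert.hyps unfolding e by simp
  qed simp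
  let ?Q = "\<Prod>x\<in>T. [:- x, 1:]"
  let ?a = "coeff R (Suc n)"
  have Q: "degree ?Q = Suc n" "coeff ?Q (Suc n) = 1" "coeff ?Q n = - \<Sum>T" using mon[OF assms(1)] assms(2) by auto
  show R: "R = smult ?a ?Q"
  proof (rule poly_eqI_degree_lead_coeff[where n = "Suc n" and A = T])
    show "poly R z = poly (smult ?a ?Q) z" if "z \<in> T" for z
      using assms(1,3) that by (auto simp: poly_prod)
  qed (use assms Q in auto)
  show "coeff R n = - ?a * \<Sum>T" using Q arg_cong[OF R, of "\<lambda>p. coeff p n"] by simp
qed

lemma too_many_roots:
  fixes R :: "'a::field poly"
  assumes "\<And>x. x \<in> T \<Longrightarrow> poly R x = 0" "degree R < card T"
  shows "R = 0"
  using poly_eqI_degree[of T R 0] assms by simp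

text \<open>In the restrictions of lines, conics and cubics the second coefficient from the top is
  1, 2 or 3 times the top one. By Vieta the parameters of the 3, 6 or 9 intersection points sum to
  -1, -2 or -3.\<close>

lemma linear_cpt: "a * cpt t $ 1 + b * cpt t $ 2 + c * cpt t $ 3 = poly [:a, b, c, c:] t"
  by (simp add: cf_def algebra_simps power2_eq_square power3_eq_cube)

lemma quad_cpt: "quad a b c d e f (cpt t) = poly [:a, b, c + d, c + e, e + f, 2 * f, f:] t"
  by (simp add: quad_def cf_def algebra_simps power2_eq_square power3_eq_cube)

lemma cubf_cpt: "cubf a b c d e f g h i j (cpt t) =
    poly [:a, b, c + d, c + e + g, e + f + h, 2 * f + h + i, f + 2 * i + j, i + 3 * j, 3 * j, j:] t"
  by (simp add: cubf_def quad_def cf_def algebra_simps power2_eq_square power3_eq_cube)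

text \<open>Vieta's formula gives the sum if \<open>c\<close> is nonzero; otherwise a polynomial of
  degree at most 1 vanishes at three parameters.\<close>

lemma collinear_cpt_sum:
  assumes "finite T" "card T = 3" "\<And>x. x \<in> T \<Longrightarrow> a * cpt x $ 1 + b * cpt x $ 2 + c * cpt x $ 3 = 0"
  shows "\<Sum>T = - 1 \<or> (a = 0 \<and> b = 0 \<and> c = 0)"
proof -
  let ?R = "[:a, b, c, c:]"
  have r: "poly ?R x = 0" if "x \<in> T" for x using assms(3)[OF that] by (simp only: linear_cpt)
  have d: "degree ?R \<le> 3" by (intro degree_le) (auto simp: coeff_pCons split: nat.splits)
  have s: "c = - c * \<Sum>T"
    using sum_of_roots(1)[OF assms(1), of 2 ?R] assms(2) r d by (simp add: numeral_2_eq_2 numeral_3_eq_3)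
  show ?thesis
  proof (cases "c = 0")
    case True
    have "degree [:a, b:] \<le> 1" by (intro degree_le) (auto simp: coeff_pCons split: nat.splits)
    then have "[:a, b:] = 0" using r True assms(2) by (intro too_many_roots[of T]) auto
    then show ?thesis using True by simp
  next
    case False
    have "c + c * \<Sum>T = 0" using s by (simp add: eq_neg_iff_add_eq_0)
    then have "c * (\<Sum>T + 1) = 0" by (simp add: algebra_simps)
    then show ?thesis using False by (simp add: eq_neg_iff_add_eq_0)
  qed
qed

lemma conic_cpt_sum:
  assumes "finite T" "card T = 6" "\<And>x. x \<in> T \<Longrightarrow> quad a b c d e f (cpt x) = 0"
  shows "\<Sum>T = - 2 \<or> (a = 0 \<and> b = 0 \<and> c = 0 \<and> d = 0 \<and> e = 0 \<and> f = 0)"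
proof -
  let ?R = "[:a, b, c + d, c + e, e + f, 2 * f, f:]"
  have r: "poly ?R x = 0" if "x \<in> T" for x using assms(3)[OF that] by (simp only: quad_cpt)
  have d: "degree ?R \<le> 6" by (intro degree_le) (auto simp: coeff_pCons split: nat.splits)
  have s: "2 * f = - f * \<Sum>T"
    using sum_of_roots(1)[OF assms(1), of 5 ?R] assms(2) r d by (simp add: eval_nat_numeral)
  show ?thesis
  proof (cases "f = 0")
    case True
    have "degree [:a, b, c + d, c + e, e:] \<le> 4" by (intro degree_le) (auto simp: coeff_pCons split: nat.splits)
    then have "[:a, b, c + d, c + e, e:] = 0" using r True assms(2) by (intro too_many_roots[of T]) auto
    then show ?thesis using True by auto
  next
    case False
    have "2 * f + f * \<Sum>T = 0" using s by (simp add: eq_neg_iff_add_eq_0)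
    then have "f * (\<Sum>T + 2) = 0" by (simp add: algebra_simps)
    then show ?thesis using False by (simp add: eq_neg_iff_add_eq_0)
  qed
qed

text \<open>The kernel of restriction to the cuspidal cubic: setting the coefficients of the
  restriction to zero leaves one free coefficient, which is that of \<open>Cf\<close>.\<close>

lemma cubic_vanishing_on_cusp:
  fixes f :: "'a::alg_closed_field ^ 3 \<Rightarrow> 'a"
  assumes "hp S 3 f" "\<And>x. f (cpt x) = 0"
  obtains k where "\<And>v. f v = k * Cf v"
proof -
  obtain a b c d e g h i j k where f: "\<And>v. f v = cubf a b c d e g h i j k v" using hp_3E[OF assms(1)] by blast
  have "[:a, b, c + d, c + e + h, e + g + i, 2 * g + i + j, g + 2 * j + k, j + 3 * k, 3 * k, k:] = 0"
    using assms(2) by (intro poly_zero_alg_closed) (simp only: f cubf_cpt)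
  then have z: "a = 0" "b = 0" "k = 0" "j = 0" "g = 0" "i = 0" "e = 0" "d = - c" "h = - c"
    by (auto simp: eq_neg_iff_add_eq_0 add.commute)
  have "f v = c * Cf v" for v
    unfolding f cubf_def quad_def Cf_def z by (simp add: algebra_simps power2_eq_square power3_eq_cube)
  then show ?thesis by (rule that)
qed

definition polcub :: "'a::field \<Rightarrow> 'a \<Rightarrow> 'a \<Rightarrow> 'a \<Rightarrow> 'a \<Rightarrow> 'a \<Rightarrow> 'a \<Rightarrow> 'a \<Rightarrow> 'a \<Rightarrow> 'a \<Rightarrow> 'a ^ 3 \<Rightarrow> 'a ^ 3 \<Rightarrow> 'a" where
  "polcub a b c d e f g h i j u w =
     w $ 1 * (3 * a * u $ 1 ^ 2 + 2 * b * u $ 1 * u $ 2 + 2 * c * u $ 1 * u $ 3 + d * u $ 2 ^ 2 + e * u $ 2 * u $ 3 + f * u $ 3 ^ 2)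
   + w $ 2 * (b * u $ 1 ^ 2 + 2 * d * u $ 1 * u $ 2 + e * u $ 1 * u $ 3 + 3 * g * u $ 2 ^ 2 + 2 * h * u $ 2 * u $ 3 + i * u $ 3 ^ 2)
   + w $ 3 * (c * u $ 1 ^ 2 + e * u $ 1 * u $ 2 + 2 * f * u $ 1 * u $ 3 + h * u $ 2 ^ 2 + 2 * i * u $ 2 * u $ 3 + 3 * j * u $ 3 ^ 2)"

lemma cubf_expand:
  "cubf a b c d e f g h i j (u + x *s w) = cubf a b c d e f g h i j u + x * polcub a b c d e f g h i j u w
     + x ^ 2 * polcub a b c d e f g h i j w u + x ^ 3 * cubf a b c d e f g h i j w"
  unfolding cubf_def quad_def polcub_def vector_add_component vector_smult_component
  by (simp add: algebra_simps power2_eq_square power3_eq_cube)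

lemma polar_cubf:
  fixes F :: "'a::alg_closed_field tpoly"
  assumes "form 3 F" "\<And>v. insertion id v F = cubf a b c d e f g h i j v"
  shows "polar F u w = polcub a b c d e f g h i j u w"
  by (rule polar_unique(2)[OF assms(1), symmetric]) (simp only: assms(2) cubf_expand)

text \<open>The derivative of \<open>cpt\<close> at \<open>x\<close>, a tangent vector of the
  cuspidal cubic.\<close>

definition ctan :: "'a::field \<Rightarrow> 'a ^ 3" where
  "ctan x = vector [0, 1, 3 * x ^ 2 + 2 * x]"

lemma ctan_simps [simp]: "ctan x $ 1 = 0" "ctan x $ 2 = 1" "ctan x $ 3 = 3 * x ^ 2 + 2 * x"
  by (simp_all add: ctan_def)

lemma polcub_cpt_ctan:
  "polcub a b c d e f g h i j (cpt x) (ctan x) =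
    poly (pderiv [:a, b, c + d, c + e + g, e + f + h, 2 * f + h + i, f + 2 * i + j, i + 3 * j, 3 * j, j:]) x"
  unfolding polcub_def cpt_simps ctan_simps cf_def
  by (simp add: pderiv_pCons algebra_simps power2_eq_square power3_eq_cube)

definition polC :: "'a::field ^ 3 \<Rightarrow> 'a ^ 3 \<Rightarrow> 'a" where
  "polC u w = w $ 1 * (2 * u $ 1 * u $ 3 - u $ 2 ^ 2) - w $ 2 * (2 * u $ 1 * u $ 2 + 3 * u $ 2 ^ 2) + w $ 3 * u $ 1 ^ 2"

lemma Cf_cubf: "Cf v = cubf 0 0 1 (- 1) 0 0 (- 1) 0 0 0 v"
  by (simp add: Cf_def cubf_def quad_def algebra_simps power2_eq_square)

lemma polC_polcub: "polC u w = polcub 0 0 1 (- 1) 0 0 (- 1) 0 0 0 u w"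
  by (simp add: polC_def polcub_def algebra_simps)

text \<open>Three conjugates with sum -1 would, on taking traces, give \<open>3 tr8 t = - 8\<close>;
  the second condition excludes such collinear triples.\<close>

definition good :: "'k::{field,finite} alg_closure \<Rightarrow> bool" where
  "good t \<longleftrightarrow> deg8 t \<and> 3 * tr8 t + 8 \<noteq> 0"

text \<open>The parameter of the ninth base point of the pencil of cubics through \<open>orb t\<close>.\<close>

definition sn :: "'k::{field,finite} alg_closure \<Rightarrow> 'k alg_closure" where
  "sn t = - tr8 t - 3"

text \<open>Up to a scalar, the restriction to the cuspidal cubic of every cubic through the orbit.
  The root \<open>sn t\<close> is chosen so that all nine roots sum to -3.\<close>

definition P9 :: "'k::{field,finite} alg_closure \<Rightarrow> 'k alg_closure poly" where
  "P9 t = minpoly8 t * [:- sn t, 1:]"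

lemma goodD: "good t \<Longrightarrow> deg8 t" "good t \<Longrightarrow> cj t 8 = t"
  by (simp_all add: good_def deg8_def)

lemma sn_rational: "cj t 8 = t \<Longrightarrow> sn t \<in> range to_ac"
  unfolding sn_def by (intro csubringD csubring_to_ac tr8_rational csubring_numeral)

lemma poly_P9: "poly (P9 t) x = (\<Prod>i<8. x - cj t i) * (x - sn t)"
  by (simp add: P9_def poly_minpoly8 algebra_simps)

lemma P9_root_iff: "poly (P9 t) x = 0 \<longleftrightarrow> x = sn t \<or> (\<exists>i<8. x = cj t i)"
  by (auto simp: poly_P9)

lemma sn_not_conj:
  assumes "deg8 t"
  shows "sn t \<noteq> cj t i"
  using deg8_not_rational[OF assms, of i] sn_rational[of t] assms by (auto simp: deg8_def)

lemma P9_coeffs: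
  assumes "deg8 t"
  shows "degree (P9 t) = 9" "coeff (P9 t) 9 = 1" "coeff (P9 t) 8 = 3"
proof -
  have m: "degree (minpoly8 t) = 8" "minpoly8 t \<noteq> 0"
    by (simp_all add: minpoly8_def degree_prod_sum_eq)
  then show d: "degree (P9 t) = 9" unfolding P9_def by (subst degree_mult_eq) auto
  have "lead_coeff (P9 t) = 1"
    unfolding P9_def lead_coeff_mult minpoly8_def by (simp add: lead_coeff_prod)
  then show c9: "coeff (P9 t) 9 = 1" by (simp add: d)
  define T where "T = insert (sn t) (cj t ` {..<8})"
  have ns: "sn t \<notin> cj t ` {..<8}" using sn_not_conj[OF assms] by auto
  have "card T = 9" unfolding T_def using ns card_image[OF deg8_inj[OF assms]] by simp
  moreover have "\<Sum>T = sn t + tr8 t"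
    unfolding T_def tr8_def using ns sum.reindex[OF deg8_inj[OF assms], of "\<lambda>x. x"] by (simp add: comp_def)
  moreover have "poly (P9 t) x = 0" if "x \<in> T" for x using that by (auto simp: T_def P9_root_iff)
  ultimately have "coeff (P9 t) 8 = - coeff (P9 t) 9 * (sn t + tr8 t)"
    using sum_of_roots(1)[of T 8 "P9 t"] d by (simp add: T_def)
  then show "coeff (P9 t) 8 = 3" by (simp add: c9 sn_def)
qed

lemma P9_rational: "cj t 8 = t \<Longrightarrow> coeff (P9 t) n \<in> range to_ac"
proof -
  assume t: "cj t 8 = t"
  have "coeff [:- sn t, 1:] i \<in> range to_ac" for i
    using csubringD(1,2,5)[OF csubring_to_ac] sn_rational[OF t] by (auto simp: coeff_pCons split: nat.splits)
  then show ?thesis unfolding P9_def coeff_mult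
    by (intro csubring_sum csubringD(3) csubring_to_ac minpoly8_rational t)
qed

lemma P9_simple:
  assumes "deg8 t" "poly (P9 t) x = 0"
  shows "poly (pderiv (P9 t)) x \<noteq> 0"
proof -
  define T where "T = insert (sn t) (cj t ` {..<8})"
  have ns: "sn t \<notin> cj t ` {..<8}" using sn_not_conj[OF assms(1)] by auto
  have "P9 t = (\<Prod>y\<in>T. [:- y, 1:])"
    unfolding T_def P9_def minpoly8_def using ns prod.reindex[OF deg8_inj[OF assms(1)], of "\<lambda>y. [:- y, 1:]"]
    by (simp add: comp_def mult.commute)
  moreover have x: "x \<in> T" using assms(2) by (auto simp: T_def P9_root_iff)
  moreover have fin: "finite T" by (simp add: T_def)
  ultimately have e: "P9 t = [:- x, 1:] * (\<Prod>y\<in>T - {x}. [:- y, 1:])" by (simp add: prod.remove)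
  have "poly (pderiv (P9 t)) x = poly (\<Prod>y\<in>T - {x}. [:- y, 1:]) x"
    unfolding e pderiv_mult by (simp add: pderiv_pCons)
  then show ?thesis using fin by (simp add: poly_prod)
qed

lemma degree_le_9_expand:
  fixes p :: "'a::field poly"
  assumes "degree p \<le> 9"
  shows "p = [:coeff p 0, coeff p 1, coeff p 2, coeff p 3, coeff p 4, coeff p 5, coeff p 6, coeff p 7, coeff p 8, coeff p 9:]"
    (is "p = ?r")
proof (rule poly_eqI)
  fix n
  show "coeff p n = coeff ?r n"
  proof (cases "n < 10")
    case True
    then have "n \<in> {0,1,2,3,4,5,6,7,8,9}" by auto
    then show ?thesis by (auto simp: eval_nat_numeral)
  next
    case False
    then have "coeff p n = 0" using assms by (intro coeff_eq_0) auto
    moreover have "degree ?r \<le> 9" by (intro degree_le) (auto simp: coeff_pCons split: nat.splits)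
    then have "coeff ?r n = 0" using False by (intro coeff_eq_0) linarith
    ultimately show ?thesis by simp
  qed
qed

lemma degree_list10: "degree [:a, b, c, d, e, f, g, h, i, j:] \<le> 9"
  by (intro degree_le) (auto simp: coeff_pCons split: nat.splits)

text \<open>The two top coefficients of both sides agree, so the difference has degree at most 7 but
  eight roots.\<close>

lemma cubic_through_orbit:
  assumes "deg8 t" "\<And>n. n < 8 \<Longrightarrow> cubf a b c d e f g h i j (cpt (cj t n)) = 0"
  shows "[:a, b, c + d, c + e + g, e + f + h, 2 * f + h + i, f + 2 * i + j, i + 3 * j, 3 * j, j:] = smult j (P9 t)"
    (is "?R = _")
proof -
  let ?S = "?R - smult j (P9 t)"
  have "degree ?S \<le> 7"
  proof (rule degree_le, intro allI impI)
    fix n :: nat assume n: "7 < n"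
    show "coeff ?S n = 0"
    proof (cases "n = 8 \<or> n = 9")
      case True
      then show ?thesis using P9_coeffs[OF assms(1)] by (auto simp: eval_nat_numeral)
    next
      case False
      then have "n > 9" using n by auto
      moreover have "degree ?R \<le> 9" by (rule degree_list10)
      ultimately have "coeff ?R n = 0" by (intro coeff_eq_0) linarith
      moreover have "coeff (P9 t) n = 0" using \<open>n > 9\<close> P9_coeffs(1)[OF assms(1)] by (intro coeff_eq_0) linarith
      ultimately show ?thesis by (simp only: coeff_diff coeff_smult mult_zero_right diff_self)
    qed
  qed
  moreover have "poly ?S x = 0" if "x \<in> cj t ` {..<8}" for x
    using that assms(2) by (auto simp: P9_root_iff cubf_cpt simp del: poly_pCons)
  moreover have "card (cj t ` {..<8}) = 8" using card_image[OF deg8_inj[OF assms(1)]] by simp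
  ultimately have "?S = 0" by (intro too_many_roots[of "cj t ` {..<8}"]) auto
  then show ?thesis by simp
qed

lemma orb_cases:
  assumes "x \<in> orb t"
  obtains i where "i < 8" "x = proj_class (cpt (cj t i))"
  using assms by (auto simp: orb_def)

lemma subset_orb:
  assumes "deg8 t" "n \<le> card {x \<in> orb t. Q x}"
  obtains I where "I \<subseteq> {..<8}" "card I = n" "\<And>i. i \<in> I \<Longrightarrow> Q (proj_class (cpt (cj t i)))"
proof -
  let ?J = "{i. i < 8 \<and> Q (proj_class (cpt (cj t i)))}"
  have "{x \<in> orb t. Q x} = (\<lambda>i. proj_class (cpt (cj t i))) ` ?J" by (auto simp: orb_def)
  then have "n \<le> card ?J" using assms(2) card_image_le[of ?J "\<lambda>i. proj_class (cpt (cj t i))"] by simp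
  then obtain I where "I \<subseteq> ?J" "card I = n" by (rule obtain_subset_with_card_n)
  then show ?thesis using that[of I] by auto
qed

lemma tr8_sum: "tr8 (\<Sum>i\<in>I. f i) = (\<Sum>i\<in>I. tr8 (f i))"
  by (simp add: tr8_def cj_sum sum.swap[of _ I])

text \<open>If \<open>u + cj u d\<close> is rational, then in characteristic 2 the
  \<open>d\<close>-th power of Frobenius swaps the two terms, so \<open>2 d\<close> is a period of
  \<open>u\<close> and \<open>d = 4\<close>. The trace is then four times a rational element, hence
  0, which contradicts \<open>good\<close>.\<close>

lemma two_conj_sum_irrational:
  assumes "good t" "(2 :: 'k::{field,finite} alg_closure) = 0" "i < j" "j < 8"
  shows "cj (t :: 'k alg_closure) i + cj t j \<notin> range to_ac"
proof
  assume e: "cj t i + cj t j \<in> range to_ac"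
  define u where "u = cj t i"
  define d where "d = j - i"
  have d: "0 < d" "d < 8" using assms by (auto simp: d_def)
  have "cj (cj t i) 8 = cj (cj t 8) i" by (simp add: cj_cj add.commute)
  then have u8: "cj u 8 = u" using goodD(2)[OF assms(1)] by (simp add: u_def)
  have u: "deg8 u"
    using goodD(1)[OF assms(1)] u8 cj_inj[of "cj t 4" i t] by (auto simp: deg8_def u_def cj_cj add.commute)
  have ud: "u + cj u d \<in> range to_ac" using e assms(3) by (simp add: u_def d_def cj_cj)
  then have "cj (u + cj u d) d = u + cj u d" by (rule cj_to_ac)
  then have 2: "cj u (2 * d) = u" by (simp add: cj_add cj_cj mult_2 add.commute)
  show False
  proof (cases "d = 4")
    case False
    have "cj u (2 * d mod 8) = u" using 2 cj_mod8[OF u] by simp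
    moreover have "0 < 2 * d mod 8" using d False by presburger
    moreover have "2 * d mod 8 < 8" by simp
    ultimately show False using deg8_cj_neq[OF u] by blast
  next
    case True
    have "(u + cj u 4) + cj (u + cj u 4) 1 + cj (u + cj u 4) 2 + cj (u + cj u 4) 3 = tr8 u"
      by (simp add: tr8_def cj_add cj_cj eval_nat_numeral)
    moreover have "cj (u + cj u 4) n = u + cj u 4" for n using ud True by (intro cj_to_ac) simp
    ultimately have "tr8 u = 2 * 2 * (u + cj u 4)" by simp
    then have "tr8 u = 0" using assms(2) by simp
    moreover have "tr8 u = tr8 t" using tr8_cj[OF goodD(2)[OF assms(1)]] by (simp add: u_def)
    moreover have "(8 :: 'k alg_closure) = 2 * 2 * 2" by simp
    ultimately show False using assms(1,2) by (simp add: good_def)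
  qed
qed

text \<open>Lines and conics are excluded by taking traces of the sum conditions. A cubic through
  the orbit and singular at one of its points restricts to the cuspidal cubic with a double root, so
  the restriction is zero and the cubic is a multiple of \<open>Cf\<close>, which is smooth at that
  point.\<close>

lemma general_points_orb:
  assumes g: "good t"
  shows "general_points (orb t)"
  unfolding general_points_def
proof (intro conjI allI impI)
  note t = goodD[OF g]
  have img: "card (cj t ` I) = card I" "\<Sum>(cj t ` I) = (\<Sum>i\<in>I. cj t i)" "finite (cj t ` I)" if "I \<subseteq> {..<8}" for I
    using card_image[OF inj_on_subset[OF deg8_inj[OF t(1)] that]]
      sum.reindex[OF inj_on_subset[OF deg8_inj[OF t(1)] that], of "\<lambda>x. x"] finite_subset[OF that]
    by (auto simp: comp_def)
  have trs: "tr8 (\<Sum>i\<in>I. cj t i) = of_nat (card I) * tr8 t" for I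
    using tr8_cj[OF t(2)] by (simp add: tr8_sum)
  have num: "tr8 (- 1) = - (8 :: 'a alg_closure)" "tr8 (- 2) = - (16 :: 'a alg_closure)"
  proof -
    have "- 1 \<in> range (to_ac :: 'a \<Rightarrow> _)" "- 2 \<in> range (to_ac :: 'a \<Rightarrow> _)"
      by (intro csubringD(5) csubring_to_ac csubringD(2) csubring_numeral)+
    then show "tr8 (- 1) = - (8 :: 'a alg_closure)" "tr8 (- 2) = - (16 :: 'a alg_closure)"
      by (simp_all add: tr8_to_ac)
  qed
  {
    fix L :: "'a alg_closure tpoly" assume L: "form 1 L \<and> L \<noteq> 0"
    show "card {x \<in> orb t. vanishes_at L x} < 3"
    proof (rule ccontr)
      assume "\<not> card {x \<in> orb t. vanishes_at L x} < 3"
      then have "3 \<le> card {x \<in> orb t. vanishes_at L x}" by simp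
      then obtain I where I: "I \<subseteq> {..<8}" "card I = 3" "\<And>i. i \<in> I \<Longrightarrow> vanishes_at L (proj_class (cpt (cj t i)))"
        by (rule subset_orb[OF t(1)]) blast
      obtain a b c where abc: "\<And>v. insertion id v L = a * v $ 1 + b * v $ 2 + c * v $ 3"
        by (rule hp_1E[OF hp_insertion_UNIV[OF conjunct1[OF L]]], rule that)
      have "\<Sum>(cj t ` I) = - 1 \<or> (a = 0 \<and> b = 0 \<and> c = 0)"
      proof (rule collinear_cpt_sum)
        fix x assume "x \<in> cj t ` I"
        then have "vanishes_at L (proj_class (cpt x))" using I(3) by auto
        then show "a * cpt x $ 1 + b * cpt x $ 2 + c * cpt x $ 3 = 0"
          unfolding abc[symmetric] using vanishes_at_class L cpt_nonzero by blast
      qed (use img I in auto)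
      moreover have "\<not> (a = 0 \<and> b = 0 \<and> c = 0)" using L by (auto simp: tpoly_nonzero_iff abc)
      ultimately have "(\<Sum>i\<in>I. cj t i) = - 1" using img(2)[OF I(1)] by simp
      from arg_cong[OF this, of tr8] have "3 * tr8 t = - 8" by (simp add: trs I(2) num)
      then show False using g by (simp add: good_def)
    qed
  next
    fix L :: "'a alg_closure tpoly" assume L: "form 2 L \<and> L \<noteq> 0"
    show "card {x \<in> orb t. vanishes_at L x} < 6"
    proof (rule ccontr)
      assume "\<not> card {x \<in> orb t. vanishes_at L x} < 6"
      then have "6 \<le> card {x \<in> orb t. vanishes_at L x}" by simp
      then obtain I where I: "I \<subseteq> {..<8}" "card I = 6" "\<And>i. i \<in> I \<Longrightarrow> vanishes_at L (proj_class (cpt (cj t i)))"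
        by (rule subset_orb[OF t(1)]) blast
      obtain a b c d e f where abc: "\<And>v. insertion id v L = quad a b c d e f v"
        by (rule hp_2E[OF hp_insertion_UNIV[OF conjunct1[OF L]]], rule that)
      have "\<Sum>(cj t ` I) = - 2 \<or> (a = 0 \<and> b = 0 \<and> c = 0 \<and> d = 0 \<and> e = 0 \<and> f = 0)"
      proof (rule conic_cpt_sum)
        fix x assume "x \<in> cj t ` I"
        then have "vanishes_at L (proj_class (cpt x))" using I(3) by auto
        then show "quad a b c d e f (cpt x) = 0"
          unfolding abc[symmetric] using vanishes_at_class L cpt_nonzero by blast
      qed (use img I in auto)
      moreover have "\<not> (a = 0 \<and> b = 0 \<and> c = 0 \<and> d = 0 \<and> e = 0 \<and> f = 0)" using L by (auto simp: tpoly_nonzero_iff abc quad_def)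
      ultimately have S: "(\<Sum>i\<in>I. cj t i) = - 2" using img(2)[OF I(1)] by simp
      from arg_cong[OF this, of tr8] have "6 * tr8 t = - 16" by (simp add: trs I(2) num)
      \<comment> \<open>This contradicts \<open>good\<close> except in characteristic 2, where the
        two orbit points off \<open>I\<close> have a rational sum of parameters.\<close>
      then have "2 * (3 * tr8 t + 8) = 0" by simp
      then have two: "(2 :: 'a alg_closure) = 0" using g unfolding good_def mult_eq_0_iff by blast
      have "card ({..<8} - I) = 2" using I by (simp add: card_Diff_subset finite_subset)
      then obtain i j where ij: "{..<8} - I = {i, j}" "i \<noteq> j" by (auto simp: card_2_iff)
      have "tr8 t = (\<Sum>i\<in>I. cj t i) + (\<Sum>i\<in>{..<8} - I. cj t i)"
        unfolding tr8_def using sum.subset_diff[OF I(1), of "cj t"] by (simp add: add.commute)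
      then have "cj t i + cj t j = tr8 t + 2" unfolding ij(1) S using ij(2) by simp
      then have r: "cj t i + cj t j \<in> range to_ac"
        using csubringD(6)[OF csubring_to_ac tr8_rational[OF t(2)] csubring_numeral[OF csubring_to_ac]] by simp
      have "i < 8" "j < 8" using ij(1) by blast+
      then show False using two_conj_sum_irrational[OF g two] r ij(2) by (metis add.commute linorder_neqE_nat)
    qed
  next
    fix F :: "'a alg_closure tpoly" assume F: "form 3 F \<and> F \<noteq> 0"
    show "\<not> ((\<exists>x\<in>orb t. singular_at F x) \<and> (\<forall>y\<in>orb t. vanishes_at F y))"
    proof
      assume "(\<exists>x\<in>orb t. singular_at F x) \<and> (\<forall>y\<in>orb t. vanishes_at F y)"
      then obtain n where n: "n < 8" "singular_at F (proj_class (cpt (cj t n)))"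
        and v: "\<And>i. i < 8 \<Longrightarrow> vanishes_at F (proj_class (cpt (cj t i)))"
        by (auto simp: orb_def)
      obtain a b c d e f g' h i j where f: "\<And>v. insertion id v F = cubf a b c d e f g' h i j v"
        by (rule hp_3E[OF hp_insertion_UNIV[OF conjunct1[OF F]]], rule that)
      have z: "cubf a b c d e f g' h i j (cpt (cj t i')) = 0" if "i' < 8" for i'
        unfolding f[symmetric] using vanishes_at_class[of 3 F] v[OF that] F cpt_nonzero by blast
      define Q where "Q = [:a, b, c + d, c + e + g', e + f + h, 2 * f + h + i, f + 2 * i + j, i + 3 * j, 3 * j, j:]"
      have R: "Q = smult j (P9 t)" unfolding Q_def by (rule cubic_through_orbit[OF t(1) z])
      have pol: "polar F (cpt (cj t n)) w = 0" for w
        using n(2) singular_at_class[of F] F cpt_nonzero by blast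
      have "poly (pderiv (smult j (P9 t))) (cj t n) = 0"
        using pol[of "ctan (cj t n)"] unfolding polar_cubf[OF conjunct1[OF F] f] polcub_cpt_ctan Q_def[symmetric] R by simp
      moreover have "poly (pderiv (P9 t)) (cj t n) \<noteq> 0"
        using P9_simple[OF t(1)] n(1) by (auto simp: P9_root_iff)
      ultimately have j: "j = 0" by (simp add: pderiv_smult)
      have Fz: "insertion id (cpt x) F = 0" for x
        unfolding f cubf_cpt Q_def[symmetric] R by (simp add: j)
      then obtain k where k: "\<And>v. insertion id v F = k * Cf v"
        by - (rule cubic_vanishing_on_cusp[OF hp_insertion_UNIV[OF conjunct1[OF F]] Fz], rule that)
      have "k \<noteq> 0" using F k by (auto simp: tpoly_nonzero_iff)
      \<comment> \<open>At \<open>cpt x\<close> the derivative of \<open>Cf\<close> along the third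
        axis is 1.\<close>
      moreover have "polar F (cpt (cj t n)) (axis 3 1) = k"
      proof (rule polar_unique(2)[OF conjunct1[OF F], symmetric])
        fix x
        show "insertion id (cpt (cj t n) + x *s axis 3 1) F = 0 + x * k + x\<^sup>2 * 0 + x ^ 3 * 0"
          unfolding k by (simp add: Cf_def axis_def cf_def algebra_simps)
      qed
      ultimately show False using pol by simp
    qed
  }
qed

subsection \<open>Cubics through general points\<close>

lemma det3_dot_cr: "det3 u w v = dot (cr u w) v"
  by (simp add: det3_expand dot_def algebra_simps)

lemma proj_plane_ex: "P \<in> proj_plane \<Longrightarrow> \<exists>v. v \<noteq> 0 \<and> P = proj_class v"
  by (erule proj_plane_cases) blast

lemma factor_line:
  fixes f :: "'a::field ^ 3 \<Rightarrow> 'a"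
  assumes "hp UNIV (Suc d) f" "\<not> par u w" "\<And>s t. f (s *s u + t *s w) = 0"
  obtains g where "hp UNIV d g" "\<And>v. f v = dot (cr u w) v * g v"
proof -
  have n: "cr u w \<noteq> 0" using assms(2) by (simp add: par_iff_cr)
  have e: "(\<Sum>j\<in>UNIV. cr u w $ j * v $ j) = dot (cr u w) v" for v by (simp only: sum_3 dot_def)
  have "f v = 0" if "(\<Sum>j\<in>UNIV. cr u w $ j * v $ j) = 0" for v
  proof -
    have "det3 u w v = 0" using that by (simp only: e det3_dot_cr)
    then obtain a b where "v = a *s u + b *s w" by (rule det3_zero_imp_span[OF assms(2)])
    then show ?thesis using assms(3) by simp
  qed
  from hp_divide_linear[OF assms(1) n this] obtain g
    where "hp UNIV d g" "\<And>v. f v = (\<Sum>j\<in>UNIV. cr u w $ j * v $ j) * g v" by blast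
  then show ?thesis using that by (simp only: e)
qed

text \<open>A line component would leave a conic; general position allows at most 2 of the eight
  points on the line and at most 5 on the conic.\<close>

lemma general_line_free:
  fixes F :: "'a::alg_closed_field tpoly"
  assumes p: "general_points p" "p \<subseteq> proj_plane" "card p = 8" and F: "F \<in> cubics_through p"
  shows "line_free F"
  unfolding line_free_def
proof (intro allI impI, rule ccontr)
  fix u w :: "'a ^ 3" assume uw: "\<not> par u w" "\<not> (\<exists>s t. insertion id (s *s u + t *s w) F \<noteq> 0)"
  have F3: "form 3 F" "F \<noteq> 0" "\<And>x. x \<in> p \<Longrightarrow> vanishes_at F x" using F by (auto simp: cubics_through_def)
  have "hp UNIV (Suc 2) (\<lambda>v. insertion id v F)" using hp_insertion_UNIV[OF F3(1)] by simp
  then obtain g where g: "hp UNIV 2 g" "\<And>v. insertion id v F = dot (cr u w) v * g v"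
    by (rule factor_line[OF _ uw(1)]) (use uw(2) in blast)+
  obtain Q where Q: "form 2 Q" "\<And>v. insertion id v Q = g v" by (rule hp_UNIV_form[OF g(1)], rule that)
  have hL: "hp UNIV 1 (\<lambda>v. dot (cr u w) v)"
    using hp_linear[OF csubring_UNIV, of "cr u w"] by (simp add: sum_3 dot_def)
  obtain L where L: "form 1 L" "\<And>v. insertion id v L = dot (cr u w) v" by (rule hp_UNIV_form[OF hL], rule that)
  obtain x where x: "insertion id x F \<noteq> 0" using F3(2) by (auto simp: tpoly_nonzero_iff)
  have "L \<noteq> 0" "Q \<noteq> 0" using x unfolding tpoly_nonzero_iff g(2) L(2) Q(2) by auto
  then have "card {x \<in> p. vanishes_at L x} < 3" "card {x \<in> p. vanishes_at Q x} < 6"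
    using p(1) L(1) Q(1) unfolding general_points_def by blast+
  moreover have "p \<subseteq> {x \<in> p. vanishes_at L x} \<union> {x \<in> p. vanishes_at Q x}"
  proof
    fix x assume x: "x \<in> p"
    then obtain v where v: "v \<noteq> 0" "x = proj_class v" using proj_plane_ex[OF subsetD[OF p(2)]] by blast
    have "dot (cr u w) v * g v = 0"
      using F3(3)[OF x] vanishes_at_class[OF F3(1) v(1)] unfolding v(2) g(2) by simp
    then show "x \<in> {x \<in> p. vanishes_at L x} \<union> {x \<in> p. vanishes_at Q x}"
      using x vanishes_at_class[OF L(1) v(1)] vanishes_at_class[OF Q(1) v(1)] unfolding L(2) Q(2) v(2) by auto
  qed
  then have "card p \<le> card ({x \<in> p. vanishes_at L x} \<union> {x \<in> p. vanishes_at Q x})"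
    using p(3) card_ge_0_finite[of p] by (intro card_mono) auto
  then have "8 \<le> card {x \<in> p. vanishes_at L x} + card {x \<in> p. vanishes_at Q x}"
    using p(3) card_Un_le[of "{x \<in> p. vanishes_at L x}" "{x \<in> p. vanishes_at Q x}"] by linarith
  ultimately show False by linarith
qed

lemma exists_relation:
  fixes a1 a2 b1 b2 c1 c2 :: "'a::field"
  obtains x y z where "x \<noteq> 0 \<or> y \<noteq> 0 \<or> z \<noteq> 0" "x * a1 + y * b1 + z * c1 = 0" "x * a2 + y * b2 + z * c2 = 0"
proof (cases "a1 * b2 - a2 * b1 = 0")
  case False
  show ?thesis
    by (rule that[of "b1 * c2 - b2 * c1" "c1 * a2 - c2 * a1" "a1 * b2 - a2 * b1"]) (use False in \<open>auto simp: algebra_simps\<close>)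
next
  case True
  show ?thesis
  proof (cases "a1 = 0 \<and> b1 = 0")
    case False
    show ?thesis by (rule that[of "- b1" a1 0]) (use False True in \<open>auto simp: algebra_simps\<close>)
  next
    case z: True
    show ?thesis
    proof (cases "a2 = 0 \<and> b2 = 0")
      case False
      show ?thesis by (rule that[of "- b2" a2 0]) (use False z in \<open>auto simp: algebra_simps\<close>)
    next
      case True
      show ?thesis by (rule that[of 1 0 0]) (use z True in auto)
    qed
  qed
qed

lemma form_lincomb:
  fixes F :: "'a::field tpoly"
  assumes "form d F" "form d G" "form d H"
  obtains L where "form d L" "\<And>v. insertion id v L = x * insertion id v F + y * insertion id v G + z * insertion id v H"
proof -
  let ?L = "const_poly x * F + const_poly y * G + const_poly z * H"
  have "form (0 + d) ?L" by (intro form_add form_mult form_const assms)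
  moreover have "insertion id v ?L = x * insertion id v F + y * insertion id v G + z * insertion id v H" for v
    by (simp add: insertion_add insertion_mult insertion_const coeff_hom_id)
  ultimately show ?thesis using that by simp
qed

text \<open>Through eight general points and a ninth point outside the base locus there is only one cubic:
  otherwise some cubic through the eight points would contain the line through two of them.\<close>

lemma pencil_member_unique:
  fixes F :: "'a::alg_closed_field tpoly"
  assumes p: "general_points p" "p \<subseteq> proj_plane" "card p = 8"
    and F: "F \<in> cubics_through p" "F' \<in> cubics_through p" "H \<in> cubics_through p"
    and x: "insertion id x F = 0" "insertion id x F' = 0" "insertion id x H \<noteq> 0"
  obtains c where "c \<noteq> 0" "\<And>v. insertion id v F' = c * insertion id v F"
proof -
  have f: "form 3 F" "F \<noteq> 0" "form 3 F'" "F' \<noteq> 0" "form 3 H" using F by (auto simp: cubics_through_def)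
  obtain P where P: "P \<in> p" using p(3) by fastforce
  have "card (p - {P}) = 7" using p(3) P by simp
  then have "p - {P} \<noteq> {}" by fastforce
  then obtain Q where PQ: "P \<in> p" "Q \<in> p" "P \<noteq> Q" using P by blast
  obtain u where u: "u \<noteq> 0" "P = proj_class u" using proj_plane_ex[OF subsetD[OF p(2) PQ(1)]] by blast
  obtain w where w: "w \<noteq> 0" "Q = proj_class w" using proj_plane_ex[OF subsetD[OF p(2) PQ(2)]] by blast
  have uw: "\<not> par u w" using PQ(3) u w proj_class_eq_iff by metis
  \<comment> \<open>Two conditions on three cubics: the combination loses both mixed terms on the
    line through \<open>P\<close> and \<open>Q\<close>, and its pure terms vanish already.\<close>
  obtain a b c where abc: "a \<noteq> 0 \<or> b \<noteq> 0 \<or> c \<noteq> 0"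
    "a * polar F u w + b * polar F' u w + c * polar H u w = 0"
    "a * polar F w u + b * polar F' w u + c * polar H w u = 0" by (rule exists_relation)
  obtain L where L: "form 3 L" "\<And>v. insertion id v L = a * insertion id v F + b * insertion id v F' + c * insertion id v H"
    using form_lincomb[OF f(1,3,5)] by blast
  have "polar L u w = a * polar F u w + b * polar F' u w + c * polar H u w" for u w
  proof -
    have "insertion id (u + t *s w) L = insertion id u L + t * (a * polar F u w + b * polar F' u w + c * polar H u w)
        + t ^ 2 * (a * polar F w u + b * polar F' w u + c * polar H w u) + t ^ 3 * insertion id w L" for t
      using cubic_expand[OF f(1), of 1 u t w] cubic_expand[OF f(3), of 1 u t w] cubic_expand[OF f(5), of 1 u t w]
      by (simp add: L(2) algebra_simps)
    from polar_unique(2)[OF L(1) this] show ?thesis by simp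
  qed
  then have pol: "polar L u w = 0" "polar L w u = 0" using abc by simp_all
  have van: "vanishes_at L P" if "P \<in> p" for P
  proof -
    from proj_plane_ex[OF subsetD[OF p(2) that]] obtain v where v: "v \<noteq> 0" "P = proj_class v" by blast
    have "vanishes_at F P" "vanishes_at F' P" "vanishes_at H P"
      using F that unfolding cubics_through_def by blast+
    then have "insertion id v F = 0" "insertion id v F' = 0" "insertion id v H = 0"
      using vanishes_at_class[OF f(1) v(1)] vanishes_at_class[OF f(3) v(1)] vanishes_at_class[OF f(5) v(1)]
      unfolding v(2) by blast+
    then show ?thesis using vanishes_at_class[OF L(1) v(1)] by (simp add: v(2) L(2))
  qed
  have "L = 0"
  proof (rule ccontr)
    assume "L \<noteq> 0"
    then have "line_free L" using general_line_free[OF p] van L(1) by (simp add: cubics_through_def)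
    then have "insertion id w L \<noteq> 0"
      using line_freeD[OF L(1) _ uw] pol vanishes_at_class[OF L(1) u(1)] van[OF PQ(1)] u(2) by simp
    then show False using vanishes_at_class[OF L(1) w(1)] van[OF PQ(2)] w(2) by simp
  qed
  then have Lz: "a * insertion id v F + b * insertion id v F' + c * insertion id v H = 0" for v
    using L(2)[of v] by simp
  have c: "c = 0" using Lz[of x] x by simp
  obtain v where v: "insertion id v F \<noteq> 0" using f(2) by (auto simp: tpoly_nonzero_iff)
  obtain v' where v': "insertion id v' F' \<noteq> 0" using f(4) by (auto simp: tpoly_nonzero_iff)
  have b: "b \<noteq> 0" using Lz[of v] v c abc(1) by auto
  have a: "a \<noteq> 0" using Lz[of v'] v' c abc(1) by auto
  have "insertion id v F' = (- a / b) * insertion id v F" for v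
  proof -
    have "insertion id v F' * b = - (a * insertion id v F)"
      unfolding eq_neg_iff_add_eq_0 using Lz[of v] c by (simp add: mult.commute add.commute)
    then have "insertion id v F' * b / b = - (a * insertion id v F) / b" by simp
    then show ?thesis using b by simp
  qed
  then show ?thesis using that[of "- a / b"] a b by simp
qed

subsection \<open>The pencil through a good orbit\<close>

lemma cubf_expand2:
  "cubf a b c d e f g h i j (x *s u + y *s w) = x ^ 3 * cubf a b c d e f g h i j u + x ^ 2 * y * polcub a b c d e f g h i j u w
     + x * y ^ 2 * polcub a b c d e f g h i j w u + y ^ 3 * cubf a b c d e f g h i j w"
  unfolding cubf_def quad_def polcub_def vector_add_component vector_smult_component
  by (simp add: algebra_simps power2_eq_square power3_eq_cube)

lemma polcub_add: "polcub a b c d e f g h i j u (x *s v + y *s w) = x * polcub a b c d e f g h i j u v + y * polcub a b c d e f g h i j u w"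
  unfolding polcub_def vector_add_component vector_smult_component by (simp add: algebra_simps)

lemma polcub_scale: "polcub a b c d e f g h i j (x *s u) w = x ^ 2 * polcub a b c d e f g h i j u w"
  unfolding polcub_def vector_smult_component by (simp add: algebra_simps power2_eq_square)

lemma polcub_first: "polcub a b c d e f g h i j (x *s u + y *s w) w = x ^ 2 * polcub a b c d e f g h i j u w
    + 2 * x * y * polcub a b c d e f g h i j w u + 3 * y ^ 2 * cubf a b c d e f g h i j w"
  unfolding polcub_def cubf_def quad_def vector_add_component vector_smult_component
  by (simp add: algebra_simps power2_eq_square power3_eq_cube)

lemma polcub_self: "polcub a b c d e f g h i j u u = 3 * cubf a b c d e f g h i j u"
  unfolding polcub_def cubf_def quad_def by (simp add: algebra_simps power2_eq_square power3_eq_cube)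

text \<open>The coefficients are solved for one after the other; the coefficient at
  \<open>X^8\<close> cannot be adjusted, but is 3 on both sides. The coefficient of
  \<open>x^2 z\<close> is set to 0, as adding a multiple of \<open>Cf\<close> does not change the
  restriction.\<close>

lemma pencil_coeffs_exist:
  assumes "deg8 t"
  shows "\<exists>c0 c1 c2 c3 b1 b2 a0 a1. {c0, c1, c2, c3, b1, b2, a0, a1} \<subseteq> range to_ac \<and>
    (\<forall>x. cubf c0 c1 0 c2 b1 a0 c3 b2 a1 1 (cpt x) = poly (P9 t) x)"
proof -
  define p where "p n = coeff (P9 t) n" for n
  have t: "cj t 8 = t" using assms by (simp add: deg8_def)
  have r: "p n \<in> range to_ac" for n unfolding p_def by (rule P9_rational[OF t])
  note cs = csubringD(2-6)[OF csubring_to_ac] csubring_numeral[OF csubring_to_ac] r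
  define a1 where "a1 = p 7 - 3"
  define a0 where "a0 = p 6 - 2 * a1 - 1"
  define b2 where "b2 = p 5 - 2 * a0 - a1"
  define b1 where "b1 = p 4 - a0 - b2"
  define c3 where "c3 = p 3 - b1"
  have m: "a1 \<in> range to_ac" unfolding a1_def by (intro cs)
  have m0: "a0 \<in> range to_ac" unfolding a0_def by (intro cs m)
  have m2: "b2 \<in> range to_ac" unfolding b2_def by (intro cs m m0)
  have m1: "b1 \<in> range to_ac" unfolding b1_def by (intro cs m m0 m2)
  have m3: "c3 \<in> range to_ac" unfolding c3_def by (intro cs m1)
  have P: "P9 t = [:p 0, p 1, p 2, p 3, p 4, p 5, p 6, p 7, 3, 1:]"
    using degree_le_9_expand[of "P9 t"] P9_coeffs[OF assms] by (simp add: p_def)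
  have C: "cubf (p 0) (p 1) 0 (p 2) b1 a0 c3 b2 a1 1 (cpt x) = poly (P9 t) x" for x
  proof -
    have e: "0 + p 2 = p 2" "0 + b1 + c3 = p 3" "b1 + a0 + b2 = p 4" "2 * a0 + b2 + a1 = p 5" "a0 + 2 * a1 + 1 = p 6"
      "a1 + 3 = p 7" "3 * 1 = (3 :: 'a alg_closure)"
      unfolding c3_def b1_def b2_def a0_def a1_def by (simp_all only: diff_add_eq diff_diff_eq diff_add_cancel add.commute mult_1_right add_0_left) (simp_all add: algebra_simps)
    show ?thesis unfolding cubf_cpt e P ..
  qed
  have S: "{p 0, p 1, p 2, c3, b1, b2, a0, a1} \<subseteq> range to_ac" using m m0 m1 m2 m3 r by simp
  show ?thesis
    by (rule exI[of _ "p 0"], rule exI[of _ "p 1"], rule exI[of _ "p 2"], rule exI[of _ c3], rule exI[of _ b1],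
        rule exI[of _ b2], rule exI[of _ a0], rule exI[of _ a1], rule conjI[OF S allI[OF C]])
qed

lemma hp_0_in:
  assumes "hp S d f" "csubring S" "d = 0"
  shows "f v \<in> S"
  using assms by (induction rule: hp.induct) (auto intro: csubringD)

lemma hp_cubf:
  assumes "csubring S" "{a, b, c, d, e, f, g, h, i, j} \<subseteq> S" "\<And>k. hp S n (\<lambda>v. U v $ k)"
  shows "hp S (n + (n + n)) (\<lambda>v. cubf a b c d e f g h i j (U v))"
proof -
  let ?m = "\<lambda>k l r v. U v $ k * (U v $ l * U v $ r)"
  have "hp S (n + (n + n)) (\<lambda>v. a * ?m 1 1 1 v + b * ?m 1 1 2 v + c * ?m 1 1 3 v + d * ?m 1 2 2 v + e * ?m 1 2 3 v + f * ?m 1 3 3 v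
      + g * ?m 2 2 2 v + h * ?m 2 2 3 v + i * ?m 2 3 3 v + j * ?m 3 3 3 v)"
    using assms(2) by (intro hp.hp_add hp_smult hp_mult assms(1,3)) auto
  then show ?thesis unfolding cubf_def quad_def
    by (rule back_subst[where P = "hp S (n + (n + n))"])
      (simp add: fun_eq_iff algebra_simps power2_eq_square power3_eq_cube)
qed

lemma hp_cubf_3:
  assumes "csubring S" "{a, b, c, d, e, f, g, h, i, j} \<subseteq> S"
  shows "hp S 3 (cubf a b c d e f g h i j)"
proof -
  have e: "1 + (1 + 1) = (3 :: nat)" by simp
  show ?thesis using hp_cubf[OF assms hp_component[OF assms(1)]] unfolding e .
qed

lemma hp_polcub:
  assumes "csubring S" "{a, b, c, d, e, f, g, h, i, j} \<subseteq> S"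
    "\<And>k. hp S n (\<lambda>v. U v $ k)" "\<And>k. hp S m (\<lambda>v. W v $ k)"
  shows "hp S (m + (n + n)) (\<lambda>v. polcub a b c d e f g h i j (U v) (W v))"
proof -
  let ?m = "\<lambda>k l r v. W v $ k * (U v $ l * U v $ r)"
  have n: "2 \<in> S" "3 \<in> S" using assms(1) by (auto intro: csubring_numeral)
  have c: "{3 * a, 2 * b, 2 * c, 2 * d, 2 * f, 3 * g, 2 * h, 2 * i, 3 * j} \<subseteq> S"
    using assms(2) n csubringD(3)[OF assms(1)] by auto
  have "hp S (m + (n + n)) (\<lambda>v. (3 * a) * ?m 1 1 1 v + (2 * b) * ?m 1 1 2 v + (2 * c) * ?m 1 1 3 v + d * ?m 1 2 2 v + e * ?m 1 2 3 v + f * ?m 1 3 3 v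
      + b * ?m 2 1 1 v + (2 * d) * ?m 2 1 2 v + e * ?m 2 1 3 v + (3 * g) * ?m 2 2 2 v + (2 * h) * ?m 2 2 3 v + i * ?m 2 3 3 v
      + c * ?m 3 1 1 v + e * ?m 3 1 2 v + (2 * f) * ?m 3 1 3 v + h * ?m 3 2 2 v + (2 * i) * ?m 3 2 3 v + (3 * j) * ?m 3 3 3 v)"
    using assms(2) c by (intro hp.hp_add hp_smult hp_mult assms(1,3,4)) auto
  then show ?thesis unfolding polcub_def
    by (rule back_subst[where P = "hp S (m + (n + n))"])
      (simp add: fun_eq_iff algebra_simps power2_eq_square)
qed

locale cusp_pencil =
  fixes t c0 c1 c2 c3 b1 b2 a0 a1 :: "'k::{field,finite} alg_closure"
  assumes good: "good t" and coeffs: "{c0, c1, c2, c3, b1, b2, a0, a1} \<subseteq> range to_ac"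
    and Dcpt: "\<And>x. cubf c0 c1 0 c2 b1 a0 c3 b2 a1 1 (cpt x) = poly (P9 t) x"
begin

abbreviation D :: "'k alg_closure ^ 3 \<Rightarrow> 'k alg_closure" where
  "D \<equiv> cubf c0 c1 0 c2 b1 a0 c3 b2 a1 1"

abbreviation polD :: "'k alg_closure ^ 3 \<Rightarrow> 'k alg_closure ^ 3 \<Rightarrow> 'k alg_closure" where
  "polD \<equiv> polcub c0 c1 0 c2 b1 a0 c3 b2 a1 1"

abbreviation s where "s \<equiv> sn t"

lemma deg8: "deg8 t" and t8: "cj t 8 = t" and tr: "3 * tr8 t + 8 \<noteq> 0"
  using good by (auto simp: good_def deg8_def)

lemma s_rational: "s \<in> range to_ac"
  by (rule sn_rational[OF t8])

text \<open>By the collinearity rule a flex of the cuspidal cubic has parameter with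
  \<open>3 s = - 1\<close>. With \<open>s = - tr8 t - 3\<close> this is the excluded trace
  condition, so the ninth base point is not a flex.\<close>

lemma s_flex: "3 * s + 1 \<noteq> 0"
proof
  assume "3 * s + 1 = 0"
  then have "3 * tr8 t + 8 = 0" unfolding sn_def by (simp add: algebra_simps)
  then show False using tr by simp
qed

text \<open>The parameters are chosen so that \<open>Fp (D v) (Cf v)\<close> is the member through
  \<open>v\<close>; the cuspidal cubic is \<open>Fp 1 0\<close>.\<close>

definition Fp :: "'k alg_closure \<Rightarrow> 'k alg_closure \<Rightarrow> 'k alg_closure ^ 3 \<Rightarrow> 'k alg_closure" where
  "Fp r m v = r * Cf v - m * D v"

definition pF :: "'k alg_closure \<Rightarrow> 'k alg_closure \<Rightarrow> 'k alg_closure ^ 3 \<Rightarrow> 'k alg_closure ^ 3 \<Rightarrow> 'k alg_closure" where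
  "pF r m u w = r * polC u w - m * polD u w"

lemma Fp_expand: "Fp r m (x *s u + y *s w) = x ^ 3 * Fp r m u + x ^ 2 * y * pF r m u w + x * y ^ 2 * pF r m w u + y ^ 3 * Fp r m w"
  unfolding Fp_def pF_def Cf_cubf polC_polcub cubf_expand2 by (simp add: algebra_simps)

lemma pF_add: "pF r m u (x *s v + y *s w) = x * pF r m u v + y * pF r m u w"
  unfolding pF_def polC_polcub polcub_add by (simp add: algebra_simps)

lemma pF_scale: "pF r m (x *s u) w = x ^ 2 * pF r m u w"
  unfolding pF_def polC_polcub polcub_scale by (simp add: algebra_simps)

lemma pF_scale2: "pF r m u (x *s w) = x * pF r m u w"
  using pF_add[of r m u x w 0 w] by simp

lemma pF_first: "pF r m (x *s u + y *s w) w = x ^ 2 * pF r m u w + 2 * x * y * pF r m w u + 3 * y ^ 2 * Fp r m w"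
  unfolding Fp_def pF_def Cf_cubf polC_polcub polcub_first by (simp add: algebra_simps)

lemma pF_self: "pF r m u u = 3 * Fp r m u"
  unfolding Fp_def pF_def Cf_cubf polC_polcub polcub_self by (simp add: algebra_simps)

lemma Fp_hom: "Fp (k * r) (k * m) v = k * Fp r m v" "pF (k * r) (k * m) u w = k * pF r m u w"
  by (simp_all add: Fp_def pF_def algebra_simps)

lemma Fp_cpt: "Fp r m (cpt x) = - m * poly (P9 t) x"
  by (simp add: Fp_def Dcpt)

lemma hp_Fp: "hp UNIV 3 (Fp r m)"
proof -
  have D: "hp UNIV 3 D" by (rule hp_cubf_3) auto
  have "hp UNIV 3 (\<lambda>v. r * Cf v - m * D v)"
    by (intro hp_diff hp_smult hp_Cf D) auto
  then show ?thesis by (simp add: Fp_def[abs_def])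
qed

lemma Fp_cases:
  obtains F where "form 3 F" "\<And>v. insertion id v F = Fp r m v" "\<And>u w. polar F u w = pF r m u w"
proof -
  obtain F where F: "form 3 F" "\<And>v. insertion id v F = Fp r m v" by (rule hp_UNIV_form[OF hp_Fp], rule that)
  have "polar F u w = pF r m u w" for u w
  proof (rule polar_unique(2)[OF F(1), symmetric])
    show "insertion id (u + x *s w) F = Fp r m u + x * pF r m u w + x ^ 2 * pF r m w u + x ^ 3 * Fp r m w" for x
      using Fp_expand[of r m 1 u x w] by (simp add: F(2))
  qed
  then show ?thesis using that F by blast
qed

lemma P9_nonroot: "\<exists>x. poly (P9 t) x \<noteq> 0"
proof (rule ccontr)
  assume "\<not> (\<exists>x. poly (P9 t) x \<noteq> 0)"
  then have "P9 t = 0" by (intro poly_zero_alg_closed) blast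
  then show False using P9_coeffs(1)[OF deg8] by simp
qed

lemma Fp_nonzero:
  assumes "r \<noteq> 0 \<or> m \<noteq> 0"
  shows "\<exists>v. Fp r m v \<noteq> 0"
proof (cases "m = 0")
  case True
  then have "Fp r m (axis 2 1) \<noteq> 0" using assms by (simp add: Fp_def Cf_def axis_def)
  then show ?thesis by blast
next
  case False
  then show ?thesis using P9_nonroot Fp_cpt[of r m] by (metis minus_mult_left mult_eq_0_iff neg_equal_0_iff_equal)
qed

lemma orb_proj: "orb t \<subseteq> proj_plane"
  by (auto simp: orb_def)

lemma Fp_through:
  assumes "form 3 F" "\<And>v. insertion id v F = Fp r m v" "r \<noteq> 0 \<or> m \<noteq> 0"
  shows "F \<in> cubics_through (orb t)"
proof -
  have "F \<noteq> 0" using Fp_nonzero[OF assms(3)] by (simp add: tpoly_nonzero_iff assms(2))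
  moreover have "vanishes_at F x" if x: "x \<in> orb t" for x
  proof -
    obtain i where i: "i < 8" "x = proj_class (cpt (cj t i))" by (rule orb_cases[OF x])
    have "poly (P9 t) (cj t i) = 0" using i(1) by (auto simp: P9_root_iff)
    then have "Fp r m (cpt (cj t i)) = 0" by (simp add: Fp_cpt)
    then show ?thesis unfolding i(2) vanishes_at_class[OF assms(1) cpt_nonzero] assms(2) .
  qed
  ultimately show ?thesis using assms(1) by (simp add: cubics_through_def)
qed

lemma Fp_line_free:
  assumes "form 3 F" "\<And>v. insertion id v F = Fp r m v" "r \<noteq> 0 \<or> m \<noteq> 0"
  shows "line_free F"
  by (rule general_line_free[OF general_points_orb[OF good] orb_proj card_orb[OF deg8] Fp_through[OF assms]])

lemma cubics_through_orb:
  assumes "F \<in> cubics_through (orb t)"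
  obtains r m where "r \<noteq> 0 \<or> m \<noteq> 0" "\<And>v. insertion id v F = Fp r m v"
proof -
  have F: "form 3 F" "F \<noteq> 0" "\<And>x. x \<in> orb t \<Longrightarrow> vanishes_at F x" using assms by (auto simp: cubics_through_def)
  obtain a b c d e f g h i j where f: "\<And>v. insertion id v F = cubf a b c d e f g h i j v"
    by (rule hp_3E[OF hp_insertion_UNIV[OF F(1)]], rule that)
  have z: "cubf a b c d e f g h i j (cpt (cj t n)) = 0" if "n < 8" for n
  proof -
    have "vanishes_at F (proj_class (cpt (cj t n)))" using that by (intro F(3)) (auto simp: orb_def)
    then show ?thesis unfolding f[symmetric] vanishes_at_class[OF F(1) cpt_nonzero] .
  qed
  define Q where "Q = [:a, b, c + d, c + e + g, e + f + h, 2 * f + h + i, f + 2 * i + j, i + 3 * j, 3 * j, j:]"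
  have R: "Q = smult j (P9 t)" unfolding Q_def by (rule cubic_through_orbit[OF deg8 z])
  have cpt: "insertion id (cpt x) F = j * D (cpt x)" for x
    unfolding f cubf_cpt[of a] Q_def[symmetric] R Dcpt by simp
  have h: "hp UNIV 3 (\<lambda>v. insertion id v F - j * D v)"
  proof -
    have "hp UNIV 3 D" by (rule hp_cubf_3) auto
    then show ?thesis by (intro hp_diff hp_smult hp_insertion_UNIV F(1)) auto
  qed
  obtain k where k: "\<And>v. insertion id v F - j * D v = k * Cf v"
    by (rule cubic_vanishing_on_cusp[OF h], simp add: cpt, rule that)
  have e: "insertion id v F = Fp k (- j) v" for v using k[of v] by (simp add: Fp_def algebra_simps)
  moreover have "k \<noteq> 0 \<or> - j \<noteq> 0"
  proof (rule ccontr)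
    assume "\<not> ?thesis"
    then have "insertion id v F = 0" for v unfolding e by (simp add: Fp_def)
    then show False using F(2) by (simp add: tpoly_nonzero_iff)
  qed
  ultimately show ?thesis using that by blast
qed

lemma base_locus_orb: "base_locus (orb t) = insert (proj_class (cpt s)) (orb t)"
proof (intro equalityI subsetI)
  fix x assume "x \<in> base_locus (orb t)"
  then have x: "x \<in> proj_plane" "\<And>F. F \<in> cubics_through (orb t) \<Longrightarrow> vanishes_at F x" by (auto simp: base_locus_def)
  obtain v where v: "v \<noteq> 0" "x = proj_class v" by (rule proj_plane_cases[OF x(1)])
  have van: "Fp r m v = 0" if "r \<noteq> 0 \<or> m \<noteq> 0" for r m
  proof -
    obtain F where F: "form 3 F" "\<And>v. insertion id v F = Fp r m v" by (rule Fp_cases, rule that)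
    from x(2)[OF Fp_through[OF F that]] show ?thesis unfolding v(2) vanishes_at_class[OF F(1) v(1)] F(2) .
  qed
  have C: "Cf v = 0" and D: "D v = 0" using van[of 1 0] van[of 0 "- 1"] by (simp_all add: Fp_def)
  \<comment> \<open>The only point of the cuspidal cubic with first coordinate 0 is the cusp
    \<open>(0, 0, 1)\<close>, where \<open>D\<close> takes the value 1, its coefficient at
    \<open>z^3\<close>.\<close>
  have v1: "v $ 1 \<noteq> 0"
  proof
    assume v1: "v $ 1 = 0"
    then have "v $ 2 = 0" using C by (simp add: Cf_def)
    then have "v $ 3 = 0" using D v1 by (simp add: cubf_def quad_def)
    then show False using v(1) v1 \<open>v $ 2 = 0\<close> by (simp add: vec3_eq)
  qed
  define y where "y = v $ 2 / v $ 1"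
  have vy: "v = v $ 1 *s cpt y"
  proof -
    have "v $ 3 * v $ 1 ^ 2 = v $ 2 ^ 3 + v $ 2 ^ 2 * v $ 1" using C by (simp add: Cf_def algebra_simps)
    then have "v $ 3 = (v $ 2 ^ 3 + v $ 2 ^ 2 * v $ 1) / v $ 1 ^ 2" using v1 by (simp add: eq_divide_eq)
    also have "\<dots> = v $ 1 * cf y" using v1 by (simp add: cf_def y_def field_simps power2_eq_square power3_eq_cube)
    finally show ?thesis using v1 by (simp add: vec3_eq y_def)
  qed
  have "D (v $ 1 *s cpt y) = 0" using D vy by simp
  then have "D (cpt y) = 0" using cubf_expand2[of c0 c1 0 c2 b1 a0 c3 b2 a1 1 "v $ 1" "cpt y" 0 0] v1 by simp
  then have "poly (P9 t) y = 0" by (simp add: Dcpt)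
  moreover have "x = proj_class (cpt y)" unfolding v(2) by (subst vy) (rule proj_class_smult[OF v1])
  ultimately show "x \<in> insert (proj_class (cpt s)) (orb t)" by (auto simp: P9_root_iff orb_def)
next
  fix x assume "x \<in> insert (proj_class (cpt s)) (orb t)"
  then obtain y where y: "x = proj_class (cpt y)" "poly (P9 t) y = 0" by (auto simp: P9_root_iff orb_def)
  have "vanishes_at F x" if F: "F \<in> cubics_through (orb t)" for F
  proof -
    have F3: "form 3 F" using F by (simp add: cubics_through_def)
    obtain r m where "\<And>v. insertion id v F = Fp r m v" by (rule cubics_through_orb[OF F], rule that)
    then show ?thesis unfolding y(1) vanishes_at_class[OF F3 cpt_nonzero] by (simp add: Fp_cpt y(2))
  qed
  then show "x \<in> base_locus (orb t)" using y(1) by (simp add: base_locus_def)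
qed

lemma s_point_rational: "proj_class (cpt s) \<in> rational_points"
proof -
  obtain a where a: "s = to_ac a" using s_rational by blast
  have "cpt s = (\<chi> i. to_ac (cpt a $ i))" by (simp add: vec3_eq cf_def a)
  then show ?thesis unfolding rational_points_def
    by (intro CollectI exI[of _ "cpt a"]) simp
qed

end

subsection \<open>The Bertini map of the pencil\<close>

lemma axis3_simps [simp]: "axis 3 (x :: 'a::zero) $ (1 :: 3) = 0" "axis 3 x $ (2 :: 3) = 0" "axis 3 x $ (3 :: 3) = x"
  by (auto simp: axis_def)

lemma polC_cpt: "polC (cpt x) (ctan x) = 0" "polC (cpt x) (axis 3 1) = 1"
  by (simp_all add: polC_def cf_def algebra_simps power2_eq_square power3_eq_cube)

text \<open>The double zero at \<open>y = x\<close> reflects tangency; the remaining zero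
  \<open>- 2 x - 1\<close> is the third point on the tangent at parameter \<open>x\<close>.\<close>

lemma polC_cpt_cpt: "polC (cpt x) (cpt y) = (y - x) ^ 2 * (y + 2 * x + 1)"
  by (simp add: polC_def cf_def algebra_simps power2_eq_square power3_eq_cube)

lemma polC_scale: "polC (x *s u) w = x ^ 2 * polC u w" "polC u (x *s w) = x * polC u w"
  by (simp_all add: polC_def algebra_simps power2_eq_square)

lemma Cf_scale: "Cf (x *s u) = x ^ 3 * Cf u"
  by (simp add: Cf_def algebra_simps power2_eq_square power3_eq_cube)

lemma cpt_of_Cf:
  assumes "Cf v = 0" "v $ 1 \<noteq> 0"
  shows "v = v $ 1 *s cpt (v $ 2 / v $ 1)"
proof -
  have "v $ 3 * v $ 1 ^ 2 = v $ 2 ^ 3 + v $ 2 ^ 2 * v $ 1" using assms(1) by (simp add: Cf_def algebra_simps)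
  then have "v $ 3 = (v $ 2 ^ 3 + v $ 2 ^ 2 * v $ 1) / v $ 1 ^ 2" using assms(2) by (simp add: eq_divide_eq)
  also have "\<dots> = v $ 1 * cf (v $ 2 / v $ 1)" using assms(2) by (simp add: cf_def field_simps power2_eq_square power3_eq_cube)
  finally show ?thesis using assms(2) by (simp add: vec3_eq)
qed

context cusp_pencil
begin

lemma D_poly: "[:c0, c1, 0 + c2, 0 + b1 + c3, b1 + a0 + b2, 2 * a0 + b2 + a1, a0 + 2 * a1 + 1, a1 + 3 * 1, 3 * 1, 1:] = P9 t"
  (is "?Q = _")
proof -
  have "poly (?Q - P9 t) x = 0" for x
    using Dcpt[of x] unfolding cubf_cpt poly_diff by simp
  from poly_zero_alg_closed[OF this] show ?thesis by simp
qed

lemma polD_cpt: "polD (cpt x) (ctan x) = poly (pderiv (P9 t)) x"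
  unfolding polcub_cpt_ctan D_poly ..

lemma polD_conj_nonzero: "poly (P9 t) x = 0 \<Longrightarrow> polD (cpt x) (ctan x) \<noteq> 0"
  unfolding polD_cpt by (rule P9_simple[OF deg8])

text \<open>\<open>dl\<close> and \<open>pr\<close> are the derivatives of \<open>D\<close> at the
  ninth base point along the third axis and along the cuspidal cubic; \<open>pr\<close> is the
  derivative of \<open>P9 t\<close> at \<open>s\<close>, hence nonzero.\<close>

definition dl where "dl = polD (cpt s) (axis 3 1)"
definition pr where "pr = polD (cpt s) (ctan s)"

lemma pr_nonzero: "pr \<noteq> 0"
  unfolding pr_def by (rule polD_conj_nonzero) (simp add: P9_root_iff)

text \<open>\<open>tv r m\<close> spans, together with the base point \<open>cpt s\<close>, the tangent at \<open>cpt s\<close> to the member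
  \<open>Fp r m\<close> of the pencil, and \<open>T r m\<close> is the third intersection point of that tangent.\<close>

definition tv where "tv r m = (r - m * dl) *s ctan s + (m * pr) *s axis 3 1"
definition al where "al r m = pF r m (tv r m) (cpt s)"
definition be where "be r m = Fp r m (tv r m)"
definition T where "T r m = be r m *s cpt s - al r m *s tv r m"

lemma Fp_s: "Fp r m (cpt s) = 0"
  by (simp add: Fp_cpt P9_root_iff)

lemma pF_s_tv: "pF r m (cpt s) (tv r m) = 0"
  unfolding tv_def pF_add unfolding pF_def polC_cpt dl_def[symmetric] pr_def[symmetric] by (simp add: algebra_simps)

lemma tv_1: "tv r m $ 1 = 0"
  by (simp add: tv_def)

lemma tv_nonzero: "r \<noteq> 0 \<or> m \<noteq> 0 \<Longrightarrow> tv r m \<noteq> 0"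
proof
  assume rm: "r \<noteq> 0 \<or> m \<noteq> 0" and "tv r m = 0"
  then have "tv r m $ 2 = 0" "tv r m $ 3 = 0" by simp_all
  then have "r - m * dl = 0" "m * pr = 0" by (simp_all add: tv_def)
  then show False using rm pr_nonzero by auto
qed

lemma tv_not_par: "r \<noteq> 0 \<or> m \<noteq> 0 \<Longrightarrow> \<not> par (cpt s) (tv r m)"
proof
  assume rm: "r \<noteq> 0 \<or> m \<noteq> 0" and "par (cpt s) (tv r m)"
  then obtain c where c: "tv r m = c *s cpt s" using parE cpt_nonzero by blast
  have "tv r m $ 1 = c * cpt s $ 1" by (simp only: c vector_smult_component)
  then have "c = 0" by (simp add: tv_1)
  then show False using c tv_nonzero[OF rm] by simp
qed

lemma al_be: "r \<noteq> 0 \<or> m \<noteq> 0 \<Longrightarrow> al r m \<noteq> 0 \<or> be r m \<noteq> 0"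
proof -
  assume rm: "r \<noteq> 0 \<or> m \<noteq> 0"
  obtain F where F: "form 3 F" "\<And>v. insertion id v F = Fp r m v" "\<And>u w. polar F u w = pF r m u w"
    by (rule Fp_cases, rule that)
  show ?thesis
    using line_freeD[OF F(1) Fp_line_free[OF F(1,2) rm] tv_not_par[OF rm]]
    unfolding F(2,3) al_def be_def by (auto simp: Fp_s pF_s_tv)
qed

text \<open>The member and its first derivative along the tangent vanish at \<open>cpt s\<close>,
  which leaves a linear factor with zero \<open>(be, - al)\<close>; this is the formula for
  \<open>T\<close>.\<close>

lemma Fp_line: "Fp r m (x *s cpt s + y *s tv r m) = y ^ 2 * (al r m * x + be r m * y)"
  unfolding Fp_expand Fp_s pF_s_tv al_def[symmetric] be_def[symmetric]
  by (simp add: algebra_simps power2_eq_square power3_eq_cube)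

lemma T_eq: "T r m = be r m *s cpt s + (- al r m) *s tv r m"
  by (simp add: T_def)

lemma Fp_T: "Fp r m (T r m) = 0"
  unfolding T_eq Fp_line by (simp add: algebra_simps)

lemma T_nonzero: "r \<noteq> 0 \<or> m \<noteq> 0 \<Longrightarrow> T r m \<noteq> 0"
proof
  assume rm: "r \<noteq> 0 \<or> m \<noteq> 0" and T: "T r m = 0"
  then have "T r m $ 1 = 0" by simp
  then have be: "be r m = 0" by (simp add: T_def tv_1)
  then have "al r m \<noteq> 0" using al_be[OF rm] by simp
  then show False using T be tv_nonzero[OF rm] by (simp add: T_def vector_mul_eq_0)
qed

lemma tv_hom: "tv (k * r) (k * m) = k *s tv r m"
  by (simp add: tv_def vec3_eq algebra_simps)

lemma Fp_scale: "Fp r m (x *s u) = x ^ 3 * Fp r m u"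
  using Fp_expand[of r m x u 0 u] by simp

lemma al_hom: "al (k * r) (k * m) = k ^ 3 * al r m"
  unfolding al_def tv_hom pF_scale Fp_hom by (simp add: power2_eq_square power3_eq_cube)

lemma be_hom: "be (k * r) (k * m) = k ^ 4 * be r m"
  unfolding be_def tv_hom Fp_scale Fp_hom by (simp add: power_numeral_reduce)

lemma T_hom: "T (k * r) (k * m) = k ^ 4 *s T r m"
  unfolding T_def tv_hom al_hom be_hom by (simp add: vec_eq_iff algebra_simps power_numeral_reduce)

text \<open>On the points \<open>x v + y Tx v\<close> the member through \<open>v\<close> restricts
  to \<open>x y (x bM + y bA)\<close>, so the third intersection has coordinates
  \<open>(bA, - bM)\<close>; it is \<open>B v\<close>.\<close>

definition Tx where "Tx v = T (D v) (Cf v)"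
definition bA where "bA v = pF (D v) (Cf v) (Tx v) v"
definition bM where "bM v = pF (D v) (Cf v) v (Tx v)"
definition B where "B v = bA v *s v - bM v *s Tx v"

lemma Fp_x: "Fp (D v) (Cf v) v = 0"
  by (simp add: Fp_def)

lemma B_eq: "B v = bA v *s v + (- bM v) *s Tx v"
  by (simp add: B_def)

lemma Fp_B: "Fp (D v) (Cf v) (B v) = 0"
  unfolding B_eq Fp_expand Fp_x bA_def[symmetric] bM_def[symmetric]
  using Fp_T[of "D v" "Cf v"] by (simp add: Tx_def[symmetric] algebra_simps power2_eq_square)

text \<open>\<open>B v\<close> lies on the member through \<open>v\<close>, so both pencil
  parameters are multiplied by one factor \<open>k\<close> and \<open>Tx\<close> by
  \<open>k^4\<close>. On the line through \<open>v\<close> and \<open>Tx v\<close> the polar forms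
  at \<open>B v\<close> are then explicit, and the third intersection is \<open>v\<close>
  again.\<close>

lemma B_B:
  assumes "D v \<noteq> 0 \<or> Cf v \<noteq> 0"
  obtains k where "D (B v) = k * D v" "Cf (B v) = k * Cf v" "B (B v) = (k ^ 9 * bA v ^ 3) *s v"
proof -
  define r m where "r = D v" and "m = Cf v"
  have rm: "r \<noteq> 0 \<or> m \<noteq> 0" using assms by (simp add: r_def m_def)
  have F: "r * Cf (B v) = m * D (B v)" using Fp_B[of v] by (simp add: Fp_def r_def m_def)
  define k where "k = (if r = 0 then Cf (B v) / m else D (B v) / r)"
  have k: "D (B v) = k * r" "Cf (B v) = k * m"
    using F rm by (auto simp: k_def field_simps)
  have Ty: "Tx (B v) = k ^ 4 *s Tx v" unfolding Tx_def k T_hom by (simp add: r_def m_def)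
  define A M where "A = bA v" and "M = bM v"
  have B: "B v = A *s v + (- M) *s Tx v" by (simp add: B_eq A_def M_def)
  have FT: "Fp r m (Tx v) = 0" using Fp_T by (simp add: Tx_def r_def m_def)
  have PTx: "pF r m (Tx v) v = A" and PxT: "pF r m v (Tx v) = M" by (simp_all add: A_def M_def bA_def bM_def r_def m_def)
  have "pF r m (Tx v) (B v) = A ^ 2"
    unfolding B pF_add pF_self FT PTx by (simp add: power2_eq_square)
  then have A': "bA (B v) = k ^ 9 * A ^ 2"
    unfolding bA_def k Ty pF_scale Fp_hom by (simp add: power_numeral_reduce)
  have "pF r m (B v) (Tx v) = - (A ^ 2 * M)"
    unfolding B pF_first FT PTx PxT by (simp add: algebra_simps power2_eq_square)
  then have M': "bM (B v) = - (k ^ 5 * A ^ 2 * M)"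
    unfolding bM_def k Ty pF_scale2 Fp_hom by (simp add: power_numeral_reduce)
  have "B (B v) = (k ^ 9 * A ^ 3) *s v"
    unfolding B_def[of "B v"] A' M' Ty unfolding B by (simp add: vec_eq_iff algebra_simps power_numeral_reduce)
  then show ?thesis using that[of k] k by (simp add: r_def m_def A_def)
qed

lemma B_degenerate: "D v = 0 \<Longrightarrow> Cf v = 0 \<Longrightarrow> B v = 0"
  by (simp add: B_def bA_def bM_def pF_def)

lemma par_B_B: "par (B (B v)) v"
proof (cases "D v \<noteq> 0 \<or> Cf v \<noteq> 0")
  case True
  then obtain c where "B (B v) = c *s v" using B_B by metis
  then show ?thesis by simp
next
  case False
  then have "B v = 0" using B_degenerate by simp
  moreover have "Cf (0 :: 'k alg_closure ^ 3) = 0" by (simp add: Cf_def)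
  moreover have "D 0 = 0" by (simp add: cubf_def quad_def)
  ultimately have "B (B v) = 0" using B_degenerate by simp
  then show ?thesis by simp
qed

text \<open>For \<open>m = 0\<close> the member is the cuspidal cubic, whose tangent at parameter
  \<open>s\<close> meets it again at \<open>- 2 s - 1\<close>.\<close>

lemma T_r0: "T r 0 = (- (r ^ 4)) *s cpt (- 2 * s - 1)"
proof -
  have tv: "tv r 0 = r *s ctan s" by (simp add: tv_def)
  have al: "al r 0 = - (r ^ 3) * (3 * s + 1)"
    unfolding al_def tv pF_scale by (simp add: pF_def polC_def power_numeral_reduce algebra_simps)
  have be: "be r 0 = - (r ^ 4)"
    unfolding be_def tv Fp_scale by (simp add: Fp_def Cf_def power_numeral_reduce)
  show ?thesis unfolding T_def tv al be
    by (simp add: vec3_eq cf_def algebra_simps power_numeral_reduce)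
qed

text \<open>This is the coefficient of \<open>e^3\<close> in \<open>al e 1\<close>; it is nonzero
  because the ninth base point is not a flex.\<close>

lemma al_r0: "al 1 0 \<noteq> 0"
proof -
  have tv: "tv 1 0 = ctan s" by (simp add: tv_def)
  have "al 1 0 = - (3 * s + 1)" unfolding al_def tv by (simp add: pF_def polC_def algebra_simps)
  then show ?thesis using s_flex by (simp only: neg_equal_0_iff_equal not_False_eq_True)
qed

text \<open>On the cuspidal cubic all is explicit: with \<open>y = - 2 s - 1\<close> the involution
  takes the parameter \<open>x\<close> to \<open>- x - y - 1\<close>, the third point on the line
  through \<open>x\<close> and \<open>y\<close>.\<close>

lemma B_B_nonzero: "\<exists>v. B (B v) \<noteq> 0"
proof -
  define y where "y = - 2 * s - 1"
  \<comment> \<open>Excluded are the base parameters, the further zeros \<open>y\<close> and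
    \<open>- 2 y - 1\<close> of \<open>bA\<close> on the curve, and the parameters sent to base
    parameters.\<close>
  define Z where "Z = {x. poly (P9 t) x = 0} \<union> {y, - 2 * y - 1} \<union> (\<lambda>z. - z - y - 1) ` {x. poly (P9 t) x = 0}"
  have "P9 t \<noteq> 0" using P9_coeffs(1)[OF deg8] by auto
  then have "finite Z" unfolding Z_def using poly_roots_finite by blast
  then have "\<exists>x. x \<notin> Z" using infinite_alg_closed[where 'a = "'k alg_closure"] ex_new_if_finite by blast
  then obtain x where "x \<notin> Z" by blast
  then have x: "poly (P9 t) x \<noteq> 0" "x \<noteq> y" "x \<noteq> - 2 * y - 1" "poly (P9 t) (- x - y - 1) \<noteq> 0"
    unfolding Z_def by (auto simp: image_iff algebra_simps)
  define r where "r = poly (P9 t) x"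
  have Tc: "Tx (cpt x) = (- (r ^ 4)) *s cpt y"
    unfolding Tx_def Dcpt Cf_cpt T_r0 by (simp add: r_def y_def)
  have A: "bA (cpt x) = r ^ 9 * ((x - y) ^ 2 * (x + 2 * y + 1))"
    unfolding bA_def Tc Dcpt Cf_cpt pF_def polC_scale polC_cpt_cpt by (simp add: r_def power_numeral_reduce)
  have M: "bM (cpt x) = - (r ^ 5) * ((x - y) ^ 2 * (y + 2 * x + 1))"
    unfolding bM_def Tc Dcpt Cf_cpt pF_def polC_scale polC_cpt_cpt by (simp add: r_def power_numeral_reduce power2_commute algebra_simps)
  have A0: "bA (cpt x) \<noteq> 0"
  proof -
    have "x + 2 * y + 1 \<noteq> 0"
    proof
      assume e: "x + 2 * y + 1 = 0"
      have "x = (x + 2 * y + 1) - 2 * y - 1" by simp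
      also have "\<dots> = - 2 * y - 1" unfolding e by simp
      finally show False using x(3) by blast
    qed
    then show ?thesis unfolding A using x(1,2) by (simp add: r_def)
  qed
  have Bv: "B (cpt x) = (r ^ 9 * (x - y) ^ 2) *s ((x + 2 * y + 1) *s cpt x - (y + 2 * x + 1) *s cpt y)"
    unfolding B_def A M Tc by (simp add: vec_eq_iff algebra_simps power_numeral_reduce)
  have B1: "B (cpt x) $ 1 = r ^ 9 * (x - y) ^ 2 * (y - x)"
    unfolding Bv by (simp add: algebra_simps)
  have B2: "B (cpt x) $ 2 = r ^ 9 * (x - y) ^ 2 * (y - x) * (- x - y - 1)"
    unfolding Bv by (simp add: algebra_simps)
  have nz: "B (cpt x) $ 1 \<noteq> 0" unfolding B1 using x(1,2) by (auto simp: r_def)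
  have "D (cpt x) \<noteq> 0 \<or> Cf (cpt x) \<noteq> 0" using x(1) by (simp add: Dcpt)
  then obtain k where k: "D (B (cpt x)) = k * D (cpt x)" "Cf (B (cpt x)) = k * Cf (cpt x)"
    "B (B (cpt x)) = (k ^ 9 * bA (cpt x) ^ 3) *s cpt x" by (rule B_B)
  have "Cf (B (cpt x)) = 0" using k(2) by simp
  from cpt_of_Cf[OF this nz] have e: "B (cpt x) = B (cpt x) $ 1 *s cpt (- x - y - 1)"
    using nz unfolding B2 B1 by simp
  have "D (B (cpt x)) = (B (cpt x) $ 1) ^ 3 * poly (P9 t) (- x - y - 1)"
    by (subst e, subst Dcpt[symmetric]) (use cubf_expand2[of c0 c1 0 c2 b1 a0 c3 b2 a1 1 "B (cpt x) $ 1" "cpt (- x - y - 1)" 0 0] in simp)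
  then have "k \<noteq> 0" using k(1) nz x(4) by auto
  then have "B (B (cpt x)) \<noteq> 0" unfolding k(3) using A0 by (simp add: vector_mul_eq_0)
  then show ?thesis by blast
qed

lemma hp_D: "hp (range to_ac) 3 D"
proof (rule hp_cubf_3[OF csubring_to_ac])
  show "{c0, c1, 0, c2, b1, a0, c3, b2, a1, 1} \<subseteq> range to_ac"
    using coeffs csubringD(1,2)[OF csubring_to_ac] by auto
qed

text \<open>\<open>D v\<close> and \<open>Cf v\<close> are cubic and \<open>T\<close> is quartic in
  them, so \<open>Tx\<close> has degree 12; the polar forms then have degree 17 for
  \<open>bM\<close> and 28 for \<open>bA\<close>. Coefficients are rational because \<open>s\<close>
  is.\<close>

lemma hp_Tx: "hp (range to_ac) 12 (\<lambda>v. Tx v $ i)"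
  and hp_bM: "hp (range to_ac) 17 bM"
  and hp_B: "hp (range to_ac) 29 (\<lambda>v. B v $ i)"
proof -
  let ?S = "range (to_ac :: 'k \<Rightarrow> _)"
  note S = csubring_to_ac
  have Dc: "{c0, c1, 0, c2, b1, a0, c3, b2, a1, 1} \<subseteq> ?S"
    using coeffs csubringD(1,2)[OF S] by auto
  have m1: "- 1 \<in> ?S" using csubringD(2,5)[OF S] by blast
  then have Cc: "{0, 0, 1, - 1, 0, 0, - 1, 0, 0, 0} \<subseteq> ?S" using csubringD(1,2)[OF S] by auto
  have sS: "cpt s $ k \<in> ?S" "ctan s $ k \<in> ?S" "axis 3 1 $ k \<in> ?S" for k :: 3
  proof -
    have "cf s \<in> ?S" "3 * s ^ 2 + 2 * s \<in> ?S"
      unfolding cf_def by (intro csubringD(3,6) csubring_power csubring_numeral s_rational S)+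
    then show "cpt s $ k \<in> ?S" "ctan s $ k \<in> ?S" "axis 3 1 $ k \<in> ?S"
      using exhaust_3[of k] s_rational csubringD(1,2)[OF S] by auto
  qed
  have polS: "polD u w \<in> ?S" if "\<And>k. u $ k \<in> ?S" "\<And>k. w $ k \<in> ?S" for u w
  proof -
    have h: "hp ?S (0 + (0 + 0)) (\<lambda>v :: 'k alg_closure ^ 3. polD u w)"
      by (rule hp_polcub[OF S Dc hp_const[OF that(1)] hp_const[OF that(2)]])
    show ?thesis using hp_0_in[OF h S] by simp
  qed
  have dp: "dl \<in> ?S" "pr \<in> ?S" unfolding dl_def pr_def by (intro polS sS)+
  have cs: "hp ?S 0 (\<lambda>v. cpt s $ k)" for k by (intro hp_const sS)
  have id: "hp ?S 1 (\<lambda>v. v $ k)" for k by (intro hp_component S)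
  have C: "hp ?S 3 Cf" by (intro hp_Cf S)
  note D = hp_D
  have tv: "hp ?S 3 (\<lambda>v. tv (D v) (Cf v) $ k)" for k
  proof -
    have "hp ?S 3 (\<lambda>v. ctan s $ k * (D v - dl * Cf v) + (pr * axis 3 1 $ k) * Cf v)"
      by (intro hp.hp_add hp_diff hp_smult C D S sS dp csubringD(3))
    then show ?thesis by (simp add: tv_def mult_ac)
  qed
  have pF: "hp ?S (3 + (m + (n + n))) (\<lambda>v. pF (D v) (Cf v) (U v) (W v))"
    if "\<And>k. hp ?S n (\<lambda>v. U v $ k)" "\<And>k. hp ?S m (\<lambda>v. W v $ k)" for U W n m
    unfolding pF_def polC_polcub
    by (intro hp_diff hp_mult S C D hp_polcub[OF S Dc that] hp_polcub[OF S Cc that])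
  have al: "hp ?S 9 (\<lambda>v. al (D v) (Cf v))" using pF[OF tv cs] unfolding al_def by simp
  have be: "hp ?S 12 (\<lambda>v. be (D v) (Cf v))"
  proof -
    have "hp ?S (3 + 3 * 3) (\<lambda>v. D v * Cf (tv (D v) (Cf v)) - Cf v * D (tv (D v) (Cf v)))"
      by (intro hp_diff hp_mult S C D hp_comp[OF C tv S] hp_comp[OF D tv S])
    then show ?thesis by (simp add: be_def Fp_def)
  qed
  have T: "hp ?S 12 (\<lambda>v. Tx v $ k)" for k
  proof -
    have "hp ?S 12 (\<lambda>v. cpt s $ k * be (D v) (Cf v))" by (intro hp_smult be sS S)
    moreover have "hp ?S (9 + 3) (\<lambda>v. al (D v) (Cf v) * tv (D v) (Cf v) $ k)" by (intro hp_mult al tv S)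
    ultimately have "hp ?S 12 (\<lambda>v. cpt s $ k * be (D v) (Cf v) - al (D v) (Cf v) * tv (D v) (Cf v) $ k)"
      using S by (intro hp_diff) auto
    then show ?thesis by (simp add: Tx_def T_def mult_ac)
  qed
  have A: "hp ?S 28 bA" using pF[OF T id] unfolding bA_def[abs_def] by simp
  have M: "hp ?S 17 bM" using pF[OF id T] unfolding bM_def[abs_def] by simp
  have "hp ?S (28 + 1) (\<lambda>v. bA v * v $ i)" "hp ?S (17 + 12) (\<lambda>v. bM v * Tx v $ i)"
    by (intro hp_mult A M T id S)+
  then have "hp ?S 29 (\<lambda>v. bA v * v $ i - bM v * Tx v $ i)" using S by (intro hp_diff) auto
  then show "hp ?S 29 (\<lambda>v. B v $ i)" by (simp add: B_def)
  show "hp ?S 12 (\<lambda>v. Tx v $ i)" by (rule T)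
  show "hp ?S 17 bM" by (rule M)
qed

text \<open>The triple is its own inverse up to proportionality, so birationality only needs that
  \<open>B (B v)\<close> is not identically zero.\<close>

lemma bertini_triple:
  obtains F :: "'k triple" where "birational F" "F \<in> triples" "\<And>v. ev F v = B v"
proof -
  have "\<exists>G. form 29 G \<and> (\<forall>v. insertion to_ac v G = B v $ i)" for i
    by (rule hp_imp_form[OF hp_B coeff_hom_to_ac])
  then have "\<exists>G. \<forall>i. form 29 (G i) \<and> (\<forall>v. insertion to_ac v (G i) = B v $ i)" by (intro choice) blast
  then obtain G where G: "\<And>i. form 29 (G i)" "\<And>i v. insertion to_ac v (G i) = B v $ i" by blast
  define F where "F = (\<chi> i. G i)"
  have ev: "ev F v = B v" for v by (simp add: ev_def F_def G(2) vec_eq_iff)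
  obtain v where v: "B (B v) \<noteq> 0" using B_B_nonzero by blast
  have "F \<noteq> 0"
  proof
    assume "F = 0"
    then have "ev F (B v) = 0" by (simp add: ev_def vec_eq_iff)
    then show False using v by (simp add: ev)
  qed
  then have F: "F \<in> triples" using G(1) by (auto simp: triples_def F_def)
  have FF: "triple_comp F F \<in> triples" by (rule triple_comp_triples[OF F F, of v]) (simp add: ev v)
  have "(triple_comp F F, triple_id) \<in> ratmap_rel"
    using FF triple_id_triples by (simp add: ratmap_rel_iff ev_comp ev par_B_B)
  then have "birational F" using F unfolding birational_def by blast
  then show ?thesis using that F ev by blast
qed

end

subsection \<open>Smoothness of general members\<close>

text \<open>The resultant of \<open>2 c\<^sup>3 + d c\<^sup>2 - p\<close> and \<open>a c\<^sup>2 + b c + g\<close> in the variable \<open>c\<close>.\<close>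

lemma resultant_zero:
  fixes c :: "'a::field"
  assumes "2 * c ^ 3 + d * c ^ 2 - p = 0" "a * c ^ 2 + b * c + g = 0"
  shows "d ^ 2 * a * g ^ 2 + 2 * d * p * a ^ 2 * g - d * p * a * b ^ 2 - 2 * d * b * g ^ 2 + p ^ 2 * a ^ 3
    - 6 * p * a * b * g + 2 * p * b ^ 3 + 4 * g ^ 3 = 0"
proof -
  have "d ^ 2 * a * g ^ 2 + 2 * d * p * a ^ 2 * g - d * p * a * b ^ 2 - 2 * d * b * g ^ 2 + p ^ 2 * a ^ 3
    - 6 * p * a * b * g + 2 * p * b ^ 3 + 4 * g ^ 3
    = ((d * a ^ 2 * b + 2 * a ^ 2 * g - 2 * a * b ^ 2) * c
        + (- d * a ^ 2 * g + d * a * b ^ 2 - p * a ^ 3 + 4 * a * b * g - 2 * b ^ 3)) * (2 * c ^ 3 + d * c ^ 2 - p)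
    + ((- 2 * d * a * b - 4 * a * g + 4 * b ^ 2) * c ^ 2
        + (2 * d * b ^ 2 - d ^ 2 * a * b + 2 * p * a ^ 2 - 4 * b * g) * c
        + (d ^ 2 * a * g + d * p * a ^ 2 - 2 * d * b * g - 2 * p * a * b + 4 * g ^ 2)) * (a * c ^ 2 + b * c + g)"
    by (simp add: algebra_simps power2_eq_square power3_eq_cube)
  then show ?thesis unfolding assms by simp
qed

lemma double_root_pderiv:
  fixes r q :: "'a::field poly"
  assumes "P = r ^ 2 * q" "poly r z = 0"
  shows "poly P z = 0" "poly (pderiv P) z = 0"
  using assms by (simp_all add: power2_eq_square pderiv_mult)

context cusp_pencil
begin

text \<open>In the coordinates \<open>(x, c)\<close> of the point
  \<open>cpt x + c *s axis 3 1\<close> the cuspidal cubic is the axis \<open>c = 0\<close>, and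
  \<open>D\<close> becomes \<open>P9 + c D1 + c^2 D2 + c^3\<close>.\<close>

definition D1 :: "'k alg_closure poly" where "D1 = [:0, b1, b2 + 2 * a0, 2 * a0 + 2 * a1, 2 * a1 + 3, 6, 3:]"
definition D2 :: "'k alg_closure poly" where "D2 = [:a0, a1, 3, 3:]"

lemma D_shift: "D (cpt x + c *s axis 3 1) = poly (P9 t) x + c * poly D1 x + c ^ 2 * poly D2 x + c ^ 3"
  unfolding cubf_expand Dcpt
  by (simp add: polcub_def cubf_def quad_def D1_def D2_def cf_def algebra_simps power2_eq_square power3_eq_cube)

lemma polD_shift_y: "polD (cpt x + c *s axis 3 1) (axis 3 1) = poly D1 x + 2 * c * poly D2 x + 3 * c ^ 2"
  by (simp add: polcub_def D1_def D2_def cf_def algebra_simps power2_eq_square power3_eq_cube)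

lemma polD_shift_x: "polD (cpt x + c *s axis 3 1) (ctan x)
    = poly (pderiv (P9 t)) x + c * poly (pderiv D1) x + c ^ 2 * poly (pderiv D2) x"
  unfolding D_poly[symmetric]
  by (simp add: polcub_def D1_def D2_def cf_def pderiv_pCons algebra_simps power2_eq_square power3_eq_cube)

text \<open>In these coordinates the member is \<open>r c - D\<close>. Its derivative in
  \<open>c\<close> gives \<open>r\<close>, which is then eliminated from the equation of the curve;
  the derivative in \<open>x\<close> is free of \<open>r\<close>, since \<open>Cf\<close> is just
  \<open>c\<close>.\<close>

lemma singular_affine:
  assumes "Fp r 1 (cpt x + c *s axis 3 1) = 0" "\<And>w. pF r 1 (cpt x + c *s axis 3 1) w = 0"
  shows "r = poly D1 x + 2 * c * poly D2 x + 3 * c ^ 2"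
    "2 * c ^ 3 + poly D2 x * c ^ 2 - poly (P9 t) x = 0"
    "poly (pderiv D2) x * c ^ 2 + poly (pderiv D1) x * c + poly (pderiv (P9 t)) x = 0"
proof -
  have C: "Cf (cpt x + c *s axis 3 1) = c" by (simp add: Cf_def cf_def algebra_simps)
  have Cy: "polC (cpt x + c *s axis 3 1) (axis 3 1) = 1" by (simp add: polC_def)
  have Cx: "polC (cpt x + c *s axis 3 1) (ctan x) = 0"
    by (simp add: polC_def algebra_simps power2_eq_square)
  show r: "r = poly D1 x + 2 * c * poly D2 x + 3 * c ^ 2"
    using assms(2)[of "axis 3 1"] unfolding pF_def Cy polD_shift_y by simp
  have F: "r * c = poly (P9 t) x + c * poly D1 x + c ^ 2 * poly D2 x + c ^ 3"
    using assms(1) unfolding Fp_def C D_shift by simp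
  show "2 * c ^ 3 + poly D2 x * c ^ 2 - poly (P9 t) x = 0"
    using F unfolding r by (simp add: algebra_simps power2_eq_square power3_eq_cube)
  show "poly (pderiv D2) x * c ^ 2 + poly (pderiv D1) x * c + poly (pderiv (P9 t)) x = 0"
  proof -
    have "poly (pderiv (P9 t)) x + c * poly (pderiv D1) x + c ^ 2 * poly (pderiv D2) x = 0"
      using assms(2)[of "ctan x"] unfolding pF_def Cx polD_shift_x
      by (simp only: mult_zero_right mult_1_left diff_0 neg_equal_0_iff_equal)
    then show ?thesis by (simp only: ac_simps)
  qed
qed

text \<open>At a root of \<open>P9 t\<close> the resultant of the two equations for \<open>c\<close>
  is the square of the derivative of \<open>P9 t\<close> times this polynomial.\<close>

definition Qp :: "'k alg_closure poly" where
  "Qp = D2 ^ 2 * pderiv D2 - 2 * D2 * pderiv D1 + 4 * pderiv (P9 t)"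

lemma degrees: "degree D2 \<le> 3" "degree D1 \<le> 6"
  unfolding D1_def D2_def by (intro degree_le; auto simp: coeff_pCons split: nat.splits)+

lemma degree_pderiv_le: "degree (pderiv p) \<le> degree p - 1" for p :: "'b::field poly"
  by (intro degree_le allI impI) (simp add: coeff_pderiv coeff_eq_0)

lemma Qp_degree: "degree Qp \<le> 8"
proof -
  have "degree (pderiv D2) \<le> 2" "degree (pderiv D1) \<le> 5" "degree (pderiv (P9 t)) \<le> 8"
    using degrees P9_coeffs(1)[OF deg8] degree_pderiv_le[of D2] degree_pderiv_le[of D1] degree_pderiv_le[of "P9 t"] by auto
  moreover have "degree (D2 ^ 2) \<le> 6" using degree_power_le[of D2 2] degrees by simp
  ultimately have "degree (D2 ^ 2 * pderiv D2) \<le> 8" "degree (2 * D2 * pderiv D1) \<le> 8" "degree (4 * pderiv (P9 t)) \<le> 8"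
    using degree_mult_le[of "D2 ^ 2" "pderiv D2"] degree_mult_le[of "2 * D2" "pderiv D1"] degree_mult_le[of 2 D2]
      degree_mult_le[of 4 "pderiv (P9 t)"] degrees by (auto simp: degree_numeral)
  then show ?thesis unfolding Qp_def by (intro degree_add_le degree_diff_le)
qed

text \<open>The contributions are \<open>81 - 108 + 36\<close>. Since \<open>Qp\<close> has degree
  at most 8, vanishing at all nine base parameters would force 9 = 0.\<close>

lemma Qp_coeff: "coeff Qp 8 = 9"
proof -
  have P: "P9 t = [:c0, c1, 0 + c2, 0 + b1 + c3, b1 + a0 + b2, 2 * a0 + b2 + a1, a0 + 2 * a1 + 1, a1 + 3 * 1, 3 * 1, 1:]"
    by (simp only: D_poly)
  have 1: "coeff (pderiv (P9 t)) 8 = 9" using P9_coeffs(2)[OF deg8] by (simp add: coeff_pderiv)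
  have sq: "D2 ^ 2 = [:a0 ^ 2, 2 * a0 * a1, a1 ^ 2 + 6 * a0, 6 * a0 + 6 * a1, 6 * a1 + 9, 18, 9:]"
    by (simp add: D2_def power2_eq_square algebra_simps)
  have d2: "pderiv D2 = [:a1, 6, 9:]" by (simp add: D2_def pderiv_pCons)
  have d1: "pderiv D1 = [:b1, 2 * (b2 + 2 * a0), 3 * (2 * a0 + 2 * a1), 4 * (2 * a1 + 3), 30, 18:]"
    by (simp add: D1_def pderiv_pCons)
  have 2: "coeff (D2 ^ 2 * pderiv D2) 8 = 81" unfolding sq d2 by (simp add: eval_nat_numeral)
  have 3: "coeff (2 * D2 * pderiv D1) 8 = 108"
  proof -
    have h: "coeff (D2 * pderiv D1) 8 = 54" unfolding D2_def d1 by (simp add: eval_nat_numeral)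
    have "coeff (2 * D2 * pderiv D1) 8 = 2 * coeff (D2 * pderiv D1) 8" by (simp add: mult.assoc numeral_poly)
    also have "\<dots> = 2 * 54" by (simp only: h)
    also have "2 * 54 = (108 :: 'k alg_closure)" by simp
    finally show ?thesis .
  qed
  have 4: "coeff (4 * pderiv (P9 t)) 8 = 36" by (simp add: numeral_poly 1)
  show ?thesis unfolding Qp_def coeff_add coeff_diff 2 3 4 by simp
qed

lemma card_P9_roots: "card {x. poly (P9 t) x = 0} = 9"
  using card_simple_roots[of "P9 t"] P9_simple[OF deg8] P9_coeffs(1)[OF deg8] by force

text \<open>Only finitely many \<open>x\<close> are coordinates of singular points in the affine plane. If the
  resultant vanishes identically, then the characteristic is 3, and there \<open>c = D2\<close> is a root of
  the second equation.\<close>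

lemma finite_singular_x:
  "\<exists>Z. finite Z \<and> (\<forall>x c. 2 * c ^ 3 + poly D2 x * c ^ 2 - poly (P9 t) x = 0 \<longrightarrow>
     poly (pderiv D2) x * c ^ 2 + poly (pderiv D1) x * c + poly (pderiv (P9 t)) x = 0 \<longrightarrow> x \<in> Z)"
proof (cases "\<exists>x. poly (P9 t) x = 0 \<and> poly Qp x \<noteq> 0")
  case True
  then obtain y where y: "poly (P9 t) y = 0" "poly Qp y \<noteq> 0" by blast
  let ?d = D2 and ?p = "P9 t" and ?a = "pderiv D2" and ?b = "pderiv D1" and ?g = "pderiv (P9 t)"
  define R where "R = ?d ^ 2 * ?a * ?g ^ 2 + 2 * ?d * ?p * ?a ^ 2 * ?g - ?d * ?p * ?a * ?b ^ 2 - 2 * ?d * ?b * ?g ^ 2 + ?p ^ 2 * ?a ^ 3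
    - 6 * ?p * ?a * ?b * ?g + 2 * ?p * ?b ^ 3 + 4 * ?g ^ 3"
  have "poly R y = (poly ?g y) ^ 2 * poly Qp y"
    unfolding R_def Qp_def by (simp add: y(1) algebra_simps power2_eq_square power3_eq_cube)
  moreover have "poly ?g y \<noteq> 0" by (rule P9_simple[OF deg8 y(1)])
  ultimately have "poly R y \<noteq> 0" using y(2) by simp
  then have "R \<noteq> 0" by auto
  then have "finite {x. poly R x = 0}" by (rule poly_roots_finite)
  moreover have "poly R x = 0" if "2 * c ^ 3 + poly ?d x * c ^ 2 - poly ?p x = 0"
    "poly ?a x * c ^ 2 + poly ?b x * c + poly ?g x = 0" for x c
    using resultant_zero[OF that] unfolding R_def by simp
  ultimately show ?thesis by (intro exI[of _ "{x. poly R x = 0}"]) simp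
next
  case False
  then have sub: "{x. poly (P9 t) x = 0} \<subseteq> {x. poly Qp x = 0}" by blast
  have Q0: "Qp = 0"
  proof (rule too_many_roots[of "{x. poly (P9 t) x = 0}"])
    show "poly Qp x = 0" if "x \<in> {x. poly (P9 t) x = 0}" for x using that sub by blast
    show "degree Qp < card {x. poly (P9 t) x = 0}" using Qp_degree card_P9_roots by linarith
  qed
  then have "(9 :: 'k alg_closure) = 0" using Qp_coeff by simp
  moreover have "(9 :: 'k alg_closure) = 3 * 3" by simp
  ultimately have three: "(3 :: 'k alg_closure) = 0" by (metis mult_eq_0_iff)
  have n: "(2 :: 'k alg_closure) = - 1" "(4 :: 'k alg_closure) = 1"
  proof -
    have "(2 :: 'k alg_closure) + 1 = 3" "(4 :: 'k alg_closure) = 3 + 1" by simp_all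
    then show "(2 :: 'k alg_closure) = - 1" "(4 :: 'k alg_closure) = 1" by (simp_all add: three eq_neg_iff_add_eq_0)
  qed
  have d2: "D2 = [:a0, a1:]" "pderiv D2 = [:a1:]" by (simp_all add: D2_def three pderiv_pCons)
  have g: "poly (pderiv (P9 t)) x = - (poly D2 x * poly (pderiv D1) x) - poly D2 x ^ 2 * a1" for x
  proof -
    have "0 = poly D2 x ^ 2 * a1 - 2 * poly D2 x * poly (pderiv D1) x + 4 * poly (pderiv (P9 t)) x"
      using arg_cong[OF Q0, of "\<lambda>p. poly p x"] unfolding Qp_def d2(2) by (simp add: mult.commute)
    then have "0 = poly D2 x ^ 2 * a1 + poly D2 x * poly (pderiv D1) x + poly (pderiv (P9 t)) x" unfolding n by simp
    then show ?thesis by (simp add: eq_neg_iff_add_eq_0 algebra_simps eq_diff_eq)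
  qed
  have fac: "poly (P9 t) x = 0 \<or> poly (pderiv D1) x + a1 * (c + poly D2 x) = 0"
    if "2 * c ^ 3 + poly D2 x * c ^ 2 - poly (P9 t) x = 0"
      "poly (pderiv D2) x * c ^ 2 + poly (pderiv D1) x * c + poly (pderiv (P9 t)) x = 0" for x c
  proof -
    have "(c - poly D2 x) * (poly (pderiv D1) x + a1 * (c + poly D2 x)) = 0"
      using that(2) unfolding g d2(2) by (simp add: algebra_simps power2_eq_square)
    \<comment> \<open>With \<open>2 = - 1\<close> the first equation reads
      \<open>c^2 (D2 - c) = P9\<close>, so the root \<open>c = D2\<close> occurs only at base
      parameters.\<close>
    moreover have "poly (P9 t) x = 0" if "c = poly D2 x"
      using \<open>2 * c ^ 3 + poly D2 x * c ^ 2 - poly (P9 t) x = 0\<close> that unfolding n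
      by (simp add: power2_eq_square power3_eq_cube)
    ultimately show ?thesis by auto
  qed
  have P0: "P9 t \<noteq> 0" using P9_coeffs(1)[OF deg8] by auto
  have finP: "finite {x. poly (P9 t) x = 0}" by (rule poly_roots_finite[OF P0])
  show ?thesis
  proof (cases "a1 = 0")
    case True
    have "pderiv D1 \<noteq> 0"
    proof
      assume "pderiv D1 = 0"
      then have "poly (pderiv (P9 t)) x = 0" for x unfolding g True by simp
      moreover have "poly (P9 t) s = 0" by (simp add: P9_root_iff)
      ultimately show False using P9_simple[OF deg8] by blast
    qed
    then have "finite {x. poly (pderiv D1) x = 0}" by (rule poly_roots_finite)
    then have "finite ({x. poly (P9 t) x = 0} \<union> {x. poly (pderiv D1) x = 0})" using finP by simp
    moreover have "poly (P9 t) x = 0 \<or> poly (pderiv D1) x = 0"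
      if e: "2 * c ^ 3 + poly D2 x * c ^ 2 - poly (P9 t) x = 0"
        "poly (pderiv D2) x * c ^ 2 + poly (pderiv D1) x * c + poly (pderiv (P9 t)) x = 0" for x c
    proof -
      have "a1 * k = 0" for k by (simp only: True mult_zero_left)
      then show ?thesis using fac[OF e] by (simp only: add_0_right)
    qed
    ultimately show ?thesis by (intro exI[of _ "{x. poly (P9 t) x = 0} \<union> {x. poly (pderiv D1) x = 0}"]) blast
  next
    case False
    \<comment> \<open>\<open>rh\<close> is the other root \<open>c\<close> of the derivative
      equation, as a polynomial in \<open>x\<close>; \<open>S\<close> is the first equation at
      \<open>c = rh\<close>.\<close>
    define rh where "rh = smult (- 1 / a1) (pderiv D1) - D2"
    define S where "S = rh ^ 2 * (D2 - rh) - P9 t"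
    have "S \<noteq> 0"
    proof
      assume "S = 0"
      then have P: "P9 t = rh ^ 2 * (D2 - rh)" by (simp add: S_def)
      show False
      \<comment> \<open>A root of \<open>rh\<close> would be a double root of \<open>P9 t\<close>;
        for constant \<open>rh\<close> the product has degree at most 1.\<close>
      proof (cases "degree rh = 0")
        case True
        then obtain k where k: "rh = [:k:]" by (rule degree_eq_zeroE)
        have "degree (D2 - rh) \<le> 1" unfolding k d2(1) by (intro degree_le) (auto simp: coeff_pCons split: nat.splits)
        moreover have "degree (rh ^ 2) = 0" by (simp add: k power2_eq_square)
        ultimately have "degree (P9 t) \<le> 1" unfolding P using degree_mult_le[of "rh ^ 2" "D2 - rh"] by simp
        then show False using P9_coeffs(1)[OF deg8] by simp
      next
        case False
        then obtain z where "poly rh z = 0" using alg_closed_imp_poly_has_root by blast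
        from double_root_pderiv[OF P this] show False using P9_simple[OF deg8] by blast
      qed
    qed
    then have "finite {x. poly S x = 0}" by (rule poly_roots_finite)
    then have "finite ({x. poly (P9 t) x = 0} \<union> {x. poly S x = 0})" using finP by simp
    moreover have "x \<in> {x. poly (P9 t) x = 0} \<union> {x. poly S x = 0}"
      if e: "2 * c ^ 3 + poly D2 x * c ^ 2 - poly (P9 t) x = 0"
        "poly (pderiv D2) x * c ^ 2 + poly (pderiv D1) x * c + poly (pderiv (P9 t)) x = 0" for x c
    proof (cases "poly (P9 t) x = 0")
      case nr: False
      have "poly (pderiv D1) x + a1 * (c + poly D2 x) = 0" using fac[OF e] nr by blast
      then have "a1 * (c + poly D2 x) = - poly (pderiv D1) x" by (simp add: eq_neg_iff_add_eq_0 add.commute)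
      then have "a1 * (c + poly D2 x) / a1 = - poly (pderiv D1) x / a1" by simp
      then have "c = poly rh x" using False by (simp add: rh_def eq_diff_eq)
      then have "poly S x = 0" using e(1) unfolding n S_def by (simp add: algebra_simps power2_eq_square power3_eq_cube)
      then show ?thesis by simp
    qed simp
    ultimately show ?thesis by blast
  qed
qed

text \<open>Each of the finitely many \<open>x\<close> carries finitely many \<open>c\<close>: at a
  base parameter the derivative equation is nontrivial because \<open>P9 t\<close> has simple roots,
  elsewhere the other equation has a nonzero constant term. Each singular point determines
  \<open>r\<close>.\<close>

lemma finite_singular:
  obtains L where "finite L" "\<And>r v. r \<notin> L \<Longrightarrow> v \<noteq> 0 \<Longrightarrow> Fp r 1 v = 0 \<Longrightarrow> \<exists>w. pF r 1 v w \<noteq> 0"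
proof -
  obtain Z where Z: "finite Z" "\<And>x c. 2 * c ^ 3 + poly D2 x * c ^ 2 - poly (P9 t) x = 0 \<Longrightarrow>
     poly (pderiv D2) x * c ^ 2 + poly (pderiv D1) x * c + poly (pderiv (P9 t)) x = 0 \<Longrightarrow> x \<in> Z"
    using finite_singular_x by blast
  define Cs where "Cs x = {c. 2 * c ^ 3 + poly D2 x * c ^ 2 - poly (P9 t) x = 0 \<and>
     poly (pderiv D2) x * c ^ 2 + poly (pderiv D1) x * c + poly (pderiv (P9 t)) x = 0}" for x
  have Cs: "finite (Cs x)" for x
  proof (cases "poly (P9 t) x = 0")
    case True
    let ?e = "[:poly (pderiv (P9 t)) x, poly (pderiv D1) x, poly (pderiv D2) x:]"
    have "?e \<noteq> 0" using P9_simple[OF deg8 True] by simp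
    then have "finite {c. poly ?e c = 0}" by (rule poly_roots_finite)
    moreover have "Cs x \<subseteq> {c. poly ?e c = 0}" by (auto simp: Cs_def algebra_simps power2_eq_square)
    ultimately show ?thesis by (rule rev_finite_subset)
  next
    case False
    let ?e = "[:- poly (P9 t) x, 0, poly D2 x, 2:]"
    have "?e \<noteq> 0" using False by simp
    then have "finite {c. poly ?e c = 0}" by (rule poly_roots_finite)
    moreover have "Cs x \<subseteq> {c. poly ?e c = 0}" by (auto simp: Cs_def algebra_simps power2_eq_square power3_eq_cube)
    ultimately show ?thesis by (rule rev_finite_subset)
  qed
  \<comment> \<open>Candidates \<open>(0, 1, y)\<close> at infinity: the curve equation and the
    derivative along the first axis each express \<open>- r\<close>, and this cubic is their
    difference.\<close>
  define Y where "Y = {y. poly [:c3 - c2, b2 - b1, a1 - a0, 1:] y = 0}"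
  have Y: "finite Y" unfolding Y_def by (rule poly_roots_finite) simp
  define L where "L = (\<Union>x\<in>Z. (\<lambda>c. poly D1 x + 2 * c * poly D2 x + 3 * c ^ 2) ` Cs x) \<union> (\<lambda>y. - (c3 + b2 * y + a1 * y ^ 2 + y ^ 3)) ` Y"
  have fin: "finite L" unfolding L_def using Z(1) Cs Y by simp
  have key: "r \<in> L" if v: "v \<noteq> 0" and F: "Fp r 1 v = 0" and pol: "\<And>w. pF r 1 v w = 0" for r v
  proof (cases "v $ 1 = 0")
    case False
    define k where "k = v $ 1"
    define x where "x = v $ 2 / k"
    define c where "c = v $ 3 / k - cf x"
    have k: "k \<noteq> 0" using False by (simp add: k_def)
    have ve: "v = k *s (cpt x + c *s axis 3 1)" using k by (simp add: vec3_eq x_def c_def) (simp add: k_def)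
    have F': "Fp r 1 (cpt x + c *s axis 3 1) = 0" using F k unfolding ve Fp_scale by simp
    have pol': "pF r 1 (cpt x + c *s axis 3 1) w = 0" for w using pol[of w] k unfolding ve pF_scale by simp
    note sa = singular_affine[OF F' pol']
    have "x \<in> Z" "c \<in> Cs x" using Z(2)[OF sa(2,3)] sa(2,3) by (auto simp: Cs_def)
    then show ?thesis unfolding L_def sa(1) by blast
  next
    case True
    have x: "v $ 2 \<noteq> 0"
    proof
      assume "v $ 2 = 0"
      then have "v $ 3 = 0" using F True by (simp add: Fp_def Cf_def cubf_def quad_def)
      then show False using v True \<open>v $ 2 = 0\<close> by (simp add: vec3_eq)
    qed
    define k where "k = v $ 2"
    define y where "y = v $ 3 / k"
    define u :: "'k alg_closure ^ 3" where "u = vector [0, 1, y]"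
    have u: "u $ 1 = 0" "u $ 2 = 1" "u $ 3 = y" by (simp_all add: u_def)
    have ve: "v = k *s u" using x True by (simp add: vec3_eq u y_def k_def)
    have k: "k \<noteq> 0" using x by (simp add: k_def)
    have F': "Fp r 1 u = 0" using F k unfolding ve Fp_scale by simp
    have pol': "pF r 1 u w = 0" for w using pol[of w] k unfolding ve pF_scale by simp
    have a: "axis 1 1 $ (2::3) = (0 :: 'k alg_closure)" "axis 1 1 $ (3::3) = (0 :: 'k alg_closure)" by (auto simp: axis_def)
    have r: "r = - (c3 + b2 * y + a1 * y ^ 2 + y ^ 3)"
    proof -
      have "- r = c3 + b2 * y + a1 * y ^ 2 + y ^ 3"
        using F' by (simp add: Fp_def Cf_def cubf_def quad_def u algebra_simps)
      then have "- (- r) = - (c3 + b2 * y + a1 * y ^ 2 + y ^ 3)" by (simp only:)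
      then show ?thesis by (simp only: minus_minus)
    qed
    have "- r - (c2 + b1 * y + a0 * y ^ 2) = 0"
      using pol'[of "axis 1 1"] by (simp add: pF_def polC_def polcub_def u a)
    then have "poly [:c3 - c2, b2 - b1, a1 - a0, 1:] y = 0"
      unfolding r by (simp add: algebra_simps power2_eq_square power3_eq_cube)
    then show ?thesis unfolding L_def r by (auto simp: Y_def)
  qed
  show ?thesis using that[OF fin] key by blast
qed

text \<open>The member through \<open>v\<close> has parameter \<open>D v / Cf v\<close>; avoiding
  the value \<open>l\<close> means not lying on the curve \<open>Fp l 1\<close>.\<close>

lemma gen_ratio_avoids:
  assumes "finite L"
  shows "gen (\<lambda>v. Cf v \<noteq> 0 \<and> D v / Cf v \<notin> L)"
proof -
  have C: "gen (\<lambda>v :: 'k alg_closure ^ 3. Cf v \<noteq> 0)"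
  proof (rule gen_hp[where u = "axis 2 1", OF hp_Cf[OF csubring_UNIV]])
    have "axis 2 1 $ (1::3) = (0 :: 'k alg_closure)" "axis 2 1 $ (3::3) = (0 :: 'k alg_closure)" by (auto simp: axis_def)
    then show "Cf (axis 2 1 :: 'k alg_closure ^ 3) \<noteq> 0" by (simp add: Cf_def)
  qed
  have g: "gen (\<lambda>v. Fp l 1 v \<noteq> 0)" for l
  proof -
    obtain u where "Fp l 1 u \<noteq> 0" using Fp_nonzero[of l 1] by auto
    then show ?thesis by (rule gen_hp[OF hp_Fp])
  qed
  have "gen (\<lambda>v. \<forall>l\<in>L. Fp l 1 v \<noteq> 0)" using assms
  proof (induction L rule: finite_induct)
    case empty
    show ?case by (rule gen_mono[OF C]) simp
  next
    case (insert l L)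
    from gen_conj[OF g[of l] insert.IH] show ?case by (rule gen_mono) simp
  qed
  then have "gen (\<lambda>v. Cf v \<noteq> 0 \<and> (\<forall>l\<in>L. Fp l 1 v \<noteq> 0))" by (rule gen_conj[OF C])
  then show ?thesis
  proof (rule gen_mono)
    fix v assume v: "Cf v \<noteq> 0 \<and> (\<forall>l\<in>L. Fp l 1 v \<noteq> 0)"
    have "Fp (D v / Cf v) 1 v = 0" using v by (simp add: Fp_def)
    then show "Cf v \<noteq> 0 \<and> D v / Cf v \<notin> L" using v by blast
  qed
qed

lemma gen_B_nonzero: "gen (\<lambda>v. B v \<noteq> 0)"
proof -
  obtain v where v: "B (B v) \<noteq> 0" using B_B_nonzero by blast
  then obtain i where "B (B v) $ i \<noteq> 0" by (metis vec_eq_iff zero_index)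
  from gen_hp[OF hp_B[of i] this] show ?thesis by (rule gen_mono) auto
qed

lemma for_general_point_gen:
  assumes "gen Q" "\<And>v. v \<noteq> 0 \<Longrightarrow> Q v \<Longrightarrow> P (proj_class v)"
  shows "for_general_point (P :: 'a::field point \<Rightarrow> bool)"
proof -
  obtain d f where f: "hp UNIV d f" "\<exists>u. f u \<noteq> 0" "\<forall>v. f v \<noteq> 0 \<longrightarrow> Q v" using assms(1) by (auto simp: gen_def)
  obtain G where G: "form d G" "\<And>v. insertion id v G = f v" by (rule hp_UNIV_form[OF f(1)], rule that)
  have "G \<noteq> 0"
  proof
    assume "G = 0"
    then have "f v = 0" for v using G(2)[of v] by simp
    then show False using f(2) by simp
  qed
  moreover have "P x" if x: "x \<in> proj_plane" "\<not> vanishes_at G x" for x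
  proof -
    obtain v where v: "v \<noteq> 0" "x = proj_class v" by (rule proj_plane_cases[OF x(1)])
    have "f v \<noteq> 0" using x(2) vanishes_at_class[OF G(1) v(1)] by (simp add: v(2) G(2))
    then show ?thesis using assms(2)[OF v(1)] f(3) v(2) by blast
  qed
  ultimately show ?thesis unfolding for_general_point_def using G(1) by blast
qed

lemma bertini_involution:
  assumes "birational F" "\<And>v. ev F v = B v"
  shows "bertini_involution_at (orb t) (ratmap_rel `` {F})"
proof -
  have Ft: "F \<in> triples" using assms(1) by (simp add: birational_def)
  obtain L where L: "finite L" "\<And>r v. r \<notin> L \<Longrightarrow> v \<noteq> 0 \<Longrightarrow> Fp r 1 v = 0 \<Longrightarrow> \<exists>w. pF r 1 v w \<noteq> 0"
    by (rule finite_singular) blast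
  have gp: "for_general_point (\<lambda>x. \<exists>G\<in>cubics_through (orb t). smooth_cubic G \<and> vanishes_at G x \<and>
             maps_to (ratmap_rel `` {F}) x (inv\<^bsub>cubic_group G (proj_class (cpt s))\<^esub> x))"
  proof (rule for_general_point_gen[OF gen_conj[OF gen_ratio_avoids[OF L(1)] gen_B_nonzero]])
    fix v assume v: "v \<noteq> 0" and g: "(Cf v \<noteq> 0 \<and> D v / Cf v \<notin> L) \<and> B v \<noteq> 0"
    define r m where "r = D v" and "m = Cf v"
    have m: "m \<noteq> 0" and rm: "r \<noteq> 0 \<or> m \<noteq> 0" using g by (auto simp: m_def)
    obtain G where G: "form 3 G" "\<And>v. insertion id v G = Fp r m v" "\<And>u w. polar G u w = pF r m u w"
      by (rule Fp_cases, rule that)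
    have thr: "G \<in> cubics_through (orb t)" by (rule Fp_through[OF G(1,2) rm])
    have lf: "line_free G" by (rule Fp_line_free[OF G(1,2) rm])
    have sm: "smooth_cubic G"
      unfolding smooth_cubic_def
    proof (intro conjI ballI)
      show "form 3 G" by fact
      show "G \<noteq> 0" using thr by (simp add: cubics_through_def)
      fix P :: "'k alg_closure point" assume "P \<in> proj_plane"
      then obtain u where u: "u \<noteq> 0" "P = proj_class u" by (rule proj_plane_cases)
      have h: "Fp r m w = m * Fp (r / m) 1 w" "pF r m w w' = m * pF (r / m) 1 w w'" for w w'
        using Fp_hom[of m "r / m" 1] m by simp_all
      show "\<not> singular_at G P"
      proof
        assume "singular_at G P"
        then have "Fp r m u = 0" "\<And>w. pF r m u w = 0"
          unfolding u(2) singular_at_class[OF G(1) u(1)] G(2,3) by blast+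
        then have "Fp (r / m) 1 u = 0" "\<And>w. pF (r / m) 1 u w = 0" unfolding h using m by simp_all
        then show False using L(2)[OF _ u(1)] g by (auto simp: r_def m_def)
      qed
    qed
    have Gv: "insertion id v G = 0" unfolding G(2) r_def m_def by (rule Fp_x)
    then have vv: "vanishes_at G (proj_class v)" using vanishes_at_class[OF G(1) v] by simp
    have Gs: "insertion id (cpt s) G = 0" by (simp add: G(2) Fp_s)
    then have vs: "vanishes_at G (proj_class (cpt s))" using vanishes_at_class[OF G(1) cpt_nonzero] by simp
    have T: "third_point G (proj_class (cpt s)) (proj_class (cpt s)) = proj_class (Tx v)"
    proof -
      have "polar G (tv r m) (cpt s) \<noteq> 0 \<or> insertion id (tv r m) G \<noteq> 0"
        using al_be[OF rm] by (simp add: G al_def be_def)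
      note ls = line_section_tangent[OF G(1) Gs _ tv_not_par[OF rm] this smooth_cubic_polar[OF sm Gs cpt_nonzero]]
      have "line_section G (proj_class (cpt s)) (proj_class (cpt s)) (proj_class (Tx v))"
        using ls by (simp add: G pF_s_tv al_def be_def Tx_def T_def r_def m_def)
      then show ?thesis
        unfolding third_point_eq[OF sm lf proj_class_in[OF cpt_nonzero] proj_class_in[OF cpt_nonzero] vs vs] by (rule sym)
    qed
    have Tv: "insertion id (Tx v) G = 0" unfolding G(2) Tx_def r_def[symmetric] m_def[symmetric] by (rule Fp_T)
    have Tnz: "Tx v \<noteq> 0" unfolding Tx_def using T_nonzero rm by (simp add: r_def m_def)
    have vT: "vanishes_at G (proj_class (Tx v))" using vanishes_at_class[OF G(1) Tnz] Tv by simp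
    have AM: "bA v = polar G (Tx v) v" "bM v = polar G v (Tx v)" by (simp_all add: bA_def bM_def G(3) r_def m_def)
    \<comment> \<open>If \<open>v\<close> and \<open>Tx v\<close> were parallel, both polar forms
      would be multiples of \<open>3 Fp v = 0\<close>, and \<open>B v\<close> would vanish.\<close>
    have np: "\<not> par v (Tx v)"
    proof
      assume "par v (Tx v)"
      then obtain c where c: "Tx v = c *s v" using parE v by blast
      have "bA v = 0" "bM v = 0"
        unfolding AM G(3) c pF_scale pF_scale2 pF_self using Gv by (simp_all add: G(2))
      then show False using g by (simp add: B_def)
    qed
    have "bA v \<noteq> 0 \<or> bM v \<noteq> 0" using g by (auto simp: B_def)
    then have "polar G v (Tx v) \<noteq> 0 \<or> polar G (Tx v) v \<noteq> 0" unfolding AM by blast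
    from line_section_distinct[OF G(1) Gv Tv np this]
    have "line_section G (proj_class v) (proj_class (Tx v)) (proj_class (B v))"
      by (simp add: B_def AM)
    then have "third_point G (proj_class v) (proj_class (Tx v)) = proj_class (B v)"
      unfolding third_point_eq[OF sm lf proj_class_in[OF v] proj_class_in[OF Tnz] vv vT] by (rule sym)
    then have inv: "inv\<^bsub>cubic_group G (proj_class (cpt s))\<^esub> (proj_class v) = proj_class (B v)"
      using cubic_group_inv[OF sm lf proj_class_in[OF v] vv proj_class_in[OF cpt_nonzero] vs] T by simp
    have F0: "F \<in> ratmap_rel `` {F}" using ratmap_rel_refl[OF Ft] by (simp only: Image_singleton_iff)
    have Bnz: "B v \<noteq> 0" using g by (rule conjunct2)
    have evB: "(\<chi> i. insertion to_ac v (F $ i)) \<in> proj_class (B v)"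
      using in_proj_class[OF Bnz] assms(2)[of v] by (simp only: ev_def)
    have "maps_to (ratmap_rel `` {F}) (proj_class v) (proj_class (B v))"
      unfolding maps_to_def
      by (intro conjI proj_class_in[OF v] proj_class_in[OF Bnz],
          rule bexI[OF _ F0], rule bexI[OF _ in_proj_class[OF v]], rule evB)
    then have "smooth_cubic G \<and> vanishes_at G (proj_class v) \<and>
             maps_to (ratmap_rel `` {F}) (proj_class v) (inv\<^bsub>cubic_group G (proj_class (cpt s))\<^esub> (proj_class v))"
      unfolding inv using sm vv by (intro conjI)
    then show "\<exists>G\<in>cubics_through (orb t). smooth_cubic G \<and> vanishes_at G (proj_class v) \<and>
             maps_to (ratmap_rel `` {F}) (proj_class v) (inv\<^bsub>cubic_group G (proj_class (cpt s))\<^esub> (proj_class v))"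
      using thr by (rule bexI)
  qed
  have bir: "ratmap_rel `` {F} \<in> carrier Bir" using assms(1) by (auto simp: Bir_def quotient_def)
  show ?thesis unfolding bertini_involution_at_def
    by (rule conjI[OF bir], rule bexI[where x = "proj_class (cpt s)"], rule conjI[OF base_locus_orb gp], rule s_point_rational)
qed

end

subsection \<open>Polynomial dependence on a parameter\<close>

definition pfun :: "('a::comm_ring_1 \<Rightarrow> 'a) \<Rightarrow> bool" where
  "pfun f \<longleftrightarrow> (\<exists>p. \<forall>e. f e = poly p e)"

lemma pfun_const: "pfun (\<lambda>e. c)"
  unfolding pfun_def by (intro exI[of _ "[:c:]"]) simp

lemma pfun_id: "pfun (\<lambda>e. e)"
  unfolding pfun_def by (intro exI[of _ "[:0, 1:]"]) simp

lemma pfun_add: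
  assumes "pfun f" "pfun g"
  shows "pfun (\<lambda>e. f e + g e)"
proof -
  obtain p q where "\<And>e. f e = poly p e" "\<And>e. g e = poly q e" using assms unfolding pfun_def by blast
  then show ?thesis unfolding pfun_def by (intro exI[of _ "p + q"]) simp
qed

lemma pfun_mult:
  assumes "pfun f" "pfun g"
  shows "pfun (\<lambda>e. f e * g e)"
proof -
  obtain p q where "\<And>e. f e = poly p e" "\<And>e. g e = poly q e" using assms unfolding pfun_def by blast
  then show ?thesis unfolding pfun_def by (intro exI[of _ "p * q"]) simp
qed

lemma pfun_diff:
  assumes "pfun f" "pfun g"
  shows "pfun (\<lambda>e. f e - g e)"
proof -
  obtain p q where "\<And>e. f e = poly p e" "\<And>e. g e = poly q e" using assms unfolding pfun_def by blast
  then show ?thesis unfolding pfun_def by (intro exI[of _ "p - q"]) simp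
qed

lemma pfun_power: "pfun f \<Longrightarrow> pfun (\<lambda>e. f e ^ n)"
  by (induction n) (simp_all add: pfun_const pfun_mult)

lemmas pfun_intros = pfun_id pfun_add pfun_diff pfun_mult pfun_power pfun_const

lemma pfun_hp:
  assumes "hp S d f" "\<And>i. pfun (\<lambda>e. U e $ i)"
  shows "pfun (\<lambda>e. f (U e))"
  using assms(1) by (induction rule: hp.induct) (intro pfun_const pfun_add pfun_mult assms(2); assumption)+

lemma pfun_mult_zero:
  fixes f :: "'a::alg_closed_field \<Rightarrow> 'a"
  assumes "pfun f" "pfun g" "\<And>e. f e * g e = 0" "f u \<noteq> 0"
  shows "g e = 0"
proof -
  obtain p q where pq: "\<And>e. f e = poly p e" "\<And>e. g e = poly q e" using assms(1,2) unfolding pfun_def by blast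
  have "p * q = 0" by (rule poly_zero_alg_closed) (simp add: pq[symmetric] assms(3))
  moreover have "p \<noteq> 0" using assms(4) pq(1) by auto
  ultimately show ?thesis using pq(2) by simp
qed

text \<open>Stands in for a limit: a factor \<open>e\<close> is cancelled for nonzero
  \<open>e\<close>, and the resulting identity still holds at 0.\<close>

lemma pfun_zero_at:
  fixes f :: "'a::alg_closed_field \<Rightarrow> 'a"
  assumes "pfun f" "\<And>e. e \<noteq> 0 \<Longrightarrow> f e = 0"
  shows "f 0 = 0"
  by (rule pfun_mult_zero[OF pfun_id assms(1), of 1]) (use assms(2) in auto)

text \<open>Without a root in common with \<open>b\<close>, the polynomial \<open>p\<close> divides
  \<open>a\<close>; its roots are split off from both one at a time.\<close>

lemma no_common_root_degree:
  fixes p :: "'a::alg_closed_field poly"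
  assumes "p * q = b * a" "\<And>x. poly p x = 0 \<Longrightarrow> poly b x \<noteq> 0" "a \<noteq> 0" "p \<noteq> 0"
  shows "degree p \<le> degree a"
  using assms
proof (induction "degree p" arbitrary: p a)
  case (Suc n)
  have "0 < degree p" using Suc.hyps(2) by simp
  then obtain z where z: "poly p z = 0" using alg_closed_imp_poly_has_root by blast
  have "poly b z * poly a z = 0" using arg_cong[OF Suc.prems(1), of "\<lambda>r. poly r z"] z by simp
  then have "poly a z = 0" using Suc.prems(2)[OF z] by simp
  then obtain p' a' where pa: "p = [:- z, 1:] * p'" "a = [:- z, 1:] * a'" using z unfolding poly_eq_0_iff_dvd dvd_def by blast
  have nz: "p' \<noteq> 0" "a' \<noteq> 0" using pa Suc.prems(3,4) by auto
  have d: "degree p = Suc (degree p')" "degree a = Suc (degree a')" unfolding pa using nz by (simp_all add: degree_mult_eq del: mult_pCons_left)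
  have "[:- z, 1:] * (p' * q) = [:- z, 1:] * (b * a')"
    using Suc.prems(1) unfolding pa by (simp only: ac_simps)
  then have "p' * q = b * a'" using mult_cancel_left[of "[:- z, 1:]"] by (metis pCons_eq_0_iff zero_neq_one)
  moreover have "poly b y \<noteq> 0" if "poly p' y = 0" for y using Suc.prems(2)[of y] that pa(1) by simp
  moreover have "n = degree p'" using d(1) Suc.hyps(2) by simp
  ultimately have "degree p' \<le> degree a'" using Suc.hyps(1)[of p' a'] nz by blast
  then show ?case using d by simp
qed simp

context cusp_pencil
begin

text \<open>The pencil parameters are packed as the first two coordinates of a vector, so that the
  facts on ternary forms serve for binary forms.\<close>

lemma hp_tv12: "hp UNIV 1 (\<lambda>v. tv (v $ 1) (v $ 2) $ k)"
proof -
  have "hp UNIV 1 (\<lambda>v. ctan s $ k * v $ 1 + (pr * axis 3 1 $ k - dl * ctan s $ k) * v $ 2)"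
    by (intro hp.hp_add hp_smult hp_component csubring_UNIV UNIV_I)
  then show ?thesis by (simp add: tv_def algebra_simps)
qed

lemma hp_al: "hp UNIV 3 (\<lambda>v. al (v $ 1) (v $ 2))"
proof -
  have "hp UNIV (1 + (0 + (1 + 1))) (\<lambda>v. v $ 1 * polcub 0 0 1 (- 1) 0 0 (- 1) 0 0 0 (tv (v $ 1) (v $ 2)) (cpt s)
      - v $ 2 * polD (tv (v $ 1) (v $ 2)) (cpt s))"
    by (intro hp_diff hp_mult hp_component hp_polcub hp_tv12 hp_const csubring_UNIV UNIV_I subset_UNIV)
  then show ?thesis by (simp add: al_def pF_def polC_polcub numeral_3_eq_3)
qed

lemma hp_be: "hp UNIV 4 (\<lambda>v. be (v $ 1) (v $ 2))"
proof -
  have D: "hp UNIV 3 D" by (rule hp_mono[OF hp_D subset_UNIV])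
  have "hp UNIV (1 + 3 * 1) (\<lambda>v. v $ 1 * Cf (tv (v $ 1) (v $ 2)) - v $ 2 * D (tv (v $ 1) (v $ 2)))"
    by (intro hp_diff hp_mult hp_component hp_comp[OF hp_Cf hp_tv12] hp_comp[OF D hp_tv12] csubring_UNIV)
  then show ?thesis by (simp add: be_def Fp_def)
qed

lemma hp_T12: "hp UNIV 4 (\<lambda>v. T (v $ 1) (v $ 2) $ k)"
proof -
  have "hp UNIV 4 (\<lambda>v. cpt s $ k * be (v $ 1) (v $ 2))" by (intro hp_smult hp_be csubring_UNIV UNIV_I)
  moreover have "hp UNIV (3 + 1) (\<lambda>v. al (v $ 1) (v $ 2) * tv (v $ 1) (v $ 2) $ k)"
    by (intro hp_mult hp_al hp_tv12 csubring_UNIV)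
  ultimately have "hp UNIV 4 (\<lambda>v. cpt s $ k * be (v $ 1) (v $ 2) - al (v $ 1) (v $ 2) * tv (v $ 1) (v $ 2) $ k)"
    by (intro hp_diff csubring_UNIV) auto
  then show ?thesis by (simp add: T_def mult_ac)
qed

lemma pfun_T:
  assumes "pfun d" "pfun c"
  shows "pfun (\<lambda>e. T (d e) (c e) $ i)"
proof -
  have "pfun (\<lambda>e. vector [d e, c e, 0] $ k)" for k :: 3
    using exhaust_3[of k] assms pfun_const[of 0] by auto
  from pfun_hp[OF hp_T12 this] show ?thesis by simp
qed

text \<open>A degree count: \<open>al e 1\<close> has degree 3 in \<open>e\<close> and no zero in common with \<open>be e 1\<close>, so it would
  divide a determinant that is linear in \<open>e\<close>.\<close>

lemma T_not_on_linear_pencil: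
  assumes x: "x \<noteq> s" and H: "\<And>e. det3 (cpt x) (e *s l1 + l0) (T e 1) = 0"
  shows "par (cpt x) (e *s l1 + l0)"
proof -
  let ?z = "cpt x" and ?l = "\<lambda>e. e *s l1 + l0"
  let ?w = "vector [1, 0, 0] :: 'k alg_closure ^ 3" and ?u = "vector [0, 1, 0] :: 'k alg_closure ^ 3"
  \<comment> \<open>The line is \<open>(e, 1, 0)\<close>; the top coefficient of \<open>pa\<close>
    is the value \<open>al 1 0\<close> at its direction.\<close>
  obtain pa where pa: "coeff pa 3 = al (?w $ 1) (?w $ 2)" "\<And>e. al ((?u + e *s ?w) $ 1) ((?u + e *s ?w) $ 2) = poly pa e"
    by (rule hp_poly_line[OF hp_al, where w = ?w and u = ?u], rule that)
  obtain pb where pb: "\<And>e. be ((?u + e *s ?w) $ 1) ((?u + e *s ?w) $ 2) = poly pb e"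
    by (rule hp_poly_line[OF hp_be, where w = ?w and u = ?u], rule that)
  have al: "al e 1 = poly pa e" and be: "be e 1 = poly pb e" for e using pa(2)[of e] pb[of e] by simp_all
  have pa3: "coeff pa 3 \<noteq> 0" using pa(1) al_r0 by simp
  then have dpa: "degree pa \<ge> 3" and pa0: "pa \<noteq> 0" by (auto intro: le_degree)
  have "pfun (\<lambda>e. det3 ?z (?l e) (tv e 1))"
    unfolding det3_expand tv_def vector_add_component vector_smult_component by (intro pfun_intros)
  then obtain p2 where p2: "\<And>e. det3 ?z (?l e) (tv e 1) = poly p2 e" unfolding pfun_def by blast
  define p1 where "p1 = [:det3 ?z l0 (cpt s), det3 ?z l1 (cpt s):]"
  have p1: "det3 ?z (?l e) (cpt s) = poly p1 e" for e
    unfolding p1_def det3_expand by (simp add: algebra_simps)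
  have "det3 ?z (?l e) (T e 1) = poly pb e * poly p1 e - poly pa e * poly p2 e" for e
    unfolding T_def p1[symmetric] p2[symmetric] al[symmetric] be[symmetric] det3_expand by (simp add: algebra_simps)
  then have "pa * p2 - pb * p1 = 0" using H by (intro poly_zero_alg_closed) (simp add: mult.commute)
  then have rel: "pa * p2 = pb * p1" by simp
  have "p1 = 0"
  proof (rule ccontr)
    assume n: "p1 \<noteq> 0"
    have "poly pb y \<noteq> 0" if "poly pa y = 0" for y using al_be[of y 1] that al be by simp
    from no_common_root_degree[OF rel this n pa0] have "degree pa \<le> degree p1" .
    moreover have "degree p1 \<le> 1" unfolding p1_def by simp
    ultimately show False using dpa by simp
  qed
  then have "p2 = 0" using rel pa0 by simp
  \<comment> \<open>The line through \<open>cpt x\<close> and the linear family, where it is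
    defined, is thus the tangent at \<open>cpt s\<close>. But that tangent misses
    \<open>cpt x\<close> for some \<open>e\<close>, so the cross product must vanish.\<close>
  have A: "dot (cr ?z (?l e)) (cpt s) = 0" "dot (cr ?z (?l e)) (tv e 1) = 0" for e
    using p1[of e] p2[of e] unfolding \<open>p1 = 0\<close> \<open>p2 = 0\<close> det3_dot_cr by simp_all
  let ?G = "\<lambda>e. det3 ?z (cpt s) (tv e 1)"
  have G: "pfun ?G"
    unfolding det3_expand tv_def vector_add_component vector_smult_component by (intro pfun_intros)
  have "\<exists>u. ?G u \<noteq> 0"
  proof (rule ccontr)
    assume "\<not> ?thesis"
    then have G0: "?G u = 0" for u by blast
    have e: "?G u = u * det3 ?z (cpt s) (ctan s) + (pr * (s - x) - dl * det3 ?z (cpt s) (ctan s))" for u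
      unfolding det3_expand tv_def by (simp add: algebra_simps)
    have "det3 ?z (cpt s) (ctan s) = 0" using G0[of 0] G0[of 1] unfolding e by simp
    then have "pr * (s - x) = 0" using G0[of 0] unfolding e by simp
    then show False using x pr_nonzero by simp
  qed
  then obtain u where u: "?G u \<noteq> 0" by blast
  have "cr ?z (?l e) $ i = 0" for i
  proof (rule pfun_mult_zero[where f = ?G and g = "\<lambda>e. cr ?z (?l e) $ i" and u = u, OF G])
    show "?G u \<noteq> 0" by (rule u)
    have c: "pfun (\<lambda>e. cr ?z (?l e) $ 1)" "pfun (\<lambda>e. cr ?z (?l e) $ 2)" "pfun (\<lambda>e. cr ?z (?l e) $ 3)"
      unfolding cr_simps vector_add_component vector_smult_component by (intro pfun_intros)+
    show "pfun (\<lambda>e. cr ?z (?l e) $ i)" using exhaust_3[of i] c by auto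
    fix e
    show "?G e * cr ?z (?l e) $ i = 0"
    proof (cases "cr ?z (?l e) = 0")
      case False
      have "dot (cr ?z (?l e)) ?z = 0" by (simp add: dot_def algebra_simps)
      from det3_zero_of_dot[OF False this A] show ?thesis by simp
    qed simp
  qed
  then show ?thesis unfolding par_iff_cr by (simp add: vec_eq_iff)
qed

text \<open>At a base point \<open>D\<close> and \<open>Cf\<close> vanish, so a factor
  \<open>e\<close> splits off. The remaining parameters take at \<open>e = 0\<close> the derivatives
  in the direction \<open>v\<close>, which describe the member tangent to \<open>v\<close>.\<close>

lemma base_expansion:
  assumes "poly (P9 t) x = 0"
  obtains d c where "pfun d" "pfun c" "d 0 = polD (cpt x) v" "c 0 = polC (cpt x) v"
    "\<And>e. D (cpt x + e *s v) = e * d e" "\<And>e. Cf (cpt x + e *s v) = e * c e"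
    "\<And>e. Tx (cpt x + e *s v) = e ^ 4 *s T (d e) (c e)"
proof -
  define d where "d e = polD (cpt x) v + e * polD v (cpt x) + e ^ 2 * D v" for e
  define c where "c e = polC (cpt x) v + e * polC v (cpt x) + e ^ 2 * Cf v" for e
  have D: "D (cpt x + e *s v) = e * d e" for e
    unfolding cubf_expand Dcpt assms d_def by (simp add: algebra_simps power2_eq_square power3_eq_cube)
  have C: "Cf (cpt x + e *s v) = e * c e" for e
    unfolding Cf_cubf cubf_expand c_def polC_polcub
    unfolding Cf_cubf[symmetric] Cf_cpt by (simp add: algebra_simps power2_eq_square power3_eq_cube)
  have "pfun d" "pfun c" unfolding d_def[abs_def] c_def[abs_def] by (intro pfun_intros)+
  moreover have "d 0 = polD (cpt x) v" "c 0 = polC (cpt x) v" unfolding d_def c_def by simp_all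
  ultimately show ?thesis using that D C unfolding Tx_def D C T_hom by blast
qed

lemma base_direction:
  "polD (cpt x) (a *s ctan x + b *s axis 3 1) = a * polD (cpt x) (ctan x) + b * polD (cpt x) (axis 3 1)"
  "polC (cpt x) (a *s ctan x + b *s axis 3 1) = b"
  unfolding polcub_add by (simp_all add: polC_def algebra_simps power2_eq_square)

lemma pF_dot: "pF r m u w = dot (vector [pF r m u (axis 1 1), pF r m u (axis 2 1), pF r m u (axis 3 1)]) w"
proof -
  have a: "axis 1 1 $ (2::3) = (0 :: 'k alg_closure)" "axis 1 1 $ (3::3) = (0 :: 'k alg_closure)"
    "axis 2 1 $ (1::3) = (0 :: 'k alg_closure)" "axis 2 1 $ (3::3) = (0 :: 'k alg_closure)"
    by (auto simp: axis_def)
  show ?thesis by (simp add: dot_def pF_def polC_def polcub_def a algebra_simps)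
qed

text \<open>If \<open>bM\<close> vanished identically, approaching \<open>cpt t\<close> along the
  tangent of any member would put \<open>T r m\<close> on that tangent. Its direction depends
  linearly on the parameter, which \<open>T_not_on_linear_pencil\<close> rules out. Nonvanishing is
  needed to recover the line through \<open>v\<close> and \<open>Tx v\<close> from
  \<open>B v\<close>.\<close>

lemma bM_nonzero: "\<exists>v. bM v \<noteq> 0"
proof (rule ccontr)
  assume "\<not> ?thesis"
  then have bM: "bM v = 0" for v by blast
  have rt: "poly (P9 t) t = 0" unfolding P9_root_iff by (intro disjI2 exI[of _ 0]) simp
  have ts: "t \<noteq> s" using sn_not_conj[OF deg8, of 0] by auto
  define p b where "p = polD (cpt t) (ctan t)" and "b = polD (cpt t) (axis 3 1)"
  have p: "p \<noteq> 0" unfolding p_def by (rule polD_conj_nonzero[OF rt])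
  have van: "pF r m (cpt t) (T r m) = 0" for r m
  proof -
    define v where "v = ((r - m * b) / p) *s ctan t + m *s axis 3 1"
    have v: "polD (cpt t) v = r" "polC (cpt t) v = m" unfolding v_def base_direction p_def[symmetric] b_def[symmetric]
      using p by simp_all
    obtain d c where dc: "pfun d" "pfun c" "d 0 = polD (cpt t) v" "c 0 = polC (cpt t) v"
      "\<And>e. D (cpt t + e *s v) = e * d e" "\<And>e. Cf (cpt t + e *s v) = e * c e"
      "\<And>e. Tx (cpt t + e *s v) = e ^ 4 *s T (d e) (c e)"
      by (rule base_expansion[OF rt, of v], rule that)
    have "pF (d 0) (c 0) (cpt t + 0 *s v) (T (d 0) (c 0)) = 0"
    proof (rule pfun_zero_at)
      show "pfun (\<lambda>e. pF (d e) (c e) (cpt t + e *s v) (T (d e) (c e)))"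
        unfolding pF_def polC_def polcub_def vector_add_component vector_smult_component
        by (intro pfun_intros pfun_T dc(1,2))
      fix e :: "'k alg_closure" assume e: "e \<noteq> 0"
      have "bM (cpt t + e *s v) = e ^ 4 * (e * pF (d e) (c e) (cpt t + e *s v) (T (d e) (c e)))"
        unfolding bM_def dc Fp_hom pF_scale2 ..
      then show "pF (d e) (c e) (cpt t + e *s v) (T (d e) (c e)) = 0" using bM e by simp
    qed
    then show ?thesis by (simp add: dc v)
  qed
  \<comment> \<open>Together with \<open>cpt t\<close>, the vector \<open>?l e\<close> spans the
    tangent of \<open>Fp e 1\<close> at \<open>cpt t\<close>.\<close>
  let ?l = "\<lambda>e. e *s ctan t + (p *s axis 3 1 - b *s ctan t)"
  have "det3 (cpt t) (?l e) (T e 1) = 0" for e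
  proof -
    define g :: "'k alg_closure ^ 3" where "g = vector [pF e 1 (cpt t) (axis 1 1), pF e 1 (cpt t) (axis 2 1), pF e 1 (cpt t) (axis 3 1)]"
    note g = pF_dot[of e 1 "cpt t", folded g_def]
    have c: "pF e 1 (cpt t) (ctan t) = - p" "pF e 1 (cpt t) (axis 3 1) = e - b"
      by (simp_all add: pF_def polC_cpt p_def b_def)
    have l: "?l e = (e - b) *s ctan t + p *s axis 3 1" by (simp add: vec_eq_iff algebra_simps)
    show ?thesis
    proof (rule det3_zero_of_dot)
      show "g \<noteq> 0" using c(1) p unfolding g by (auto simp: dot_def)
      show "dot g (cpt t) = 0" unfolding g[symmetric] pF_self Fp_cpt rt by simp
      show "dot g (?l e) = 0" unfolding g[symmetric] l pF_add c by (simp add: algebra_simps)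
      show "dot g (T e 1) = 0" unfolding g[symmetric] by (rule van)
    qed
  qed
  from T_not_on_linear_pencil[OF ts this] have "par (cpt t) (?l (b + 1))" .
  then have "cpt t $ 1 * ?l (b + 1) $ 2 = cpt t $ 2 * ?l (b + 1) $ 1" unfolding par_def by blast
  then show False by simp
qed

end

subsection \<open>The orbit is determined by its Bertini involution\<close>

lemma par_add: "par u v \<Longrightarrow> par u w \<Longrightarrow> par u (v + w)"
  unfolding par_def by (simp add: algebra_simps)

lemma par_scale: "par u v \<Longrightarrow> par u (c *s v)"
  unfolding par_def by (simp add: algebra_simps)

lemma par_diff: "par u v \<Longrightarrow> par u w \<Longrightarrow> par u (v - w)"
  unfolding par_def by (simp add: algebra_simps)

lemma par_of_dot:
  assumes "\<And>n. dot n z = 0 \<Longrightarrow> dot n w = 0"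
  shows "par z w"
proof -
  have "dot (vector [0, - (z $ 3), z $ 2]) w = 0" "dot (vector [z $ 3, 0, - (z $ 1)]) w = 0"
    "dot (vector [- (z $ 2), z $ 1, 0]) w = 0"
    by (rule assms, simp add: dot_def)+
  then show ?thesis unfolding par_iff_cr vec3_eq by (simp add: dot_def)
qed

lemma hp_matrix: "hp UNIV 1 (\<lambda>y. (K *v y) $ i)" for K :: "'a::field ^ 3 ^ 3"
  unfolding matrix_vector_mult_def vec_lambda_beta by (rule hp_linear[OF csubring_UNIV UNIV_I])

lemma matrix_lin: "K *v (a *s u + b *s w) = a *s (K *v u) + b *s (K *v w)" for K :: "'a::field ^ 3 ^ 3"
  unfolding matrix_vector_mult_def by (simp add: vec_eq_iff sum_3 algebra_simps)

lemma matrix_scale: "K *v (a *s u) = a *s (K *v u)" for K :: "'a::field ^ 3 ^ 3"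
  unfolding matrix_vector_mult_def by (simp add: vec_eq_iff sum_3 algebra_simps)

lemma matrix_0: "K *v 0 = 0" for K :: "'a::field ^ 3 ^ 3"
  unfolding matrix_vector_mult_def by (simp add: vec_eq_iff)

text \<open>\<open>conj\<close> is what conjugacy by a projectivity gives for chosen triples:
  proportional values, possibly zero at special points.\<close>

locale pencil_pair = P: cusp_pencil t c0 c1 c2 c3 b1 b2 a0 a1 + Q: cusp_pencil t' c0' c1' c2' c3' b1' b2' a0' a1'
  for t c0 c1 c2 c3 b1 b2 a0 a1 t' c0' c1' c2' c3' b1' b2' a0' a1' :: "'k::{field,finite} alg_closure" +
  fixes A A' :: "'k ^ 3 ^ 3"
  assumes A: "A ** A' = mat 1" "A' ** A = mat 1"
    and conj: "\<And>v. par (Q.B (acm A *v v)) (acm A *v P.B v)"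
begin

abbreviation M where "M \<equiv> \<lambda>v. acm A *v v"
abbreviation N where "N \<equiv> \<lambda>v. acm A' *v v"

lemma MN: "M (N y) = y" and NM: "N (M y) = y"
  by (rule acm_inverse[OF A(1)], rule acm_inverse[OF A(2)])

text \<open>The residual point of the first pencil carried over by the projectivity, to be compared
  with \<open>Q.Tx y\<close>.\<close>

definition S where "S y = M (P.Tx (N y))"

lemma hp_S: "hp UNIV 12 (\<lambda>y. S y $ i)"
proof -
  have "hp UNIV (12 * 1) (\<lambda>y. P.Tx (N y) $ j)" for j
    by (rule hp_comp[OF hp_mono[OF P.hp_Tx subset_UNIV] hp_matrix csubring_UNIV])
  then have "hp UNIV 12 (\<lambda>y. \<Sum>j\<in>UNIV. acm A $ i $ j * P.Tx (N y) $ j)"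
    by (intro hp_sum hp_smult csubring_UNIV UNIV_I) simp
  then show ?thesis unfolding S_def matrix_vector_mult_def[of "acm A"] by simp
qed

text \<open>The image of \<open>y\<close> is a combination of \<open>y\<close> and
  \<open>S y\<close>, and proportionally one of \<open>y\<close> and \<open>Q.Tx y\<close>. The
  triple product of \<open>y\<close> with both combinations is, up to sign, the determinant times
  the coefficients at \<open>S y\<close> and \<open>Q.Tx y\<close>, which are generically
  nonzero.\<close>

lemma det_S: "det3 y (S y) (Q.Tx y) = 0"
proof (rule gen_hp_zero[where f = "\<lambda>y. det3 y (S y) (Q.Tx y)"])
  show "hp UNIV (1 + (12 + 12)) (\<lambda>y. det3 y (S y) (Q.Tx y))"
    unfolding det3_expand
    by (intro hp.hp_add hp_mult hp_diff hp_component hp_S hp_mono[OF Q.hp_Tx subset_UNIV] csubring_UNIV)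
  obtain v where v: "P.bM v \<noteq> 0" using P.bM_nonzero by blast
  have h: "hp UNIV (17 * 1) (\<lambda>y. P.bM (N y))"
    by (rule hp_comp[OF hp_mono[OF P.hp_bM subset_UNIV] hp_matrix csubring_UNIV])
  have g1: "gen (\<lambda>y. P.bM (N y) \<noteq> 0)" by (rule gen_hp[OF h, of "M v"]) (simp only: NM v not_False_eq_True)
  obtain w where w: "Q.bM w \<noteq> 0" using Q.bM_nonzero by blast
  have g2: "gen (\<lambda>y. Q.bM y \<noteq> 0)" by (rule gen_hp[OF Q.hp_bM w])
  show "gen (\<lambda>y. det3 y (S y) (Q.Tx y) = 0)"
  proof (rule gen_mono[OF gen_conj[OF g1 g2]])
    fix y assume y: "P.bM (N y) \<noteq> 0 \<and> Q.bM y \<noteq> 0"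
    define a m a' m' where "a = P.bA (N y)" and "m = - P.bM (N y)" and "a' = Q.bA y" and "m' = - Q.bM y"
    have "par (a' *s y + m' *s Q.Tx y) (M (P.B (N y)))"
      using conj[of "N y"] unfolding MN Q.B_eq a'_def m'_def .
    moreover have "M (P.B (N y)) = a *s y + m *s S y"
      unfolding P.B_eq matrix_lin MN S_def a_def m_def ..
    ultimately have c: "cr (a' *s y + m' *s Q.Tx y) (a *s y + m *s S y) = 0" unfolding par_iff_cr by simp
    have "m * m' * det3 y (S y) (Q.Tx y) = - dot y (cr (a' *s y + m' *s Q.Tx y) (a *s y + m *s S y))"
      unfolding det3_expand dot_def cr_simps vector_add_component vector_smult_component by (simp add: algebra_simps)
    also have "\<dots> = 0" unfolding c by (simp add: dot_def)
    finally show "det3 y (S y) (Q.Tx y) = 0" using y by (simp add: m_def m'_def)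
  qed
qed

lemma pfun_S: "pfun (\<lambda>e. S (u + e *s v) $ i)"
proof (rule pfun_hp[OF hp_S])
  show "pfun (\<lambda>e. (u + e *s v) $ k)" for k
    unfolding vector_add_component vector_smult_component by (intro pfun_intros)
qed

lemma base_det:
  assumes "poly (P9 t') x = 0"
  obtains d c where "pfun d" "pfun c" "d 0 = Q.polD (cpt x) v" "c 0 = polC (cpt x) v"
    "\<And>e. e \<noteq> 0 \<Longrightarrow> det3 (cpt x + e *s v) (S (cpt x + e *s v)) (Q.T (d e) (c e)) = 0"
proof -
  obtain d c where dc: "pfun d" "pfun c" "d 0 = Q.polD (cpt x) v" "c 0 = polC (cpt x) v"
    "\<And>e. Q.Tx (cpt x + e *s v) = e ^ 4 *s Q.T (d e) (c e)"
    by (rule Q.base_expansion[OF assms, of v], rule that)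
  have "det3 (cpt x + e *s v) (S (cpt x + e *s v)) (Q.T (d e) (c e)) = 0" if e: "e \<noteq> 0" for e
  proof -
    have "det3 y u (k *s w) = k * det3 y u w" for y u w and k :: "'k alg_closure"
      unfolding det3_expand by (simp add: algebra_simps)
    then have "e ^ 4 * det3 (cpt x + e *s v) (S (cpt x + e *s v)) (Q.T (d e) (c e)) = 0"
      using det_S[of "cpt x + e *s v"] unfolding dc(5) by metis
    then show ?thesis using e by simp
  qed
  then show ?thesis using that dc(1-4) by blast
qed

context
  fixes x
  assumes rt: "poly (P9 t') x = 0" and xs: "x \<noteq> Q.s"
begin

definition "pz = Q.polD (cpt x) (ctan x)"
definition "dz = Q.polD (cpt x) (axis 3 1)"
text \<open>The direction at \<open>cpt x\<close> in which \<open>D\<close> and \<open>Cf\<close>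
  have derivatives \<open>a\<close> and \<open>b\<close>, normalised to first coordinate 0.\<close>

definition "dir a b = ((a - b * dz) / pz) *s ctan x + b *s axis 3 1"

lemma pz: "pz \<noteq> 0" unfolding pz_def by (rule Q.polD_conj_nonzero[OF rt])

lemma dir: "Q.polD (cpt x) (dir a b) = a" "polC (cpt x) (dir a b) = b" "dir a b $ 1 = 0"
  unfolding dir_def Q.base_direction pz_def[symmetric] dz_def[symmetric] using pz by simp_all

lemma dir_lin: "dir a b = a *s dir 1 0 + b *s dir 0 1"
  using pz by (simp add: dir_def vec_eq_iff field_simps)

text \<open>Approaching \<open>cpt x\<close> in the direction \<open>dir r m\<close> gives the
  determinant relation with \<open>T r m\<close>, for every member;
  \<open>T_not_on_linear_pencil\<close> then applies to a constant family.\<close>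

lemma par_S: "par (cpt x) (S (cpt x))"
proof -
  have "det3 (cpt x) (S (cpt x)) (Q.T r m) = 0" for r m
  proof -
    obtain d c where dc: "pfun d" "pfun c" "d 0 = Q.polD (cpt x) (dir r m)" "c 0 = polC (cpt x) (dir r m)"
      "\<And>e. e \<noteq> 0 \<Longrightarrow> det3 (cpt x + e *s dir r m) (S (cpt x + e *s dir r m)) (Q.T (d e) (c e)) = 0"
      by (rule base_det[OF rt, of "dir r m"], rule that)
    have "det3 (cpt x + 0 *s dir r m) (S (cpt x + 0 *s dir r m)) (Q.T (d 0) (c 0)) = 0"
    proof (rule pfun_zero_at[where f = "\<lambda>e. det3 (cpt x + e *s dir r m) (S (cpt x + e *s dir r m)) (Q.T (d e) (c e))"])
      show "pfun (\<lambda>e. det3 (cpt x + e *s dir r m) (S (cpt x + e *s dir r m)) (Q.T (d e) (c e)))"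
        unfolding det3_expand vector_add_component vector_smult_component
        by (intro pfun_id pfun_add pfun_diff pfun_mult pfun_S Q.pfun_T dc(1,2) pfun_const)
    qed (rule dc(5))
    then show ?thesis by (simp add: dc(3,4) dir)
  qed
  then have "det3 (cpt x) (e *s 0 + S (cpt x)) (Q.T e 1) = 0" for e by simp
  from Q.T_not_on_linear_pencil[OF xs this, of 0] show ?thesis by simp
qed

text \<open>If \<open>S z = k z\<close> with \<open>k\<close> nonzero, then the first order parts at \<open>z\<close> of both lines through \<open>v\<close>
  and its image can be compared. They are forced to agree modulo \<open>z\<close> for all directions, but in the
  direction \<open>v0\<close> tangent to the member through \<open>N z\<close>, the point \<open>S\<close> does not move to first order.\<close>

lemma base_point_image: "P.D (N (cpt x)) = 0 \<and> Cf (N (cpt x)) = 0"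
proof (rule ccontr)
  assume "\<not> ?thesis"
  then have nz: "P.D (N (cpt x)) \<noteq> 0 \<or> Cf (N (cpt x)) \<noteq> 0" by blast
  define z where "z = cpt x"
  define r0 m0 where "r0 = P.D (N z)" and "m0 = Cf (N z)"
  have rm: "r0 \<noteq> 0 \<or> m0 \<noteq> 0" using nz by (simp add: r0_def m0_def z_def)
  have "P.Tx (N z) \<noteq> 0" unfolding P.Tx_def r0_def[symmetric] m0_def[symmetric] by (rule P.T_nonzero[OF rm])
  then have Snz: "S z \<noteq> 0" unfolding S_def using NM matrix_0 by metis
  obtain k where k: "S z = k *s z" using parE[OF par_S cpt_nonzero] z_def by metis
  have k0: "k \<noteq> 0" using Snz k by auto
  have "\<exists>g. \<forall>v. \<exists>r. \<forall>e. S (z + e *s v) $ i = S z $ i + e * (\<Sum>j\<in>UNIV. g $ j * v $ j) + e ^ 2 * poly r e" for i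
    by (rule hp_taylor[OF hp_S[of i], of z]) blast
  then have H: "\<forall>i. \<exists>g. \<forall>v. \<exists>r. \<forall>e. S (z + e *s v) $ i = S z $ i + e * (\<Sum>j\<in>UNIV. g $ j * v $ j) + e ^ 2 * poly r e"
    by (rule allI)
  obtain G where G: "\<forall>i. \<forall>v. \<exists>r. \<forall>e. S (z + e *s v) $ i = S z $ i + e * (\<Sum>j\<in>UNIV. G i $ j * v $ j) + e ^ 2 * poly r e"
    using choice[OF H] ..
  define L where "L v = (\<chi> i. \<Sum>j\<in>UNIV. G i $ j * v $ j)" for v
  have Llin: "L (a *s u + b *s w) = a *s L u + b *s L w" for a b u w
    by (simp add: L_def vec_eq_iff sum_3 algebra_simps)
  have tay: "\<exists>U. (\<forall>i. pfun (\<lambda>e. U e $ i)) \<and> U 0 = L v \<and> (\<forall>e. S (z + e *s v) = k *s z + e *s U e)" for v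
  proof -
    have "\<forall>i. \<exists>r. \<forall>e. S (z + e *s v) $ i = S z $ i + e * (\<Sum>j\<in>UNIV. G i $ j * v $ j) + e ^ 2 * poly r e"
      by (rule allI) (rule G[rule_format])
    from choice[OF this]
    obtain r where r: "\<forall>i. \<forall>e. S (z + e *s v) $ i = S z $ i + e * (\<Sum>j\<in>UNIV. G i $ j * v $ j) + e ^ 2 * poly (r i) e" ..
    define U where "U e = (\<chi> i. L v $ i + e * poly (r i) e)" for e
    have "pfun (\<lambda>e. poly (r i) e)" for i unfolding pfun_def by blast
    then have "pfun (\<lambda>e. U e $ i)" for i unfolding U_def vec_lambda_beta by (intro pfun_add pfun_mult pfun_id pfun_const)
    moreover have "U 0 = L v" by (simp add: U_def vec_eq_iff)
    moreover have "S (z + e *s v) = k *s z + e *s U e" for e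
      by (simp add: vec_eq_iff r k U_def L_def algebra_simps power2_eq_square)
    ultimately show ?thesis by blast
  qed
  \<comment> \<open>The first order part in \<open>e\<close> of the determinant relation, after
    substituting \<open>S z = k z\<close>.\<close>
  have fact1: "det3 z (L (dir a b) - k *s dir a b) (Q.T a b) = 0" for a b
  proof -
    define v where "v = dir a b"
    obtain U where U: "\<And>i. pfun (\<lambda>e. U e $ i)" "U 0 = L v" "\<And>e. S (z + e *s v) = k *s z + e *s U e" using tay[of v] by blast
    obtain d c where dc: "pfun d" "pfun c" "d 0 = Q.polD (cpt x) v" "c 0 = polC (cpt x) v"
      "\<And>e. e \<noteq> 0 \<Longrightarrow> det3 (cpt x + e *s v) (S (cpt x + e *s v)) (Q.T (d e) (c e)) = 0"
      by (rule base_det[OF rt, of v], rule that)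
    let ?f = "\<lambda>e. det3 z (U e - k *s v) (Q.T (d e) (c e)) + e * det3 v (U e) (Q.T (d e) (c e))"
    have "?f 0 = 0"
    proof (rule pfun_zero_at[where f = ?f])
      show "pfun ?f" unfolding det3_expand vector_minus_component vector_smult_component
        by (intro pfun_id pfun_add pfun_diff pfun_mult U(1) Q.pfun_T dc(1,2) pfun_const)
      fix e :: "'k alg_closure" assume e: "e \<noteq> 0"
      have "det3 (z + e *s v) (k *s z + e *s u) w = e * (det3 z (u - k *s v) w + e * det3 v u w)" for u w
        unfolding det3_expand vector_add_component vector_minus_component vector_smult_component
        by (simp add: algebra_simps)
      then show "?f e = 0" using dc(5)[OF e] e unfolding z_def[symmetric] U(3) by simp
    qed
    then show ?thesis by (simp add: U(2) dc(3,4)) (simp add: v_def dir)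
  qed
  define l1 l0 where "l1 = L (dir 1 0) - k *s dir 1 0" and "l0 = L (dir 0 1) - k *s dir 0 1"
  have ll: "L (dir a b) - k *s dir a b = a *s l1 + b *s l0" for a b
    unfolding dir_lin[of a b] Llin l1_def l0_def by (simp add: vec_eq_iff algebra_simps)
  have "det3 (cpt x) (e *s l1 + l0) (Q.T e 1) = 0" for e using fact1[of e 1] unfolding ll z_def by simp
  from Q.T_not_on_linear_pencil[OF xs this] have pl: "par z (e *s l1 + l0)" for e unfolding z_def .
  have p0: "par z l0" using pl[of 0] by simp
  have p1: "par z l1" using par_diff[OF pl[of 1] p0] by simp
  have fact2: "par z (L (dir a b) - k *s dir a b)" for a b
    unfolding ll by (intro par_add par_scale p0 p1)
  \<comment> \<open>\<open>ph w = 0\<close> means that moving in the direction \<open>w\<close>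
    keeps the pencil parameters proportional to \<open>(r0, m0)\<close> to first order.\<close>
  define ph where "ph w = m0 * P.polD (N z) (N w) - r0 * polC (N z) (N w)" for w
  have phlin: "ph (dir a b) = a * ph (dir 1 0) + b * ph (dir 0 1)" for a b
    unfolding dir_lin[of a b] ph_def matrix_lin polcub_add polC_polcub by (simp add: algebra_simps)
  obtain a b where ab: "a \<noteq> 0 \<or> b \<noteq> 0" "ph (dir a b) = 0"
  proof (cases "ph (dir 1 0) = 0")
    case True
    then show ?thesis using that[of 1 0] by simp
  next
    case False
    have "ph (dir (ph (dir 0 1)) (- ph (dir 1 0))) = 0" unfolding phlin[of "ph (dir 0 1)" "- ph (dir 1 0)"] by simp
    then show ?thesis using that[of "ph (dir 0 1)" "- ph (dir 1 0)"] False by simp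
  qed
  define v where "v = dir a b"
  have v1: "v $ 1 = 0" unfolding v_def by (rule dir)
  have vnz: "v \<noteq> 0"
  proof
    assume "v = 0"
    then have "Q.polD (cpt x) 0 = a" "polC (cpt x) 0 = b" using dir(1,2)[of a b] by (simp_all add: v_def)
    then show False using ab(1) by (simp add: polcub_def polC_def)
  qed
  have npar: "\<not> par z v"
  proof
    assume "par z v"
    then have "z $ 1 * v $ i = z $ i * v $ 1" for i unfolding par_def by blast
    then have "v $ i = 0" for i by (simp add: v1 z_def)
    then show False using vnz by (simp add: vec_eq_iff)
  qed
  obtain U where U: "\<And>i. pfun (\<lambda>e. U e $ i)" "U 0 = L v" "\<And>e. S (z + e *s v) = k *s z + e *s U e" using tay[of v] by blast
  have "par z (L v)"
  proof (rule par_of_dot)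
    fix n assume n: "dot n z = 0"
    define h where "h w = dot n (M (P.T (w $ 1) (w $ 2)))" for w :: "'k alg_closure ^ 3"
    have hM: "hp UNIV 4 (\<lambda>w. M (P.T (w $ 1) (w $ 2)) $ i)" for i
    proof -
      have "hp UNIV 4 (\<lambda>w. \<Sum>j\<in>UNIV. acm A $ i $ j * P.T (w $ 1) (w $ 2) $ j)"
        by (intro hp_sum hp_smult P.hp_T12 csubring_UNIV UNIV_I)
      then show ?thesis unfolding matrix_vector_mult_def by simp
    qed
    have h: "hp UNIV (Suc 3) h"
    proof -
      have "hp UNIV 4 h" unfolding h_def[abs_def] dot_def
        by (intro hp.hp_add hp_smult hM csubring_UNIV UNIV_I)
      then show ?thesis by (simp add: eval_nat_numeral)
    qed
    define n' :: "'k alg_closure ^ 3" where "n' = vector [m0, - r0, 0]"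
    have n': "(\<Sum>j\<in>UNIV. n' $ j * w $ j) = m0 * w $ 1 - r0 * w $ 2" for w by (simp add: n'_def sum_3)
    have n'0: "n' \<noteq> 0" using rm by (auto simp: n'_def vec3_eq)
    have dots: "dot n (c *s w) = c * dot n w" for c w by (simp add: dot_def algebra_simps)
    have hz: "h w = 0" if "(\<Sum>j\<in>UNIV. n' $ j * w $ j) = 0" for w
    proof -
      have e: "m0 * w $ 1 = r0 * w $ 2" using that unfolding n' by simp
      obtain c where c: "w $ 1 = c * r0" "w $ 2 = c * m0"
      proof (cases "r0 = 0")
        case True
        then show ?thesis using that[of "w $ 2 / m0"] rm e by simp
      next
        case False
        then show ?thesis using that[of "w $ 1 / r0"] e by (simp add: field_simps)
      qed
      have "h w = c ^ 4 * dot n (M (P.T r0 m0))" unfolding h_def c P.T_hom matrix_scale dots ..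
      also have "M (P.T r0 m0) = S z" unfolding S_def P.Tx_def r0_def m0_def ..
      finally show ?thesis by (simp add: k dots n)
    qed
    \<comment> \<open>As a form in the pencil parameters, \<open>h\<close> vanishes at
      \<open>(r0, m0)\<close>, so the linear form \<open>n'\<close> divides it; along
      \<open>v\<close> that linear form is of order \<open>e^2\<close>.\<close>
    obtain g where g: "hp UNIV 3 g" "\<And>w. h w = (\<Sum>j\<in>UNIV. n' $ j * w $ j) * g w"
      by (rule hp_divide_linear[OF h n'0 hz], assumption, rule that)
    define d where "d e = P.D (N z + e *s N v)" for e
    define c where "c e = Cf (N z + e *s N v)" for e
    define q where "q e = m0 * (P.polD (N v) (N z) + e * P.D (N v)) - r0 * (polC (N v) (N z) + e * Cf (N v))" for e
    have mN: "N (z + e *s v) = N z + e *s N v" for e using matrix_lin[of "acm A'" 1 z e v] by simp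
    have dc: "m0 * d e - r0 * c e = e ^ 2 * q e" for e
    proof -
      have "m0 * d e - r0 * c e = e * ph v + e ^ 2 * q e"
        unfolding d_def c_def Cf_cubf[of "N z + e *s N v"] cubf_expand q_def ph_def polC_polcub
        unfolding Cf_cubf[symmetric] r0_def[symmetric] m0_def[symmetric]
        by (simp add: algebra_simps power2_eq_square power3_eq_cube)
      then show ?thesis using ab(2) by (simp add: v_def)
    qed
    have pd: "pfun d" "pfun c" "pfun q"
      unfolding d_def[abs_def] c_def[abs_def] q_def[abs_def] cubf_def quad_def Cf_def vector_add_component vector_smult_component
      by (intro pfun_intros)+
    have vc: "pfun (\<lambda>e. vector [d e, c e, 0] $ i)" for i :: 3
      using exhaust_3[of i] pd pfun_const[of 0] by auto
    let ?g = "\<lambda>e. g (vector [d e, c e, 0])"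
    have pg: "pfun ?g" by (rule pfun_hp[OF g(1) vc])
    have key: "e * dot n (U e) = e * (e * q e * ?g e)" for e
    proof -
      have "dot n (S (z + e *s v)) = h (vector [d e, c e, 0])"
        by (simp add: h_def S_def P.Tx_def mN d_def c_def)
      also have "\<dots> = e * (e * q e * ?g e)" unfolding g(2) n' by (simp add: dc power2_eq_square)
      also have "dot n (S (z + e *s v)) = k * dot n z + e * dot n (U e)"
        unfolding U(3) by (simp add: dot_def algebra_simps)
      finally show ?thesis using n by simp
    qed
    have "dot n (U 0) - 0 * q 0 * ?g 0 = 0"
    proof (rule pfun_zero_at[where f = "\<lambda>e. dot n (U e) - e * q e * ?g e"])
      show "pfun (\<lambda>e. dot n (U e) - e * q e * ?g e)" unfolding dot_def
        by (intro pfun_id pfun_add pfun_diff pfun_mult U(1) pd pg pfun_const)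
      show "dot n (U e) - e * q e * ?g e = 0" if "e \<noteq> 0" for e using key[of e] that by simp
    qed
    then show "dot n (L v) = 0" by (simp add: U(2))
  qed
  \<comment> \<open>Modulo \<open>z\<close>, both \<open>L v\<close> and \<open>L v - k v\<close>
    vanish, hence so does \<open>k v\<close>.\<close>
  from par_diff[OF this fact2[of a b, folded v_def]] have "par z (k *s v)" by simp
  from par_scale[OF this, of "1 / k"] have "par z v" using k0 by simp
  then show False using npar by blast
qed

end

text \<open>The preimage of \<open>cpt t'\<close> is a base point of the first pencil. It is not the
  rational one, because a matrix over the ground field preserves rational points and
  \<open>t'\<close> is not rational.\<close>

lemma orbit_related:
  obtains j where "j < 8" "par (M (cpt (cj t j))) (cpt t')"
proof -
  have rt: "poly (P9 t') t' = 0" unfolding P9_root_iff by (intro disjI2 exI[of _ 0]) simp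
  have ts: "t' \<noteq> Q.s" using sn_not_conj[OF Q.deg8, of 0] by auto
  define w where "w = N (cpt t')"
  have w: "P.D w = 0" "Cf w = 0" using base_point_image[OF rt ts] by (simp_all add: w_def)
  have Mw: "M w = cpt t'" unfolding w_def by (rule MN)
  have w1: "w $ 1 \<noteq> 0"
  proof
    assume 1: "w $ 1 = 0"
    then have 2: "w $ 2 = 0" using w(2) by (simp add: Cf_def)
    then have "w $ 3 = 0" using 1 w(1) by (simp add: cubf_def quad_def)
    then have "w = 0" using 1 2 by (simp add: vec3_eq)
    then show False using Mw matrix_0[of "acm A"] by simp
  qed
  define y where "y = w $ 2 / w $ 1"
  have wy: "w = w $ 1 *s cpt y" unfolding y_def by (rule cpt_of_Cf[OF w(2) w1])
  have "P.Fp 0 (- 1) (w $ 1 *s cpt y) = 0" unfolding wy[symmetric] by (simp add: P.Fp_def w)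
  then have "poly (P9 t) y = 0" unfolding P.Fp_scale P.Fp_cpt using w1 by simp
  then have y: "y = P.s \<or> (\<exists>i<8. y = cj t i)" unfolding P9_root_iff .
  have Mz: "cpt t' = w $ 1 *s M (cpt y)" using Mw wy matrix_scale by metis
  show ?thesis
  proof (cases "y = P.s")
    case True
    obtain a where a: "y = to_ac a" using True P.s_rational by auto
    have "cpt y = (\<chi> i. to_ac (cpt a $ i))" unfolding vec3_eq a by (simp add: cf_def)
    then have rat: "M (cpt y) $ i \<in> range to_ac" for i
      unfolding matrix_vector_mult_def acm_def by (simp add: sum_3) (intro csubringD(3,6) csubring_to_ac rangeI)
    have "cpt t' $ 1 = w $ 1 * M (cpt y) $ 1" "cpt t' $ 2 = w $ 1 * M (cpt y) $ 2" by (subst Mz, simp)+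
    then have e: "1 = w $ 1 * M (cpt y) $ 1" "t' = w $ 1 * M (cpt y) $ 2" by simp_all
    then have "t' * M (cpt y) $ 1 = M (cpt y) $ 2" by (simp add: mult_ac)
    then have f: "cj (t' * M (cpt y) $ 1) 1 = t' * M (cpt y) $ 1" using cj_to_ac[OF rat[of 2], of 1] by (simp only:)
    then have "cj t' 1 * M (cpt y) $ 1 = t' * M (cpt y) $ 1"
      unfolding cj_mult cj_to_ac[OF rat[of 1], of 1] .
    moreover have "M (cpt y) $ 1 \<noteq> 0" using e(1) by auto
    ultimately have "cj t' 1 = t'" by simp
    then have "t' \<in> range to_ac" by (simp only: range_to_ac_cj)
    then show ?thesis using deg8_not_rational[OF Q.deg8, of 0] by simp
  next
    case False
    then obtain i where i: "i < 8" "y = cj t i" using y by blast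
    have "par (M (cpt (cj t i))) (cpt t')" unfolding i(2)[symmetric] Mz by (rule par_smult_self)
    then show ?thesis by (rule that[OF i(1)])
  qed
qed

end

subsection \<open>Projectively equivalent orbits\<close>

lemma hp_conj:
  assumes "hp (range to_ac) d f"
  shows "cj (f v) n = f (\<chi> k. cj (v $ k) n)"
  using assms
proof (induction rule: hp.induct)
  case (hp_const c)
  then show ?case by (rule cj_to_ac)
next
  case (hp_zero d)
  show ?case by (rule cj_to_ac) (rule csubringD(1)[OF csubring_to_ac])
qed (simp_all add: cj_mult cj_add)

lemma rational_divide: "a \<in> range to_ac \<Longrightarrow> b \<in> range to_ac \<Longrightarrow> a / b \<in> range to_ac"
  for a b :: "'k::{field,finite} alg_closure"
  unfolding range_to_ac_iff by (simp add: power_divide)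

lemma Cf_expand: "Cf (u + x *s w) = Cf u + x * polC u w + x ^ 2 * polC w u + x ^ 3 * Cf w"
  unfolding Cf_cubf polC_polcub by (rule cubf_expand)

text \<open>A linear map preserving the cubic fixes the cusp and the cuspidal tangent, so it acts on
  the parameter by an affine map. Compatibility with the collinearity rule, sum -1, leaves one
  degree of freedom: translation part \<open>b\<close> forces slope \<open>1 + 3 b\<close>.\<close>

lemma cusp_automorphism:
  fixes M N :: "'k::{field,finite} alg_closure ^ 3 ^ 3"
  assumes MN: "\<And>w. M *v (N *v w) = w" and C: "\<And>w. Cf (M *v w) = k * Cf w" "k \<noteq> 0"
    and rat: "\<And>i j. M $ i $ j \<in> range to_ac" and p: "par (M *v cpt x) (cpt y)"
  obtains b where "b \<in> range to_ac" "y = (1 + 3 * b) * x + b"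
proof -
  have pol: "polC (M *v u) (M *v w) = k * polC u w" for u w
  proof -
    have "Cf (M *v u) + z * polC (M *v u) (M *v w) + z ^ 2 * polC (M *v w) (M *v u) + z ^ 3 * Cf (M *v w)
      = k * Cf u + z * (k * polC u w) + z ^ 2 * (k * polC w u) + z ^ 3 * (k * Cf w)" for z
    proof -
      have "M *v (u + z *s w) = M *v u + z *s (M *v w)" using matrix_lin[of M 1 u z w] by simp
      then have "Cf (M *v u + z *s (M *v w)) = k * Cf (u + z *s w)" using C(1)[of "u + z *s w"] by simp
      then show ?thesis unfolding Cf_expand by (simp add: algebra_simps)
    qed
    from cubic_coeffs[OF infinite_alg_closed this] show ?thesis by blast
  qed
  \<comment> \<open>The image of the cusp, the point where all polar values of the cubic
    vanish.\<close>
  define u where "u = M *v axis 3 1"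
  have "polC (axis 3 1) w = 0" for w :: "'k alg_closure ^ 3" by (simp add: polC_def)
  then have "polC u w = 0" for w using pol[of "axis 3 1" "N *v w"] unfolding MN u_def by simp
  from this[of "axis 3 1"] this[of "axis 1 1"] have u: "u $ 1 = 0" "u $ 2 = 0"
    by (simp_all add: polC_def axis_def)
  have sq: "u $ 3 * (M *v w) $ 1 ^ 2 = k * w $ 1 ^ 2" for w
    using pol[of w "axis 3 1"] unfolding u_def[symmetric] polC_def u by simp
  have comp: "(M *v w) $ i = M $ i $ 1 * w $ 1 + M $ i $ 2 * w $ 2 + M $ i $ 3 * w $ 3" for w i
    by (simp add: matrix_vector_mult_def sum_3)
  have ax: "axis 2 1 $ (1::3) = (0 :: 'k alg_closure)" "axis 2 1 $ (3::3) = (0 :: 'k alg_closure)" by (auto simp: axis_def)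
  have M3: "u $ i = M $ i $ 3" for i unfolding u_def comp by simp
  have u3: "u $ 3 \<noteq> 0" using sq[of "cpt 0"] C(2) by auto
  have M12: "M $ 1 $ 2 = 0" using sq[of "axis 2 1"] u3 unfolding comp ax by simp
  define a d b e f c where "a = M $ 1 $ 1" and "d = M $ 2 $ 1" and "b = M $ 2 $ 2" and "e = M $ 3 $ 1"
    and "f = M $ 3 $ 2" and "c = M $ 3 $ 3"
  have cp: "(M *v cpt z) $ 1 = a" "(M *v cpt z) $ 2 = d + b * z" "(M *v cpt z) $ 3 = e + f * z + c * cf z" for z
    unfolding comp M3[symmetric] u M12 by (simp_all add: a_def b_def d_def e_def f_def c_def M3)
  have a: "a \<noteq> 0" using sq[of "cpt 0"] C(2) unfolding cp by auto
  have c: "c \<noteq> 0" using u3 M3[of 3] by (simp add: c_def)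
  have "(a ^ 2 * e - d ^ 3 - d ^ 2 * a) + z * (a ^ 2 * f - 3 * d ^ 2 * b - 2 * d * b * a)
      + z ^ 2 * (a ^ 2 * c - 3 * d * b ^ 2 - b ^ 2 * a) + z ^ 3 * (a ^ 2 * c - b ^ 3)
      = 0 + z * 0 + z ^ 2 * 0 + z ^ 3 * 0" for z
  proof -
    have "Cf (M *v cpt z) = 0" unfolding C(1) by simp
    then show ?thesis unfolding Cf_def cp by (simp add: cf_def algebra_simps power2_eq_square power3_eq_cube)
  qed
  from cubic_coeffs[OF infinite_alg_closed this] have co: "a ^ 2 * c - 3 * d * b ^ 2 - b ^ 2 * a = 0" "a ^ 2 * c - b ^ 3 = 0" by blast+
  have b: "b \<noteq> 0" using co(2) a c by auto
  have "b ^ 2 * (b - 3 * d - a) = 0" using co by (simp add: algebra_simps power2_eq_square power3_eq_cube)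
  then have "b - 3 * d = a" using b by simp
  then have ba: "b = a + 3 * d" by (simp only: diff_eq_eq)
  have "a * y = (d + b * x) * 1"
    using p[unfolded par_def, rule_format, of 1 2] unfolding cp by simp
  moreover define z where "z = d / a"
  have d: "d = a * z" unfolding z_def using a by simp
  ultimately have "a * y = a * ((1 + 3 * z) * x + z)" unfolding ba d by (simp add: algebra_simps)
  then have "y = (1 + 3 * z) * x + z" using a by (simp only: mult_cancel_left) simp
  moreover have "z \<in> range to_ac" unfolding z_def d_def a_def by (intro rational_divide rat)
  ultimately show ?thesis using that by blast
qed

definition moves :: "'k::{field,finite} ^ 3 ^ 3 \<Rightarrow> 'k ^ 3 ^ 3 \<Rightarrow> 'k alg_closure \<Rightarrow> 'k alg_closure \<Rightarrow> bool" where
  "moves A A' t t' \<longleftrightarrow> A ** A' = mat 1 \<and> A' ** A = mat 1 \<and> par (acm A *v cpt t) (cpt t')"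

lemma acm_rational: "acm A $ i $ j \<in> range to_ac" by (simp add: acm_def)

lemma conj_cpt: "(\<chi> k. cj (cpt t $ k) n) = cpt (cj t n)"
  unfolding vec3_eq cf_def
  by (simp add: cj_to_ac[OF csubringD(2)[OF csubring_to_ac]] cf_def cj_add) (simp add: cj_def power_mult[symmetric] mult.commute)

context cusp_pencil
begin

text \<open>Pulling the cuspidal cubic back along \<open>A\<close> gives a cubic over the ground
  field through \<open>cpt t\<close>, hence through all conjugates, so a member of the pencil. Its
  parameters are determined by the cubic and therefore fixed by Frobenius.\<close>

lemma moved_cusp_member:
  assumes "moves A A' t t'"
  obtains r m where "r \<in> range to_ac" "m \<in> range to_ac" "r \<noteq> 0 \<or> m \<noteq> 0" "\<And>v. Cf (acm A *v v) = Fp r m v"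
proof -
  have A: "A ** A' = mat 1" "A' ** A = mat 1" and par: "par (acm A *v cpt t) (cpt t')" using assms by (auto simp: moves_def)
  define f where "f v = Cf (acm A *v v)" for v
  have "hp (range to_ac) 1 (\<lambda>v. (acm A *v v) $ i)" for i
    unfolding matrix_vector_mult_def vec_lambda_beta by (rule hp_linear[OF csubring_to_ac acm_rational])
  from hp_comp[OF hp_Cf[OF csubring_to_ac] this csubring_to_ac] have hf: "hp (range to_ac) 3 f"
    by (simp add: f_def[abs_def])
  obtain F where F: "form 3 F" "\<And>v. insertion id v F = f v"
    by (rule hp_UNIV_form[OF hp_mono[OF hf subset_UNIV]], rule that)
  have "acm A *v cpt t \<noteq> 0"
  proof
    assume "acm A *v cpt t = 0"
    then have "acm A' *v (acm A *v cpt t) = 0" by (simp only: matrix_0)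
    then show False unfolding acm_inverse[OF A(2)] by simp
  qed
  from parE[OF par_sym[OF par] cpt_nonzero] obtain c where c: "acm A *v cpt t = c *s cpt t'" .
  have f0: "f (cpt t) = 0" unfolding f_def c Cf_scale by simp
  have z: "f (cpt (cj t i)) = 0" for i
    using hp_conj[OF hf, of "cpt t" i] unfolding conj_cpt f0 cj_to_ac[OF csubringD(1)[OF csubring_to_ac]] by (rule sym)
  have "f (acm A' *v axis 2 1) \<noteq> 0"
  proof -
    have "axis 2 1 $ (1::3) = (0 :: 'k alg_closure)" "axis 2 1 $ (3::3) = (0 :: 'k alg_closure)" by (auto simp: axis_def)
    then show ?thesis unfolding f_def acm_inverse[OF A(1)] by (simp add: Cf_def)
  qed
  then have fn: "\<exists>v. insertion id v F \<noteq> 0" using F(2) by auto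
  have "F \<in> cubics_through (orb t)" unfolding cubics_through_def
  proof (intro CollectI conjI ballI F(1))
    show "F \<noteq> 0" unfolding tpoly_nonzero_iff by (rule fn)
    fix x assume "x \<in> orb t"
    then obtain i where i: "x = proj_class (cpt (cj t i))" by (rule orb_cases)
    show "vanishes_at F x" unfolding i vanishes_at_class[OF F(1) cpt_nonzero] F(2) by (rule z)
  qed
  then obtain r m where rm: "r \<noteq> 0 \<or> m \<noteq> 0" "\<And>v. insertion id v F = Fp r m v" by (rule cubics_through_orb) (rule that)
  have fF: "f v = Fp r m v" for v using rm(2) F(2) by simp
  have "Fp (r - cj r 1) (m - cj m 1) w = 0" for w
  proof -
    define v where "v = (\<chi> k. (SOME y. cj y 1 = w $ k))"
    have "cj (v $ k) 1 = w $ k" for k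
    proof -
      obtain y where "y ^ (CARD('k) ^ 1) = w $ k" using frob_pow_surj by blast
      then have "cj y 1 = w $ k" by (simp only: cj_def)
      then show ?thesis unfolding v_def vec_lambda_beta by (rule someI)
    qed
    then have w: "(\<chi> k. cj (v $ k) 1) = w" by (simp add: vec_eq_iff)
    have "cj (Fp r m v) 1 = Fp r m w" using hp_conj[OF hf, of v 1] unfolding w fF .
    moreover have "cj (Fp r m v) 1 = cj r 1 * Cf w - cj m 1 * D w"
      unfolding Fp_def cj_diff cj_mult hp_conj[OF hp_D] hp_conj[OF hp_Cf[OF csubring_to_ac]] w ..
    ultimately have "r * Cf w - m * D w = cj r 1 * Cf w - cj m 1 * D w" unfolding Fp_def by (simp only:)
    moreover have "(r - cj r 1) * Cf w - (m - cj m 1) * D w = (r * Cf w - m * D w) - (cj r 1 * Cf w - cj m 1 * D w)"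
      by (simp only: left_diff_distrib) simp
    ultimately show ?thesis unfolding Fp_def by (simp only: diff_self)
  qed
  then have "r - cj r 1 = 0 \<and> m - cj m 1 = 0" using Fp_nonzero[of "r - cj r 1" "m - cj m 1"] by blast
  then have "cj r 1 = r" "cj m 1 = m" by simp_all
  then have "r \<in> range to_ac" "m \<in> range to_ac" unfolding range_to_ac_cj .
  then show ?thesis using that rm(1) fF unfolding f_def by blast
qed

text \<open>The \<open>t'\<close> are grouped by the member that the matrix carries to the cuspidal
  cubic. Two matrices in one group differ by an automorphism of that cubic, so a group has at most
  \<open>q\<close> elements; up to scaling the rational members are \<open>(1, 0)\<close> and the
  \<open>q\<close> pairs \<open>(r, 1)\<close>.\<close>

lemma card_moved:
  "finite {t'. \<exists>A A'. moves A A' t t'} \<and> card {t'. \<exists>A A'. moves A A' t t'} \<le> (CARD('k) + 1) * CARD('k)"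
proof -
  let ?R = "range (to_ac :: 'k \<Rightarrow> 'k alg_closure)"
  have R: "finite ?R" "card ?R = CARD('k)" by (simp_all add: card_image inj_def)
  define W where "W r m = {t'. \<exists>A A' c. moves A A' t t' \<and> c \<noteq> 0 \<and> (\<forall>v. Cf (acm A *v v) = c * Fp r m v)}" for r m
  have W: "\<exists>z. W r m \<subseteq> (\<lambda>b. (1 + 3 * b) * z + b) ` ?R" for r m
  proof (cases "W r m = {}")
    case False
    then obtain z where "z \<in> W r m" by blast
    then obtain A A' c where A: "moves A A' t z" "c \<noteq> 0" "\<And>v. Cf (acm A *v v) = c * Fp r m v" by (auto simp: W_def)
    have "W r m \<subseteq> (\<lambda>b. (1 + 3 * b) * z + b) ` ?R"
    proof
      fix y assume "y \<in> W r m"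
      then obtain E E' k where E: "moves E E' t y" "k \<noteq> 0" "\<And>v. Cf (acm E *v v) = k * Fp r m v" by (auto simp: W_def)
      have AA: "A ** A' = mat 1" "A' ** A = mat 1" "par (acm A *v cpt t) (cpt z)"
        and EE: "E ** E' = mat 1" "E' ** E = mat 1" "par (acm E *v cpt t) (cpt y)"
        using A(1) E(1) by (auto simp: moves_def)
      have m: "acm (E ** A') *v w = acm E *v (acm A' *v w)" for w
        unfolding acm_mult by (simp add: matrix_vector_mul_assoc)
      have m': "acm (A ** E') *v w = acm A *v (acm E' *v w)" for w
        unfolding acm_mult by (simp add: matrix_vector_mul_assoc)
      obtain b where b: "b \<in> ?R" "y = (1 + 3 * b) * z + b"
      proof (rule cusp_automorphism[where M = "acm (E ** A')" and N = "acm (A ** E')" and k = "k / c" and x = z and y = y])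
        show "acm (E ** A') *v (acm (A ** E') *v w) = w" for w
          unfolding m m' acm_inverse[OF AA(2)] acm_inverse[OF EE(1)] ..
        show "Cf (acm (E ** A') *v w) = k / c * Cf w" for w
        proof -
          have "c * Fp r m (acm A' *v w) = Cf w" unfolding A(3)[symmetric] acm_inverse[OF AA(1)] ..
          then show ?thesis unfolding m E(3) using A(2) by (simp add: field_simps)
        qed
        show "k / c \<noteq> 0" using A(2) E(2) by simp
        show "acm (E ** A') $ i $ j \<in> ?R" for i j by (rule acm_rational)
        obtain d where d: "acm A *v cpt t = d *s cpt z" using parE[OF par_sym[OF AA(3)] cpt_nonzero] .
        have ct: "cpt t = d *s (acm A' *v cpt z)" using arg_cong[OF d, of "\<lambda>v. acm A' *v v"]
          unfolding acm_inverse[OF AA(2)] matrix_scale .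
        have e: "acm E *v cpt t = d *s (acm (E ** A') *v cpt z)" 
          using arg_cong[OF ct, of "\<lambda>v. acm E *v v"] unfolding matrix_scale m[symmetric] .
        have d0: "d \<noteq> 0"
        proof
          assume "d = 0"
          then have "cpt t = 0" using ct by simp
          then show False by simp
        qed
        have ez: "acm (E ** A') *v cpt z = (1 / d) *s (acm E *v cpt t)" unfolding e using d0 by (simp add: vec_eq_iff)
        show "par (acm (E ** A') *v cpt z) (cpt y)" unfolding ez by (rule par_smult[OF EE(3)])
      qed (rule that)
      then show "y \<in> (\<lambda>b. (1 + 3 * b) * z + b) ` ?R" by blast
    qed
    then show ?thesis by blast
  qed simp
  have cW: "finite (W r m) \<and> card (W r m) \<le> CARD('k)" for r m
  proof -
    obtain z where z: "W r m \<subseteq> (\<lambda>b. (1 + 3 * b) * z + b) ` ?R" using W by blast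
    have "finite (W r m)" by (rule finite_subset[OF z finite_imageI[OF R(1)]])
    moreover have "card (W r m) \<le> card ((\<lambda>b. (1 + 3 * b) * z + b) ` ?R)" by (rule card_mono[OF finite_imageI[OF R(1)] z])
    moreover have "card ((\<lambda>b. (1 + 3 * b) * z + b) ` ?R) \<le> CARD('k)"
      using card_image_le[OF R(1), of "\<lambda>b. (1 + 3 * b) * z + b"] unfolding R(2) .
    ultimately show ?thesis by linarith
  qed
  have sub: "{t'. \<exists>A A'. moves A A' t t'} \<subseteq> W 1 0 \<union> (\<Union>r\<in>?R. W r 1)"
  proof
    fix t' assume "t' \<in> {t'. \<exists>A A'. moves A A' t t'}"
    then obtain A A' where mv: "moves A A' t t'" by blast
    obtain r m where rm: "r \<in> ?R" "m \<in> ?R" "r \<noteq> 0 \<or> m \<noteq> 0" "\<And>v. Cf (acm A *v v) = Fp r m v"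
      by (rule moved_cusp_member[OF mv], rule that)
    show "t' \<in> W 1 0 \<union> (\<Union>r\<in>?R. W r 1)"
    proof (cases "m = 0")
      case True
      have "Cf (acm A *v v) = r * Fp 1 0 v" for v unfolding rm(4) True Fp_def by simp
      then have "t' \<in> W 1 0" unfolding W_def
        by (intro CollectI exI[of _ A] exI[of _ A'] exI[of _ r] conjI allI mv) (use rm(3) True in auto)
      then show ?thesis by blast
    next
      case False
      have "Cf (acm A *v v) = m * Fp (r / m) 1 v" for v unfolding rm(4) Fp_def using False by (simp add: field_simps)
      then have "t' \<in> W (r / m) 1" unfolding W_def
        by (intro CollectI exI[of _ A] exI[of _ A'] exI[of _ m] conjI allI mv False)
      then show ?thesis using rational_divide[OF rm(1,2)] by blast
    qed
  qed
  have fin: "finite (W 1 0 \<union> (\<Union>r\<in>?R. W r 1))" using cW R(1) by simp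
  have "card (W 1 0 \<union> (\<Union>r\<in>?R. W r 1)) \<le> card (W 1 0) + card (\<Union>r\<in>?R. W r 1)" by (rule card_Un_le)
  also have "card (\<Union>r\<in>?R. W r 1) \<le> (\<Sum>r\<in>?R. card (W r 1))" by (rule card_UN_le[OF R(1)])
  also have "\<dots> \<le> (\<Sum>r\<in>?R. CARD('k))" using cW by (intro sum_mono) blast
  also have "(\<Sum>r\<in>?R. CARD('k)) = CARD('k) * CARD('k)" by (simp add: R(2))
  also have "card (W 1 0) \<le> CARD('k)" using cW by blast
  finally have "card (W 1 0 \<union> (\<Union>r\<in>?R. W r 1)) \<le> (CARD('k) + 1) * CARD('k)" by simp
  then show ?thesis using rev_finite_subset[OF fin sub] card_mono[OF fin sub] by linarith
qed

end

subsection \<open>Counting classes\<close>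

text \<open>The trace condition is a polynomial equation of degree at most \<open>q^7\<close>, and
  the other excluded parameters lie in the field with \<open>q^4\<close> elements.\<close>

lemma card_good:
  "finite {t :: 'k::{field,finite} alg_closure. good t}"
  "CARD('k) ^ 8 \<le> card {t :: 'k alg_closure. good t} + CARD('k) ^ 7 + CARD('k) ^ 4"
proof -
  let ?q = "CARD('k)"
  define F where "F n = {t :: 'k alg_closure. t ^ (?q ^ n) = t}" for n
  define Z where "Z = {t :: 'k alg_closure. 3 * tr8 t + 8 = 0}"
  have q: "?q \<ge> 2" by (rule card_field_ge_2)
  have F: "card (F n) = ?q ^ n" if "n > 0" for n unfolding F_def by (rule card_frob_fixed[OF that])
  have finF: "finite (F n)" if "n > 0" for n using F[OF that] q by (intro card_ge_0_finite) simp
  have Z: "finite Z \<and> card Z \<le> ?q ^ 7"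
  proof (cases "(3 :: 'k alg_closure) = 0")
    case True
    \<comment> \<open>In characteristic 3 one has \<open>8 = - 1\<close>, so the trace condition
      excludes no parameter.\<close>
    have e: "(8 :: 'k alg_closure) + 1 = 3 * 3" by simp
    have "(8 :: 'k alg_closure) \<noteq> 0"
    proof
      assume h: "(8 :: 'k alg_closure) = 0"
      from e show False unfolding h True by simp
    qed
    then have "Z = {}" using True by (simp add: Z_def)
    then show ?thesis by simp
  next
    case False
    define p :: "'k alg_closure poly" where "p = [:8:] + smult 3 (\<Sum>i<8. monom 1 (?q ^ i))"
    have pp: "poly p x = 3 * tr8 x + 8" for x
      by (simp add: p_def poly_sum poly_monom tr8_def cj_def)
    have "coeff p (?q ^ 7) = 3 * (\<Sum>i<8::nat. if i = 7 then 1 else 0)"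
    proof -
      have "coeff (\<Sum>i<8. monom (1 :: 'k alg_closure) (?q ^ i)) (?q ^ 7) = (\<Sum>i<8::nat. if i = 7 then 1 else 0)"
        unfolding coeff_sum coeff_monom
      proof (rule sum.cong)
        fix i :: nat
        show "(if ?q ^ i = ?q ^ 7 then 1 else 0) = (if i = 7 then 1 else (0 :: 'k alg_closure))"
          using power_inject_exp[of ?q i 7] q by simp
      qed simp
      moreover have "coeff [:8 :: 'k alg_closure:] (?q ^ 7) = 0" using q by (cases "?q ^ 7") auto
      ultimately show ?thesis by (simp add: p_def)
    qed
    then have c: "coeff p (?q ^ 7) \<noteq> 0" using False by simp
    then have p0: "p \<noteq> 0" by auto
    have "degree p \<le> ?q ^ 7" unfolding p_def
    proof (intro degree_add_le order.trans[OF degree_smult_le] degree_sum_le)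
      fix i :: nat assume "i \<in> {..<8}"
      then have "?q ^ i \<le> ?q ^ 7" using q by (intro power_increasing) auto
      then show "degree (monom (1 :: 'k alg_closure) (?q ^ i)) \<le> ?q ^ 7" using degree_monom_le order.trans by blast
    qed simp_all
    moreover have "Z = {x. poly p x = 0}" by (simp add: Z_def pp)
    ultimately show ?thesis using poly_roots_finite[OF p0] card_poly_roots_bound[OF p0] by simp
  qed
  have sub: "{t :: 'k alg_closure. good t} \<subseteq> F 8" by (auto simp: good_def deg8_def cj_def F_def)
  then show fin: "finite {t :: 'k alg_closure. good t}" using finF[of 8] finite_subset by auto
  have "F 8 \<subseteq> {t :: 'k alg_closure. good t} \<union> Z \<union> F 4" by (auto simp: good_def deg8_def cj_def F_def Z_def)
  then have "card (F 8) \<le> card ({t :: 'k alg_closure. good t} \<union> Z \<union> F 4)"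
    using fin Z finF[of 4] by (intro card_mono) auto
  also have "\<dots> \<le> card ({t :: 'k alg_closure. good t} \<union> Z) + card (F 4)" by (rule card_Un_le)
  also have "card ({t :: 'k alg_closure. good t} \<union> Z) \<le> card {t :: 'k alg_closure. good t} + card Z" by (rule card_Un_le)
  finally show "?q ^ 8 \<le> card {t :: 'k alg_closure. good t} + ?q ^ 7 + ?q ^ 4" using F[of 8] F[of 4] Z by simp
qed

text \<open>The coefficients of \<open>D\<close> are quantified away, so that one triple can be
  chosen for each \<open>t\<close> independently of how its pencil is written.\<close>

definition cusp_bertini :: "'k::{field,finite} alg_closure \<Rightarrow> 'k triple \<Rightarrow> bool" where
  "cusp_bertini t F \<longleftrightarrow> birational F \<and> (\<exists>c0 c1 c2 c3 b1 b2 a0 a1. cusp_pencil t c0 c1 c2 c3 b1 b2 a0 a1 \<and>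
     (\<forall>v. ev F v = cusp_pencil.B t c0 c1 c2 c3 b1 b2 a0 a1 v))"

lemma cusp_bertiniE:
  assumes "cusp_bertini t F"
  obtains c0 c1 c2 c3 b1 b2 a0 a1 where "birational F" "cusp_pencil t c0 c1 c2 c3 b1 b2 a0 a1"
    "\<And>v. ev F v = cusp_pencil.B t c0 c1 c2 c3 b1 b2 a0 a1 v"
  using assms unfolding cusp_bertini_def by (elim exE conjE) (rule that; (assumption | erule spec))

lemma cusp_bertini_exists:
  assumes "good t"
  shows "\<exists>F. cusp_bertini t F"
proof -
  from pencil_coeffs_exist[OF goodD(1)[OF assms]]
  obtain c0 c1 c2 c3 b1 b2 a0 a1 where c: "{c0, c1, c2, c3, b1, b2, a0, a1} \<subseteq> range to_ac"
    "\<forall>x. cubf c0 c1 0 c2 b1 a0 c3 b2 a1 1 (cpt x) = poly (P9 t) x"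
    by (elim exE conjE) (rule that)
  have cp: "cusp_pencil t c0 c1 c2 c3 b1 b2 a0 a1"
    by (rule cusp_pencil.intro[OF assms c(1) c(2)[rule_format]])
  obtain F where F: "birational F" "\<And>v. ev F v = cusp_pencil.B t c0 c1 c2 c3 b1 b2 a0 a1 v"
    by (rule cusp_pencil.bertini_triple[OF cp], rule that)
  show ?thesis unfolding cusp_bertini_def
    by (rule exI[of _ F], intro conjI F(1) exI, rule cp, rule allI, rule F(2))
qed

lemma cusp_bertini_involution:
  assumes "cusp_bertini t F"
  shows "F \<in> triples" "ratmap_rel `` {F} \<in> bertini_involutions"
proof -
  obtain c0 c1 c2 c3 b1 b2 a0 a1 where c: "birational F" "cusp_pencil t c0 c1 c2 c3 b1 b2 a0 a1"
    "\<And>v. ev F v = cusp_pencil.B t c0 c1 c2 c3 b1 b2 a0 a1 v"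
    by (rule cusp_bertiniE[OF assms], rule that)
  show "F \<in> triples" using c(1) by (simp add: birational_def)
  have g: "good t" by (rule cusp_pencil.good[OF c(2)])
  show "ratmap_rel `` {F} \<in> bertini_involutions"
    unfolding bertini_involutions_def
    by (intro CollectI exI[of _ "orb t"] conjI degree8_orb general_points_orb goodD(1) g cusp_pencil.bertini_involution[OF c(2,1,3)])
qed

lemma cusp_bertini_conj:
  assumes "cusp_bertini t F" "cusp_bertini t' F'" "(ratmap_rel `` {F}, ratmap_rel `` {F'}) \<in> bertini_conj"
  obtains j A A' where "j < 8" "moves A A' (cj t j) t'"
proof -
  obtain c0 c1 c2 c3 b1 b2 a0 a1 where c: "cusp_pencil t c0 c1 c2 c3 b1 b2 a0 a1"
    "\<And>v. ev F v = cusp_pencil.B t c0 c1 c2 c3 b1 b2 a0 a1 v" by (rule cusp_bertiniE[OF assms(1)], rule that)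
  obtain d0 d1 d2 d3 e1 e2 f0 f1 where d: "cusp_pencil t' d0 d1 d2 d3 e1 e2 f0 f1"
    "\<And>v. ev F' v = cusp_pencil.B t' d0 d1 d2 d3 e1 e2 f0 f1 v" by (rule cusp_bertiniE[OF assms(2)], rule that)
  obtain A A' where A: "A ** A' = mat 1" "A' ** A = mat 1" "\<And>v. par (ev F' (acm A *v v)) (acm A *v ev F v)"
    by (rule bertini_conjD[OF assms(3) refl refl cusp_bertini_involution(1)[OF assms(1)] cusp_bertini_involution(1)[OF assms(2)]], rule that)
  have pp: "pencil_pair t c0 c1 c2 c3 b1 b2 a0 a1 t' d0 d1 d2 d3 e1 e2 f0 f1 A A'"
    by (rule pencil_pair.intro[OF c(1) d(1) pencil_pair_axioms.intro[OF A(1,2)]]) (use A(3) in \<open>simp only: c(2) d(2)\<close>)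
  obtain j where j: "j < 8" "par (acm A *v cpt (cj t j)) (cpt t')"
    by (rule pencil_pair.orbit_related[OF pp], rule that)
  have "moves A A' (cj t j) t'" unfolding moves_def by (intro conjI A(1,2) j(2))
  then show ?thesis by (rule that[OF j(1)])
qed

lemma good_cj: "good t \<Longrightarrow> good (cj t j)"
proof -
  assume g: "good t"
  then have t: "cj t 8 = t" "cj t 4 \<noteq> t" by (auto simp: good_def deg8_def)
  have "cj (cj t j) 8 = cj (cj t 8) j" "cj (cj t j) 4 = cj (cj t 4) j" by (simp_all only: cj_cj add.commute)
  then have "deg8 (cj t j)" using t cj_inj[of "cj t 4" j t] by (auto simp: deg8_def)
  then show ?thesis using g by (simp add: good_def tr8_cj t(1))
qed

lemma cusp_pencil_exists:
  assumes "good t"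
  obtains c0 c1 c2 c3 b1 b2 a0 a1 where "cusp_pencil t c0 c1 c2 c3 b1 b2 a0 a1"
proof -
  obtain F where "cusp_bertini t F" using cusp_bertini_exists[OF assms] ..
  then show ?thesis by (rule cusp_bertiniE) (rule that)
qed

text \<open>By reflexivity \<open>b t'\<close> lies in its own class; if this is the class of
  \<open>t\<close>, a matrix takes one of the 8 conjugates of \<open>t\<close> to \<open>t'\<close>.
  Each conjugate contributes at most \<open>(q + 1) q\<close> parameters, which bounds the fibres of
  the map to classes.\<close>

lemma card_classes:
  assumes fin: "finite (bertini_involutions :: 'k::{field,finite} ratmap set)"
  shows "card {t :: 'k alg_closure. good t}
    \<le> card (bertini_involutions // (bertini_conj :: 'k ratmap rel)) * (8 * ((CARD('k) + 1) * CARD('k)))"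
proof -
  let ?G = "{t :: 'k alg_closure. good t}" and ?m = "8 * ((CARD('k) + 1) * CARD('k))"
  have "\<forall>t. \<exists>F. good t \<longrightarrow> cusp_bertini t F" for t :: "'k alg_closure" using cusp_bertini_exists by blast
  then obtain F where F: "\<And>t :: 'k alg_closure. good t \<Longrightarrow> cusp_bertini t (F t)" by metis
  define b where "b t = ratmap_rel `` {F t}" for t
  define cl where "cl t = bertini_conj `` {b t}" for t
  have b: "b t \<in> bertini_involutions" if "good t" for t unfolding b_def by (rule cusp_bertini_involution(2)[OF F[OF that]])
  have fibre: "card {t' \<in> ?G. cl t' = c} \<le> ?m" for c
  proof (cases "{t' \<in> ?G. cl t' = c} = {}")
    case False
    then obtain t where t: "good t" "cl t = c" by blast
    let ?W = "\<lambda>j. {t'. \<exists>A A'. moves A A' (cj t j) t'}"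
    have W: "finite (?W j) \<and> card (?W j) \<le> (CARD('k) + 1) * CARD('k)" for j
    proof -
      obtain c0 c1 c2 c3 b1 b2 a0 a1 where "cusp_pencil (cj t j) c0 c1 c2 c3 b1 b2 a0 a1"
        by (rule cusp_pencil_exists[OF good_cj[OF t(1)]])
      then show ?thesis by (rule cusp_pencil.card_moved)
    qed
    have sub: "{t' \<in> ?G. cl t' = c} \<subseteq> (\<Union>j<8. ?W j)"
    proof
      fix t' assume "t' \<in> {t' \<in> ?G. cl t' = c}"
      then have t': "good t'" "cl t' = c" by auto
      have "b t' \<in> cl t'" unfolding cl_def using bertini_conj_refl[OF b[OF t'(1)]] by blast
      then have "b t' \<in> cl t" using t(2) t'(2) by (simp only:)
      then have rel: "(ratmap_rel `` {F t}, ratmap_rel `` {F t'}) \<in> bertini_conj"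
        by (simp only: cl_def b_def Image_singleton_iff)
      obtain j A A' where "j < 8" "moves A A' (cj t j) t'"
        by (rule cusp_bertini_conj[OF F[OF t(1)] F[OF t'(1)] rel], rule that)
      then show "t' \<in> (\<Union>j<8. ?W j)" by blast
    qed
    have finW: "finite (\<Union>j<8. ?W j)" using W by blast
    have "card {t' \<in> ?G. cl t' = c} \<le> card (\<Union>j<8. ?W j)" by (rule card_mono[OF finW sub])
    also have "\<dots> \<le> (\<Sum>j<8. card (?W j))" by (rule card_UN_le) simp
    also have "\<dots> \<le> (\<Sum>j<8::nat. (CARD('k) + 1) * CARD('k))" using W by (intro sum_mono) blast
    also have "\<dots> = ?m" by simp
    finally show ?thesis .
  next
    case True
    then show ?thesis by (simp only: card.empty)
  qed
  have finG: "finite ?G" by (rule card_good(1))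
  have img: "cl ` ?G \<subseteq> bertini_involutions // bertini_conj" using b by (auto simp: cl_def quotient_def)
  have finQ: "finite (bertini_involutions // (bertini_conj :: 'k ratmap rel))" unfolding quotient_def using fin by simp
  have eq: "?G = (\<Union>c\<in>cl ` ?G. {t' \<in> ?G. cl t' = c})" by blast
  have "card ?G = card (\<Union>c\<in>cl ` ?G. {t' \<in> ?G. cl t' = c})" by (rule arg_cong[OF eq])
  also have "\<dots> \<le> (\<Sum>c\<in>cl ` ?G. card {t' \<in> ?G. cl t' = c})" by (rule card_UN_le[OF finite_imageI[OF finG]])
  also have "\<dots> \<le> (\<Sum>c\<in>cl ` ?G. ?m)" by (rule sum_mono) (rule fibre)
  also have "\<dots> = card (cl ` ?G) * ?m" by simp
  also have "\<dots> \<le> card (bertini_involutions // (bertini_conj :: 'k ratmap rel)) * ?m"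
    by (rule mult_le_mono1) (rule card_mono[OF finQ img])
  finally show ?thesis .
qed

text \<open>For \<open>q = 2\<close> and \<open>q = 3\<close> the hypotheses give
  \<open>112 \<le> 48 K\<close> and \<open>4293 \<le> 96 K\<close>. For \<open>q \<ge> 4\<close> the
  leading terms are compared using \<open>4 q^6 \<le> q^7\<close>.\<close>

lemma bertini_bound_arith:
  fixes q N K :: nat
  assumes "q \<ge> 2" "q ^ 8 \<le> N + q ^ 7 + q ^ 4" "N \<le> K * (8 * ((q + 1) * q))"
  shows "bertini_bound q \<le> real K"
proof -
  consider "q = 2" | "q = 3" | "q \<ge> 4" using assms(1) by linarith
  then show ?thesis
  proof cases
    case 1
    then have "2 \<le> K" using assms by simp
    then show ?thesis using 1 by (simp add: bertini_bound_def)
  next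
    case 2
    then have "12 \<le> K" using assms by simp
    then show ?thesis using 2 by (simp add: bertini_bound_def)
  next
    case 3
    define x where "x = real q"
    have x: "x \<ge> 4" using 3 by (simp add: x_def)
    have "real (q ^ 8) \<le> real (K * (8 * ((q + 1) * q)) + q ^ 7 + q ^ 4)"
      using assms(2,3) by (intro of_nat_mono) linarith
    then have "x ^ 8 \<le> real K * (8 * ((x + 1) * x)) + x ^ 7 + x ^ 4" by (simp add: x_def algebra_simps)
    \<comment> \<open>The factor 80 turns the 8 of the class size into the 640 of the bound.\<close>
    then have "x * (80 * (x ^ 7 - x ^ 6 - x ^ 3)) \<le> x * (640 * real K * (x + 1))" by (simp add: algebra_simps power_numeral_reduce)
    then have m: "80 * (x ^ 7 - x ^ 6 - x ^ 3) \<le> 640 * real K * (x + 1)" using x by simp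
    have "4 * x ^ 6 \<le> x * x ^ 6" using x by (intro mult_right_mono) auto
    then have 7: "4 * x ^ 6 \<le> x ^ 7" by (simp add: power_numeral_reduce)
    have h: "x ^ 3 \<le> x ^ 6" "0 \<le> x ^ 6" using x by (intro power_increasing) auto
    have e: "(x ^ 6 - 1) * (x + 1) = x ^ 7 + x ^ 6 - x - 1" by (simp add: algebra_simps power_numeral_reduce)
    have lin: "a + b - y - 1 \<le> 80 * (a - b - c)" if "4 * b \<le> a" "c \<le> b" "0 \<le> b" "4 \<le> y" for a b c y :: real
    proof -
      have "0 \<le> 79 * (a - 4 * b) + (80 * (b - c) + (155 * b + (y + 1)))"
        using that by (intro add_nonneg_nonneg mult_nonneg_nonneg) auto
      also have "\<dots> = 80 * (a - b - c) - (a + b - y - 1)" by (simp add: algebra_simps)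
      finally show ?thesis by simp
    qed
    have "x ^ 7 + x ^ 6 - x - 1 \<le> 80 * (x ^ 7 - x ^ 6 - x ^ 3)" by (rule lin[OF 7 h x])
    then have "(x ^ 6 - 1) * (x + 1) \<le> 80 * (x ^ 7 - x ^ 6 - x ^ 3)" by (simp only: e)
    then have "(x ^ 6 - 1) * (x + 1) \<le> (640 * real K) * (x + 1)" using m by linarith
    then have "x ^ 6 - 1 \<le> 640 * real K" using x by (simp add: mult_le_cancel_right)
    then show ?thesis using 3 by (simp add: bertini_bound_def x_def)
  qed
qed

text \<open>For \<open>n \<ge> 4\<close> one has \<open>n^6 \<ge> 4^5 n = 1024 n\<close>, more than
  \<open>640 n + 1\<close>.\<close>

lemma bertini_bound_ge:
  fixes n :: nat
  assumes "n \<ge> 2"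
  shows "bertini_bound n \<ge> real n"
proof -
  consider "n = 2" | "n = 3" | "n \<ge> 4" using assms by linarith
  then show ?thesis
  proof cases
    case 3
    define x where "x = real n"
    have x: "x \<ge> 4" using 3 by (simp add: x_def)
    have "4 ^ 5 * x \<le> x ^ 5 * x" using x by (intro mult_right_mono power_mono) auto
    then have "1024 * x \<le> x ^ 6" by (simp add: power_numeral_reduce)
    then show ?thesis using 3 x by (simp add: bertini_bound_def x_def)
  qed (simp_all add: bertini_bound_def)
qed

subsection \<open>Finiteness\<close>

text \<open>Among nine successive images under the Frobenius of a point of \<open>p\<close> two coincide, so a
  normalised representative of the point has coordinates in an extension of degree at most 8.\<close>

lemma finite_degree8_points: "finite {p :: 'k::{field,finite} alg_closure point set. degree8_point p}"
proof -
  let ?K = "\<Union>n\<in>{1..8}. {t :: 'k alg_closure. cj t n = t}"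
  have finK: "finite ?K"
  proof (rule finite_UN_I)
    fix n :: nat assume "n \<in> {1..8}"
    then have "card {t :: 'k alg_closure. cj t n = t} = CARD('k) ^ n"
      unfolding cj_def by (intro card_frob_fixed) simp
    then show "finite {t :: 'k alg_closure. cj t n = t}"
      using card_field_ge_2[where 'k = 'k] by (intro card_ge_0_finite) simp
  qed simp
  define V where "V = {v :: 'k alg_closure ^ 3. \<forall>i. v $ i \<in> ?K}"
  have "V \<subseteq> (\<lambda>(a, b, c). vector [a, b, c]) ` (?K \<times> ?K \<times> ?K)"
  proof
    fix v assume v: "v \<in> V"
    have "v = vector [v $ 1, v $ 2, v $ 3]" by (simp add: vec3_eq)
    then show "v \<in> (\<lambda>(a, b, c). vector [a, b, c]) ` (?K \<times> ?K \<times> ?K)"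
      using v unfolding V_def by (intro image_eqI[of _ _ "(v $ 1, v $ 2, v $ 3)"]) (auto simp del: UN_iff)
  qed
  then have finV: "finite V" by (rule finite_subset) (intro finite_imageI finite_cartesian_product finK)
  let ?o = "\<lambda>v. {galois_act \<sigma> (proj_class v) | \<sigma>. \<sigma> \<in> galois_group}"
  have "{p :: 'k alg_closure point set. degree8_point p} \<subseteq> ?o ` V"
  proof
    fix p :: "'k alg_closure point set" assume "p \<in> {p. degree8_point p}"
    then obtain x where x: "x \<in> proj_plane" "p = {galois_act \<sigma> x | \<sigma>. \<sigma> \<in> galois_group}" "card p = 8"
      by (auto simp: degree8_point_def)
    obtain u where u: "u \<noteq> 0" "x = proj_class u" by (rule proj_plane_cases[OF x(1)])
    obtain k where k: "u $ k \<noteq> 0" using u(1) by (auto simp: vec_eq_iff)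
    define v where "v = (1 / u $ k) *s u"
    have vk: "v $ k = 1" using k by (simp add: v_def)
    have xv: "x = proj_class v" unfolding u(2) v_def using k by (intro proj_class_smult[symmetric]) simp
    define f where "f n = (\<chi> i. cj (v $ i) n)" for n
    have fk: "f n $ k = 1" for n
      unfolding f_def vec_lambda_beta vk by (rule cj_to_ac[OF csubringD(2)[OF csubring_to_ac]])
    then have fnz: "f n \<noteq> 0" for n by (metis zero_index zero_neq_one)
    have "proj_class (f n) \<in> p" for n
      unfolding x(2) xv using galois_act_class[OF cj_galois[of n], of v, symmetric] cj_galois[of n] unfolding f_def by blast
    then have "(\<lambda>n. proj_class (f n)) ` {..8} \<subseteq> p" by blast
    moreover have "finite p" using x(3) by (intro card_ge_0_finite) simp
    ultimately have "card ((\<lambda>n. proj_class (f n)) ` {..8}) \<le> 8" using card_mono x(3) by metis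
    then have "card ((\<lambda>n. proj_class (f n)) ` {..8}) < card {..8::nat}" by simp
    then have "\<not> inj_on (\<lambda>n. proj_class (f n)) {..8}" by (rule pigeonhole)
    then obtain i j where ij: "i \<in> {..8}" "j \<in> {..8}" "proj_class (f i) = proj_class (f j)" "i \<noteq> j" unfolding inj_on_def by blast
    then obtain a b where ab: "a < b" "b \<le> 8" "proj_class (f a) = proj_class (f b)"
      by (cases "i < j") (force, metis atMost_iff linorder_neqE_nat)
    from proj_class_eqE[OF ab(3) fnz] obtain c where c: "f a = c *s f b" .
    have "f a $ k = c * f b $ k" unfolding c by simp
    then have "c = 1" unfolding fk by simp
    then have e: "f a = f b" using c by simp
    have "v $ i \<in> ?K" for i
    proof -
      have "cj (v $ i) a = cj (v $ i) b" using arg_cong[OF e, of "\<lambda>w. w $ i"] by (simp add: f_def)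
      also have "\<dots> = cj (cj (v $ i) (b - a)) a" unfolding cj_cj using ab(1) by simp
      finally have "cj (v $ i) (b - a) = v $ i" using cj_inj by metis
      moreover have "b - a \<in> {1..8}" using ab(1,2) by (simp add: Suc_le_eq)
      ultimately show ?thesis by blast
    qed
    then have "v \<in> V" by (simp only: V_def mem_Collect_eq) blast
    then show "p \<in> ?o ` V" unfolding x(2) xv by blast
  qed
  then show ?thesis by (rule finite_subset) (rule finite_imageI[OF finV])
qed

section \<open>Uniqueness of the involution with a given base point\<close>

lemma rational_galois:
  assumes "y \<in> rational_points" "\<sigma> \<in> galois_group"
  shows "galois_act \<sigma> y = y"
proof -
  obtain v where v: "y = proj_class (\<chi> i. to_ac (v $ i))" using assms(1) unfolding rational_points_def by blast
  have "\<sigma> (to_ac a) = to_ac a" for a by (rule galois_simps(6)[OF assms(2) rangeI])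
  then show ?thesis unfolding v galois_act_class[OF assms(2)] by simp
qed

text \<open>A rational point is fixed by the Galois group, so its orbit cannot have 8 elements.
  Hence the base locus determines the neutral element, as its point outside
  \<open>p\<close>.\<close>

lemma rational_not_in_degree8:
  fixes p :: "'k::{field,finite} alg_closure point set"
  assumes "degree8_point p" "y \<in> rational_points"
  shows "y \<notin> p"
proof
  assume y: "y \<in> p"
  obtain x where x: "x \<in> proj_plane" "p = {galois_act \<sigma> x | \<sigma>. \<sigma> \<in> galois_group}" "card p = 8"
    using assms(1) unfolding degree8_point_def by blast
  obtain \<sigma> where s: "\<sigma> \<in> galois_group" "y = galois_act \<sigma> x" using y unfolding x(2) by blast
  have "z = y" if zp: "z \<in> p" for z
  proof -
    obtain \<tau> where t: "\<tau> \<in> galois_group" "z = galois_act \<tau> x" using zp unfolding x(2) by blast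
    obtain v where v: "y = proj_class (\<chi> i. to_ac (v $ i))" "v \<noteq> 0" using assms(2) unfolding rational_points_def by blast
    obtain u where u: "u \<noteq> 0" "x = proj_class u" by (rule proj_plane_cases[OF x(1)])
    let ?v = "(\<chi> i. to_ac (v $ i)) :: 'k alg_closure ^ 3"
    have vnz: "?v \<noteq> 0" using v(2) by (auto simp: vec_eq_iff)
    have eq: "proj_class ?v = proj_class (\<chi> i. \<sigma> (u $ i))" using s(2) unfolding v(1) u(2) galois_act_class[OF s(1)] .
    from proj_class_eqE[OF eq vnz] obtain c where c: "c \<noteq> 0" "?v = c *s (\<chi> i. \<sigma> (u $ i))" .
    obtain d where d: "\<sigma> d = c" using galois_simps(7)[OF s(1)] by (metis bij_pointE)
    have "\<sigma> (d * u $ i) = \<sigma> (to_ac (v $ i))" for i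
      using arg_cong[OF c(2), of "\<lambda>w. w $ i"] unfolding galois_simps(2)[OF s(1)] d galois_simps(6)[OF s(1) rangeI] by simp
    then have "d * u $ i = to_ac (v $ i)" for i using bij_is_inj[OF galois_simps(7)[OF s(1)]] by (simp only: inj_eq)
    then have dv: "?v = d *s u" by (simp add: vec_eq_iff)
    have d0: "d \<noteq> 0" using c(1) d galois_simps(3)[OF s(1)] by auto
    have "x = y" unfolding u(2) v(1) dv by (rule proj_class_smult[OF d0, symmetric])
    then show ?thesis unfolding t(2) using rational_galois[OF assms(2) t(1)] by simp
  qed
  then have "p \<subseteq> {y}" by blast
  then have "card p \<le> 1" using card_mono[of "{y}" p] by simp
  then show False using x(3) by simp
qed

lemma degree8_proj:
  assumes "degree8_point p"
  shows "p \<subseteq> proj_plane" "card p = 8"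
proof -
  obtain x where x: "x \<in> proj_plane" "p = {galois_act \<sigma> x | \<sigma>. \<sigma> \<in> galois_group}" "card p = 8"
    using assms unfolding degree8_point_def by blast
  show "card p = 8" by fact
  show "p \<subseteq> proj_plane"
  proof
    fix z assume "z \<in> p"
    then obtain \<tau> where t: "\<tau> \<in> galois_group" "z = galois_act \<tau> x" unfolding x(2) by blast
    obtain u where u: "u \<noteq> 0" "x = proj_class u" by (rule proj_plane_cases[OF x(1)])
    obtain k where k: "u $ k \<noteq> 0" using u(1) by (auto simp: vec_eq_iff)
    then have "\<tau> (u $ k) \<noteq> 0" using bij_is_inj[OF galois_simps(7)[OF t(1)]] galois_simps(3)[OF t(1)] by (metis injD)
    then have "(\<chi> i. \<tau> (u $ i)) \<noteq> 0" by (metis vec_lambda_beta zero_index)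
    then show "z \<in> proj_plane" unfolding t(2) u(2) galois_act_class[OF t(1)] by (rule proj_class_in)
  qed
qed

lemma for_general_point_imp_gen:
  assumes "for_general_point Q"
  shows "gen (\<lambda>v :: 'a::alg_closed_field ^ 3. v \<noteq> 0 \<and> Q (proj_class v))"
proof -
  obtain d G where G: "form d G" "G \<noteq> 0" "\<And>x. x \<in> proj_plane \<Longrightarrow> \<not> vanishes_at G x \<Longrightarrow> Q x"
    using assms unfolding for_general_point_def by blast
  obtain u where u: "insertion id u G \<noteq> 0" using G(2) unfolding tpoly_nonzero_iff by blast
  \<comment> \<open>Requiring a nonzero first coordinate keeps the zero vector out, also when
    \<open>G\<close> is constant.\<close>
  have c: "hp UNIV 1 (\<lambda>v :: 'a ^ 3. v $ 1)" by (rule hp_component[OF csubring_UNIV])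
  have g: "gen (\<lambda>v :: 'a ^ 3. v $ 1 \<noteq> 0)" by (rule gen_hp[OF c, of "axis 1 1"]) simp
  show ?thesis
  proof (rule gen_mono[OF gen_conj[OF g gen_hp[OF hp_insertion_UNIV[OF G(1)] u]]])
    fix v :: "'a ^ 3" assume v: "v $ 1 \<noteq> 0 \<and> insertion id v G \<noteq> 0"
    then have v0: "v \<noteq> 0" by auto
    have "\<not> vanishes_at G (proj_class v)" using vanishes_at_class[OF G(1) v0] v by simp
    then show "v \<noteq> 0 \<and> Q (proj_class v)" using G(3)[OF proj_class_in[OF v0]] v0 by simp
  qed
qed

lemma line_section_proportional:
  assumes "\<And>v. insertion id v F' = c * insertion id v F" "c \<noteq> 0" "line_section F P Q R"
  shows "line_section F' P Q R"
proof -
  obtain u w a1 b1 a2 b2 a3 b3 k where h: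
    "{P, Q, R} \<subseteq> proj_plane" "\<forall>s t. s *s u + t *s w = 0 \<longrightarrow> s = 0 \<and> t = 0"
    "P = proj_class (a1 *s u + b1 *s w)" "Q = proj_class (a2 *s u + b2 *s w)" "R = proj_class (a3 *s u + b3 *s w)" "k \<noteq> 0"
    "\<forall>s t. insertion id (s *s u + t *s w) F = k * (s * b1 - t * a1) * (s * b2 - t * a2) * (s * b3 - t * a3)"
    by (rule line_sectionE[OF assms(3)], rule that)
  show ?thesis
  proof (rule line_sectionI[OF h(1-5)])
    show "c * k \<noteq> 0" using assms(2) h(6) by simp
    show "\<forall>s t. insertion id (s *s u + t *s w) F' = c * k * (s * b1 - t * a1) * (s * b2 - t * a2) * (s * b3 - t * a3)"
      unfolding assms(1) h(7)[rule_format] by (simp add: mult.assoc)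
  qed
qed

text \<open>The member through a point is determined only up to a scalar, which the chord-tangent
  construction does not see.\<close>

lemma cubic_group_proportional:
  fixes F F' :: "'a::field tpoly"
  assumes F: "\<And>v. insertion id v F' = c * insertion id v F" "c \<noteq> 0" "form 3 F" "form 3 F'"
  shows "cubic_group F' Z = cubic_group F Z"
proof -
  have F2: "insertion id v F = (1 / c) * insertion id v F'" for v using F(1)[of v] F(2) by simp
  have c2: "1 / c \<noteq> 0" using F(2) by simp
  have "line_section F' P Q R \<longleftrightarrow> line_section F P Q R" for P Q R
    using line_section_proportional[OF F(1,2)] line_section_proportional[OF F2 c2] by blast
  then have t: "third_point F' = third_point F" by (simp add: third_point_def fun_eq_iff)
  have "P \<in> proj_plane \<Longrightarrow> vanishes_at F' P \<longleftrightarrow> vanishes_at F P" for P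
  proof -
    assume "P \<in> proj_plane"
    then obtain v where v: "v \<noteq> 0" "P = proj_class v" by (rule proj_plane_cases)
    show "vanishes_at F' P \<longleftrightarrow> vanishes_at F P"
      unfolding v(2) vanishes_at_class[OF F(3) v(1)] vanishes_at_class[OF F(4) v(1)] F(1) using F(2) by simp
  qed
  then have "{P \<in> proj_plane. vanishes_at F' P} = {P \<in> proj_plane. vanishes_at F P}" by blast
  then show ?thesis by (simp only: cubic_group_def t)
qed

text \<open>\<open>maps_to\<close> may be witnessed by any representative of the class; the chosen
  triple \<open>F\<close> then has a parallel, possibly zero, value.\<close>

lemma maps_to_par:
  assumes F: "F \<in> triples" and m: "maps_to (ratmap_rel `` {F}) (proj_class v) (proj_class w)" "v \<noteq> 0"
  shows "par (ev F v) w"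
proof -
  obtain G u where G: "G \<in> ratmap_rel `` {F}" "u \<in> proj_class v" "ev G u \<in> proj_class w" and w: "proj_class w \<in> proj_plane"
    using m(1) unfolding maps_to_def ev_def by blast
  have w0: "w \<noteq> 0" using w unfolding proj_class_in_iff .
  obtain a where a: "a \<noteq> 0" "u = a *s v" using G(2) unfolding proj_class_eq[OF m(2)] by blast
  obtain b where b: "b \<noteq> 0" "ev G u = b *s w" using G(3) unfolding proj_class_eq[OF w0] by blast
  obtain d where d: "\<And>c v. ev F (c *s v) = c ^ d *s ev F v" using ev_scale[OF F] by blast
  have "(F, G) \<in> ratmap_rel" using G(1) by (simp only: Image_singleton_iff)
  then have "par (ev F u) (ev G u)" unfolding ratmap_rel_iff by blast
  then have "par (a ^ d *s ev F v) (b *s w)" unfolding b(2) unfolding a(2) d .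
  from par_scale[OF par_smult[OF this, of "1 / a ^ d"], of "1 / b"]
  have pr: "par ((1 / a ^ d) *s (a ^ d *s ev F v)) ((1 / b) *s (b *s w))" .
  have e: "(1 / a ^ d) *s (a ^ d *s ev F v) = ev F v" "(1 / b) *s (b *s w) = w" using a(1) b(1) by (simp_all add: vec_eq_iff)
  show ?thesis using pr unfolding e .
qed

text \<open>At a general vector both defining conditions hold, with the same neutral element and
  with proportional cubics. So both maps send the point to the same image, and agreement at general
  points is equality of rational maps.\<close>

lemma bertini_involution_unique:
  fixes p :: "'k::{field,finite} alg_closure point set"
  assumes p: "degree8_point p" "general_points p" and b: "bertini_involution_at p b" "bertini_involution_at p b'"
  shows "b = b'"
proof -
  note pp = degree8_proj[OF p(1)]
  obtain F where F: "birational F" "b = ratmap_rel `` {F}" using b(1) by (auto simp: bertini_involution_at_def Bir_def quotient_def)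
  obtain F' where F': "birational F'" "b' = ratmap_rel `` {F'}" using b(2) by (auto simp: bertini_involution_at_def Bir_def quotient_def)
  have Ft: "F \<in> triples" "F' \<in> triples" using F(1) F'(1) by (simp_all add: birational_def)
  define Q where "Q b q x \<longleftrightarrow> (\<exists>G\<in>cubics_through p. smooth_cubic G \<and> vanishes_at G x \<and>
             maps_to b x (inv\<^bsub>cubic_group G q\<^esub> x))" for b :: "'k ratmap" and q x
  obtain q where q: "q \<in> rational_points" "base_locus p = insert q p" "for_general_point (Q b q)"
    using b(1) unfolding bertini_involution_at_def Q_def by blast
  obtain q' where q': "q' \<in> rational_points" "base_locus p = insert q' p" "for_general_point (Q b' q')"
    using b(2) unfolding bertini_involution_at_def Q_def by blast
  have "q \<in> insert q' p" using q(2) q'(2) by blast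
  then have qq: "q' = q" using rational_not_in_degree8[OF p(1) q(1)] by blast
  have g1: "gen (\<lambda>v. v \<noteq> 0 \<and> Q b q (proj_class v))" by (rule for_general_point_imp_gen[OF q(3)])
  have g2: "gen (\<lambda>v. v \<noteq> 0 \<and> Q b' q (proj_class v))" using for_general_point_imp_gen[OF q'(3)] unfolding qq .
  obtain v0 where "v0 \<noteq> 0 \<and> Q b q (proj_class v0)" using gen_ex[OF g1] ..
  \<comment> \<open>A fixed cubic of the pencil: general vectors avoid it and so lie off the base
    locus, where the member is unique up to scalars.\<close>
  then obtain H where H: "H \<in> cubics_through p" unfolding Q_def by blast
  have H3: "form 3 H" "H \<noteq> 0" using H by (simp_all add: cubics_through_def)
  obtain u where u: "insertion id u H \<noteq> 0" using H3(2) unfolding tpoly_nonzero_iff by blast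
  have g3: "gen (\<lambda>v. insertion id v H \<noteq> 0)" by (rule gen_hp[OF hp_insertion_UNIV[OF H3(1)] u])
  have qP: "q \<in> proj_plane" using q(2) unfolding base_locus_def by blast
  have "gen (\<lambda>v. par (ev F v) (ev F' v))"
  proof (rule gen_mono[OF gen_conj[OF gen_conj[OF g1 g2] g3]])
    fix v assume v: "((v \<noteq> 0 \<and> Q b q (proj_class v)) \<and> v \<noteq> 0 \<and> Q b' q (proj_class v)) \<and> insertion id v H \<noteq> 0"
    then have v0: "v \<noteq> 0" and Hv: "insertion id v H \<noteq> 0" by blast+
    obtain G where G: "G \<in> cubics_through p" "smooth_cubic G" "vanishes_at G (proj_class v)"
      "maps_to b (proj_class v) (inv\<^bsub>cubic_group G q\<^esub> (proj_class v))" using v unfolding Q_def by blast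
    obtain G' where G': "G' \<in> cubics_through p" "smooth_cubic G'" "vanishes_at G' (proj_class v)"
      "maps_to b' (proj_class v) (inv\<^bsub>cubic_group G' q\<^esub> (proj_class v))" using v unfolding Q_def by blast
    have f3: "form 3 G" "form 3 G'" using G(1) G'(1) by (simp_all add: cubics_through_def)
    have z: "insertion id v G = 0" "insertion id v G' = 0"
      using G(3) G'(3) unfolding vanishes_at_class[OF f3(1) v0] vanishes_at_class[OF f3(2) v0] .
    obtain c where c: "c \<noteq> 0" "\<And>w. insertion id w G' = c * insertion id w G"
      by (rule pencil_member_unique[OF p(2) pp G(1) G'(1) H z Hv], rule that)
    have cg: "cubic_group G' q = cubic_group G q" by (rule cubic_group_proportional[OF c(2,1) f3])
    have "inv\<^bsub>cubic_group G q\<^esub> (proj_class v) \<in> proj_plane" using G(4) unfolding maps_to_def by blast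
    then obtain w where w: "w \<noteq> 0" "inv\<^bsub>cubic_group G q\<^esub> (proj_class v) = proj_class w" by (rule proj_plane_cases)
    have "par (ev F v) w" by (rule maps_to_par[OF Ft(1) _ v0]) (use G(4) in \<open>simp only: F(2) w(2)\<close>)
    moreover have "par (ev F' v) w" by (rule maps_to_par[OF Ft(2) _ v0]) (use G'(4) in \<open>simp only: F'(2) cg w(2)\<close>)
    ultimately show "par (ev F v) (ev F' v)" using par_trans[OF _ par_sym w(1)] by blast
  qed
  from gen_par[OF Ft this] show ?thesis unfolding F(2) F'(2) ratmap_class_eq_iff[OF Ft] .
qed

text \<open>By uniqueness the involution is a function of its base point, of which there are
  finitely many.\<close>

lemma finite_bertini_involutions: "finite (bertini_involutions :: 'k::{field,finite} ratmap set)"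
proof -
  let ?P = "{p :: 'k alg_closure point set. degree8_point p}"
  have "bertini_involutions \<subseteq> (\<lambda>p. THE b :: 'k ratmap. bertini_involution_at p b) ` ?P"
  proof
    fix b :: "'k ratmap" assume "b \<in> bertini_involutions"
    then obtain p where p: "degree8_point p" "general_points p" "bertini_involution_at p b"
      unfolding bertini_involutions_def by blast
    have "(THE b. bertini_involution_at p b) = b"
      by (rule the_equality[where P = "bertini_involution_at p"], rule p(3))
        (rule bertini_involution_unique[OF p(1,2) _ p(3)])
    then show "b \<in> (\<lambda>p. THE b. bertini_involution_at p b) ` ?P" using p(1) by blast
  qed
  then show ?thesis by (rule finite_subset) (rule finite_imageI[OF finite_degree8_points])
qed

theorem proposition4p17:
  fixes q :: nat
  assumes "CARD('k::{field,finite}) = q"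
  shows "bertini_bound q \<le> real (card (bertini_involutions // (bertini_conj :: 'k ratmap rel)))
         \<and> (\<forall>n\<ge>2. bertini_bound n \<ge> real n)"
proof (intro conjI allI impI)
  show "bertini_bound q \<le> real (card (bertini_involutions // (bertini_conj :: 'k ratmap rel)))"
    unfolding assms[symmetric]
    by (rule bertini_bound_arith[OF card_field_ge_2 card_good(2) card_classes[OF finite_bertini_involutions]])
qed (rule bertini_bound_ge)

end
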